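(* Let $m=m(n)$ and $p=p(n)$ satisfy $m=o(n/\log n)$ and $p/n\to y$ for some $y>0$ as $n\to\infty$, and let $\{(\mathbf y_{pk},\Sigma_{pk})\}_{k=1}^n$ be an $m$-dependent sequence for each $n$. Suppose that the following hold. (A3) For any $M,\varepsilon>0$, $$\frac1n\sum_{k=1}^n\sup_{A_p}\mathbb P\big(|\mathbf y_{pk}^\top A_p\mathbf y_{pk}-\mathrm{tr}(\Sigma_{pk}A_p)|>\varepsilon p\big)\to0,\quad n\to\infty,$$ where each supremum is over all real symmetric positive semi-definite $p\times p$ matrices $A_p$ with spectral norm $\|A_p\|\le M$. (A4) For any $\varepsilon>0$, $\frac1n\sum_{k=1}^n\mathbb P(\mathrm{tr}(\Sigma_{pk}^2)>\varepsilon p^2)\to0$ as $n\to\infty$. (A5) As $n\to\infty$, $$\sum\mathbb E\Big[\big(\|\mathbb E_k\Sigma_{pl}\|+\|\mathbb E_k\mathbf y_{pl}\mathbf y_{pl}^\top\|\big)\,\mathrm{tr}\big(\mathbf y_{pk}\mathbf y_{pk}^\top+\Sigma_{pk}\big)\Big]=o(n^3),$$ where the sum is over all $(k,l)$ with $1\le k<l\le n$ and $l<k+m$; and $$\sum\big(\|\mathbb E\Sigma_{pl}\|+\|\mathbb E\mathbf y_{pl}\mathbf y_{pl}^\top\|\big)\,\mathrm{tr}\big(\mathbb E\mathbf y_{pk}\mathbf y_{pk}^\top+\mathbb E\Sigma_{pk}\big)=o(n^3),$$ where the sum is over all $(k,l)$ with $1\le k,l\le n$ and $m\le|k-l|<2m$.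 Then for all $z\in\mathbb C^+$, as $n\to\infty$, $$p^{-1}\mathrm{tr}\big(n^{-1}\mathbf Y_{pn}\mathbf Y_{pn}^\top-zI_p\big)^{-1}-p^{-1}\mathrm{tr}\big(n^{-1}\mathbf Z_{pn}\mathbf Z_{pn}^\top-zI_p\big)^{-1}\to0\quad\text{almost surely}.$$
   Context: For each $p,n\ge1$ and $k=1,\dots,n$, $\mathbf y_{pk}$ is a random vector in $\mathbb R^p$ and $\Sigma_{pk}$ is a symmetric random positive semi-definite $p\times p$ matrix; the entries of $\mathbf y_{pk}\mathbf y_{pk}^\top$ and $\Sigma_{pk}$ have finite expectations. $\mathcal F_k^p=\sigma((\mathbf y_{pj},\Sigma_{pj}),1\le j\le k)$ for $1\le k\le n$, $\mathcal F_0^p$ is the trivial $\sigma$-algebra, and $\mathbb E_k=\mathbb E(\cdot\mid\mathcal F_k^p)$. The sequence $\{(\mathbf y_{pk},\Sigma_{pk})\}_{k=1}^n$ is $m$-dependent if for each $k=1,\dots,n-m$ the $\sigma$-algebras $\mathcal F_k^p$ and $\sigma((\mathbf y_{pj},\Sigma_{pj}),k+m\le j\le n)$ are independent. $\mathbf Y_{pn}$ is the $p\times n$ matrix with columns $\mathbf y_{p1},\dots,\mathbf y_{pn}$, and $\mathbf Z_{pn}$ is the $p\times n$ matrix with columns $\Sigma_{pk}^{1/2}\mathbf w_{pk}$, $k=1,\dots,n$, where $\Sigma_{pk}^{1/2}$ is the principal square root and $\{\mathbf w_{pk}\}_{k=1}^n$ are independent standard normal vectors in $\mathbb R^p$ that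 are also independent of $\{\Sigma_{pk}\}_{k=1}^n$. All random objects, over all $n$, are defined on a common probability space. $\|\cdot\|$ is the spectral norm, $I_p$ the $p\times p$ identity matrix, $\mathbb C^+=\{w\in\mathbb C:\mathrm{Im}(w)>0\}$, and $\mathrm{tr}(M)^{-1}$ denotes the trace of $M^{-1}$. *)

theory Defs
  imports
    "HOL-Probability.Probability"
    "Jordan_Normal_Form.Gauss_Jordan_Elimination"
begin

unbundle no vec_syntax
unbundle no inner_syntax

text \<open>
  Since the dimension varies with the sample size, vectors and matrices are those of
  \<open>Jordan_Normal_Form.Matrix\<close>; their coordinates are indexed from 0, whereas the members
  of a sequence of random vectors are indexed from 1.
\<close>

section \<open>Matrices\<close>

definition mat_trace :: "'a::comm_monoid_add mat \<Rightarrow> 'a" where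
  "mat_trace A = (\<Sum>i<dim_row A. A $$ (i, i))"

definition outer_self :: "real Matrix.vec \<Rightarrow> real mat" where
  "outer_self v = mat (dim_vec v) (dim_vec v) (\<lambda>(i, j). v $ i * v $ j)"

definition spectral_norm :: "real mat \<Rightarrow> real" where
  "spectral_norm A =
     (SUP v\<in>{v \<in> carrier_vec (dim_col A). v \<bullet> v = 1}. sqrt ((A *\<^sub>v v) \<bullet> (A *\<^sub>v v)))"

definition sym_psd_mats :: "nat \<Rightarrow> real mat set" where
  "sym_psd_mats p =
     {A \<in> carrier_mat p p. transpose_mat A = A \<and> (\<forall>v\<in>carrier_vec p. 0 \<le> v \<bullet> (A *\<^sub>v v))}"

definition psd_sqrt :: "real mat \<Rightarrow> real mat" where
  "psd_sqrt A = (THE B. B \<in> sym_psd_mats (dim_row A) \<and> B * B = A)"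

definition data_mat :: "nat \<Rightarrow> nat \<Rightarrow> (nat \<Rightarrow> real Matrix.vec) \<Rightarrow> real mat" where
  "data_mat p n x = mat_of_cols p (map x [1..<n+1])"

text \<open>The value is \<open>p\<^sup>-\<^sup>1 tr (n\<^sup>-\<^sup>1 X X\<^sup>T - z I\<^sub>p)\<^sup>-\<^sup>1\<close> for the
  \<open>p \<times> n\<close> matrix \<open>X\<close> with the columns \<open>x 1, \<dots>, x n\<close>. The inverse exists for every
  non-real \<open>z\<close>, so the partiality of \<open>mat_inverse\<close> is harmless.\<close>

definition resolvent_trace ::
    "nat \<Rightarrow> nat \<Rightarrow> (nat \<Rightarrow> real Matrix.vec) \<Rightarrow> complex \<Rightarrow> complex" where
  "resolvent_trace p n x z =
     (let X = data_mat p n x;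
          C = map_mat complex_of_real ((1 / real n) \<cdot>\<^sub>m (X * transpose_mat X))
      in mat_trace (the (mat_inverse (C - z \<cdot>\<^sub>m 1\<^sub>m p))) / of_nat p)"

section \<open>Random vectors and matrices\<close>

text \<open>The Borel \<open>\<sigma>\<close>-algebras on \<open>\<real>\<^sup>p\<close> and on the real \<open>p \<times> p\<close> matrices,
  i.e. those generated by the coordinates.\<close>

definition borel_vec :: "nat \<Rightarrow> real Matrix.vec measure" where
  "borel_vec p =
     vimage_algebra (carrier_vec p) (\<lambda>v. \<lambda>i\<in>{..<p}. v $ i) (PiM {..<p} (\<lambda>_. borel))"

definition borel_mat :: "nat \<Rightarrow> real mat measure" where
  "borel_mat p =
     vimage_algebra (carrier_mat p p) (\<lambda>A. \<lambda>ij\<in>{..<p} \<times> {..<p}. A $$ ij)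
       (PiM ({..<p} \<times> {..<p}) (\<lambda>_. borel))"

text \<open>The \<open>\<sigma>\<close>-algebra generated by the random elements \<open>X i\<close>, \<open>i \<in> I\<close>, of \<open>N\<close>;
  it is trivial for \<open>I = {}\<close>.\<close>

definition gen_sigma ::
    "'a measure \<Rightarrow> 'b measure \<Rightarrow> ('i \<Rightarrow> 'a \<Rightarrow> 'b) \<Rightarrow> 'i set \<Rightarrow> 'a measure" where
  "gen_sigma P N X I = sigma (space P) (\<Union>i\<in>I. {X i -` A \<inter> space P | A. A \<in> sets N})"

definition pair_sigma ::
    "'a measure \<Rightarrow> nat \<Rightarrow> (nat \<Rightarrow> 'a \<Rightarrow> real Matrix.vec) \<Rightarrow> (nat \<Rightarrow> 'a \<Rightarrow> real mat)
       \<Rightarrow> nat set \<Rightarrow> 'a measure" where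
  "pair_sigma P p y S I =
     gen_sigma P (borel_vec p \<Otimes>\<^sub>M borel_mat p) (\<lambda>j \<omega>. (y j \<omega>, S j \<omega>)) I"

definition m_dependent ::
    "'a measure \<Rightarrow> nat \<Rightarrow> nat \<Rightarrow> nat
       \<Rightarrow> (nat \<Rightarrow> 'a \<Rightarrow> real Matrix.vec) \<Rightarrow> (nat \<Rightarrow> 'a \<Rightarrow> real mat) \<Rightarrow> bool" where
  "m_dependent P m p n y S \<longleftrightarrow>
     (\<forall>k. 1 \<le> k \<and> k + m \<le> n \<longrightarrow>
        prob_space.indep_set P (sets (pair_sigma P p y S {1..k})) (sets (pair_sigma P p y S {k+m..n})))"

definition std_normal_vec :: "'a measure \<Rightarrow> nat \<Rightarrow> ('a \<Rightarrow> real Matrix.vec) \<Rightarrow> bool" where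
  "std_normal_vec P p w \<longleftrightarrow>
     w \<in> P \<rightarrow>\<^sub>M borel_vec p \<and>
     prob_space.indep_vars P (\<lambda>_. borel) (\<lambda>i \<omega>. w \<omega> $ i) {..<p} \<and>
     (\<forall>i<p. distributed P lborel (\<lambda>\<omega>. w \<omega> $ i) (\<lambda>x. ennreal (std_normal_density x)))"

definition integrable_mat :: "'a measure \<Rightarrow> nat \<Rightarrow> ('a \<Rightarrow> real mat) \<Rightarrow> bool" where
  "integrable_mat P p X \<longleftrightarrow> (\<forall>i<p. \<forall>j<p. integrable P (\<lambda>\<omega>. X \<omega> $$ (i, j)))"

definition expectation_mat :: "'a measure \<Rightarrow> nat \<Rightarrow> ('a \<Rightarrow> real mat) \<Rightarrow> real mat" where
  "expectation_mat P p X = mat p p (\<lambda>ij. integral\<^sup>L P (\<lambda>\<omega>. X \<omega> $$ ij))"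

definition cond_exp_mat ::
    "'a measure \<Rightarrow> 'a measure \<Rightarrow> nat \<Rightarrow> ('a \<Rightarrow> real mat) \<Rightarrow> 'a \<Rightarrow> real mat" where
  "cond_exp_mat P F p X \<omega> = mat p p (\<lambda>ij. real_cond_exp P F (\<lambda>\<omega>'. X \<omega>' $$ ij) \<omega>)"

end

theory Submission
  imports
    "HOL-Complex_Analysis.Great_Picard"
    "Jordan_Normal_Form.Char_Poly"
    Defs
begin

unbundle no vec_syntax
unbundle no inner_syntax

text \<open>
  Write \<open>\<Phi>(x) = ln det (\<beta> I + G) - ln det (\<alpha> I + G)\<close> with \<open>G = n\<^sup>-\<^sup>1 \<Sum>\<^sub>j x\<^sub>j x\<^sub>j\<^sup>T\<close> and
  \<open>0 < \<alpha> < \<beta>\<close>. Convergence of the differences of \<open>p\<^sup>-\<^sup>1 \<Phi>\<close> for countably many pairs \<open>\<alpha>, \<beta>\<close> controls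
  the Stieltjes transforms on the negative half line, and the theorem of Montel and analytic
  continuation carry this over to the upper half plane. Using \<open>\<Phi>\<close> instead of the resolvent
  keeps all matrices real, and altering one column changes \<open>\<Phi>\<close> by at most \<open>ln (\<beta> / \<alpha>)\<close>.

  Hence \<open>\<Phi>\<close> concentrates: Azuma's inequality for blocks of length \<open>m\<close>, with increments of order
  \<open>m\<close>, gives tails \<open>exp (- c n / m)\<close>, which are summable because \<open>m = o(n / ln n)\<close>.

  The expectations are compared by Lindeberg's replacement of \<open>y\<^sub>k\<close> with \<open>\<Sigma>\<^sub>k\<^sup>1\<^sup>/\<^sup>2 w\<^sub>k\<close>, one column
  at a time. Each replacement changes \<open>\<Phi>\<close> by differences of \<open>ln (1 + x\<^sup>T A x / n)\<close>, \<open>A\<close> being the resolvent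
  at \<open>\<alpha>\<close> or \<open>\<beta>\<close> of the other columns. Removing from \<open>A\<close> the columns at distance less than \<open>2 m\<close> from \<open>k\<close>
  costs at most the sum over these \<open>j\<close> of \<open>n\<^sup>-\<^sup>2 (x\<^sub>j\<^sup>T A x)\<^sup>2\<close>, whose expectation is bounded by (A5); the
  remaining resolvent is independent of \<open>(y\<^sub>k, \<Sigma>\<^sub>k)\<close>, so that (A3) applies to it conditionally. For
  the Gaussian column the variance of the quadratic form is at most a multiple of \<open>tr (\<Sigma>\<^sub>k\<^sup>2)\<close>, which
  is where (A4) enters.
\<close>

text \<open>The Gaussian vectors are independent of the matrices \<open>S k\<close>, but nothing is
  known about their joint law with the \<open>y k\<close>. Hence the data and the Gaussian model
  concentrate separately, each around its own mean, and the means are compared on a product space: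
  the first coordinate carries the Gaussian vectors, the second the pairs \<open>(y k, S k)\<close>.
  This is legitimate because the Gaussian model involves \<open>w\<close> and \<open>S\<close> only.

  (A3) and (A4) are statements in probability and give no moments. They suffice because the
  resolvent R(\<nu>) decreases and \<nu> R(\<nu>) increases in \<nu>: a column of any size has
  bounded influence on \<Phi>, and every deviation may be cut off at ln (\<beta> / \<alpha>).

  Neighbours are removed up to distance 2 m and not only m, because m-dependence separates a past
  from a future: a removed column shortly after k must itself be independent of the columns left
  beyond it. Removed columns at distance between m and 2 m from k are independent of the k-th pair
  and are paid for by the second sum in (A5), the closer ones by the first.\<close>

lemma sprod_sum:
  assumes "u \<in> carrier_vec p" "v \<in> carrier_vec p"
  shows "u \<bullet> v = (\<Sum>i<p. u $ i * v $ i)"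
  using assms by (auto simp: scalar_prod_def lessThan_atLeast0)

lemma sprod_self_nonneg: "(u::real Matrix.vec) \<bullet> u \<ge> 0"
  by (auto simp: scalar_prod_def intro!: sum_nonneg)

lemma sprod_self_eq_0:
  assumes "(u::real Matrix.vec) \<in> carrier_vec p" "u \<bullet> u = 0" shows "u = 0\<^sub>v p"
proof -
  have "(\<Sum>i<p. u $ i * u $ i) = 0" using assms sprod_sum by metis
  then have "u $ i * u $ i = 0" if "i < p" for i
    by (subst (asm) sum_nonneg_eq_0_iff) (use that in auto)
  then show ?thesis using assms by (intro eq_vecI) auto
qed

lemma sprod_cauchy_schwarz:
  assumes "(u::real Matrix.vec) \<in> carrier_vec p" "v \<in> carrier_vec p"
  shows "(u \<bullet> v)\<^sup>2 \<le> (u \<bullet> u) * (v \<bullet> v)"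
  using Cauchy_Schwarz_ineq_sum[of "\<lambda>i. u $ i" "\<lambda>i. v $ i" "{..<p}"] assms
  by (simp add: sprod_sum power2_eq_square)

lemma sprod_symmetric_mat:
  assumes "B \<in> carrier_mat p p" "B\<^sup>T = B" "u \<in> carrier_vec p" "(v::'a::comm_ring_1 Matrix.vec) \<in> carrier_vec p"
  shows "u \<bullet> (B *\<^sub>v v) = v \<bullet> (B *\<^sub>v u)"
proof -
  have "u \<bullet> (B *\<^sub>v v) = (B\<^sup>T *\<^sub>v u) \<bullet> v"
    using transpose_vec_mult_scalar[OF assms(1) assms(4,3)] by simp
  also have "\<dots> = v \<bullet> (B *\<^sub>v u)" using assms by (simp add: comm_scalar_prod[of _ p])
  finally show ?thesis .
qed

section \<open>Positive definite matrices, their inverses and rank-one updates\<close>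

definition pos_def_mat :: "real \<Rightarrow> nat \<Rightarrow> real mat \<Rightarrow> bool" where
  "pos_def_mat \<nu> p B \<longleftrightarrow> B \<in> carrier_mat p p \<and> B\<^sup>T = B \<and>
     (\<forall>v\<in>carrier_vec p. \<nu> * (v \<bullet> v) \<le> v \<bullet> (B *\<^sub>v v))"

lemma pos_def_matD:
  assumes "pos_def_mat \<nu> p B"
  shows "B \<in> carrier_mat p p" "B\<^sup>T = B" "v \<in> carrier_vec p \<Longrightarrow> \<nu> * (v \<bullet> v) \<le> v \<bullet> (B *\<^sub>v v)"
  using assms by (auto simp: pos_def_mat_def)

lemma det_pos_def_nonzero:
  assumes "pos_def_mat \<nu> p B" "\<nu> > 0" shows "Determinant.det B \<noteq> 0"
proof
  assume "Determinant.det B = 0"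
  then obtain v where v: "v \<in> carrier_vec p" "v \<noteq> 0\<^sub>v p" "B *\<^sub>v v = 0\<^sub>v p"
    using det_0_iff_vec_prod_zero[OF pos_def_matD(1)[OF assms(1)]] by auto
  have "\<nu> * (v \<bullet> v) \<le> 0" using pos_def_matD(3)[OF assms(1) v(1)] v by simp
  then have "v \<bullet> v = 0" using assms(2) sprod_self_nonneg[of v]
    by (simp add: mult_le_0_iff)
  then show False using v sprod_self_eq_0 by blast
qed

text \<open>Cramer's rule writes the inverse as a quotient of polynomials in the entries, so that
  the inverse of a random matrix is measurable as soon as determinants are.\<close>

definition cramer_inverse :: "real mat \<Rightarrow> real mat" where
  "cramer_inverse B = (1 / Determinant.det B) \<cdot>\<^sub>m adj_mat B"

lemma cramer_inverse:
  assumes "B \<in> carrier_mat p p" "Determinant.det B \<noteq> 0"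
  shows "cramer_inverse B \<in> carrier_mat p p" "B * cramer_inverse B = 1\<^sub>m p" "cramer_inverse B * B = 1\<^sub>m p"
proof -
  have "(1 / Determinant.det B) \<cdot>\<^sub>m (Determinant.det B \<cdot>\<^sub>m 1\<^sub>m p) = 1\<^sub>m p"
    using assms(2) by (intro eq_matI) auto
  then show "cramer_inverse B \<in> carrier_mat p p" "B * cramer_inverse B = 1\<^sub>m p" "cramer_inverse B * B = 1\<^sub>m p"
    using adj_mat[OF assms(1)] assms(1)
    by (auto simp: cramer_inverse_def mult_smult_distrib[of _ p p _ p] mult_smult_assoc_mat[of _ p p _ p])
qed

context
  fixes \<nu> :: real and p :: nat and B :: "real mat"
  assumes pd: "pos_def_mat \<nu> p B" and nu: "\<nu> > 0"
begin

lemma pd_inverse: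
  shows "cramer_inverse B \<in> carrier_mat p p" "B * cramer_inverse B = 1\<^sub>m p" "cramer_inverse B * B = 1\<^sub>m p"
  using cramer_inverse[OF pos_def_matD(1)[OF pd] det_pos_def_nonzero[OF pd nu]] by auto

lemma pd_inverse_mult_vec:
  assumes "x \<in> carrier_vec p"
  shows "cramer_inverse B *\<^sub>v x \<in> carrier_vec p" "B *\<^sub>v (cramer_inverse B *\<^sub>v x) = x"
  using pd_inverse pos_def_matD(1)[OF pd] assms
  by (auto simp: assoc_mult_mat_vec[of B p p _ p, symmetric])

lemma pd_inverse_symmetric: "(cramer_inverse B)\<^sup>T = cramer_inverse B"
proof -
  let ?R = "cramer_inverse B"
  note [simp] = pd_inverse(1) pos_def_matD(1)[OF pd]
  have "?R\<^sup>T = ?R\<^sup>T * (B * ?R)" by (simp add: pd_inverse right_mult_one_mat[of _ p p])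
  also have "\<dots> = (?R\<^sup>T * B\<^sup>T) * ?R"
    by (simp add: pos_def_matD(2)[OF pd] assoc_mult_mat[of _ p p _ p _ p])
  also have "?R\<^sup>T * B\<^sup>T = (B * ?R)\<^sup>T" by (rule transpose_mult[of _ p p _ p, symmetric]) auto
  also have "\<dots> = 1\<^sub>m p" by (simp add: pd_inverse)
  finally show ?thesis by (simp add: left_mult_one_mat[of _ p p])
qed

text \<open>For u = B^-1 x, definiteness of B reads \<nu> |u|^2 <= u . x. This gives the sign at
  once, and Cauchy-Schwarz on the right-hand side gives \<nu> |u| <= |x|.\<close>

lemma pd_inverse_quadratic:
  assumes "x \<in> carrier_vec p"
  shows "0 \<le> x \<bullet> (cramer_inverse B *\<^sub>v x)"
    and "(cramer_inverse B *\<^sub>v x) \<bullet> (cramer_inverse B *\<^sub>v x) \<le> (x \<bullet> x) / \<nu>\<^sup>2"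
proof -
  let ?u = "cramer_inverse B *\<^sub>v x"
  have u: "?u \<in> carrier_vec p" using pd_inverse_mult_vec[OF assms] by auto
  have *: "\<nu> * (?u \<bullet> ?u) \<le> ?u \<bullet> x"
    using pos_def_matD(3)[OF pd u] pd_inverse_mult_vec[OF assms] by simp
  then show "0 \<le> x \<bullet> ?u" using nu sprod_self_nonneg[of ?u] comm_scalar_prod[OF assms u]
    by (metis mult_nonneg_nonneg less_imp_le order_trans)
  have "(\<nu> * (?u \<bullet> ?u))\<^sup>2 \<le> (?u \<bullet> x)\<^sup>2"
    using * nu sprod_self_nonneg[of ?u] by (intro power_mono) auto
  also have "\<dots> \<le> (?u \<bullet> ?u) * (x \<bullet> x)" using sprod_cauchy_schwarz[OF u assms] .
  finally have **: "\<nu>\<^sup>2 * (?u \<bullet> ?u) * (?u \<bullet> ?u) \<le> (x \<bullet> x) * (?u \<bullet> ?u)"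
    by (simp add: power2_eq_square mult_ac)
  show "?u \<bullet> ?u \<le> (x \<bullet> x) / \<nu>\<^sup>2"
  proof (cases "?u \<bullet> ?u = 0")
    case True then show ?thesis using sprod_self_nonneg[of x] by simp
  next
    case False
    then have "?u \<bullet> ?u > 0" using sprod_self_nonneg[of ?u] by simp
    with ** have "\<nu>\<^sup>2 * (?u \<bullet> ?u) \<le> x \<bullet> x" by simp
    then show ?thesis using nu by (simp add: field_simps)
  qed
qed

end

text \<open>Adding a positive semidefinite matrix \<open>D\<close> to \<open>B\<close> decreases the quadratic form of
  the inverse, and to first order only by that of \<open>B\<^sup>-\<^sup>1 D B\<^sup>-\<^sup>1\<close>.\<close>

lemma inverse_quadratic_perturbation:
  assumes B: "B \<in> carrier_mat p p" "B\<^sup>T = B" and D: "D \<in> carrier_mat p p" "D\<^sup>T = D"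
    and Bp: "\<And>v. v \<in> carrier_vec p \<Longrightarrow> 0 \<le> v \<bullet> (B *\<^sub>v v)"
    and Dp: "\<And>v. v \<in> carrier_vec p \<Longrightarrow> 0 \<le> v \<bullet> (D *\<^sub>v v)"
    and u: "u \<in> carrier_vec p" and v: "v \<in> carrier_vec p"
    and x: "x = B *\<^sub>v u" "x = B *\<^sub>v v + D *\<^sub>v (v::real Matrix.vec)"
  shows "x \<bullet> v \<le> x \<bullet> u" "x \<bullet> u - x \<bullet> v \<le> u \<bullet> (D *\<^sub>v u)"
proof -
  define w where "w = u - v"
  have w: "w \<in> carrier_vec p" using u v by (simp add: w_def)
  have uv: "u = v + w" using u v by (intro eq_vecI) (auto simp: w_def)
  have [simp]: "B *\<^sub>v t \<in> carrier_vec p" "D *\<^sub>v t \<in> carrier_vec p" if "t \<in> carrier_vec p" for t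
    using B D that by auto
  note [simp] = u v w
  have Bu: "B *\<^sub>v u = B *\<^sub>v v + B *\<^sub>v w" unfolding uv using B by (simp add: mult_add_distrib_mat_vec[of _ p p])
  have Du: "D *\<^sub>v u = D *\<^sub>v v + D *\<^sub>v w" unfolding uv using D by (simp add: mult_add_distrib_mat_vec[of _ p p])
  \<comment> \<open>Subtracting the two equations for \<open>x\<close> gives B w = D v. Thus the
    mixed term w . D v equals w . B w, which is nonnegative; both inequalities rest on this.\<close>
  have BwDv: "t \<bullet> (B *\<^sub>v w) = t \<bullet> (D *\<^sub>v v)" if "t \<in> carrier_vec p" for t
  proof -
    have "t \<bullet> (B *\<^sub>v v + B *\<^sub>v w) = t \<bullet> (B *\<^sub>v v + D *\<^sub>v v)" using Bu x by simp
    then show ?thesis using that by (simp add: scalar_prod_add_distrib[of _ p])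
  qed
  have xu: "x \<bullet> u - x \<bullet> v = v \<bullet> (D *\<^sub>v u)"
  proof -
    have "x \<bullet> u = u \<bullet> (B *\<^sub>v v) + u \<bullet> (D *\<^sub>v v)"
      unfolding x(2) using scalar_prod_add_distrib[of u p "B *\<^sub>v v" "D *\<^sub>v v"]
      comm_scalar_prod[of u p "B *\<^sub>v v + D *\<^sub>v v"] by simp
    moreover have "x \<bullet> v = v \<bullet> (B *\<^sub>v u)" unfolding x(1) by (simp add: comm_scalar_prod[of _ p v])
    moreover have "v \<bullet> (B *\<^sub>v u) = u \<bullet> (B *\<^sub>v v)" "v \<bullet> (D *\<^sub>v u) = u \<bullet> (D *\<^sub>v v)"
      using sprod_symmetric_mat[OF B v u] sprod_symmetric_mat[OF D v u] by auto
    ultimately show ?thesis by simp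
  qed
  have vDw: "v \<bullet> (D *\<^sub>v w) = w \<bullet> (D *\<^sub>v v)" using sprod_symmetric_mat[OF D v w] .
  have wDv: "0 \<le> w \<bullet> (D *\<^sub>v v)" using Bp[OF w] BwDv[OF w] by simp
  have vDu: "v \<bullet> (D *\<^sub>v u) = v \<bullet> (D *\<^sub>v v) + w \<bullet> (D *\<^sub>v v)"
    unfolding Du by (simp add: scalar_prod_add_distrib[of _ p] vDw)
  show "x \<bullet> v \<le> x \<bullet> u" using xu vDu wDv Dp[OF v] by simp
  have "u \<bullet> (D *\<^sub>v u) = v \<bullet> (D *\<^sub>v u) + w \<bullet> (D *\<^sub>v u)"
    by (subst (1) uv) (simp add: add_scalar_prod_distrib[of _ p])
  moreover have "w \<bullet> (D *\<^sub>v u) = w \<bullet> (D *\<^sub>v v) + w \<bullet> (D *\<^sub>v w)"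
    unfolding Du by (simp add: scalar_prod_add_distrib[of _ p])
  ultimately show "x \<bullet> u - x \<bullet> v \<le> u \<bullet> (D *\<^sub>v u)" using xu wDv Dp[OF w] by simp
qed

text \<open>Matrix determinant lemma. The bordered matrix with the blocks B, X, -Y, 1 is factorised
  into block triangular matrices in two ways, eliminating X once by means of B and once by means of
  the corner 1. The remaining diagonal blocks are B with its Schur complement \<open>s\<close>, and
  B + X Y with 1.\<close>

lemma det_add_mult:
  assumes B: "(B::real mat) \<in> carrier_mat p p" and d: "Determinant.det B \<noteq> 0"
    and X: "X \<in> carrier_mat p 1" and Y: "Y \<in> carrier_mat 1 p"
  shows "Determinant.det (B + X * Y) = Determinant.det B * (1 + (Y * (cramer_inverse B * X)) $$ (0, 0))"
proof -
  let ?R = "cramer_inverse B"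
  note R = cramer_inverse[OF B d]
  define s where "s = 1\<^sub>m 1 + Y * (?R * X)"
  have RX: "?R * X \<in> carrier_mat p 1" using R X by auto
  have s: "s \<in> carrier_mat 1 1" using Y RX by (auto simp: s_def)
  have BRX: "B * (?R * X) = X" using R B X by (simp add: assoc_mult_mat[of _ p p _ p _ 1, symmetric])
  have YRX: "Y * (?R * X) \<in> carrier_mat 1 1" using Y RX by auto
  have m1: "four_block_mat B (0\<^sub>m p 1) (-Y) s * four_block_mat (1\<^sub>m p) (?R * X) (0\<^sub>m 1 p) (1\<^sub>m 1)
     = four_block_mat B X (-Y) (1\<^sub>m 1)"
  proof -
    have "- W + (1\<^sub>m 1 + W) = 1\<^sub>m 1" if "W \<in> carrier_mat 1 1" for W :: "real mat"
      using that by (intro eq_matI) auto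
    moreover have "- Y * (?R * X) = - (Y * (?R * X))" using Y RX by (auto intro!: uminus_mult_left_mat)
    moreover have "s * 1\<^sub>m 1 = s" by (rule right_mult_one_mat[OF s])
    ultimately have "- Y * (?R * X) + s * 1\<^sub>m 1 = 1\<^sub>m 1" using YRX unfolding s_def by (simp only:)
    moreover have "B * 1\<^sub>m p + 0\<^sub>m p 1 * 0\<^sub>m 1 p = B" using B by simp
    moreover have "B * (?R * X) + 0\<^sub>m p 1 * 1\<^sub>m 1 = X" using X by (simp add: BRX)
    moreover have "- Y * 1\<^sub>m p + s * 0\<^sub>m 1 p = - Y" using Y s by simp
    moreover note mult_four_block_mat[of B p p "0\<^sub>m p 1" 1 "-Y" 1 s "1\<^sub>m p" p "?R * X" 1 "0\<^sub>m 1 p" "1\<^sub>m 1"]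
    ultimately show ?thesis using B X Y s RX by (simp only: zero_carrier_mat one_carrier_mat uminus_carrier_iff_mat simp_thms)
  qed
  have XY: "X * Y \<in> carrier_mat p p" using X Y by auto
  have m2: "four_block_mat (1\<^sub>m p) X (0\<^sub>m 1 p) (1\<^sub>m 1) * four_block_mat (B + X * Y) (0\<^sub>m p 1) (-Y) (1\<^sub>m 1)
     = four_block_mat B X (-Y) (1\<^sub>m 1)"
  proof -
    have "B + C + - C = B" if "C \<in> carrier_mat p p" for C using B that by (intro eq_matI) auto
    moreover have "X * - Y = - (X * Y)" using X Y by simp
    ultimately have "1\<^sub>m p * (B + X * Y) + X * - Y = B" using XY B by (simp add: left_mult_one_mat[of _ p p])
    moreover have "1\<^sub>m p * 0\<^sub>m p 1 + X * 1\<^sub>m 1 = X" using X by simp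
    moreover have "0\<^sub>m 1 p * (B + X * Y) + 1\<^sub>m 1 * - Y = - Y"
    proof -
      have "0\<^sub>m 1 p * (B + X * Y) = 0\<^sub>m 1 p" by (rule left_mult_zero_mat) (use B XY in simp)
      moreover have "1\<^sub>m 1 * - Y = - Y" by (rule left_mult_one_mat) (use Y in simp)
      moreover have "0\<^sub>m 1 p + - Y = - Y" by (rule left_add_zero_mat) (use Y in simp)
      ultimately show ?thesis by simp
    qed
    moreover have "0\<^sub>m 1 p * 0\<^sub>m p 1 + 1\<^sub>m 1 * 1\<^sub>m 1 = (1\<^sub>m 1 :: real mat)" by simp
    moreover note mult_four_block_mat[of "1\<^sub>m p" p p X 1 "0\<^sub>m 1 p" 1 "1\<^sub>m 1" "B + X * Y" p "0\<^sub>m p 1" 1 "-Y" "1\<^sub>m 1"]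
    ultimately show ?thesis using B X Y XY by (simp only: add_carrier_mat zero_carrier_mat one_carrier_mat uminus_carrier_iff_mat simp_thms)
  qed
  have "Determinant.det (four_block_mat B (0\<^sub>m p 1) (-Y) s) = Determinant.det B * Determinant.det s"
    by (rule det_four_block_mat_upper_right_zero[OF B]) (use Y s in auto)
  moreover have "Determinant.det (four_block_mat (1\<^sub>m p) (?R * X) (0\<^sub>m 1 p) (1\<^sub>m 1)) = Determinant.det (1\<^sub>m p) * Determinant.det (1\<^sub>m 1)"
    by (rule det_four_block_mat_lower_left_zero) (use RX in auto)
  moreover have "Determinant.det (four_block_mat (1\<^sub>m p) X (0\<^sub>m 1 p) (1\<^sub>m 1)) = Determinant.det (1\<^sub>m p) * Determinant.det (1\<^sub>m 1)"
    by (rule det_four_block_mat_lower_left_zero) (use X in auto)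
  moreover have "Determinant.det (four_block_mat (B + X * Y) (0\<^sub>m p 1) (-Y) (1\<^sub>m 1)) = Determinant.det (B + X * Y) * Determinant.det (1\<^sub>m 1)"
    by (rule det_four_block_mat_upper_right_zero) (use B XY Y in auto)
  moreover have "Determinant.det (four_block_mat B X (-Y) (1\<^sub>m 1)) =
      Determinant.det (four_block_mat B (0\<^sub>m p 1) (-Y) s) * Determinant.det (four_block_mat (1\<^sub>m p) (?R * X) (0\<^sub>m 1 p) (1\<^sub>m 1))"
    unfolding m1[symmetric] by (intro det_mult[of _ "p+1"] four_block_carrier_mat B s one_carrier_mat)
  moreover have "Determinant.det (four_block_mat B X (-Y) (1\<^sub>m 1)) =
      Determinant.det (four_block_mat (1\<^sub>m p) X (0\<^sub>m 1 p) (1\<^sub>m 1)) * Determinant.det (four_block_mat (B + X * Y) (0\<^sub>m p 1) (-Y) (1\<^sub>m 1))"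
    unfolding m2[symmetric] by (intro det_mult[of _ "p+1"] four_block_carrier_mat B XY add_carrier_mat one_carrier_mat)
  moreover have "Determinant.det s = 1 + (Y * (?R * X)) $$ (0, 0)"
  proof -
    have "(1\<^sub>m 1 + W) $$ (0, 0) = 1 + W $$ (0, 0)" if "W \<in> carrier_mat 1 1" for W :: "real mat"
      using that by simp
    moreover have "Determinant.det s = s $$ (0, 0)" using s by (rule det_single)
    ultimately show ?thesis using YRX unfolding s_def by (simp only:)
  qed
  ultimately show ?thesis by simp
qed


section \<open>Regularised Gram matrices and their resolvents\<close>

definition reg_gram :: "nat \<Rightarrow> nat \<Rightarrow> nat set \<Rightarrow> (nat \<Rightarrow> real Matrix.vec) \<Rightarrow> real \<Rightarrow> real mat" where
  "reg_gram p n I x \<nu> = mat p p (\<lambda>(a, b). (\<Sum>j\<in>I. x j $ a * x j $ b) / real n + (if a = b then \<nu> else 0))"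

lemma reg_gram_carrier [simp]: "reg_gram p n I x \<nu> \<in> carrier_mat p p"
  by (simp add: reg_gram_def)

lemma reg_gram_symmetric: "(reg_gram p n I x \<nu>)\<^sup>T = reg_gram p n I x \<nu>"
  by (intro eq_matI) (auto simp: reg_gram_def mult.commute)

lemma reg_gram_cong:
  assumes "\<And>j. j \<in> I \<Longrightarrow> x j = x' j"
  shows "reg_gram p n I x \<nu> = reg_gram p n I x' \<nu>"
  using assms by (intro eq_matI) (auto simp: reg_gram_def)

lemma reg_gram_bilinear:
  assumes "\<And>j. j \<in> I \<Longrightarrow> x j \<in> carrier_vec p" and u: "u \<in> carrier_vec p" and v: "v \<in> carrier_vec p"
  shows "u \<bullet> (reg_gram p n I x \<nu> *\<^sub>v v) = (\<Sum>j\<in>I. (x j \<bullet> u) * (x j \<bullet> v)) / real n + \<nu> * (u \<bullet> v)"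
proof -
  have "u \<bullet> (reg_gram p n I x \<nu> *\<^sub>v v) = (\<Sum>a<p. \<Sum>b<p. u $ a * ((\<Sum>j\<in>I. x j $ a * x j $ b) / real n + (if a = b then \<nu> else 0)) * v $ b)"
    unfolding sprod_sum[OF u mult_mat_vec_carrier[OF reg_gram_carrier v]]
    by (intro sum.cong refl) (use v in \<open>simp add: reg_gram_def scalar_prod_def lessThan_atLeast0 sum_distrib_left mult_ac\<close>)
  also have "\<dots> = (\<Sum>a<p. \<Sum>b<p. (\<Sum>j\<in>I. (x j $ a * u $ a) * (x j $ b * v $ b)) / real n + (if a = b then \<nu> * (u $ a * v $ b) else 0))"
    by (intro sum.cong refl) (auto simp: sum_distrib_left sum_distrib_right sum_divide_distrib algebra_simps)
  also have "\<dots> = (\<Sum>a<p. \<Sum>b<p. (\<Sum>j\<in>I. (x j $ a * u $ a) * (x j $ b * v $ b))) / real n + \<nu> * (\<Sum>a<p. u $ a * v $ a)"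
    by (simp add: sum.distrib sum_divide_distrib sum_distrib_left)
  also have "(\<Sum>a<p. \<Sum>b<p. (\<Sum>j\<in>I. (x j $ a * u $ a) * (x j $ b * v $ b)))
      = (\<Sum>a<p. \<Sum>j\<in>I. \<Sum>b<p. (x j $ a * u $ a) * (x j $ b * v $ b))"
    by (intro sum.cong refl sum.swap)
  also have "\<dots> = (\<Sum>j\<in>I. \<Sum>a<p. \<Sum>b<p. (x j $ a * u $ a) * (x j $ b * v $ b))"
    by (rule sum.swap)
  also have "\<dots> = (\<Sum>j\<in>I. (x j \<bullet> u) * (x j \<bullet> v))"
    using assms by (intro sum.cong refl) (simp add: sprod_sum[of _ p] sum_product)
  finally show ?thesis using u v by (simp add: sprod_sum)
qed

lemma reg_gram_pos_def:
  assumes "\<And>j. j \<in> I \<Longrightarrow> x j \<in> carrier_vec p"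
  shows "pos_def_mat \<nu> p (reg_gram p n I x \<nu>)"
  unfolding pos_def_mat_def using assms reg_gram_symmetric
  by (auto simp: reg_gram_bilinear intro!: divide_nonneg_nonneg sum_nonneg)

text \<open>The shift is split together with the index set, so that one identity serves both
  comparisons of resolvents: removing columns (\<open>\<beta> = 0\<close>) and moving the spectral
  parameter (\<open>J = {}\<close>).\<close>

lemma reg_gram_Un:
  assumes "finite I" "finite J" "I \<inter> J = {}"
  shows "reg_gram p n (I \<union> J) x (\<nu> + \<beta>) = reg_gram p n I x \<nu> + reg_gram p n J x \<beta>"
  using assms by (intro eq_matI) (auto simp: reg_gram_def sum.union_disjoint add_divide_distrib)

text \<open>The resolvent of the Gram matrix at the negative real point -\<nu>. The index set varies
  while the normalisation by \<open>n\<close> stays fixed, so leaving out columns is a comparison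
  between two subsets.\<close>

definition resolv :: "nat \<Rightarrow> nat \<Rightarrow> nat set \<Rightarrow> (nat \<Rightarrow> real Matrix.vec) \<Rightarrow> real \<Rightarrow> real mat" where
  "resolv p n I x \<nu> = cramer_inverse (reg_gram p n I x \<nu>)"

lemma resolv_cong:
  assumes "\<And>j. j \<in> I \<Longrightarrow> x j = x' j"
  shows "resolv p n I x \<nu> = resolv p n I x' \<nu>"
  using reg_gram_cong[OF assms] by (simp add: resolv_def)

context
  fixes p n :: nat and I :: "nat set" and x :: "nat \<Rightarrow> real Matrix.vec" and \<nu> :: real
  assumes xc: "\<And>j. j \<in> I \<Longrightarrow> x j \<in> carrier_vec p" and nu: "\<nu> > 0"
begin

lemma resolv_carrier: "resolv p n I x \<nu> \<in> carrier_mat p p"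
  unfolding resolv_def by (rule pd_inverse(1)[OF reg_gram_pos_def nu]) (rule xc)

lemma resolv_symmetric: "(resolv p n I x \<nu>)\<^sup>T = resolv p n I x \<nu>"
  unfolding resolv_def by (rule pd_inverse_symmetric[OF reg_gram_pos_def nu]) (rule xc)

lemma resolv_mult_vec:
  assumes "g \<in> carrier_vec p"
  shows "resolv p n I x \<nu> *\<^sub>v g \<in> carrier_vec p" "reg_gram p n I x \<nu> *\<^sub>v (resolv p n I x \<nu> *\<^sub>v g) = g"
  unfolding resolv_def using pd_inverse_mult_vec[OF reg_gram_pos_def nu assms] xc by auto

lemma resolv_quadratic:
  assumes "g \<in> carrier_vec p"
  shows "0 \<le> g \<bullet> (resolv p n I x \<nu> *\<^sub>v g)"
    and "(resolv p n I x \<nu> *\<^sub>v g) \<bullet> (resolv p n I x \<nu> *\<^sub>v g) \<le> (g \<bullet> g) / \<nu>\<^sup>2"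
  unfolding resolv_def using pd_inverse_quadratic[OF reg_gram_pos_def nu assms] xc by auto

end

text \<open>The perturbation is the unshifted Gram matrix of the removed columns, whose quadratic
  form is a sum of squares. The error contains the resolvent of the columns that stay, not of all of
  them; this is what makes it possible to decouple it from the removed columns.\<close>

lemma resolv_removal:
  assumes xc: "\<And>j. j \<in> I \<union> J \<Longrightarrow> x j \<in> carrier_vec p" and fin: "finite I" "finite J" "I \<inter> J = {}"
    and nu: "\<nu> > 0" and g: "g \<in> carrier_vec p"
  shows "g \<bullet> (resolv p n (I \<union> J) x \<nu> *\<^sub>v g) \<le> g \<bullet> (resolv p n I x \<nu> *\<^sub>v g)"
    and "g \<bullet> (resolv p n I x \<nu> *\<^sub>v g) - g \<bullet> (resolv p n (I \<union> J) x \<nu> *\<^sub>v g)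
      \<le> (\<Sum>j\<in>J. (x j \<bullet> (resolv p n I x \<nu> *\<^sub>v g))\<^sup>2) / real n"
proof -
  let ?u = "resolv p n I x \<nu> *\<^sub>v g" and ?v = "resolv p n (I \<union> J) x \<nu> *\<^sub>v g"
  have uc: "?u \<in> carrier_vec p" "reg_gram p n I x \<nu> *\<^sub>v ?u = g"
    using resolv_mult_vec[of I x p \<nu> g n] xc nu g by auto
  have vc: "?v \<in> carrier_vec p" "reg_gram p n (I \<union> J) x \<nu> *\<^sub>v ?v = g"
    using resolv_mult_vec[of "I \<union> J" x p \<nu> g n] xc nu g by auto
  have eq: "reg_gram p n I x \<nu> *\<^sub>v ?v + reg_gram p n J x 0 *\<^sub>v ?v = g"
    using reg_gram_Un[OF fin, of p n x \<nu> 0] vc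
    by (simp add: add_mult_distrib_mat_vec[of _ p p])
  have pd: "0 \<le> v \<bullet> (reg_gram p n I x \<nu> *\<^sub>v v)" if "v \<in> carrier_vec p" for v
    using pos_def_matD(3)[OF reg_gram_pos_def that, of I x \<nu> n] xc nu sprod_self_nonneg[of v]
    by (auto intro: order_trans[of 0 "\<nu> * (v \<bullet> v)"])
  have pd': "0 \<le> v \<bullet> (reg_gram p n J x 0 *\<^sub>v v)" if "v \<in> carrier_vec p" for v
    using pos_def_matD(3)[OF reg_gram_pos_def that, of J x 0 n] xc by auto
  note * = inverse_quadratic_perturbation[OF reg_gram_carrier reg_gram_symmetric reg_gram_carrier
      reg_gram_symmetric pd pd' uc(1) vc(1) uc(2)[symmetric] eq[symmetric]]
  show "g \<bullet> ?v \<le> g \<bullet> ?u" using *(1) .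
  show "g \<bullet> ?u - g \<bullet> ?v \<le> (\<Sum>j\<in>J. (x j \<bullet> ?u)\<^sup>2) / real n"
    using *(2) xc uc by (simp add: reg_gram_bilinear power2_eq_square)
qed

text \<open>For the second inequality, with G the unshifted Gram matrix, \<nu> R(\<nu>) is the
  inverse of G / \<nu> + 1. Since G / \<alpha> + 1 exceeds G / \<beta> + 1 by the semidefinite
  matrix (1 / \<alpha> - 1 / \<beta>) G, monotonicity of the inverse applies to the scaled matrices
  as it does to the original ones for the first inequality.\<close>

lemma resolv_shift:
  assumes xc: "\<And>j. j \<in> I \<Longrightarrow> x j \<in> carrier_vec p" and fin: "finite I"
    and nu: "0 < \<alpha>" "\<alpha> < \<beta>" and g: "g \<in> carrier_vec p"
  shows "g \<bullet> (resolv p n I x \<beta> *\<^sub>v g) \<le> g \<bullet> (resolv p n I x \<alpha> *\<^sub>v g)"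
    and "\<alpha> * (g \<bullet> (resolv p n I x \<alpha> *\<^sub>v g)) \<le> \<beta> * (g \<bullet> (resolv p n I x \<beta> *\<^sub>v g))"
proof -
  let ?u = "resolv p n I x \<alpha> *\<^sub>v g" and ?v = "resolv p n I x \<beta> *\<^sub>v g"
  have uc: "?u \<in> carrier_vec p" "reg_gram p n I x \<alpha> *\<^sub>v ?u = g"
    using resolv_mult_vec[of I x p \<alpha> g n] xc nu g by auto
  have vc: "?v \<in> carrier_vec p" "reg_gram p n I x \<beta> *\<^sub>v ?v = g"
    using resolv_mult_vec[of I x p \<beta> g n] xc nu g by auto
  have sc: "reg_gram p n I x \<nu> *\<^sub>v v = reg_gram p n I x 0 *\<^sub>v v + \<nu> \<cdot>\<^sub>v v" if "v \<in> carrier_vec p" for v \<nu>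
  proof -
    have e: "reg_gram p n {} x \<nu> = \<nu> \<cdot>\<^sub>m 1\<^sub>m p" by (intro eq_matI) (auto simp: reg_gram_def)
    have "(\<nu> \<cdot>\<^sub>m 1\<^sub>m p) *\<^sub>v v = \<nu> \<cdot>\<^sub>v v"
      using that by (intro eq_vecI) (auto simp: smult_scalar_prod_distrib[of _ p])
    then show ?thesis using reg_gram_Un[of I "{}" p n x 0 \<nu>] fin e that
      by (simp add: add_mult_distrib_mat_vec[of _ p p])
  qed
  have pd: "0 \<le> v \<bullet> (reg_gram p n J x \<nu> *\<^sub>v v)" if "v \<in> carrier_vec p" "\<nu> \<ge> 0" "J \<subseteq> I" for v \<nu> J
  proof -
    have "\<And>j. j \<in> J \<Longrightarrow> x j \<in> carrier_vec p" using xc that by auto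
    then show ?thesis using pos_def_matD(3)[OF reg_gram_pos_def that(1), of J x \<nu> n] that sprod_self_nonneg[of v]
      by (auto intro: order_trans[of 0 "\<nu> * (v \<bullet> v)"])
  qed
  have eq: "reg_gram p n I x \<alpha> *\<^sub>v ?v + reg_gram p n {} x (\<beta> - \<alpha>) *\<^sub>v ?v = g"
    using reg_gram_Un[of I "{}" p n x \<alpha> "\<beta> - \<alpha>"] vc fin
    by (simp add: add_mult_distrib_mat_vec[of _ p p])
  show "g \<bullet> ?v \<le> g \<bullet> ?u"
    by (rule inverse_quadratic_perturbation(1)[OF reg_gram_carrier reg_gram_symmetric reg_gram_carrier
      reg_gram_symmetric pd pd uc(1) vc(1) uc(2)[symmetric] eq[symmetric]]) (use nu in auto)
  define D where "D = (1 / \<alpha> - 1 / \<beta>) \<cdot>\<^sub>m reg_gram p n I x 0"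
  define B where "B = (1 / \<beta>) \<cdot>\<^sub>m reg_gram p n I x \<beta>"
  have BD: "B \<in> carrier_mat p p" "D \<in> carrier_mat p p" "B\<^sup>T = B" "D\<^sup>T = D"
    by (auto simp: B_def D_def reg_gram_def mult.commute)
  have lm: "1 / \<alpha> - 1 / \<beta> \<ge> 0" using nu by (simp add: field_simps)
  have smv: "(t \<cdot>\<^sub>m reg_gram p n I x \<nu>) *\<^sub>v w = t \<cdot>\<^sub>v (reg_gram p n I x \<nu> *\<^sub>v w)" if "w \<in> carrier_vec p" for t \<nu> w
    using that by (intro eq_vecI) (auto simp: smult_scalar_prod_distrib[of _ p] reg_gram_def)
  have pdB: "0 \<le> w \<bullet> (B *\<^sub>v w)" "0 \<le> w \<bullet> (D *\<^sub>v w)" if w: "w \<in> carrier_vec p" for w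
  proof -
    have c: "reg_gram p n I x \<nu> *\<^sub>v w \<in> carrier_vec p" for \<nu> by (rule mult_mat_vec_carrier[OF reg_gram_carrier w])
    show "0 \<le> w \<bullet> (B *\<^sub>v w)" unfolding B_def smv[OF w] using pd[OF w, of \<beta> I] nu c
      by (simp add: scalar_prod_smult_distrib[OF w])
    show "0 \<le> w \<bullet> (D *\<^sub>v w)" unfolding D_def smv[OF w] using pd[OF w, of 0 I] lm c
      by (simp add: scalar_prod_smult_distrib[OF w])
  qed
  have muv: "g = B *\<^sub>v (\<beta> \<cdot>\<^sub>v ?v)"
  proof -
    have "B *\<^sub>v (\<beta> \<cdot>\<^sub>v ?v) = \<beta> \<cdot>\<^sub>v ((1/\<beta>) \<cdot>\<^sub>v g)"
      using vc smv BD(1) by (simp add: mult_mat_vec[of _ p p] B_def)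
    then show ?thesis using nu by (intro eq_vecI) (auto simp: smult_smult_assoc)
  qed
  have lau: "g = B *\<^sub>v (\<alpha> \<cdot>\<^sub>v ?u) + D *\<^sub>v (\<alpha> \<cdot>\<^sub>v ?u)"
  proof -
    have e: "\<alpha> \<cdot>\<^sub>v ((1/\<beta>) \<cdot>\<^sub>v (a + \<beta> \<cdot>\<^sub>v b)) + \<alpha> \<cdot>\<^sub>v ((1 / \<alpha> - 1 / \<beta>) \<cdot>\<^sub>v a) = a + \<alpha> \<cdot>\<^sub>v b"
      if "a \<in> carrier_vec p" "b \<in> carrier_vec p" for a b
      using that nu by (intro eq_vecI) (auto simp: field_simps)
    let ?c = "reg_gram p n I x 0 *\<^sub>v ?u"
    have c: "?c \<in> carrier_vec p" by (rule mult_mat_vec_carrier[OF reg_gram_carrier uc(1)])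
    have "B *\<^sub>v (\<alpha> \<cdot>\<^sub>v ?u) + D *\<^sub>v (\<alpha> \<cdot>\<^sub>v ?u)
      = \<alpha> \<cdot>\<^sub>v ((1/\<beta>) \<cdot>\<^sub>v (?c + \<beta> \<cdot>\<^sub>v ?u)) + \<alpha> \<cdot>\<^sub>v ((1 / \<alpha> - 1 / \<beta>) \<cdot>\<^sub>v ?c)"
      using uc(1) smv sc[OF uc(1), of \<beta>] BD(1,2) by (simp add: mult_mat_vec[of _ p p] B_def D_def)
    also have "\<dots> = ?c + \<alpha> \<cdot>\<^sub>v ?u"
      using e[OF c uc(1)] .
    finally show ?thesis using sc[OF uc(1), of \<alpha>] uc(2) by simp
  qed
  have "g \<bullet> (\<alpha> \<cdot>\<^sub>v ?u) \<le> g \<bullet> (\<beta> \<cdot>\<^sub>v ?v)"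
    by (rule inverse_quadratic_perturbation(1)[OF BD(1,3) BD(2,4) pdB _ _ muv lau]) (use uc vc in auto)
  then show "\<alpha> * (g \<bullet> ?u) \<le> \<beta> * (g \<bullet> ?v)" using uc vc g by simp
qed

lemma det_reg_gram_insert:
  assumes xc: "\<And>j. j \<in> insert k I \<Longrightarrow> x j \<in> carrier_vec p" and fin: "finite I" "k \<notin> I" and nu: "\<nu> > 0"
  shows "Determinant.det (reg_gram p n (insert k I) x \<nu>)
    = Determinant.det (reg_gram p n I x \<nu>) * (1 + (x k \<bullet> (resolv p n I x \<nu> *\<^sub>v x k)) / real n)"
proof -
  let ?B = "reg_gram p n I x \<nu>" and ?R = "resolv p n I x \<nu>"
  define X where "X = mat p 1 (\<lambda>(a, b). x k $ a / real n)"
  define Y where "Y = mat 1 p (\<lambda>(a, b). x k $ b)"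
  have XY: "X \<in> carrier_mat p 1" "Y \<in> carrier_mat 1 p" by (auto simp: X_def Y_def)
  have R: "?R \<in> carrier_mat p p" using resolv_carrier[of I x p \<nu> n] xc nu by auto
  have "reg_gram p n (insert k I) x \<nu> = ?B + X * Y"
  proof (rule eq_matI)
    fix i j assume "i < dim_row (?B + X * Y)" "j < dim_col (?B + X * Y)"
    then have ij: "i < p" "j < p" using XY by auto
    have "(X * Y) $$ (i, j) = x k $ i / real n * x k $ j"
      using ij by (simp add: X_def Y_def scalar_prod_def)
    then show "reg_gram p n (insert k I) x \<nu> $$ (i, j) = (?B + X * Y) $$ (i, j)"
      using ij fin XY by (simp add: reg_gram_def add_divide_distrib)
  qed (use XY in \<open>auto simp: reg_gram_def\<close>)
  moreover have "Determinant.det ?B \<noteq> 0"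
    by (rule det_pos_def_nonzero[OF reg_gram_pos_def nu]) (use xc in auto)
  moreover have "(Y * (?R * X)) $$ (0, 0) = (x k \<bullet> (?R *\<^sub>v x k)) / real n"
  proof -
    have "row Y 0 = x k" using xc[of k] by (intro eq_vecI) (auto simp: Y_def)
    moreover have "col (?R * X) 0 = (1 / real n) \<cdot>\<^sub>v (?R *\<^sub>v x k)"
    proof (rule eq_vecI)
      fix i assume "i < dim_vec ((1 / real n) \<cdot>\<^sub>v (?R *\<^sub>v x k))"
      then have i: "i < p" using R by auto
      have "(\<Sum>l = 0..<p. ?R $$ (i, l) * (x k $ l / real n)) = (\<Sum>l = 0..<p. ?R $$ (i, l) * x k $ l) / real n"
        by (simp add: sum_divide_distrib)
      then show "col (?R * X) 0 $ i = ((1 / real n) \<cdot>\<^sub>v (?R *\<^sub>v x k)) $ i"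
        using i R xc[of k] by (simp add: X_def scalar_prod_def)
    qed (use R in auto)
    moreover have "?R *\<^sub>v x k \<in> carrier_vec p" using R xc[of k] by auto
    ultimately show ?thesis using R XY xc[of k] by (simp add: scalar_prod_smult_distrib[of _ p])
  qed
  ultimately show ?thesis using det_add_mult[of ?B p X Y] XY by (simp add: resolv_def)
qed

lemma det_reg_gram_pos:
  assumes "finite I" "\<And>j. j \<in> I \<Longrightarrow> x j \<in> carrier_vec p" "\<nu> > 0"
  shows "Determinant.det (reg_gram p n I x \<nu>) > 0"
  using assms
proof (induction I)
  case empty
  have "reg_gram p n {} x \<nu> = \<nu> \<cdot>\<^sub>m 1\<^sub>m p" by (intro eq_matI) (auto simp: reg_gram_def)
  then show ?case using empty by simp
next
  case (insert k I)
  have "x k \<bullet> (resolv p n I x \<nu> *\<^sub>v x k) \<ge> 0"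
    using resolv_quadratic(1)[of I x p \<nu> "x k" n] insert by auto
  then have "1 + (x k \<bullet> (resolv p n I x \<nu> *\<^sub>v x k)) / real n > 0" by (simp add: add_pos_nonneg)
  moreover have "Determinant.det (reg_gram p n I x \<nu>) > 0" using insert by auto
  moreover have "Determinant.det (reg_gram p n (insert k I) x \<nu>)
      = Determinant.det (reg_gram p n I x \<nu>) * (1 + (x k \<bullet> (resolv p n I x \<nu> *\<^sub>v x k)) / real n)"
    by (rule det_reg_gram_insert) (use insert in auto)
  ultimately show ?case by simp
qed

section \<open>Differences of log-determinants and the influence of one column\<close>

definition logdet_ratio :: "nat \<Rightarrow> nat \<Rightarrow> real \<Rightarrow> real \<Rightarrow> nat set \<Rightarrow> (nat \<Rightarrow> real Matrix.vec) \<Rightarrow> real" where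
  "logdet_ratio p n \<alpha> \<beta> I x = ln (Determinant.det (reg_gram p n I x \<beta>)) - ln (Determinant.det (reg_gram p n I x \<alpha>))"

lemma logdet_ratio_cong:
  assumes "\<And>j. j \<in> I \<Longrightarrow> x j = x' j"
  shows "logdet_ratio p n \<alpha> \<beta> I x = logdet_ratio p n \<alpha> \<beta> I x'"
  using reg_gram_cong[OF assms] by (simp add: logdet_ratio_def)

lemma logdet_ratio_insert:
  assumes xc: "\<And>j. j \<in> insert k I \<Longrightarrow> x j \<in> carrier_vec p" and fin: "finite I" "k \<notin> I"
    and nu: "0 < \<alpha>" "\<alpha> < \<beta>"
  shows "logdet_ratio p n \<alpha> \<beta> (insert k I) x = logdet_ratio p n \<alpha> \<beta> I x
      - (ln (1 + (x k \<bullet> (resolv p n I x \<alpha> *\<^sub>v x k)) / real n) - ln (1 + (x k \<bullet> (resolv p n I x \<beta> *\<^sub>v x k)) / real n))"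
proof -
  have "ln (Determinant.det (reg_gram p n (insert k I) x \<nu>))
    = ln (Determinant.det (reg_gram p n I x \<nu>)) + ln (1 + (x k \<bullet> (resolv p n I x \<nu> *\<^sub>v x k)) / real n)"
    if "\<nu> > 0" for \<nu>
  proof -
    have "x k \<bullet> (resolv p n I x \<nu> *\<^sub>v x k) \<ge> 0"
      using resolv_quadratic(1)[of I x p \<nu> "x k" n] xc that by auto
    moreover have "Determinant.det (reg_gram p n (insert k I) x \<nu>)
      = Determinant.det (reg_gram p n I x \<nu>) * (1 + (x k \<bullet> (resolv p n I x \<nu> *\<^sub>v x k)) / real n)"
      by (rule det_reg_gram_insert) (use xc fin that in auto)
    moreover have "Determinant.det (reg_gram p n I x \<nu>) > 0"
      using det_reg_gram_pos[of I x p \<nu> n] xc fin that by auto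
    ultimately show ?thesis by (simp add: ln_mult_pos add_pos_nonneg)
  qed
  then show ?thesis using nu by (simp add: logdet_ratio_def)
qed

text \<open>The two halves of \<open>resolv_shift\<close> give the two bounds: \<open>s\<close>
  decreases, which yields the sign, and \<nu> (1 + s \<nu>) increases, so that the quotient of 1 + s
  \<alpha> and 1 + s \<beta> is at most \<beta> / \<alpha>. No assumption on the size of
  \<open>g\<close> enters, and this is the origin of the truncation level in all later
  estimates.\<close>

lemma ln_ratio_bounds:
  fixes n :: nat
  assumes xc: "\<And>j. j \<in> I \<Longrightarrow> x j \<in> carrier_vec p" and fin: "finite I"
    and nu: "0 < \<alpha>" "\<alpha> < \<beta>" and g: "g \<in> carrier_vec p"
  defines "s \<equiv> \<lambda>\<nu>. (g \<bullet> (resolv p n I x \<nu> *\<^sub>v g)) / real n"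
  shows "0 \<le> ln (1 + s \<alpha>) - ln (1 + s \<beta>)" "ln (1 + s \<alpha>) - ln (1 + s \<beta>) \<le> ln (\<beta> / \<alpha>)"
proof -
  have nn: "0 \<le> s \<alpha>" "0 \<le> s \<beta>"
    unfolding s_def using resolv_quadratic(1)[of I x p _ g n] xc g nu by auto
  have le: "s \<beta> \<le> s \<alpha>" "\<alpha> * s \<alpha> \<le> \<beta> * s \<beta>"
    unfolding s_def times_divide_eq_right
    using resolv_shift[where I = I and x = x and n = n, OF xc fin nu g] by (auto intro!: divide_right_mono)
  show "0 \<le> ln (1 + s \<alpha>) - ln (1 + s \<beta>)" using nn le by simp
  have "\<alpha> * (1 + s \<alpha>) \<le> \<beta> * (1 + s \<beta>)" using le nu by (simp add: algebra_simps)
  then have "(1 + s \<alpha>) / (1 + s \<beta>) \<le> \<beta> / \<alpha>" using nn nu by (simp add: field_simps)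
  then have "ln ((1 + s \<alpha>) / (1 + s \<beta>)) \<le> ln (\<beta> / \<alpha>)" using nn nu by (simp add: add_pos_nonneg)
  then show "ln (1 + s \<alpha>) - ln (1 + s \<beta>) \<le> ln (\<beta> / \<alpha>)" using nn by (simp add: ln_divide_pos)
qed

lemma logdet_ratio_subset:
  assumes fin: "finite J" "finite I" "I \<inter> J = {}" and xc: "\<And>j. j \<in> I \<union> J \<Longrightarrow> x j \<in> carrier_vec p"
    and nu: "0 < \<alpha>" "\<alpha> < \<beta>"
  shows "\<bar>logdet_ratio p n \<alpha> \<beta> (I \<union> J) x - logdet_ratio p n \<alpha> \<beta> I x\<bar> \<le> real (card J) * ln (\<beta> / \<alpha>)"
  using fin xc
proof (induction J)
  case empty then show ?case by simp
next
  case (insert k J)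
  have c0: "\<And>j. j \<in> I \<union> J \<Longrightarrow> x j \<in> carrier_vec p" using insert by auto
  have c: "\<And>j. j \<in> insert k (I \<union> J) \<Longrightarrow> x j \<in> carrier_vec p" using insert by auto
  have k: "k \<notin> I \<union> J" "finite (I \<union> J)" using insert by auto
  have "\<bar>logdet_ratio p n \<alpha> \<beta> (insert k (I \<union> J)) x - logdet_ratio p n \<alpha> \<beta> (I \<union> J) x\<bar> \<le> ln (\<beta> / \<alpha>)"
    using logdet_ratio_insert[where x = x and I = "I \<union> J" and k = k and n = n, OF c k(2,1) nu] ln_ratio_bounds[where x = x and I = "I \<union> J" and g = "x k" and n = n, OF c0 k(2) nu] c by force
  moreover have "\<bar>logdet_ratio p n \<alpha> \<beta> (I \<union> J) x - logdet_ratio p n \<alpha> \<beta> I x\<bar> \<le> real (card J) * ln (\<beta> / \<alpha>)"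
    using insert by auto
  ultimately show ?case using insert by (simp add: algebra_simps)
qed

section \<open>The principal square root\<close>

lemma sym_psd_matsD:
  assumes "A \<in> sym_psd_mats p"
  shows "A \<in> carrier_mat p p" "A\<^sup>T = A" "v \<in> carrier_vec p \<Longrightarrow> 0 \<le> v \<bullet> (A *\<^sub>v v)"
  using assms by (auto simp: sym_psd_mats_def)

lemma psd_cauchy_schwarz:
  assumes A: "A \<in> sym_psd_mats p" and u: "u \<in> carrier_vec p" and v: "v \<in> carrier_vec p"
  shows "(u \<bullet> (A *\<^sub>v v))\<^sup>2 \<le> (u \<bullet> (A *\<^sub>v u)) * (v \<bullet> (A *\<^sub>v v))"
proof -
  note A' = sym_psd_matsD[OF A]
  define \<alpha> \<beta> \<gamma> where "\<alpha> = u \<bullet> (A *\<^sub>v u)" and "\<beta> = u \<bullet> (A *\<^sub>v v)" and "\<gamma> = v \<bullet> (A *\<^sub>v v)"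
  have c: "A *\<^sub>v u \<in> carrier_vec p" "A *\<^sub>v v \<in> carrier_vec p" using A' u v by auto
  have q: "0 \<le> \<alpha> + 2 * s * \<beta> + s\<^sup>2 * \<gamma>" for s
  proof -
    have "0 \<le> (u + s \<cdot>\<^sub>v v) \<bullet> (A *\<^sub>v (u + s \<cdot>\<^sub>v v))" using A'(3)[of "u + s \<cdot>\<^sub>v v"] u v by simp
    also have "A *\<^sub>v (u + s \<cdot>\<^sub>v v) = A *\<^sub>v u + s \<cdot>\<^sub>v (A *\<^sub>v v)"
      using A'(1) u v by (simp add: mult_add_distrib_mat_vec[of _ p p] mult_mat_vec[of _ p p])
    also have "(u + s \<cdot>\<^sub>v v) \<bullet> (A *\<^sub>v u + s \<cdot>\<^sub>v (A *\<^sub>v v)) = \<alpha> + s * \<beta> + s * (v \<bullet> (A *\<^sub>v u)) + s * s * \<gamma>"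
      using u v c by (simp add: add_scalar_prod_distrib[of _ p] scalar_prod_add_distrib[of _ p] \<alpha>_def \<beta>_def \<gamma>_def algebra_simps)
    also have "v \<bullet> (A *\<^sub>v u) = \<beta>" using sprod_symmetric_mat[OF A'(1,2) u v] by (simp add: \<beta>_def)
    finally show ?thesis by (simp add: power2_eq_square algebra_simps)
  qed
  have nn: "0 \<le> \<alpha>" "0 \<le> \<gamma>" using A'(3) u v by (auto simp: \<alpha>_def \<gamma>_def)
  have "\<beta>\<^sup>2 \<le> \<alpha> * \<gamma>"
  proof (cases "\<gamma> = 0")
    case True
    \<comment> \<open>With \<gamma> = 0 the nonnegative function of \<open>s\<close> is affine and
      must have slope zero; otherwise it would take the value -1 at the point chosen below.\<close>
    have "\<beta> = 0"
    proof (rule ccontr)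
      assume "\<beta> \<noteq> 0"
      then have "2 * (- (\<alpha> + 1) / (2 * \<beta>)) * \<beta> = - (\<alpha> + 1)" by (simp add: field_simps)
      then show False using q[of "- (\<alpha> + 1) / (2 * \<beta>)"] True by simp
    qed
    then show ?thesis using True by simp
  next
    case False
    then have "\<gamma> > 0" using nn by simp
    have "\<alpha> + 2 * (- \<beta> / \<gamma>) * \<beta> + (- \<beta> / \<gamma>)\<^sup>2 * \<gamma> = \<alpha> - \<beta>\<^sup>2 / \<gamma>"
      using False by (simp add: field_simps power2_eq_square)
    then have "\<beta>\<^sup>2 / \<gamma> \<le> \<alpha>" using q[of "- \<beta> / \<gamma>"] by simp
    then show ?thesis using \<open>\<gamma> > 0\<close> by (simp add: field_simps)
  qed
  then show ?thesis by (simp add: \<alpha>_def \<beta>_def \<gamma>_def)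
qed

lemma psd_quadratic_zero:
  assumes A: "A \<in> sym_psd_mats p" and v: "v \<in> carrier_vec p" and z: "v \<bullet> (A *\<^sub>v v) = 0"
  shows "A *\<^sub>v v = 0\<^sub>v p"
proof -
  have c: "A *\<^sub>v v \<in> carrier_vec p" using sym_psd_matsD(1)[OF A] v by auto
  have "((A *\<^sub>v v) \<bullet> (A *\<^sub>v v))\<^sup>2 \<le> 0" using psd_cauchy_schwarz[OF A c v] z by simp
  then have "(A *\<^sub>v v) \<bullet> (A *\<^sub>v v) = 0" by simp
  then show ?thesis using sprod_self_eq_0[OF c] by simp
qed

lemma mat_mult_entry:
  assumes "(X::'a::comm_ring_1 mat) \<in> carrier_mat p p" "Y \<in> carrier_mat p p" "i < p" "j < p"
  shows "(X * Y) $$ (i, j) = (\<Sum>l<p. X $$ (i, l) * Y $$ (l, j))"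
  using assms by (simp add: scalar_prod_def lessThan_atLeast0)

lemma mat_entry_sprod:
  assumes "(A::real mat) \<in> carrier_mat p p" "i < p" "j < p"
  shows "unit_vec p i \<bullet> (A *\<^sub>v unit_vec p j) = A $$ (i, j)"
  using assms by (simp add: scalar_prod_left_unit[of _ p] scalar_prod_right_unit[of _ p])

text \<open>The trace replaces the largest eigenvalue, which would require a spectral theorem.
  Cauchy-Schwarz for the form of A bounds each entry by the geometric mean of two diagonal entries;
  the usual Cauchy-Schwarz inequality then sums these bounds. The estimate serves to scale a matrix
  below the identity before its square root is expanded.\<close>

lemma psd_trace_bound:
  assumes A: "A \<in> sym_psd_mats p" and v: "v \<in> carrier_vec p"
  shows "v \<bullet> (A *\<^sub>v v) \<le> mat_trace A * (v \<bullet> v)" "0 \<le> mat_trace A"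
proof -
  note A' = sym_psd_matsD[OF A]
  have d: "0 \<le> A $$ (i, i)" if "i < p" for i
    using A'(3)[of "unit_vec p i"] mat_entry_sprod[OF A'(1) that that] by simp
  have e: "\<bar>A $$ (i, j)\<bar> \<le> sqrt (A $$ (i, i)) * sqrt (A $$ (j, j))" if "i < p" "j < p" for i j
  proof -
    have "(A $$ (i, j))\<^sup>2 \<le> A $$ (i, i) * A $$ (j, j)"
      using psd_cauchy_schwarz[OF A, of "unit_vec p i" "unit_vec p j"] that mat_entry_sprod[OF A'(1)] by simp
    then have "sqrt ((A $$ (i, j))\<^sup>2) \<le> sqrt (A $$ (i, i) * A $$ (j, j))" by (rule real_sqrt_le_mono)
    then show ?thesis by (simp add: real_sqrt_mult)
  qed
  show "0 \<le> mat_trace A" using A' d by (auto simp: mat_trace_def intro!: sum_nonneg)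
  have "v \<bullet> (A *\<^sub>v v) = (\<Sum>i<p. v $ i * (\<Sum>j<p. A $$ (i, j) * v $ j))"
    unfolding sprod_sum[OF v mult_mat_vec_carrier[OF A'(1) v]]
    by (intro sum.cong refl) (use A'(1) v in \<open>simp add: scalar_prod_def lessThan_atLeast0\<close>)
  also have "\<dots> = (\<Sum>i<p. \<Sum>j<p. v $ i * A $$ (i, j) * v $ j)"
    by (simp add: sum_distrib_left mult_ac)
  also have "\<dots> \<le> (\<Sum>i<p. \<Sum>j<p. (\<bar>v $ i\<bar> * sqrt (A $$ (i, i))) * (\<bar>v $ j\<bar> * sqrt (A $$ (j, j))))"
  proof (intro sum_mono)
    fix i j assume "i \<in> {..<p}" "j \<in> {..<p}"
    then have "\<bar>v $ i\<bar> * \<bar>A $$ (i, j)\<bar> * \<bar>v $ j\<bar> \<le> \<bar>v $ i\<bar> * (sqrt (A $$ (i, i)) * sqrt (A $$ (j, j))) * \<bar>v $ j\<bar>"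
      by (intro mult_right_mono mult_left_mono e) auto
    moreover have "v $ i * A $$ (i, j) * v $ j \<le> \<bar>v $ i\<bar> * \<bar>A $$ (i, j)\<bar> * \<bar>v $ j\<bar>"
      by (metis abs_ge_self abs_mult)
    ultimately show "v $ i * A $$ (i, j) * v $ j \<le> (\<bar>v $ i\<bar> * sqrt (A $$ (i, i))) * (\<bar>v $ j\<bar> * sqrt (A $$ (j, j)))"
      by (simp add: mult_ac)
  qed
  also have "\<dots> = (\<Sum>i<p. \<bar>v $ i\<bar> * sqrt (A $$ (i, i)))\<^sup>2"
    by (simp add: power2_eq_square sum_product)
  also have "\<dots> \<le> (\<Sum>i<p. \<bar>v $ i\<bar>\<^sup>2) * (\<Sum>i<p. (sqrt (A $$ (i, i)))\<^sup>2)"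
    by (rule Cauchy_Schwarz_ineq_sum)
  also have "(\<Sum>i<p. \<bar>v $ i\<bar>\<^sup>2) = v \<bullet> v" using v by (simp add: sprod_sum[of _ p] power2_eq_square)
  also have "(\<Sum>i<p. (sqrt (A $$ (i, i)))\<^sup>2) = mat_trace A"
    using A'(1) d by (auto simp: mat_trace_def intro!: sum.cong)
  finally show "v \<bullet> (A *\<^sub>v v) \<le> mat_trace A * (v \<bullet> v)" by (simp add: mult.commute)
qed

text \<open>The coefficients of \<open>1 - sqrt (1 - x) = (\<Sum>j. sqrt_coeff j * x ^ j)\<close>.\<close>

function sqrt_coeff :: "nat \<Rightarrow> real" where
  "sqrt_coeff k = (if k = 0 then 0 else if k = 1 then 1 / 2
     else (\<Sum>i\<in>{1..<k}. sqrt_coeff i * sqrt_coeff (k - i)) / 2)"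
  by pat_completeness auto
termination by (relation "Wellfounded.measure id") auto

declare sqrt_coeff.simps [simp del]

lemma sqrt_coeff_0 [simp]: "sqrt_coeff 0 = 0" by (simp add: sqrt_coeff.simps)

lemma sqrt_coeff_nonneg: "0 \<le> sqrt_coeff k"
proof (induction k rule: less_induct)
  case (less k)
  then show ?case by (subst sqrt_coeff.simps) (auto intro!: sum_nonneg mult_nonneg_nonneg)
qed

text \<open>In terms of T = 1 - sqrt (1 - x) this is the coefficient form of T^2 = 2 T - x. The end
  terms of the sum vanish since the coefficient at 0 does, and k = 1 is the place of the term
  x.\<close>

lemma sqrt_coeff_convolution:
  "(\<Sum>i\<le>k. sqrt_coeff i * sqrt_coeff (k - i)) = 2 * sqrt_coeff k - (if k = 1 then 1 else 0)"
proof -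
  have "(\<Sum>i\<le>k. sqrt_coeff i * sqrt_coeff (k - i)) = (\<Sum>i\<in>{1..<k}. sqrt_coeff i * sqrt_coeff (k - i))"
    by (rule sum.mono_neutral_right) (auto simp: not_less_eq_eq Suc_le_eq)
  also have "\<dots> = 2 * sqrt_coeff k - (if k = 1 then 1 else 0)"
    by (subst (3) sqrt_coeff.simps) auto
  finally show ?thesis .
qed

text \<open>The partial sums s_N satisfy 2 s_{N+1} <= s_N^2 + 1: all products with positive indices
  and index sum at most N have both indices below N, so they occur in s_N^2. Hence the bound 1
  propagates, without any appeal to the function sqrt.\<close>

lemma sqrt_coeff_partial_sum: "(\<Sum>k<N. sqrt_coeff k) \<le> 1"
proof (induction N)
  case 0 then show ?case by simp
next
  case (Suc N)
  have s: "(\<Sum>k<Suc N. \<Sum>i\<le>k. sqrt_coeff i * sqrt_coeff (k - i)) \<le> (\<Sum>k<N. sqrt_coeff k) * (\<Sum>k<N. sqrt_coeff k)"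
  proof -
    have "(\<Sum>k<Suc N. \<Sum>i\<le>k. sqrt_coeff i * sqrt_coeff (k - i))
       = (\<Sum>(k,i)\<in>(SIGMA k:{..<Suc N}. {..k}). sqrt_coeff i * sqrt_coeff (k - i))"
      by (rule sum.Sigma) auto
    also have "\<dots> = (\<Sum>(k,i)\<in>(SIGMA k:{..<Suc N}. {1..<k}). sqrt_coeff i * sqrt_coeff (k - i))"
    proof (rule sum.mono_neutral_right)
      show "\<forall>q\<in>Sigma {..<Suc N} atMost - (SIGMA k:{..<Suc N}. {1..<k}). (case q of (k, i) \<Rightarrow> sqrt_coeff i * sqrt_coeff (k - i)) = 0"
      proof
        fix q assume q: "q \<in> Sigma {..<Suc N} atMost - (SIGMA k:{..<Suc N}. {1..<k})"
        obtain k i where "q = (k, i)" by (cases q)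
        with q have "i = 0 \<or> k - i = 0" by auto
        then show "(case q of (k, i) \<Rightarrow> sqrt_coeff i * sqrt_coeff (k - i)) = 0" using \<open>q = (k, i)\<close> by auto
      qed
    qed auto
    also have "\<dots> = (\<Sum>(i,j)\<in>(\<lambda>(k,i). (i, k - i)) ` (SIGMA k:{..<Suc N}. {1..<k}). sqrt_coeff i * sqrt_coeff j)"
      by (subst sum.reindex) (auto simp: inj_on_def case_prod_unfold)
    also have "\<dots> \<le> (\<Sum>(i,j)\<in>{..<N} \<times> {..<N}. sqrt_coeff i * sqrt_coeff j)"
      by (rule sum_mono2) (auto simp: sqrt_coeff_nonneg)
    also have "\<dots> = (\<Sum>k<N. sqrt_coeff k) * (\<Sum>k<N. sqrt_coeff k)"
      by (simp add: sum_product sum.cartesian_product)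
    finally show ?thesis .
  qed
  have nn: "0 \<le> (\<Sum>k<N. sqrt_coeff k)" by (simp add: sum_nonneg sqrt_coeff_nonneg)
  have "2 * (\<Sum>k<Suc N. sqrt_coeff k) = (\<Sum>k<Suc N. (\<Sum>i\<le>k. sqrt_coeff i * sqrt_coeff (k - i)) + (if k = 1 then 1 else 0))"
    unfolding sum_distrib_left by (intro sum.cong refl) (simp add: sqrt_coeff_convolution)
  also have "\<dots> = (\<Sum>k<Suc N. \<Sum>i\<le>k. sqrt_coeff i * sqrt_coeff (k - i)) + (\<Sum>k<Suc N. (if k = 1 then 1 else 0))"
    by (rule sum.distrib)
  also have "\<dots> \<le> (\<Sum>k<N. sqrt_coeff k) * (\<Sum>k<N. sqrt_coeff k) + 1"
    by (intro add_mono s) (simp add: sum.delta del: sum.lessThan_Suc)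
  also have "\<dots> \<le> 1 * 1 + 1" using Suc nn by (intro add_mono mult_mono) auto
  finally show ?case by simp
qed

lemma sqrt_coeff_summable: "summable sqrt_coeff"
  by (rule summableI_nonneg_bounded[OF sqrt_coeff_nonneg sqrt_coeff_partial_sum])

lemma sqrt_coeff_suminf: "suminf sqrt_coeff \<le> 1"
  by (rule suminf_le_const[OF sqrt_coeff_summable sqrt_coeff_partial_sum])

text \<open>The binomial series, summed entry by entry, for the square root of I - C. It is meant
  for 0 <= C <= I, where the entries of all powers of C are bounded by 1.\<close>

definition series_sqrt :: "nat \<Rightarrow> real mat \<Rightarrow> real mat" where
  "series_sqrt p C = mat p p (\<lambda>(i, j). (if i = j then 1 else 0) - (\<Sum>k. sqrt_coeff k * (C ^\<^sub>m k) $$ (i, j)))"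

context
  fixes p :: nat and C :: "real mat"
  assumes C: "C \<in> sym_psd_mats p" and C1: "\<And>v. v \<in> carrier_vec p \<Longrightarrow> v \<bullet> (C *\<^sub>v v) \<le> v \<bullet> v"
begin

private lemma Cc [simp]: "C \<in> carrier_mat p p" using C by (simp add: sym_psd_matsD)

private lemma pow_c [simp]: "C ^\<^sub>m k \<in> carrier_mat p p" by (simp add: pow_carrier_mat)

private lemma pow_add: "C ^\<^sub>m (r + k) = C ^\<^sub>m r * C ^\<^sub>m k"
proof (induction k)
  case 0 then show ?case by (simp add: right_mult_one_mat[of _ p p] carrier_matD[OF Cc])
next
  case (Suc k) then show ?case by (simp add: assoc_mult_mat[of _ p p _ p _ p])
qed

text \<open>With u = C v, Cauchy-Schwarz for the form of C gives |u|^4 <= (u . C u) (v . C v), and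
  each factor is bounded through C <= I. This upgrades the bound on the form to a bound on the
  operator without eigenvalues.\<close>

private lemma contraction:
  assumes v: "v \<in> carrier_vec p" shows "(C *\<^sub>v v) \<bullet> (C *\<^sub>v v) \<le> v \<bullet> v"
proof -
  let ?u = "C *\<^sub>v v"
  have u: "?u \<in> carrier_vec p" by (rule mult_mat_vec_carrier[OF Cc v])
  have "(?u \<bullet> ?u)\<^sup>2 \<le> (?u \<bullet> (C *\<^sub>v ?u)) * (v \<bullet> ?u)" using psd_cauchy_schwarz[OF C u v] .
  also have "\<dots> \<le> (?u \<bullet> ?u) * (v \<bullet> v)"
    using C1[OF u] C1[OF v] sym_psd_matsD(3)[OF C u] sym_psd_matsD(3)[OF C v] by (intro mult_mono) (auto simp: sprod_self_nonneg)
  finally have "(?u \<bullet> ?u) * (?u \<bullet> ?u) \<le> (?u \<bullet> ?u) * (v \<bullet> v)" by (simp add: power2_eq_square)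
  then show ?thesis using sprod_self_nonneg[of ?u] sprod_self_nonneg[of v]
    by (cases "?u \<bullet> ?u = 0") (auto simp: mult_le_cancel_left)
qed

private lemma pow_contraction:
  assumes v: "v \<in> carrier_vec p" shows "(C ^\<^sub>m k *\<^sub>v v) \<bullet> (C ^\<^sub>m k *\<^sub>v v) \<le> v \<bullet> v"
  using v
proof (induction k arbitrary: v)
  case 0 then show ?case using Cc by (simp del: Cc add: carrier_matD[OF Cc])
next
  case (Suc k)
  have "C ^\<^sub>m Suc k *\<^sub>v v = C ^\<^sub>m k *\<^sub>v (C *\<^sub>v v)" using Suc by (simp add: assoc_mult_mat_vec[of _ p p _ p])
  then show ?case using Suc.IH[of "C *\<^sub>v v"] contraction[OF Suc.prems] Suc.prems
    by (smt (verit) Cc mult_mat_vec_carrier)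
qed

private lemma pow_bilinear:
  assumes u: "u \<in> carrier_vec p" and v: "v \<in> carrier_vec p"
  shows "\<bar>u \<bullet> (C ^\<^sub>m k *\<^sub>v v)\<bar> \<le> sqrt (u \<bullet> u) * sqrt (v \<bullet> v)"
proof -
  have c: "C ^\<^sub>m k *\<^sub>v v \<in> carrier_vec p" by (rule mult_mat_vec_carrier[OF pow_c v])
  have "(u \<bullet> (C ^\<^sub>m k *\<^sub>v v))\<^sup>2 \<le> (u \<bullet> u) * (v \<bullet> v)"
    using sprod_cauchy_schwarz[OF u c] pow_contraction[OF v, of k] sprod_self_nonneg[of u]
    by (meson mult_left_mono order_trans)
  then have "sqrt ((u \<bullet> (C ^\<^sub>m k *\<^sub>v v))\<^sup>2) \<le> sqrt ((u \<bullet> u) * (v \<bullet> v))" by (rule real_sqrt_le_mono)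
  then show ?thesis by (simp add: real_sqrt_mult)
qed

private lemma pow_entry:
  assumes "i < p" "j < p" shows "\<bar>(C ^\<^sub>m k) $$ (i, j)\<bar> \<le> 1"
  using pow_bilinear[of "unit_vec p i" "unit_vec p j" k] assms by (simp add: mat_entry_sprod[of _ p])

private lemma entry_abs_summable:
  assumes "i < p" "j < p" shows "summable (\<lambda>k. norm (sqrt_coeff k * (C ^\<^sub>m k) $$ (i, j)))"
proof (rule summable_comparison_test'[OF sqrt_coeff_summable, of 0])
  fix k show "norm (norm (sqrt_coeff k * (C ^\<^sub>m k) $$ (i, j))) \<le> sqrt_coeff k"
    using mult_left_mono[OF pow_entry[OF assms] sqrt_coeff_nonneg, of k k]
    by (simp add: abs_mult sqrt_coeff_nonneg)
qed

private lemma entry_summable: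
  assumes "i < p" "j < p" shows "summable (\<lambda>k. sqrt_coeff k * (C ^\<^sub>m k) $$ (i, j))"
  using summable_norm_cancel[OF entry_abs_summable[OF assms]] .

private definition T where "T i j = (\<Sum>k. sqrt_coeff k * (C ^\<^sub>m k) $$ (i, j))"

private lemma T_sums:
  assumes "i < p" "j < p" shows "(\<lambda>k. sqrt_coeff k * (C ^\<^sub>m k) $$ (i, j)) sums T i j"
  unfolding T_def by (rule summable_sums[OF entry_summable[OF assms]])

lemma series_sqrt_carrier: "series_sqrt p C \<in> carrier_mat p p"
  by (simp add: series_sqrt_def)

private lemma series_entry: "i < p \<Longrightarrow> j < p \<Longrightarrow> series_sqrt p C $$ (i, j) = (if i = j then 1 else 0) - T i j"
  by (simp add: series_sqrt_def T_def)

private lemma pow_symmetric: "(C ^\<^sub>m k)\<^sup>T = C ^\<^sub>m k"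
proof (induction k)
  case 0 then show ?case by simp
next
  case (Suc k)
  have "(C ^\<^sub>m Suc k)\<^sup>T = C\<^sup>T * (C ^\<^sub>m k)\<^sup>T" by (simp add: transpose_mult[of _ p p _ p])
  also have "\<dots> = C * C ^\<^sub>m k" using Suc sym_psd_matsD(2)[OF C] by simp
  also have "\<dots> = C ^\<^sub>m (Suc k)" using pow_add[of 1 k] carrier_matD[OF Cc] by (simp add: left_mult_one_mat[of _ p p])
  finally show ?case .
qed

text \<open>The matrix version of T^2 = 2 T - C: the Cauchy product of the absolutely convergent
  entry series turns products of powers into powers, and \<open>sqrt_coeff_convolution\<close>
  evaluates the coefficients. It follows that (I - T)^2 = I - C.\<close>

private lemma T_mult: 
  assumes i: "i < p" and j: "j < p"
  shows "(\<Sum>l<p. T i l * T l j) = 2 * T i j - C $$ (i, j)"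
proof -
  have "(\<lambda>k. \<Sum>r\<le>k. (sqrt_coeff r * (C ^\<^sub>m r) $$ (i, l)) * (sqrt_coeff (k - r) * (C ^\<^sub>m (k - r)) $$ (l, j))) sums (T i l * T l j)"
    if "l < p" for l
    unfolding T_def using entry_abs_summable[OF i that] entry_abs_summable[OF that j] by (rule Cauchy_product_sums)
  then have "(\<lambda>k. \<Sum>l<p. \<Sum>r\<le>k. (sqrt_coeff r * (C ^\<^sub>m r) $$ (i, l)) * (sqrt_coeff (k - r) * (C ^\<^sub>m (k - r)) $$ (l, j))) sums (\<Sum>l<p. T i l * T l j)"
    by (intro sums_sum) auto
  moreover have "(\<Sum>l<p. \<Sum>r\<le>k. (sqrt_coeff r * (C ^\<^sub>m r) $$ (i, l)) * (sqrt_coeff (k - r) * (C ^\<^sub>m (k - r)) $$ (l, j)))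
      = 2 * (sqrt_coeff k * (C ^\<^sub>m k) $$ (i, j)) - (if k = 1 then C $$ (i, j) else 0)" for k
  proof -
    have m: "(\<Sum>l<p. (C ^\<^sub>m r) $$ (i, l) * (C ^\<^sub>m (k - r)) $$ (l, j)) = (C ^\<^sub>m k) $$ (i, j)" if "r \<le> k" for r
    proof -
      have "C ^\<^sub>m k = C ^\<^sub>m r * C ^\<^sub>m (k - r)" using pow_add[of r "k - r"] that by simp
      moreover have "(C ^\<^sub>m r * C ^\<^sub>m (k - r)) $$ (i, j) = (\<Sum>l<p. (C ^\<^sub>m r) $$ (i, l) * (C ^\<^sub>m (k - r)) $$ (l, j))"
        by (rule mat_mult_entry) (use i j in auto)
      ultimately show ?thesis by simp
    qed
    have "(\<Sum>l<p. \<Sum>r\<le>k. (sqrt_coeff r * (C ^\<^sub>m r) $$ (i, l)) * (sqrt_coeff (k - r) * (C ^\<^sub>m (k - r)) $$ (l, j)))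
      = (\<Sum>r\<le>k. \<Sum>l<p. (sqrt_coeff r * sqrt_coeff (k - r)) * ((C ^\<^sub>m r) $$ (i, l) * (C ^\<^sub>m (k - r)) $$ (l, j)))"
      by (subst sum.swap) (simp add: mult_ac)
    also have "\<dots> = (\<Sum>r\<le>k. (sqrt_coeff r * sqrt_coeff (k - r)) * (C ^\<^sub>m k) $$ (i, j))"
      by (intro sum.cong refl) (simp add: sum_distrib_left[symmetric] m)
    also have "\<dots> = (2 * sqrt_coeff k - (if k = 1 then 1 else 0)) * (C ^\<^sub>m k) $$ (i, j)"
      by (simp add: sum_distrib_right[symmetric] sqrt_coeff_convolution)
    also have "\<dots> = 2 * (sqrt_coeff k * (C ^\<^sub>m k) $$ (i, j)) - (if k = 1 then C $$ (i, j) else 0)"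
      by (auto simp: algebra_simps)
    finally show ?thesis .
  qed
  ultimately have 1: "(\<lambda>k. 2 * (sqrt_coeff k * (C ^\<^sub>m k) $$ (i, j)) - (if k = 1 then C $$ (i, j) else 0)) sums (\<Sum>l<p. T i l * T l j)"
    by simp
  have 2: "(\<lambda>k. 2 * (sqrt_coeff k * (C ^\<^sub>m k) $$ (i, j)) - (if k = 1 then C $$ (i, j) else 0)) sums (2 * T i j - C $$ (i, j))"
    by (intro sums_diff sums_mult T_sums i j) (rule sums_single[of 1 "\<lambda>_. C $$ (i, j)"])
  show ?thesis using sums_unique2[OF 1 2] .
qed

lemma series_sqrt_square: "series_sqrt p C * series_sqrt p C = 1\<^sub>m p - C"
proof (rule eq_matI)
  fix i j assume "i < dim_row (1\<^sub>m p - C)" "j < dim_col (1\<^sub>m p - C)"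
  then have ij: "i < p" "j < p" using carrier_matD[OF Cc] by auto
  let ?d = "\<lambda>i j. if i = j then 1 else (0::real)"
  have "(series_sqrt p C * series_sqrt p C) $$ (i, j) = (\<Sum>l<p. (?d i l - T i l) * (?d l j - T l j))"
    unfolding mat_mult_entry[OF series_sqrt_carrier series_sqrt_carrier ij] using ij by (simp add: series_entry)
  also have "\<dots> = (\<Sum>l<p. ?d i l * ?d l j) - (\<Sum>l<p. ?d i l * T l j) - (\<Sum>l<p. T i l * ?d l j) + (\<Sum>l<p. T i l * T l j)"
    by (simp add: algebra_simps sum.distrib sum_subtractf)
  also have "(\<Sum>l<p. ?d i l * ?d l j) = ?d i j" using ij by (simp add: if_distrib[of "\<lambda>x. x * _"] cong: if_cong)
  also have "(\<Sum>l<p. ?d i l * T l j) = T i j" using ij by (simp add: if_distrib[of "\<lambda>x. x * _"] cong: if_cong)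
  also have "(\<Sum>l<p. T i l * ?d l j) = T i j" using ij by (simp add: if_distrib[of "\<lambda>x. _ * x"] cong: if_cong)
  finally show "(series_sqrt p C * series_sqrt p C) $$ (i, j) = (1\<^sub>m p - C) $$ (i, j)"
    using ij carrier_matD[OF Cc] by (simp add: T_mult)
qed (use series_sqrt_carrier carrier_matD[OF Cc] in \<open>auto simp: carrier_matD\<close>)

private lemma series_bilinear:
  assumes u: "u \<in> carrier_vec p" and v: "v \<in> carrier_vec p"
  shows "(\<lambda>k. sqrt_coeff k * (u \<bullet> (C ^\<^sub>m k *\<^sub>v v))) sums (u \<bullet> v - u \<bullet> (series_sqrt p C *\<^sub>v v))"
proof -
  have bil: "u \<bullet> (M *\<^sub>v v) = (\<Sum>i<p. \<Sum>j<p. u $ i * v $ j * M $$ (i, j))" if M: "M \<in> carrier_mat p p" for M :: "real mat"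
  proof -
    have "u \<bullet> (M *\<^sub>v v) = (\<Sum>i<p. u $ i * (\<Sum>j<p. M $$ (i, j) * v $ j))"
      unfolding sprod_sum[OF u mult_mat_vec_carrier[OF M v]]
      by (intro sum.cong refl) (use M v in \<open>simp add: scalar_prod_def lessThan_atLeast0\<close>)
    then show ?thesis by (simp add: sum_distrib_left mult_ac)
  qed
  have "(\<lambda>k. \<Sum>i<p. \<Sum>j<p. u $ i * v $ j * (sqrt_coeff k * (C ^\<^sub>m k) $$ (i, j))) sums (\<Sum>i<p. \<Sum>j<p. u $ i * v $ j * T i j)"
    by (intro sums_sum sums_mult T_sums) auto
  moreover have "(\<Sum>i<p. \<Sum>j<p. u $ i * v $ j * (sqrt_coeff k * (C ^\<^sub>m k) $$ (i, j))) = sqrt_coeff k * (u \<bullet> (C ^\<^sub>m k *\<^sub>v v))" for k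
    by (simp add: bil sum_distrib_left mult_ac)
  moreover have "(\<Sum>i<p. \<Sum>j<p. u $ i * v $ j * T i j) = u \<bullet> v - u \<bullet> (series_sqrt p C *\<^sub>v v)"
  proof -
    have "u \<bullet> (series_sqrt p C *\<^sub>v v) = (\<Sum>i<p. \<Sum>j<p. (if i = j then u $ i * v $ j else 0) - u $ i * v $ j * T i j)"
      unfolding bil[OF series_sqrt_carrier] by (intro sum.cong refl) (auto simp: series_entry algebra_simps)
    also have "\<dots> = u \<bullet> v - (\<Sum>i<p. \<Sum>j<p. u $ i * v $ j * T i j)"
      using u v by (simp add: sum_subtractf sprod_sum[of _ p])
    finally show ?thesis by simp
  qed
  ultimately show ?thesis by simp
qed

text \<open>Powers of C are contractions and the coefficients are nonnegative with sum at most 1, so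
  the form subtracted from v . v cannot exceed v . v.\<close>

lemma series_sqrt_psd: "series_sqrt p C \<in> sym_psd_mats p"
proof -
  have "(series_sqrt p C)\<^sup>T = series_sqrt p C"
  proof (rule eq_matI)
    fix i j assume "i < dim_row (series_sqrt p C)" "j < dim_col (series_sqrt p C)"
    then have ij: "i < p" "j < p" using series_sqrt_carrier by auto
    have "(C ^\<^sub>m k) $$ (j, i) = (C ^\<^sub>m k) $$ (i, j)" for k
      using arg_cong[OF pow_symmetric[of k], of "\<lambda>M. M $$ (i, j)"] ij carrier_matD[OF pow_c, of k] by simp
    then show "(series_sqrt p C)\<^sup>T $$ (i, j) = series_sqrt p C $$ (i, j)"
      using ij carrier_matD[OF series_sqrt_carrier] by (simp add: series_entry T_def)
  qed (use series_sqrt_carrier in auto)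
  moreover have "0 \<le> v \<bullet> (series_sqrt p C *\<^sub>v v)" if v: "v \<in> carrier_vec p" for v
  proof -
    have "v \<bullet> v - v \<bullet> (series_sqrt p C *\<^sub>v v) \<le> suminf sqrt_coeff * (v \<bullet> v)"
    proof (rule sums_le[OF _ series_bilinear[OF v v] sums_mult2[OF summable_sums[OF sqrt_coeff_summable]]])
      fix k
      have "v \<bullet> (C ^\<^sub>m k *\<^sub>v v) \<le> v \<bullet> v" using pow_bilinear[OF v v, of k] by (simp add: sprod_self_nonneg)
      then show "sqrt_coeff k * (v \<bullet> (C ^\<^sub>m k *\<^sub>v v)) \<le> sqrt_coeff k * (v \<bullet> v)"
        by (intro mult_left_mono sqrt_coeff_nonneg)
    qed
    also have "\<dots> \<le> 1 * (v \<bullet> v)" by (intro mult_right_mono sqrt_coeff_suminf sprod_self_nonneg)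
    finally show ?thesis by simp
  qed
  ultimately show ?thesis using series_sqrt_carrier by (simp add: sym_psd_mats_def)
qed

text \<open>Prepares uniqueness of the square root: any root of A commutes with A, hence with every
  power of the scaled complement and with the series built from them.\<close>

lemma series_sqrt_commute:
  assumes B: "B \<in> carrier_mat p p" and BC: "B * C = C * B"
  shows "B * series_sqrt p C = series_sqrt p C * B"
proof -
  have pw: "B * C ^\<^sub>m k = C ^\<^sub>m k * B" for k
  proof (induction k)
    case 0 then show ?case using B carrier_matD[OF Cc] by simp
  next
    case (Suc k)
    have "B * C ^\<^sub>m Suc k = (B * C ^\<^sub>m k) * C" using B by (simp add: assoc_mult_mat[of _ p p _ p _ p])
    also have "\<dots> = C ^\<^sub>m k * (B * C)" unfolding Suc using B by (simp add: assoc_mult_mat[of _ p p _ p _ p])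
    also have "\<dots> = C ^\<^sub>m Suc k * B" unfolding BC using B by (simp add: assoc_mult_mat[of _ p p _ p _ p])
    finally show ?case .
  qed
  show ?thesis
  proof (rule eq_matI)
    fix i j assume "i < dim_row (series_sqrt p C * B)" "j < dim_col (series_sqrt p C * B)"
    then have ij: "i < p" "j < p" using series_sqrt_carrier B by auto
    have ent: "(X * Y) $$ (i, j) = (\<Sum>l<p. X $$ (i, l) * Y $$ (l, j))" if "X \<in> carrier_mat p p" "Y \<in> carrier_mat p p" for X Y :: "real mat"
      using mat_mult_entry[OF that] ij by simp
    have 1: "(\<lambda>k. \<Sum>l<p. B $$ (i, l) * (sqrt_coeff k * (C ^\<^sub>m k) $$ (l, j))) sums (\<Sum>l<p. B $$ (i, l) * T l j)"
      by (intro sums_sum sums_mult T_sums) (use ij in auto)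
    have 2: "(\<lambda>k. \<Sum>l<p. (sqrt_coeff k * (C ^\<^sub>m k) $$ (i, l)) * B $$ (l, j)) sums (\<Sum>l<p. T i l * B $$ (l, j))"
      by (intro sums_sum sums_mult2 T_sums) (use ij in auto)
    have "(\<Sum>l<p. B $$ (i, l) * (sqrt_coeff k * (C ^\<^sub>m k) $$ (l, j))) = (\<Sum>l<p. (sqrt_coeff k * (C ^\<^sub>m k) $$ (i, l)) * B $$ (l, j))" for k
    proof -
      have "(\<Sum>l<p. B $$ (i, l) * (sqrt_coeff k * (C ^\<^sub>m k) $$ (l, j))) = sqrt_coeff k * (B * C ^\<^sub>m k) $$ (i, j)"
        unfolding ent[OF B pow_c] by (simp add: sum_distrib_left mult_ac)
      also have "\<dots> = (\<Sum>l<p. (sqrt_coeff k * (C ^\<^sub>m k) $$ (i, l)) * B $$ (l, j))"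
        unfolding pw ent[OF pow_c B] by (simp add: sum_distrib_left mult_ac)
      finally show ?thesis .
    qed
    with 1 2 have "(\<Sum>l<p. B $$ (i, l) * T l j) = (\<Sum>l<p. T i l * B $$ (l, j))" using sums_unique2 by simp
    moreover have "(\<Sum>l<p. B $$ (i, l) * (if l = j then 1 else 0)) = (\<Sum>l<p. (if i = l then 1 else 0) * B $$ (l, j))"
      using ij by (simp add: if_distrib[of "\<lambda>x. _ * x"] if_distrib[of "\<lambda>x. x * _"] cong: if_cong)
    ultimately show "(B * series_sqrt p C) $$ (i, j) = (series_sqrt p C * B) $$ (i, j)"
      unfolding ent[OF B series_sqrt_carrier] ent[OF series_sqrt_carrier B]
      using ij by (simp add: series_entry algebra_simps sum_subtractf)
  qed (use series_sqrt_carrier B in auto)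
qed

end

text \<open>Commutation makes (B + B') (B - B') vanish. On a vector w = (B - B') v the two
  nonnegative forms therefore add up to zero, so B w = B' w = 0; as D = B - B' is symmetric, |w|^2 =
  v . D w = 0.\<close>

lemma psd_square_unique:
  assumes B: "B \<in> sym_psd_mats p" and B': "B' \<in> sym_psd_mats p"
    and sq: "B * B = B' * B'" and comm: "B * B' = B' * B"
  shows "B = B'"
proof -
  note c = sym_psd_matsD(1)[OF B] sym_psd_matsD(1)[OF B']
  define D where "D = B - B'"
  have D: "D \<in> carrier_mat p p" unfolding D_def by (rule minus_carrier_mat[OF c(2)])
  have DT: "D\<^sup>T = D" unfolding D_def using c sym_psd_matsD(2)[OF B] sym_psd_matsD(2)[OF B'] by (simp add: transpose_minus[of _ p p])
  have BBD: "(B + B') * D = 0\<^sub>m p p"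
  proof -
    have "(B + B') * D = (B * B + B' * B) - (B * B' + B' * B')"
      unfolding D_def using c by (simp add: add_mult_distrib_mat[of _ p p] mult_minus_distrib_mat[of _ p p])
    also have "\<dots> = (B' * B' + B' * B) - (B' * B + B' * B')" unfolding sq comm ..
    also have "\<dots> = 0\<^sub>m p p"
    proof -
      have "(X + Y) - (Y + X) = 0\<^sub>m p p" if "X \<in> carrier_mat p p" "Y \<in> carrier_mat p p" for X Y :: "real mat"
        using that by (intro eq_matI) auto
      then show ?thesis using c by simp
    qed
    finally show ?thesis .
  qed
  have Dv: "D *\<^sub>v v = 0\<^sub>v p" if v: "v \<in> carrier_vec p" for v
  proof -
    define w where "w = D *\<^sub>v v"
    have w: "w \<in> carrier_vec p" using D v by (simp add: w_def)
    have s: "B *\<^sub>v w + B' *\<^sub>v w = 0\<^sub>v p"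
    proof -
      have "B *\<^sub>v w + B' *\<^sub>v w = ((B + B') * D) *\<^sub>v v" unfolding w_def using c D v
        by (simp add: add_mult_distrib_mat_vec[of _ p p] assoc_mult_mat_vec[of _ p p _ p])
      then show ?thesis unfolding BBD using v by auto
    qed
    have "w \<bullet> (B *\<^sub>v w) + w \<bullet> (B' *\<^sub>v w) = 0"
      using arg_cong[OF s, of "\<lambda>t. w \<bullet> t"] w c by (simp add: scalar_prod_add_distrib[of _ p])
    then have "w \<bullet> (B *\<^sub>v w) = 0" "w \<bullet> (B' *\<^sub>v w) = 0"
      using sym_psd_matsD(3)[OF B w] sym_psd_matsD(3)[OF B' w] by auto
    then have "B *\<^sub>v w = 0\<^sub>v p" "B' *\<^sub>v w = 0\<^sub>v p"
      using psd_quadratic_zero[OF B w] psd_quadratic_zero[OF B' w] by auto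
    then have "D *\<^sub>v w = 0\<^sub>v p" unfolding D_def using c w by (simp add: minus_mult_distrib_mat_vec[of _ p p])
    then have "w \<bullet> w = 0" using sprod_symmetric_mat[OF D DT w v] v unfolding w_def[symmetric] by simp
    then show ?thesis using sprod_self_eq_0[OF w] by (simp add: w_def)
  qed
  have "D $$ (i, j) = 0" if "i < p" "j < p" for i j
    using mat_entry_sprod[OF D that] Dv[of "unit_vec p j"] that by simp
  then have "B $$ (i, j) = B' $$ (i, j)" if "i < p" "j < p" for i j
    using that c by (auto simp: D_def)
  then show ?thesis using c by (intro eq_matI) auto
qed

text \<open>For semidefinite A the trace dominates the largest eigenvalue, so A / (1 + tr A) lies
  between 0 and I and so does this matrix. The summand 1 keeps the denominator positive when A =
  0.\<close>

definition scaled_complement :: "nat \<Rightarrow> real mat \<Rightarrow> real mat" where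
  "scaled_complement p A = mat p p (\<lambda>(i, j). (if i = j then 1 else 0) - A $$ (i, j) / (1 + mat_trace A))"

text \<open>The definite description in \<open>psd_sqrt\<close> is replaced by an explicit formula.
  Besides existence and uniqueness this provides a countable sum of powers of a matrix that depends
  measurably on A, which is how the root of a random matrix is seen to be measurable.\<close>

lemma psd_sqrt_series:
  assumes A: "A \<in> sym_psd_mats p"
  defines "B \<equiv> sqrt (1 + mat_trace A) \<cdot>\<^sub>m series_sqrt p (scaled_complement p A)"
  shows "psd_sqrt A = B" "B \<in> sym_psd_mats p" "B * B = A"
proof -
  note A' = sym_psd_matsD[OF A]
  define t where "t = 1 + mat_trace A"
  have t: "t > 0" using psd_trace_bound(2)[OF A, of "0\<^sub>v p"] by (simp add: t_def)
  define C where "C = scaled_complement p A"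
  have Cc: "C \<in> carrier_mat p p" by (simp add: C_def scaled_complement_def)
  have CA: "C = 1\<^sub>m p - (1 / t) \<cdot>\<^sub>m A" using A'(1) by (intro eq_matI) (auto simp: C_def scaled_complement_def t_def)
  have Cv: "C *\<^sub>v v = v - (1 / t) \<cdot>\<^sub>v (A *\<^sub>v v)" if v: "v \<in> carrier_vec p" for v
  proof -
    have "((1 / t) \<cdot>\<^sub>m A) *\<^sub>v v = (1 / t) \<cdot>\<^sub>v (A *\<^sub>v v)"
      using v A'(1) by (intro eq_vecI) (auto simp: smult_scalar_prod_distrib[of _ p])
    then show ?thesis unfolding CA using A'(1) v by (simp add: minus_mult_distrib_mat_vec[of _ p p])
  qed
  have q: "v \<bullet> (C *\<^sub>v v) = v \<bullet> v - (v \<bullet> (A *\<^sub>v v)) / t" if v: "v \<in> carrier_vec p" for v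
    unfolding Cv[OF v] using v A'(1) by (simp add: scalar_prod_minus_distrib[of _ p] scalar_prod_smult_distrib[of _ p])
  have b: "(v \<bullet> (A *\<^sub>v v)) / t \<le> v \<bullet> v" "0 \<le> (v \<bullet> (A *\<^sub>v v)) / t" if v: "v \<in> carrier_vec p" for v
  proof -
    have "v \<bullet> (A *\<^sub>v v) \<le> t * (v \<bullet> v)" using psd_trace_bound(1)[OF A v] sprod_self_nonneg[of v] by (simp add: t_def algebra_simps)
    then show "(v \<bullet> (A *\<^sub>v v)) / t \<le> v \<bullet> v" using t by (simp add: field_simps)
    show "0 \<le> (v \<bullet> (A *\<^sub>v v)) / t" using A'(3)[OF v] t by simp
  qed
  have "C\<^sup>T = C"
  proof (rule eq_matI)
    fix i j assume "i < dim_row C" "j < dim_col C"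
    then have "i < p" "j < p" using Cc by auto
    moreover from this have "A $$ (i, j) = A $$ (j, i)" using arg_cong[OF A'(2), of "\<lambda>M. M $$ (i, j)"] A'(1) by simp
    ultimately show "C\<^sup>T $$ (i, j) = C $$ (i, j)" by (auto simp: C_def scaled_complement_def)
  qed (use Cc in auto)
  moreover have "0 \<le> v \<bullet> (C *\<^sub>v v)" if v: "v \<in> carrier_vec p" for v using q[OF v] b(1)[OF v] by linarith
  ultimately have C: "C \<in> sym_psd_mats p" using Cc unfolding sym_psd_mats_def by blast
  have C1: "v \<bullet> (C *\<^sub>v v) \<le> v \<bullet> v" if v: "v \<in> carrier_vec p" for v using q[OF v] b(2)[OF v] by linarith
  let ?R = "series_sqrt p C"
  have R: "?R \<in> sym_psd_mats p" "?R * ?R = 1\<^sub>m p - C"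
    using series_sqrt_psd[OF C C1] series_sqrt_square[OF C C1] by auto
  note R' = sym_psd_matsD[OF R(1)]
  have Bd: "B = sqrt t \<cdot>\<^sub>m ?R" by (simp add: B_def t_def C_def)
  have Bc: "B \<in> carrier_mat p p" using R'(1) by (simp add: Bd)
  have Bv: "B *\<^sub>v v = sqrt t \<cdot>\<^sub>v (?R *\<^sub>v v)" if v: "v \<in> carrier_vec p" for v
    unfolding Bd using v R'(1) by (intro eq_vecI) (auto simp: smult_scalar_prod_distrib[of _ p])
  have BT: "B\<^sup>T = B"
  proof (rule eq_matI)
    fix i j assume "i < dim_row B" "j < dim_col B"
    then have "i < p" "j < p" using Bc by auto
    moreover from this have "?R $$ (i, j) = ?R $$ (j, i)" using arg_cong[OF R'(2), of "\<lambda>M. M $$ (i, j)"] R'(1) by simp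
    ultimately show "B\<^sup>T $$ (i, j) = B $$ (i, j)" using R'(1) by (auto simp: Bd)
  qed (use Bc in auto)
  show B: "B \<in> sym_psd_mats p" unfolding sym_psd_mats_def
    using Bc BT R' t by (auto simp: Bv scalar_prod_smult_distrib[of _ p])
  have "B * B = (sqrt t * sqrt t) \<cdot>\<^sub>m (?R * ?R)"
  proof -
    have "a \<cdot>\<^sub>m M * (a \<cdot>\<^sub>m M) = (a * a) \<cdot>\<^sub>m (M * M)" if M: "M \<in> carrier_mat p p" for a :: real and M
    proof (rule eq_matI)
      fix i j assume "i < dim_row ((a * a) \<cdot>\<^sub>m (M * M))" "j < dim_col ((a * a) \<cdot>\<^sub>m (M * M))"
      then have "i < p" "j < p" using M by auto
      then show "(a \<cdot>\<^sub>m M * (a \<cdot>\<^sub>m M)) $$ (i, j) = ((a * a) \<cdot>\<^sub>m (M * M)) $$ (i, j)"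
        using M mat_mult_entry[of M p M] mat_mult_entry[of "a \<cdot>\<^sub>m M" p "a \<cdot>\<^sub>m M"]
        by (simp add: sum_distrib_left mult_ac del: index_mult_mat(1))
    qed (use M in auto)
    then show ?thesis unfolding Bd using R'(1) by blast
  qed
  also have "\<dots> = t \<cdot>\<^sub>m (1\<^sub>m p - C)" using t R by simp
  also have "\<dots> = A" unfolding CA using A'(1) t by (intro eq_matI) auto
  finally show BB: "B * B = A" .
  show "psd_sqrt A = B" unfolding psd_sqrt_def
  proof (rule the_equality)
    show "B \<in> sym_psd_mats (dim_row A) \<and> B * B = A" using B BB A'(1) by simp
    fix B' assume "B' \<in> sym_psd_mats (dim_row A) \<and> B' * B' = A"
    then have B': "B' \<in> sym_psd_mats p" "B' * B' = A" using A'(1) by auto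
    note B'c = sym_psd_matsD(1)[OF B'(1)]
    have BA: "B' * A = A * B'" unfolding B'(2)[symmetric] using B'c by (simp add: assoc_mult_mat[of _ p p _ p _ p])
    have "B' * C = C * B'" unfolding CA using B'c A'(1) BA
      by (simp add: mult_minus_distrib_mat[of B' p p "1\<^sub>m p" p "(1 / t) \<cdot>\<^sub>m A"] minus_mult_distrib_mat[of _ p p] mult_smult_distrib[of _ p p _ p] mult_smult_assoc_mat[of _ p p _ p])
    then have "B' * ?R = ?R * B'" using series_sqrt_commute[OF C C1 B'c] by simp
    then have "B' * B = B * B'" unfolding Bd using B'c R'(1)
      by (simp add: mult_smult_distrib[of _ p p _ p] mult_smult_assoc_mat[of _ p p _ p])
    then show "B' = B" using psd_square_unique[OF B'(1) B] B'(2) BB by simp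
  qed
qed

lemma psd_sqrt:
  assumes "A \<in> sym_psd_mats p"
  shows "psd_sqrt A \<in> sym_psd_mats p" "psd_sqrt A * psd_sqrt A = A"
  using psd_sqrt_series[OF assms] by auto

section \<open>Measurability\<close>

lemma space_borel_vec [simp]: "space (borel_vec p) = carrier_vec p"
  by (simp add: borel_vec_def)

lemma space_borel_mat [simp]: "space (borel_mat p) = carrier_mat p p"
  by (simp add: borel_mat_def)

lemma measurable_borel_vecI:
  assumes "\<And>\<omega>. \<omega> \<in> space M \<Longrightarrow> f \<omega> \<in> carrier_vec p" "\<And>i. i < p \<Longrightarrow> (\<lambda>\<omega>. f \<omega> $ i) \<in> borel_measurable M"
  shows "f \<in> M \<rightarrow>\<^sub>M borel_vec p"
  unfolding borel_vec_def
  by (rule measurable_vimage_algebra2) (use assms in \<open>auto intro!: measurable_restrict\<close>)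

lemma measurable_borel_vecD:
  assumes f: "f \<in> M \<rightarrow>\<^sub>M borel_vec p"
  shows "\<omega> \<in> space M \<Longrightarrow> f \<omega> \<in> carrier_vec p" "i < p \<Longrightarrow> (\<lambda>\<omega>. f \<omega> $ i) \<in> borel_measurable M"
proof -
  show "f \<omega> \<in> carrier_vec p" if "\<omega> \<in> space M" using measurable_space[OF f that] by simp
  assume i: "i < p"
  have "(\<lambda>v. \<lambda>i\<in>{..<p}. v $ i) \<in> borel_vec p \<rightarrow>\<^sub>M PiM {..<p} (\<lambda>_. borel :: real measure)"
    unfolding borel_vec_def by (rule measurable_vimage_algebra1) (auto simp: space_PiM)
  from measurable_compose[OF measurable_compose[OF f this] measurable_component_singleton[of i]] i
  have "(\<lambda>\<omega>. (\<lambda>i\<in>{..<p}. f \<omega> $ i) i) \<in> borel_measurable M" by simp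
  then show "(\<lambda>\<omega>. f \<omega> $ i) \<in> borel_measurable M" using i by simp
qed

lemma measurable_borel_matI:
  assumes "\<And>\<omega>. \<omega> \<in> space M \<Longrightarrow> f \<omega> \<in> carrier_mat p p"
    "\<And>i j. i < p \<Longrightarrow> j < p \<Longrightarrow> (\<lambda>\<omega>. f \<omega> $$ (i, j)) \<in> borel_measurable M"
  shows "f \<in> M \<rightarrow>\<^sub>M borel_mat p"
  unfolding borel_mat_def
  by (rule measurable_vimage_algebra2) (use assms in \<open>auto intro!: measurable_restrict\<close>)

lemma measurable_borel_matD:
  assumes f: "f \<in> M \<rightarrow>\<^sub>M borel_mat p"
  shows "\<omega> \<in> space M \<Longrightarrow> f \<omega> \<in> carrier_mat p p"
    "i < p \<Longrightarrow> j < p \<Longrightarrow> (\<lambda>\<omega>. f \<omega> $$ (i, j)) \<in> borel_measurable M"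
proof -
  show "f \<omega> \<in> carrier_mat p p" if "\<omega> \<in> space M" using measurable_space[OF f that] by simp
  assume i: "i < p" "j < p"
  let ?I = "{..<p} \<times> {..<p}"
  have "(\<lambda>A. \<lambda>ij\<in>?I. A $$ ij) \<in> borel_mat p \<rightarrow>\<^sub>M PiM ?I (\<lambda>_. borel :: real measure)"
    unfolding borel_mat_def by (rule measurable_vimage_algebra1) (auto simp: space_PiM)
  from measurable_compose[OF measurable_compose[OF f this] measurable_component_singleton[of "(i, j)"]] i
  have "(\<lambda>\<omega>. (\<lambda>ij\<in>?I. f \<omega> $$ ij) (i, j)) \<in> borel_measurable M" by simp
  then show "(\<lambda>\<omega>. f \<omega> $$ (i, j)) \<in> borel_measurable M" using i by simp
qed

lemma measurable_det:
  assumes "B \<in> M \<rightarrow>\<^sub>M borel_mat p"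
  shows "(\<lambda>\<omega>. Determinant.det (B \<omega>)) \<in> borel_measurable M"
proof -
  have "(\<lambda>\<omega>. \<Sum>q \<in> {q. q permutes {0 ..< p}}. signof q * (\<Prod>i = 0 ..< p. B \<omega> $$ (i, q i))) \<in> borel_measurable M"
  proof (intro borel_measurable_sum borel_measurable_times borel_measurable_prod borel_measurable_const)
    fix q i assume "q \<in> {q. q permutes {0 ..< p}}" "i \<in> {0 ..< p}"
    then have "i < p" "q i < p" using permutes_in_image[of q "{0..<p}" i] by auto
    then show "(\<lambda>\<omega>. B \<omega> $$ (i, q i)) \<in> borel_measurable M" using measurable_borel_matD(2)[OF assms] by auto
  qed
  then show ?thesis
    by (rule measurable_cong[THEN iffD1, rotated]) (rule det_def'[OF measurable_borel_matD(1)[OF assms], symmetric])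
qed

lemma measurable_mat_delete:
  assumes "B \<in> M \<rightarrow>\<^sub>M borel_mat p" "i < p" "j < p"
  shows "(\<lambda>\<omega>. mat_delete (B \<omega>) i j) \<in> M \<rightarrow>\<^sub>M borel_mat (p - 1)"
proof (rule measurable_borel_matI)
  fix \<omega> assume "\<omega> \<in> space M"
  then show "mat_delete (B \<omega>) i j \<in> carrier_mat (p - 1) (p - 1)"
    using carrier_matD[OF measurable_borel_matD(1)[OF assms(1)]] by (simp add: mat_delete_def)
next
  fix a b assume "a < p - 1" "b < p - 1"
  then have "(\<lambda>\<omega>. B \<omega> $$ (if a < i then a else Suc a, if b < j then b else Suc b)) \<in> borel_measurable M"
    by (intro measurable_borel_matD(2)[OF assms(1)]) auto
  then show "(\<lambda>\<omega>. mat_delete (B \<omega>) i j $$ (a, b)) \<in> borel_measurable M"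
    by (rule measurable_cong[THEN iffD1, rotated])
      (use carrier_matD[OF measurable_borel_matD(1)[OF assms(1)]] \<open>a < p - 1\<close> \<open>b < p - 1\<close> in \<open>auto simp: mat_delete_def\<close>)
qed

lemma measurable_cramer_inverse:
  assumes "B \<in> M \<rightarrow>\<^sub>M borel_mat p"
  shows "(\<lambda>\<omega>. cramer_inverse (B \<omega>)) \<in> M \<rightarrow>\<^sub>M borel_mat p"
proof (rule measurable_borel_matI)
  fix \<omega> assume "\<omega> \<in> space M"
  then show "cramer_inverse (B \<omega>) \<in> carrier_mat p p"
    using adj_mat(1)[OF measurable_borel_matD(1)[OF assms(1)]] by (simp add: cramer_inverse_def)
next
  fix i j assume ij: "i < p" "j < p"
  have "(\<lambda>\<omega>. 1 / Determinant.det (B \<omega>) * ((-1) ^ (j + i) * Determinant.det (mat_delete (B \<omega>) j i))) \<in> borel_measurable M"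
    by (intro borel_measurable_times borel_measurable_divide borel_measurable_const measurable_det[OF assms]
        measurable_det[OF measurable_mat_delete[OF assms]] ij)
  then show "(\<lambda>\<omega>. cramer_inverse (B \<omega>) $$ (i, j)) \<in> borel_measurable M"
    by (rule measurable_cong[THEN iffD1, rotated])
      (use carrier_matD[OF measurable_borel_matD(1)[OF assms(1)]] ij in \<open>auto simp: cramer_inverse_def adj_mat_def cofactor_def\<close>)
qed

lemma measurable_sprod:
  assumes "u \<in> M \<rightarrow>\<^sub>M borel_vec p" "v \<in> M \<rightarrow>\<^sub>M borel_vec p"
  shows "(\<lambda>\<omega>. u \<omega> \<bullet> v \<omega>) \<in> borel_measurable M"
proof -
  have "(\<lambda>\<omega>. \<Sum>i<p. u \<omega> $ i * v \<omega> $ i) \<in> borel_measurable M"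
    by (intro borel_measurable_sum borel_measurable_times measurable_borel_vecD(2)[OF assms(1)] measurable_borel_vecD(2)[OF assms(2)]) auto
  then show ?thesis
    by (rule measurable_cong[THEN iffD1, rotated])
      (rule sprod_sum[OF measurable_borel_vecD(1)[OF assms(1)] measurable_borel_vecD(1)[OF assms(2)], symmetric])
qed

lemma measurable_mult_mat_vec:
  assumes "B \<in> M \<rightarrow>\<^sub>M borel_mat p" "v \<in> M \<rightarrow>\<^sub>M borel_vec p"
  shows "(\<lambda>\<omega>. B \<omega> *\<^sub>v v \<omega>) \<in> M \<rightarrow>\<^sub>M borel_vec p"
proof (rule measurable_borel_vecI)
  fix \<omega> assume "\<omega> \<in> space M"
  then show "B \<omega> *\<^sub>v v \<omega> \<in> carrier_vec p"
    using measurable_borel_matD(1)[OF assms(1)] measurable_borel_vecD(1)[OF assms(2)] by (intro mult_mat_vec_carrier)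
next
  fix i assume i: "i < p"
  have "(\<lambda>\<omega>. \<Sum>j<p. B \<omega> $$ (i, j) * v \<omega> $ j) \<in> borel_measurable M"
    by (intro borel_measurable_sum borel_measurable_times measurable_borel_matD(2)[OF assms(1) i] measurable_borel_vecD(2)[OF assms(2)]) auto
  moreover have "(\<Sum>j<p. B \<omega> $$ (i, j) * v \<omega> $ j) = (B \<omega> *\<^sub>v v \<omega>) $ i" if "\<omega> \<in> space M" for \<omega>
    using measurable_borel_matD(1)[OF assms(1) that] measurable_borel_vecD(1)[OF assms(2) that] i
    by (simp add: scalar_prod_def lessThan_atLeast0)
  ultimately show "(\<lambda>\<omega>. (B \<omega> *\<^sub>v v \<omega>) $ i) \<in> borel_measurable M"
    by (rule measurable_cong[THEN iffD1, rotated])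
qed

lemma measurable_mat_col:
  assumes "B \<in> M \<rightarrow>\<^sub>M borel_mat p" "i < p"
  shows "(\<lambda>\<omega>. col (B \<omega>) i) \<in> M \<rightarrow>\<^sub>M borel_vec p"
proof (rule measurable_borel_vecI)
  fix \<omega> assume "\<omega> \<in> space M"
  then show "col (B \<omega>) i \<in> carrier_vec p"
    using col_dim[of "B \<omega>" i] carrier_matD(1)[OF measurable_borel_matD(1)[OF assms(1)]] by simp
next
  fix j assume j: "j < p"
  have "(\<lambda>\<omega>. B \<omega> $$ (j, i)) \<in> borel_measurable M" by (rule measurable_borel_matD(2)[OF assms(1) j assms(2)])
  then show "(\<lambda>\<omega>. col (B \<omega>) i $ j) \<in> borel_measurable M"
    by (rule measurable_cong[THEN iffD1, rotated])
      (use carrier_matD[OF measurable_borel_matD(1)[OF assms(1)]] j assms(2) in auto)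
qed

lemma measurable_mat_trace_mult:
  assumes "A \<in> M \<rightarrow>\<^sub>M borel_mat p" "B \<in> M \<rightarrow>\<^sub>M borel_mat p"
  shows "(\<lambda>\<omega>. mat_trace (A \<omega> * B \<omega>)) \<in> borel_measurable M"
proof -
  have "(\<lambda>\<omega>. \<Sum>i<p. \<Sum>l<p. A \<omega> $$ (i, l) * B \<omega> $$ (l, i)) \<in> borel_measurable M"
    by (intro borel_measurable_sum borel_measurable_times measurable_borel_matD(2)[OF assms(1)] measurable_borel_matD(2)[OF assms(2)]) auto
  moreover have "(\<Sum>i<p. \<Sum>l<p. A \<omega> $$ (i, l) * B \<omega> $$ (l, i)) = mat_trace (A \<omega> * B \<omega>)" if "\<omega> \<in> space M" for \<omega>
    using measurable_borel_matD(1)[OF assms(1) that] measurable_borel_matD(1)[OF assms(2) that]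
    by (auto simp: mat_trace_def mat_mult_entry[of _ p] simp del: index_mult_mat(1))
  ultimately show ?thesis by (rule measurable_cong[THEN iffD1, rotated])
qed

lemma measurable_mat_trace:
  assumes "A \<in> M \<rightarrow>\<^sub>M borel_mat p"
  shows "(\<lambda>\<omega>. mat_trace (A \<omega>)) \<in> borel_measurable M"
proof -
  have "(\<lambda>\<omega>. \<Sum>i<p. A \<omega> $$ (i, i)) \<in> borel_measurable M"
    by (intro borel_measurable_sum measurable_borel_matD(2)[OF assms(1)]) auto
  moreover have "(\<Sum>i<p. A \<omega> $$ (i, i)) = mat_trace (A \<omega>)" if "\<omega> \<in> space M" for \<omega>
    using measurable_borel_matD(1)[OF assms(1) that] by (auto simp: mat_trace_def)
  ultimately show ?thesis by (rule measurable_cong[THEN iffD1, rotated])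
qed

lemma measurable_reg_gram:
  assumes "\<And>j. j \<in> I \<Longrightarrow> x j \<in> M \<rightarrow>\<^sub>M borel_vec p"
  shows "(\<lambda>\<omega>. reg_gram p n I (\<lambda>j. x j \<omega>) \<nu>) \<in> M \<rightarrow>\<^sub>M borel_mat p"
  by (rule measurable_borel_matI)
    (auto simp: reg_gram_def intro!: borel_measurable_add borel_measurable_divide borel_measurable_sum
      borel_measurable_times measurable_borel_vecD(2)[OF assms])

lemma measurable_resolv:
  assumes "\<And>j. j \<in> I \<Longrightarrow> x j \<in> M \<rightarrow>\<^sub>M borel_vec p"
  shows "(\<lambda>\<omega>. resolv p n I (\<lambda>j. x j \<omega>) \<nu>) \<in> M \<rightarrow>\<^sub>M borel_mat p"
  unfolding resolv_def by (rule measurable_cramer_inverse[OF measurable_reg_gram[OF assms]])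

lemma measurable_logdet_ratio:
  assumes "\<And>j. j \<in> I \<Longrightarrow> x j \<in> M \<rightarrow>\<^sub>M borel_vec p"
  shows "(\<lambda>\<omega>. logdet_ratio p n \<alpha> \<beta> I (\<lambda>j. x j \<omega>)) \<in> borel_measurable M"
proof -
  have "(\<lambda>\<omega>. Determinant.det (reg_gram p n I (\<lambda>j. x j \<omega>) \<nu>)) \<in> borel_measurable M" for \<nu>
    using measurable_det measurable_reg_gram assms by blast
  then show ?thesis unfolding logdet_ratio_def by (intro borel_measurable_diff borel_measurable_ln)
qed

lemma measurable_psd_sqrt:
  assumes S: "S \<in> M \<rightarrow>\<^sub>M borel_mat p" and psd: "\<And>\<omega>. \<omega> \<in> space M \<Longrightarrow> S \<omega> \<in> sym_psd_mats p"
  shows "(\<lambda>\<omega>. psd_sqrt (S \<omega>)) \<in> M \<rightarrow>\<^sub>M borel_mat p"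
proof (rule measurable_borel_matI)
  fix \<omega> assume "\<omega> \<in> space M"
  then show "psd_sqrt (S \<omega>) \<in> carrier_mat p p" using psd_sqrt(1)[OF psd] sym_psd_matsD(1) by blast
next
  fix i j assume ij: "i < p" "j < p"
  let ?C = "\<lambda>\<omega>. scaled_complement p (S \<omega>)"
  have C: "?C \<in> M \<rightarrow>\<^sub>M borel_mat p"
  proof (rule measurable_borel_matI)
    fix a b assume ab: "a < p" "b < p"
    note [measurable] = measurable_mat_trace[OF S] measurable_borel_matD(2)[OF S ab]
    have "(\<lambda>\<omega>. (if a = b then 1 else 0) - S \<omega> $$ (a, b) / (1 + mat_trace (S \<omega>))) \<in> borel_measurable M"
      by measurable
    then show "(\<lambda>\<omega>. ?C \<omega> $$ (a, b)) \<in> borel_measurable M"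
      using ab by (simp add: scaled_complement_def)
  qed (simp add: scaled_complement_def)
  have pow: "(\<lambda>\<omega>. ?C \<omega> ^\<^sub>m k) \<in> M \<rightarrow>\<^sub>M borel_mat p" for k
  proof (induction k)
    case 0
    show ?case
      by (rule measurable_borel_matI) (auto simp: scaled_complement_def)
  next
    case (Suc k)
    have c2: "?C \<omega> \<in> carrier_mat p p" for \<omega> by (simp add: scaled_complement_def)
    then have c1: "?C \<omega> ^\<^sub>m k \<in> carrier_mat p p" for \<omega> by (rule pow_carrier_mat)
    note c = c1 c2
    show ?case
    proof (rule measurable_borel_matI)
      show "?C \<omega> ^\<^sub>m Suc k \<in> carrier_mat p p" for \<omega> by (rule pow_carrier_mat[OF c2])
      fix a b assume ab: "a < p" "b < p"
      have "(\<lambda>\<omega>. \<Sum>l<p. (?C \<omega> ^\<^sub>m k) $$ (a, l) * ?C \<omega> $$ (l, b)) \<in> borel_measurable M"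
        using ab by (intro borel_measurable_sum borel_measurable_times measurable_borel_matD(2)[OF Suc] measurable_borel_matD(2)[OF C]) auto
      then show "(\<lambda>\<omega>. (?C \<omega> ^\<^sub>m Suc k) $$ (a, b)) \<in> borel_measurable M"
        using mat_mult_entry[OF c ab] by simp
    qed
  qed
  note [measurable] = measurable_mat_trace[OF S] measurable_borel_matD(2)[OF pow ij]
  have "(\<lambda>\<omega>. sqrt (1 + mat_trace (S \<omega>)) * ((if i = j then 1 else 0) - (\<Sum>k. sqrt_coeff k * (?C \<omega> ^\<^sub>m k) $$ (i, j)))) \<in> borel_measurable M"
    by measurable
  then show "(\<lambda>\<omega>. psd_sqrt (S \<omega>) $$ (i, j)) \<in> borel_measurable M"
    by (rule measurable_cong[THEN iffD1, rotated])
      (use ij in \<open>auto simp: psd_sqrt_series(1)[OF psd] series_sqrt_def\<close>)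
qed

section \<open>Independent sub-sigma-algebras\<close>

context prob_space
begin

lemma measurable_ident_subalgebra:
  assumes "subalgebra N F" shows "(\<lambda>\<omega>. \<omega>) \<in> N \<rightarrow>\<^sub>M F"
proof (rule measurableI)
  show "\<omega> \<in> space F" if "\<omega> \<in> space N" for \<omega> using that assms by (simp add: subalgebra_def)
  fix A assume A: "A \<in> sets F"
  then have "(\<lambda>\<omega>. \<omega>) -` A \<inter> space N = A" using sets.sets_into_space[OF A] assms by (auto simp: subalgebra_def)
  then show "(\<lambda>\<omega>. \<omega>) -` A \<inter> space N \<in> sets N" using A assms by (auto simp: subalgebra_def)
qed

text \<open>A sub-sigma-algebra F is treated as a random variable, namely the identity from
  \<open>M\<close> to F. Independence of F and G then says that the image of \<open>M\<close> under
  the diagonal map, on the product of F and G, is a product measure.\<close>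

lemma decouple_distr:
  assumes F: "subalgebra M F" and G: "subalgebra M G" and ind: "indep_set (sets F) (sets G)"
  shows "distr M F (\<lambda>\<omega>. \<omega>) \<Otimes>\<^sub>M distr M G (\<lambda>\<omega>. \<omega>) = distr M (F \<Otimes>\<^sub>M G) (\<lambda>\<omega>. (\<omega>, \<omega>))"
proof -
  have s: "space F = space M" "space G = space M" using F G by (auto simp: subalgebra_def)
  have e: "sigma_sets (space M) {(\<lambda>\<omega>. \<omega>) -` A \<inter> space M |A. A \<in> sets H} = sets H" if "subalgebra M H" for H
  proof -
    have "{(\<lambda>\<omega>. \<omega>) -` A \<inter> space M |A. A \<in> sets H} = sets H"
      using that sets.sets_into_space[of _ H] by (auto simp: subalgebra_def Int_absorb2 image_def)
    then show ?thesis using that sets.sigma_sets_eq[of H] by (simp add: subalgebra_def)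
  qed
  have "(\<lambda>\<omega>. \<omega>) \<in> M \<rightarrow>\<^sub>M F" "(\<lambda>\<omega>. \<omega>) \<in> M \<rightarrow>\<^sub>M G"
    using measurable_ident_subalgebra F G by auto
  then have "indep_var F (\<lambda>\<omega>. \<omega>) G (\<lambda>\<omega>. \<omega>)"
    unfolding indep_var_eq e[OF F] e[OF G] using ind by simp
  then show ?thesis unfolding indep_var_distribution_eq by simp
qed

text \<open>A quantity that depends on the outcome once through F and once through G is written as a
  function of two points, restricted to the diagonal. Independence allows the two points to vary
  separately; freezing one of them is the basic device of all later decoupling arguments.\<close>

lemma decouple_nn:
  assumes F: "subalgebra M F" and G: "subalgebra M G" and ind: "indep_set (sets F) (sets G)"
    and h: "h \<in> borel_measurable (F \<Otimes>\<^sub>M G)"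
  shows "(\<integral>\<^sup>+\<omega>. h (\<omega>, \<omega>) \<partial>M) = (\<integral>\<^sup>+\<omega>1. (\<integral>\<^sup>+\<omega>2. h (\<omega>1, \<omega>2) \<partial>M) \<partial>M)"
proof -
  note i = measurable_ident_subalgebra[OF F] measurable_ident_subalgebra[OF G]
  interpret G': prob_space "distr M G (\<lambda>\<omega>. \<omega>)" by (rule prob_space_distr[OF i(2)])
  have h': "h \<in> borel_measurable (distr M F (\<lambda>\<omega>. \<omega>) \<Otimes>\<^sub>M distr M G (\<lambda>\<omega>. \<omega>))"
    using h by (simp cong: measurable_cong_sets)
  have "(\<integral>\<^sup>+\<omega>. h (\<omega>, \<omega>) \<partial>M) = (\<integral>\<^sup>+q. h q \<partial>distr M (F \<Otimes>\<^sub>M G) (\<lambda>\<omega>. (\<omega>, \<omega>)))"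
    by (rule nn_integral_distr[symmetric]) (use i h in \<open>auto intro!: measurable_Pair\<close>)
  also have "\<dots> = (\<integral>\<^sup>+\<omega>1. (\<integral>\<^sup>+\<omega>2. h (\<omega>1, \<omega>2) \<partial>distr M G (\<lambda>\<omega>. \<omega>)) \<partial>distr M F (\<lambda>\<omega>. \<omega>))"
    unfolding decouple_distr[OF F G ind, symmetric] by (rule G'.nn_integral_fst[symmetric, OF h'])
  also have "\<dots> = (\<integral>\<^sup>+\<omega>1. (\<integral>\<^sup>+\<omega>2. h (\<omega>1, \<omega>2) \<partial>distr M G (\<lambda>\<omega>. \<omega>)) \<partial>M)"
    using G'.borel_measurable_nn_integral_fst[OF h'] by (intro nn_integral_distr i(1)) simp
  also have "\<dots> = (\<integral>\<^sup>+\<omega>1. (\<integral>\<^sup>+\<omega>2. h (\<omega>1, \<omega>2) \<partial>M) \<partial>M)"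
  proof (intro nn_integral_cong nn_integral_distr i(2))
    fix \<omega>1 assume "\<omega>1 \<in> space M"
    then have "\<omega>1 \<in> space F" using F by (simp add: subalgebra_def)
    then show "(\<lambda>\<omega>2. h (\<omega>1, \<omega>2)) \<in> borel_measurable (distr M G (\<lambda>\<omega>. \<omega>))"
      using h by (simp add: measurable_Pair2 cong: measurable_cong_sets)
  qed
  finally show ?thesis .
qed

lemma decouple_lebesgue:
  fixes h :: "'a \<times> 'a \<Rightarrow> real"
  assumes F: "subalgebra M F" and G: "subalgebra M G" and ind: "indep_set (sets F) (sets G)"
    and h: "h \<in> borel_measurable (F \<Otimes>\<^sub>M G)" and b: "\<And>q. q \<in> space M \<times> space M \<Longrightarrow> \<bar>h q\<bar> \<le> B"
  shows "(\<integral>\<omega>. h (\<omega>, \<omega>) \<partial>M) = (\<integral>\<omega>1. (\<integral>\<omega>2. h (\<omega>1, \<omega>2) \<partial>M) \<partial>M)"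
    and "(\<lambda>\<omega>1. (\<integral>\<omega>2. h (\<omega>1, \<omega>2) \<partial>M)) \<in> borel_measurable F"
proof -
  note i = measurable_ident_subalgebra[OF F] measurable_ident_subalgebra[OF G]
  interpret F': prob_space "distr M F (\<lambda>\<omega>. \<omega>)" by (rule prob_space_distr[OF i(1)])
  interpret G': prob_space "distr M G (\<lambda>\<omega>. \<omega>)" by (rule prob_space_distr[OF i(2)])
  interpret FG: pair_prob_space "distr M F (\<lambda>\<omega>. \<omega>)" "distr M G (\<lambda>\<omega>. \<omega>)" ..
  have h': "h \<in> borel_measurable (distr M F (\<lambda>\<omega>. \<omega>) \<Otimes>\<^sub>M distr M G (\<lambda>\<omega>. \<omega>))"
    using h by (simp cong: measurable_cong_sets)
  have s: "space F = space M" "space G = space M" using F G by (auto simp: subalgebra_def)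
  have int: "integrable (distr M F (\<lambda>\<omega>. \<omega>) \<Otimes>\<^sub>M distr M G (\<lambda>\<omega>. \<omega>)) h"
    by (rule FG.integrable_const_bound[of _ B]) (use h' b s in \<open>auto simp: space_pair_measure intro!: AE_I2\<close>)
  have inner: "(\<integral>\<omega>2. h (\<omega>1, \<omega>2) \<partial>distr M G (\<lambda>\<omega>. \<omega>)) = (\<integral>\<omega>2. h (\<omega>1, \<omega>2) \<partial>M)" if "\<omega>1 \<in> space M" for \<omega>1
  proof (intro integral_distr i(2))
    show "(\<lambda>\<omega>2. h (\<omega>1, \<omega>2)) \<in> borel_measurable G" using h that s by (simp add: measurable_Pair2)
  qed
  have m: "(\<lambda>\<omega>1. (\<integral>\<omega>2. h (\<omega>1, \<omega>2) \<partial>distr M G (\<lambda>\<omega>. \<omega>))) \<in> borel_measurable F"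
    using G'.borel_measurable_lebesgue_integral[of "\<lambda>a b. h (a, b)" F] h by (simp add: case_prod_eta cong: measurable_cong_sets)
  show "(\<lambda>\<omega>1. (\<integral>\<omega>2. h (\<omega>1, \<omega>2) \<partial>M)) \<in> borel_measurable F"
    by (rule measurable_cong[THEN iffD1, OF _ m]) (use inner s in auto)
  have "(\<integral>\<omega>. h (\<omega>, \<omega>) \<partial>M) = (\<integral>q. h q \<partial>distr M (F \<Otimes>\<^sub>M G) (\<lambda>\<omega>. (\<omega>, \<omega>)))"
    by (rule integral_distr[symmetric]) (use i h in \<open>auto intro!: measurable_Pair\<close>)
  also have "\<dots> = (\<integral>\<omega>1. (\<integral>\<omega>2. h (\<omega>1, \<omega>2) \<partial>distr M G (\<lambda>\<omega>. \<omega>)) \<partial>distr M F (\<lambda>\<omega>. \<omega>))"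
    unfolding decouple_distr[OF F G ind, symmetric] by (rule FG.integral_fst'[symmetric, OF int])
  also have "\<dots> = (\<integral>\<omega>1. (\<integral>\<omega>2. h (\<omega>1, \<omega>2) \<partial>distr M G (\<lambda>\<omega>. \<omega>)) \<partial>M)"
    by (intro integral_distr i(1) m)
  also have "\<dots> = (\<integral>\<omega>1. (\<integral>\<omega>2. h (\<omega>1, \<omega>2) \<partial>M) \<partial>M)"
    by (intro Bochner_Integration.integral_cong refl inner)
  finally show "(\<integral>\<omega>. h (\<omega>, \<omega>) \<partial>M) = (\<integral>\<omega>1. (\<integral>\<omega>2. h (\<omega>1, \<omega>2) \<partial>M) \<partial>M)" .
qed

text \<open>Integrating out the argument that is independent of the larger \<open>\<sigma>\<close>-algebra \<open>F\<close> leaves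
  a function of the smaller \<open>F'\<close>, so both conditional expectations agree.\<close>

lemma cond_exp_freezing:
  fixes h :: "'a \<times> 'a \<Rightarrow> real"
  assumes F: "subalgebra M F" and F': "subalgebra F F'" and G: "subalgebra M G" and ind: "indep_set (sets F) (sets G)"
    and h: "h \<in> borel_measurable (F' \<Otimes>\<^sub>M G)" and b: "\<And>q. q \<in> space M \<times> space M \<Longrightarrow> \<bar>h q\<bar> \<le> B"
  shows "AE \<omega> in M. real_cond_exp M F (\<lambda>\<omega>. h (\<omega>, \<omega>)) \<omega> = real_cond_exp M F' (\<lambda>\<omega>. h (\<omega>, \<omega>)) \<omega>"
proof -
  define H where "H = (\<lambda>\<omega>1. \<integral>\<omega>2. h (\<omega>1, \<omega>2) \<partial>M)"
  have MF': "subalgebra M F'" using F F' by (auto simp: subalgebra_def)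
  have s: "space F = space M" "space F' = space M" using F MF' by (auto simp: subalgebra_def)
  have ind': "indep_set (sets F') (sets G)"
    using ind F' unfolding indep_sets2_eq by (auto simp: subalgebra_def)
  have HF': "H \<in> borel_measurable F'" unfolding H_def
    by (rule decouple_lebesgue(2)[OF MF' G ind' h b])
  have hd: "(\<lambda>\<omega>. h (\<omega>, \<omega>)) \<in> borel_measurable M"
    using measurable_ident_subalgebra[OF MF'] measurable_ident_subalgebra[OF G]
    by (intro measurable_compose[OF _ h]) (rule measurable_Pair)
  have inth: "integrable M (\<lambda>\<omega>. h (\<omega>, \<omega>))"
    by (rule integrable_const_bound[of _ B]) (use hd b in auto)
  have HM: "H \<in> borel_measurable M" using HF' measurable_from_subalg[OF MF'] by blast
  have Hb: "\<bar>H \<omega>\<bar> \<le> B" if "\<omega> \<in> space M" for \<omega>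
  proof -
    have m: "(\<lambda>\<omega>2. h (\<omega>, \<omega>2)) \<in> borel_measurable M"
      using measurable_from_subalg[OF G] measurable_Pair2[OF h] that s by auto
    have "\<bar>\<integral>\<omega>2. h (\<omega>, \<omega>2) \<partial>M\<bar> \<le> (\<integral>\<omega>2. \<bar>h (\<omega>, \<omega>2)\<bar> \<partial>M)" by (rule integral_abs_bound)
    also have "\<dots> \<le> B"
      by (rule integral_le_const) (use m b that in \<open>auto intro!: integrable_const_bound[of _ B]\<close>)
    finally show ?thesis by (simp add: H_def)
  qed
  have intH: "integrable M H" by (rule integrable_const_bound[of _ B]) (use HM Hb in auto)
  \<comment> \<open>\<open>K\<close> stands for any sigma-algebra between F' and F. The partial
    integral \<open>H\<close> is F'-measurable and is a version of the conditional expectation for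
    each of them; the two extreme choices of \<open>K\<close> give the claim.\<close>
  have "AE \<omega> in M. real_cond_exp M K (\<lambda>\<omega>. h (\<omega>, \<omega>)) \<omega> = H \<omega>"
    if K: "subalgebra F K" "subalgebra K F'" for K
  proof -
    have MK: "subalgebra M K" using K(1) F by (auto simp: subalgebra_def)
    interpret K: finite_measure_subalgebra M K
      by unfold_locales (rule MK)
    have indK: "indep_set (sets K) (sets G)"
      using ind K(1) unfolding indep_sets2_eq by (auto simp: subalgebra_def)
    show ?thesis
    proof (rule K.real_cond_exp_charact[OF _ inth intH])
      show "H \<in> borel_measurable K" using HF' measurable_from_subalg[OF K(2)] by blast
      fix A assume A: "A \<in> sets K"
      have idm: "(\<lambda>\<omega>. \<omega>) \<in> K \<rightarrow>\<^sub>M F'"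
        by (rule measurable_ident_subalgebra[OF K(2)])
      have hK: "h \<in> borel_measurable (K \<Otimes>\<^sub>M G)"
      proof -
        have "(\<lambda>q. h (fst q, snd q)) \<in> borel_measurable (K \<Otimes>\<^sub>M G)"
          by (intro measurable_compose[OF _ h] measurable_Pair measurable_compose[OF measurable_fst idm] measurable_snd)
        then show ?thesis by simp
      qed
      have m: "(\<lambda>q. indicator A (fst q) * h q) \<in> borel_measurable (K \<Otimes>\<^sub>M G)"
        by (intro borel_measurable_times hK measurable_compose[OF measurable_fst borel_measurable_indicator[OF A]])
      have "(\<integral>\<omega>\<in>A. h (\<omega>, \<omega>) \<partial>M) = (\<integral>\<omega>. (\<lambda>q. indicator A (fst q) * h q) (\<omega>, \<omega>) \<partial>M)"
        by (simp add: set_lebesgue_integral_def)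
      also have "\<dots> = (\<integral>\<omega>1. (\<integral>\<omega>2. (\<lambda>q. indicator A (fst q) * h q) (\<omega>1, \<omega>2) \<partial>M) \<partial>M)"
      proof (rule decouple_lebesgue(1)[OF MK G indK m])
        fix q assume "q \<in> space M \<times> space M"
        then have "\<bar>h q\<bar> \<le> B" by (rule b)
        then show "\<bar>indicator A (fst q) * h q\<bar> \<le> B" by (auto simp: indicator_def)
      qed
      also have "\<dots> = (\<integral>\<omega>\<in>A. H \<omega> \<partial>M)" by (simp add: set_lebesgue_integral_def H_def)
      finally show "(\<integral>\<omega>\<in>A. h (\<omega>, \<omega>) \<partial>M) = (\<integral>\<omega>\<in>A. H \<omega> \<partial>M)" .
    qed
  qed
  from this[of F] this[of F'] F' have "AE \<omega> in M. real_cond_exp M F (\<lambda>\<omega>. h (\<omega>, \<omega>)) \<omega> = H \<omega>"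
    "AE \<omega> in M. real_cond_exp M F' (\<lambda>\<omega>. h (\<omega>, \<omega>)) \<omega> = H \<omega>"
    by (auto simp: subalgebra_def)
  then show ?thesis by eventually_elim simp
qed

section \<open>Concentration\<close>

text \<open>The exponent x^2 is twice the sharp one, but has an elementary proof: for |x| <= 1 the
  estimate exp x <= 1 + x + x^2 gives cosh x <= 1 + x^2, and otherwise cosh x <= exp |x| <= exp
  (x^2). For negative x the first estimate comes from the quadratic lower bound for exp
  (-x).\<close>

lemma cosh_le_exp_square: "cosh (x::real) \<le> exp (x\<^sup>2)"
proof (cases "\<bar>x\<bar> \<le> 1")
  case True
  have "exp x \<le> 1 + x + x\<^sup>2" if "\<bar>x\<bar> \<le> 1" for x :: real
  proof (cases "x \<ge> 0")
    case True then show ?thesis using exp_bound[of x] that by auto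
  next
    case False
    have "exp x * (1 - x + x\<^sup>2 / 2) \<le> 1"
      using exp_lower_Taylor_quadratic[of "-x"] False by (simp add: exp_minus field_simps)
    moreover have "1 \<le> (1 + x + x\<^sup>2) * (1 - x + x\<^sup>2 / 2)"
    proof -
      have "(1 + x + x\<^sup>2) * (1 - x + x\<^sup>2 / 2) - 1 = x\<^sup>2 / 2 * (1 + - x + x\<^sup>2)"
        by (simp add: power2_eq_square field_simps)
      moreover have "\<dots> \<ge> 0" using False by (intro mult_nonneg_nonneg) auto
      ultimately show ?thesis by linarith
    qed
    moreover have "1 - x + x\<^sup>2 / 2 > 0" using False by (simp add: add_pos_nonneg)
    ultimately show ?thesis by (meson mult_le_cancel_right order_trans linorder_not_le)
  qed
  from this[of x] this[of "-x"] True have "cosh x \<le> 1 + x\<^sup>2" by (simp add: cosh_def)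
  then show ?thesis using exp_ge_add_one_self[of "x\<^sup>2"] by linarith
next
  case False
  define E where "E = exp \<bar>x\<bar>"
  have "exp x \<le> E" "exp (-x) \<le> E" by (auto simp: E_def)
  from add_mono[OF this] have "cosh x \<le> E" by (simp add: cosh_field_def)
  then have "cosh x \<le> exp \<bar>x\<bar>" by (simp add: E_def)
  also have "\<bar>x\<bar> * 1 \<le> \<bar>x\<bar> * \<bar>x\<bar>" using False by (intro mult_left_mono) auto
  then have "exp \<bar>x\<bar> \<le> exp (x\<^sup>2)" by (simp add: power2_eq_square)
  finally show ?thesis .
qed

text \<open>By convexity the exponential lies below its chord over [-c, c]. The chord is affine in
  \<open>d\<close>, so for a martingale increment only the constant term cosh (t c) survives the
  integration.\<close>

lemma exp_le_chord:
  fixes d c t :: real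
  assumes "\<bar>d\<bar> \<le> c" "c > 0"
  shows "exp (t * d) \<le> cosh (t * c) + d / c * sinh (t * c)"
proof -
  define u where "u = (1 + d / c) / 2"
  have u: "0 \<le> u" "u \<le> 1" using assms by (auto simp: u_def field_simps)
  have "t * d = (1 - u) * (- (t * c)) + u * (t * c)" using assms by (simp add: u_def field_simps)
  then have "exp (t * d) \<le> (1 - u) * exp (- (t * c)) + u * exp (t * c)"
    using convex_onD[OF exp_convex u, of "- (t * c)" "t * c"] by simp
  also have "\<dots> = cosh (t * c) + d / c * sinh (t * c)"
  proof -
    have "(1 - (1 + r) / 2) * b + (1 + r) / 2 * a = (a + b) / 2 + r * ((a - b) / 2)" for r a b :: real
      by (simp add: field_simps)
    from this[of "d / c"] show ?thesis by (simp add: u_def cosh_field_def sinh_field_def)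
  qed
  finally show ?thesis .
qed

text \<open>The conditional expectations \<open>D j\<close> of \<open>f\<close> start at the mean
  and end at \<open>f\<close>. The moment generating function grows by the factor cosh (t c) <= exp
  (t^2 c^2) per step, and Chernoff's inequality is applied to both tails. The bound \<open>B\<close>
  serves only to make everything integrable and does not appear in the result.\<close>

lemma azuma:
  fixes F :: "nat \<Rightarrow> 'a measure" and f :: "'a \<Rightarrow> real"
  assumes sub: "\<And>j. subalgebra M (F j)" and mono: "\<And>j. subalgebra (F (Suc j)) (F j)"
    and triv: "sets (F 0) = {{}, space M}"
    and f: "f \<in> borel_measurable (F N)" and fb: "\<And>\<omega>. \<omega> \<in> space M \<Longrightarrow> \<bar>f \<omega>\<bar> \<le> B"
    and inc: "\<And>j. j < N \<Longrightarrow> AE \<omega> in M. \<bar>real_cond_exp M (F (Suc j)) f \<omega> - real_cond_exp M (F j) f \<omega>\<bar> \<le> c"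
    and c: "c > 0" and N: "N > 0" and \<epsilon>: "\<epsilon> > 0"
  shows "prob {\<omega> \<in> space M. \<bar>f \<omega> - expectation f\<bar> \<ge> \<epsilon>} \<le> 2 * exp (- (\<epsilon>\<^sup>2 / (4 * real N * c\<^sup>2)))"
proof -
  define D where "D j = real_cond_exp M (F j) f" for j
  define e where "e = expectation f"
  have fM: "f \<in> borel_measurable M" using f measurable_from_subalg[OF sub] by blast
  have intf: "integrable M f" by (rule integrable_const_bound[of _ B]) (use fM fb in auto)
  have fms: "finite_measure_subalgebra M (F j)" for j by unfold_locales (rule sub)
  interpret S: finite_measure_subalgebra M "F j" for j by (rule fms)
  have DF: "D j \<in> borel_measurable (F j)" for j unfolding D_def by simp
  have DM: "D j \<in> borel_measurable M" for j using DF measurable_from_subalg[OF sub] by blast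
  have DN: "AE \<omega> in M. D N \<omega> = f \<omega>" unfolding D_def by (rule S.real_cond_exp_F_meas[OF intf f])
  have D0: "AE \<omega> in M. D 0 \<omega> = e" unfolding D_def
  proof (rule S.real_cond_exp_charact[OF _ intf])
    fix A assume "A \<in> sets (F 0)"
    then have "A = {} \<or> A = space M" using triv by auto
    then show "(\<integral>\<omega>\<in>A. f \<omega> \<partial>M) = (\<integral>\<omega>\<in>A. e \<partial>M)"
      by (auto simp: e_def set_lebesgue_integral_def[of M "{}"] set_integral_space[OF intf] set_integral_space[of M "\<lambda>_. e", simplified e_def] prob_space)
  qed auto
  have Db: "AE \<omega> in M. \<bar>D j \<omega> - e\<bar> \<le> real j * c" if "j \<le> N" for j
    using that
  proof (induction j)
    case 0 show ?case using D0 by eventually_elim simp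
  next
    case (Suc j)
    then have "AE \<omega> in M. \<bar>D j \<omega> - e\<bar> \<le> real j * c" "AE \<omega> in M. \<bar>D (Suc j) \<omega> - D j \<omega>\<bar> \<le> c"
      using inc[of j] by (auto simp: D_def)
    then show ?case by eventually_elim (auto simp: algebra_simps)
  qed
  have expint: "integrable M (\<lambda>\<omega>. exp (t * (D j \<omega> - e)))" if "j \<le> N" for t j
  proof (rule integrable_const_bound[of _ "exp (\<bar>t\<bar> * (real j * c))"])
    show "AE \<omega> in M. norm (exp (t * (D j \<omega> - e))) \<le> exp (\<bar>t\<bar> * (real j * c))"
      using Db[OF that]
    proof eventually_elim
      case (elim \<omega>)
      have "t * (D j \<omega> - e) \<le> \<bar>t\<bar> * \<bar>D j \<omega> - e\<bar>" by (metis abs_ge_self abs_mult)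
      also have "\<dots> \<le> \<bar>t\<bar> * (real j * c)" using elim by (intro mult_left_mono) auto
      finally show ?case by simp
    qed
  qed (use DM in measurable)
  have mgf: "expectation (\<lambda>\<omega>. exp (t * (D j \<omega> - e))) \<le> exp (real j * (t\<^sup>2 * c\<^sup>2))" if "j \<le> N" for t j
    using that
  proof (induction j)
    case 0
    have "expectation (\<lambda>\<omega>. exp (t * (D 0 \<omega> - e))) = expectation (\<lambda>\<omega>. 1)"
      by (rule integral_cong_AE) (use D0 DM in auto)
    then show ?case by (simp add: prob_space)
  next
    case (Suc j)
    define U where "U \<omega> = exp (t * (D j \<omega> - e))" for \<omega>
    have j: "j \<le> N" using Suc by simp
    have UF: "U \<in> borel_measurable (F j)" unfolding U_def using DF[of j] by measurable
    have UF': "U \<in> borel_measurable (F (Suc j))" using UF measurable_from_subalg[OF mono] by blast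
    have UM: "U \<in> borel_measurable M" using UF measurable_from_subalg[OF sub] by blast
    have Ui: "integrable M U" using expint[OF j] by (simp add: U_def[abs_def])
    have Ufi: "integrable M (\<lambda>\<omega>. U \<omega> * f \<omega>)"
    proof (rule Bochner_Integration.integrable_bound[of _ "\<lambda>\<omega>. U \<omega> * B"])
      show "integrable M (\<lambda>\<omega>. U \<omega> * B)" using Ui by simp
      show "AE \<omega> in M. norm (U \<omega> * f \<omega>) \<le> norm (U \<omega> * B)"
      proof (rule AE_I2)
        fix \<omega> assume "\<omega> \<in> space M"
        then have "\<bar>f \<omega>\<bar> \<le> \<bar>B\<bar>" using fb[of \<omega>] by linarith
        then show "norm (U \<omega> * f \<omega>) \<le> norm (U \<omega> * B)" by (simp add: abs_mult mult_left_mono)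
      qed
    qed (use UM fM in measurable)
    note i1 = S.real_cond_exp_intg[OF Ufi UF fM] and i2 = S.real_cond_exp_intg[OF Ufi UF' fM]
    \<comment> \<open>\<open>U\<close> is measurable for both \<open>F j\<close> and
      \<open>F (Suc j)\<close>, so both conditional expectations of \<open>f\<close> have the same
      integral against it as \<open>f\<close> itself. Thus the increment is orthogonal to
      \<open>U\<close>.\<close>
    have zero: "expectation (\<lambda>\<omega>. U \<omega> * (D (Suc j) \<omega> - D j \<omega>)) = 0"
      and zi: "integrable M (\<lambda>\<omega>. U \<omega> * (D (Suc j) \<omega> - D j \<omega>))"
      using i1 i2 by (auto simp: D_def right_diff_distrib)
    have "expectation (\<lambda>\<omega>. exp (t * (D (Suc j) \<omega> - e)))
      \<le> expectation (\<lambda>\<omega>. cosh (t * c) * U \<omega> + (sinh (t * c) / c) * (U \<omega> * (D (Suc j) \<omega> - D j \<omega>)))"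
    proof (rule integral_mono_AE[OF expint[OF Suc.prems]])
      show "integrable M (\<lambda>\<omega>. cosh (t * c) * U \<omega> + (sinh (t * c) / c) * (U \<omega> * (D (Suc j) \<omega> - D j \<omega>)))"
        using Ui zi by simp
      have "AE \<omega> in M. \<bar>D (Suc j) \<omega> - D j \<omega>\<bar> \<le> c" using inc[of j] Suc.prems by (simp add: D_def)
      then show "AE \<omega> in M. exp (t * (D (Suc j) \<omega> - e)) \<le> cosh (t * c) * U \<omega> + (sinh (t * c) / c) * (U \<omega> * (D (Suc j) \<omega> - D j \<omega>))"
      proof eventually_elim
        case (elim \<omega>)
        have "exp (t * (D (Suc j) \<omega> - e)) = U \<omega> * exp (t * (D (Suc j) \<omega> - D j \<omega>))"
          by (simp add: U_def exp_add[symmetric] algebra_simps)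
        also have "\<dots> \<le> U \<omega> * (cosh (t * c) + (D (Suc j) \<omega> - D j \<omega>) / c * sinh (t * c))"
          by (intro mult_left_mono exp_le_chord elim c) (simp add: U_def)
        finally show ?case by (simp add: algebra_simps diff_divide_distrib)
      qed
    qed
    also have "\<dots> = cosh (t * c) * expectation U" using Ui zi zero by simp
    also have "\<dots> \<le> exp (t\<^sup>2 * c\<^sup>2) * exp (real j * (t\<^sup>2 * c\<^sup>2))"
    proof (rule mult_mono)
      show "cosh (t * c) \<le> exp (t\<^sup>2 * c\<^sup>2)" using cosh_le_exp_square[of "t * c"] by (simp add: power_mult_distrib)
      show "expectation U \<le> exp (real j * (t\<^sup>2 * c\<^sup>2))" using Suc.IH[OF j] by (simp add: U_def[abs_def])
    qed (auto simp: U_def intro!: Bochner_Integration.integral_nonneg)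
    also have "\<dots> = exp (real (Suc j) * (t\<^sup>2 * c\<^sup>2))" by (simp add: exp_add[symmetric] algebra_simps)
    finally show ?case .
  qed
  have mgf': "expectation (\<lambda>\<omega>. exp (t * (f \<omega> - e))) \<le> exp (real N * (t\<^sup>2 * c\<^sup>2))" for t
  proof -
    have "expectation (\<lambda>\<omega>. exp (t * (f \<omega> - e))) = expectation (\<lambda>\<omega>. exp (t * (D N \<omega> - e)))"
    proof (rule integral_cong_AE)
      show "AE \<omega> in M. exp (t * (f \<omega> - e)) = exp (t * (D N \<omega> - e))" using DN by eventually_elim simp
    qed (use DM fM in measurable)
    then show ?thesis using mgf[of N t] by simp
  qed
  have fint: "integrable M (\<lambda>\<omega>. exp (t * (f \<omega> - e)))" for t
  proof (rule integrable_const_bound[of _ "exp (\<bar>t\<bar> * (B + \<bar>e\<bar>))"])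
    show "AE \<omega> in M. norm (exp (t * (f \<omega> - e))) \<le> exp (\<bar>t\<bar> * (B + \<bar>e\<bar>))"
    proof (rule AE_I2)
      fix \<omega> assume "\<omega> \<in> space M"
      have "t * (f \<omega> - e) \<le> \<bar>t\<bar> * \<bar>f \<omega> - e\<bar>" by (metis abs_ge_self abs_mult)
      also have "\<dots> \<le> \<bar>t\<bar> * (B + \<bar>e\<bar>)" using fb[OF \<open>\<omega> \<in> space M\<close>] by (intro mult_left_mono) auto
      finally show "norm (exp (t * (f \<omega> - e))) \<le> exp (\<bar>t\<bar> * (B + \<bar>e\<bar>))" by simp
    qed
  qed (use fM in measurable)
  \<comment> \<open>Minimises - t \<epsilon> + N t^2 c^2; the minimum is the exponent - \<epsilon>^2
    / (4 N c^2).\<close>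
  define t where "t = \<epsilon> / (2 * real N * c\<^sup>2)"
  have t: "t > 0" using \<epsilon> N c by (simp add: t_def)
  have te: "exp (- t * \<epsilon>) * exp (real N * (t\<^sup>2 * c\<^sup>2)) = exp (- (\<epsilon>\<^sup>2 / (4 * real N * c\<^sup>2)))"
    using N c by (simp add: exp_add[symmetric] t_def field_simps power2_eq_square)
  have tail: "prob {\<omega> \<in> space M. s * (f \<omega> - e) \<ge> \<epsilon>} \<le> exp (- (\<epsilon>\<^sup>2 / (4 * real N * c\<^sup>2)))" if s: "s = 1 \<or> s = -1" for s
  proof -
    have "prob {\<omega> \<in> space M. s * (f \<omega> - e) \<ge> \<epsilon>} \<le> exp (- t * \<epsilon>) * (\<integral>\<omega>\<in>space M. exp (t * (s * (f \<omega> - e))) \<partial>M)"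
    proof (rule Chernoff_ineq_ge[OF t])
      have "integrable M (\<lambda>\<omega>. exp (t * (s * (f \<omega> - e))))" using fint[of "t * s"] by (simp add: mult.assoc)
      then show "set_integrable M (space M) (\<lambda>\<omega>. exp (t * (s * (f \<omega> - e))))"
        unfolding set_integrable_def by (rule integrable_mult_indicator[OF sets.top])
    qed auto
    also have "(\<integral>\<omega>\<in>space M. exp (t * (s * (f \<omega> - e))) \<partial>M) = expectation (\<lambda>\<omega>. exp ((t * s) * (f \<omega> - e)))"
      using fint[of "t * s"] by (subst set_integral_space) (auto simp: mult.assoc)
    also have "exp (- t * \<epsilon>) * \<dots> \<le> exp (- t * \<epsilon>) * exp (real N * ((t * s)\<^sup>2 * c\<^sup>2))"
      by (intro mult_left_mono mgf') auto
    also have "(t * s)\<^sup>2 = t\<^sup>2" using s by auto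
    finally show ?thesis unfolding te .
  qed
  have "prob {\<omega> \<in> space M. \<bar>f \<omega> - expectation f\<bar> \<ge> \<epsilon>}
    \<le> prob ({\<omega> \<in> space M. 1 * (f \<omega> - e) \<ge> \<epsilon>} \<union> {\<omega> \<in> space M. (-1) * (f \<omega> - e) \<ge> \<epsilon>})"
    by (rule finite_measure_mono) (use fM in \<open>auto simp: e_def\<close>)
  also have "\<dots> \<le> prob {\<omega> \<in> space M. 1 * (f \<omega> - e) \<ge> \<epsilon>} + prob {\<omega> \<in> space M. (-1) * (f \<omega> - e) \<ge> \<epsilon>}"
    by (rule measure_Un_le) (use fM in auto)
  also have "\<dots> \<le> 2 * exp (- (\<epsilon>\<^sup>2 / (4 * real N * c\<^sup>2)))"
    using tail[of 1] tail[of "-1"] by simp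
  finally show ?thesis .
qed

text \<open>Let g be \<Phi> without the columns in two consecutive blocks, j m < i <= (j + 2) m.
  What remains is measurable for the first j blocks together with columns independent of the first j
  + 1 blocks, so g has the same conditional expectation at both times. The increment of f is
  therefore that of f - g, at most twice 2 m ln (\<beta> / \<alpha>). The families \<open>Fs\<close>
  and \<open>Gs\<close> are left abstract because the lemma is applied to the data and to the
  Gaussian columns.\<close>

lemma logdet_ratio_concentration:
  fixes Fs Gs :: "nat \<Rightarrow> 'a measure" and x :: "nat \<Rightarrow> 'a \<Rightarrow> real Matrix.vec"
  assumes Fs: "\<And>k. subalgebra M (Fs k)" and Fm: "\<And>k l. k \<le> l \<Longrightarrow> subalgebra (Fs l) (Fs k)"
    and F0: "sets (Fs 0) = {{}, space M}" and Gs: "\<And>l. subalgebra M (Gs l)"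
    and ind: "\<And>k l. k + m \<le> l \<Longrightarrow> indep_set (sets (Fs k)) (sets (Gs l))" and m: "m \<ge> 1"
    and xF: "\<And>j k. 1 \<le> j \<Longrightarrow> j \<le> k \<Longrightarrow> j \<le> n \<Longrightarrow> x j \<in> Fs k \<rightarrow>\<^sub>M borel_vec p"
    and xG: "\<And>j l. 1 \<le> j \<Longrightarrow> l \<le> j \<Longrightarrow> j \<le> n \<Longrightarrow> x j \<in> Gs l \<rightarrow>\<^sub>M borel_vec p"
    and ab: "0 < \<alpha>" "\<alpha> < \<beta>" and \<epsilon>: "\<epsilon> > 0"
  defines "f \<equiv> \<lambda>\<omega>. logdet_ratio p n \<alpha> \<beta> {1..n} (\<lambda>j. x j \<omega>)"
  shows "prob {\<omega> \<in> space M. \<bar>f \<omega> - expectation f\<bar> \<ge> \<epsilon>}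
    \<le> 2 * exp (- (\<epsilon>\<^sup>2 / (4 * real (n div m + 1) * (4 * real m * ln (\<beta> / \<alpha>))\<^sup>2)))"
proof -
  define K where "K = ln (\<beta> / \<alpha>)"
  have K: "K > 0" using ab by (simp add: K_def)
  define L0 where "L0 = logdet_ratio p n \<alpha> \<beta> {} (\<lambda>_. 0\<^sub>v p)"
  have bnd: "\<bar>logdet_ratio p n \<alpha> \<beta> I u\<bar> \<le> \<bar>L0\<bar> + real n * K"
    if "I \<subseteq> {1..n}" "\<And>j. j \<in> I \<Longrightarrow> u j \<in> carrier_vec p" for I u
  proof -
    have fin: "finite I" using that(1) finite_subset by blast
    have "\<bar>logdet_ratio p n \<alpha> \<beta> ({} \<union> I) u - logdet_ratio p n \<alpha> \<beta> {} u\<bar> \<le> real (card I) * K"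
      unfolding K_def by (rule logdet_ratio_subset) (use that fin ab in auto)
    moreover have "logdet_ratio p n \<alpha> \<beta> {} u = L0" unfolding L0_def by (rule logdet_ratio_cong) auto
    moreover have "real (card I) * K \<le> real n * K"
      using card_mono[OF _ that(1)] K by (intro mult_right_mono) auto
    ultimately show ?thesis by simp
  qed
  define F where "F j = Fs (j * m)" for j
  have xM: "x j \<in> M \<rightarrow>\<^sub>M borel_vec p" if "j \<in> {1..n}" for j
    using xF[of j j] measurable_from_subalg[OF Fs] that by auto
  have fM: "f \<in> borel_measurable M" unfolding f_def by (rule measurable_logdet_ratio[OF xM])
  have xc: "x j \<omega> \<in> carrier_vec p" if "j \<in> {1..n}" "\<omega> \<in> space M" for j \<omega>
    using measurable_borel_vecD(1)[OF xM] that by auto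
  have fb: "\<bar>f \<omega>\<bar> \<le> \<bar>L0\<bar> + real n * K" if "\<omega> \<in> space M" for \<omega>
    unfolding f_def by (rule bnd) (use xc that in auto)
  have fi: "integrable M f" by (rule integrable_const_bound) (use fb fM in auto)
  have "prob {\<omega> \<in> space M. \<bar>f \<omega> - expectation f\<bar> \<ge> \<epsilon>}
    \<le> 2 * exp (- (\<epsilon>\<^sup>2 / (4 * real (n div m + 1) * (4 * real m * K)\<^sup>2)))"
  proof (rule azuma[of F])
    show "subalgebra M (F j)" "subalgebra (F (Suc j)) (F j)" for j
      unfolding F_def by (auto intro!: Fs Fm)
    show "sets (F 0) = {{}, space M}" by (simp add: F_def F0)
    \<comment> \<open>The last block may be incomplete; the additional summand 1 makes the blocks of
      length \<open>m\<close> cover {1..n}.\<close>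
    have "n \<le> (n div m + 1) * m" using m by (simp add: dividend_less_div_times less_imp_le add.commute)
    then show "f \<in> borel_measurable (F (n div m + 1))"
      unfolding f_def F_def by (intro measurable_logdet_ratio xF) auto
    show "4 * real m * K > 0" using m K by simp
    fix j assume "j < n div m + 1"
    define I where "I = {i\<in>{1..n}. i \<le> j * m \<or> (j + 2) * m < i}"
    define J where "J = {i\<in>{1..n}. j * m < i \<and> i \<le> (j + 2) * m}"
    \<comment> \<open>The early columns are read at the first point and the late ones at the second,
      as required by \<open>cond_exp_freezing\<close>; on the diagonal this is
      \<open>g\<close>.\<close>
    define h where "h q = logdet_ratio p n \<alpha> \<beta> I (\<lambda>i. if i \<le> j * m then x i (fst q) else x i (snd q))" for q
    have IJ: "{1..n} = I \<union> J" "I \<inter> J = {}" "finite I" "finite J" by (auto simp: I_def J_def)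
    have "J \<subseteq> {j * m<..(j + 2) * m}" by (auto simp: J_def)
    then have "card J \<le> card {j * m<..(j + 2) * m}" by (intro card_mono) auto
    then have cJ: "card J \<le> 2 * m" by simp
    have hm: "h \<in> borel_measurable (F j \<Otimes>\<^sub>M Gs ((j + 2) * m))"
      unfolding h_def
    proof (rule measurable_logdet_ratio)
      fix i assume i: "i \<in> I"
      show "(\<lambda>q. if i \<le> j * m then x i (fst q) else x i (snd q)) \<in> F j \<Otimes>\<^sub>M Gs ((j + 2) * m) \<rightarrow>\<^sub>M borel_vec p"
      proof (cases "i \<le> j * m")
        case True
        then have "x i \<in> F j \<rightarrow>\<^sub>M borel_vec p" unfolding F_def using i by (intro xF) (auto simp: I_def)
        then show ?thesis using True by (simp add: measurable_compose[OF measurable_fst])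
      next
        case False
        then have "x i \<in> Gs ((j + 2) * m) \<rightarrow>\<^sub>M borel_vec p" using i by (intro xG) (auto simp: I_def)
        then show ?thesis using False by (simp add: measurable_compose[OF measurable_snd])
      qed
    qed
    have hb: "\<bar>h q\<bar> \<le> \<bar>L0\<bar> + real n * K" if "q \<in> space M \<times> space M" for q
      unfolding h_def by (rule bnd) (use that xc in \<open>auto simp: I_def\<close>)
    define g where "g \<omega> = h (\<omega>, \<omega>)" for \<omega>
    have g: "g \<omega> = logdet_ratio p n \<alpha> \<beta> I (\<lambda>i. x i \<omega>)" for \<omega>
      unfolding g_def h_def by (rule logdet_ratio_cong) auto
    have diff: "\<bar>f \<omega> - g \<omega>\<bar> \<le> 2 * real m * K" if "\<omega> \<in> space M" for \<omega>
    proof -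
      have "\<bar>f \<omega> - g \<omega>\<bar> \<le> real (card J) * K"
        unfolding f_def g IJ(1) K_def by (rule logdet_ratio_subset) (use IJ xc that ab in auto)
      also have "\<dots> \<le> real (2 * m) * K" using cJ K by (intro mult_right_mono) auto
      finally show ?thesis by simp
    qed
    have "subalgebra M (F j)" "subalgebra M (F (Suc j))" unfolding F_def by (auto intro!: Fs)
    then interpret S0: finite_measure_subalgebra M "F j" + S1: finite_measure_subalgebra M "F (Suc j)"
      by unfold_locales
    have frz: "AE \<omega> in M. real_cond_exp M (F (Suc j)) g \<omega> = real_cond_exp M (F j) g \<omega>"
      unfolding g_def
    proof (rule cond_exp_freezing[OF _ _ Gs _ hm hb])
      show "subalgebra M (F (Suc j))" "subalgebra (F (Suc j)) (F j)" unfolding F_def by (auto intro!: Fs Fm)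
      show "indep_set (sets (F (Suc j))) (sets (Gs ((j + 2) * m)))"
        unfolding F_def by (rule ind) (simp add: algebra_simps)
    qed
    have gM: "g \<in> borel_measurable M" unfolding g by (rule measurable_logdet_ratio) (use xM in \<open>auto simp: I_def\<close>)
    have gi: "integrable M g"
      by (rule integrable_const_bound[of _ "\<bar>L0\<bar> + real n * K"]) (use gM hb in \<open>auto simp: g_def\<close>)
    have di: "integrable M (\<lambda>\<omega>. f \<omega> - g \<omega>)" using fi gi by simp
    have b1: "AE \<omega> in M. real_cond_exp M G (\<lambda>\<omega>. f \<omega> - g \<omega>) \<omega> \<le> 2 * real m * K"
      "AE \<omega> in M. real_cond_exp M G (\<lambda>\<omega>. f \<omega> - g \<omega>) \<omega> \<ge> - (2 * real m * K)"
      "AE \<omega> in M. real_cond_exp M G (\<lambda>\<omega>. f \<omega> - g \<omega>) \<omega> = real_cond_exp M G f \<omega> - real_cond_exp M G g \<omega>"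
      if "finite_measure_subalgebra M G" for G
    proof -
      interpret G: finite_measure_subalgebra M G by fact
      show "AE \<omega> in M. real_cond_exp M G (\<lambda>\<omega>. f \<omega> - g \<omega>) \<omega> \<le> 2 * real m * K"
        by (rule G.real_cond_exp_le_c[OF di]) (use diff in \<open>auto intro!: AE_I2 simp: abs_le_iff\<close>)
      show "AE \<omega> in M. real_cond_exp M G (\<lambda>\<omega>. f \<omega> - g \<omega>) \<omega> \<ge> - (2 * real m * K)"
        by (rule G.real_cond_exp_ge_c[OF di]) (use diff in \<open>fastforce intro!: AE_I2 simp: abs_le_iff\<close>)
      show "AE \<omega> in M. real_cond_exp M G (\<lambda>\<omega>. f \<omega> - g \<omega>) \<omega> = real_cond_exp M G f \<omega> - real_cond_exp M G g \<omega>"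
        by (rule G.real_cond_exp_diff[OF fi gi])
    qed
    show "AE \<omega> in M. \<bar>real_cond_exp M (F (Suc j)) f \<omega> - real_cond_exp M (F j) f \<omega>\<bar> \<le> 4 * real m * K"
      using frz b1[OF S0.finite_measure_subalgebra_axioms] b1[OF S1.finite_measure_subalgebra_axioms]
      by eventually_elim (auto simp: abs_le_iff)
  qed (use \<epsilon> fb in auto)
  then show ?thesis by (simp add: K_def)
qed

end

section \<open>Generated sigma-algebras and m-dependence\<close>

context prob_space
begin

lemma subalgebra_gen_sigma:
  assumes "\<And>i. i \<in> I \<Longrightarrow> X i \<in> M \<rightarrow>\<^sub>M N"
  shows "subalgebra M (gen_sigma M N X I)"
proof -
  have "(\<Union>i\<in>I. {X i -` A \<inter> space M | A. A \<in> sets N}) \<subseteq> sets M" using assms by (auto intro: measurable_sets)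
  moreover have "(\<Union>i\<in>I. {X i -` A \<inter> space M | A. A \<in> sets N}) \<subseteq> Pow (space M)" by auto
  ultimately show ?thesis unfolding subalgebra_def gen_sigma_def
    by (simp add: sets_measure_of space_measure_of_conv sets.sigma_sets_subset)
qed

lemma gen_sigma_sets: "sets (gen_sigma M N X I) = sigma_sets (space M) (\<Union>i\<in>I. {X i -` A \<inter> space M | A. A \<in> sets N})"
  unfolding gen_sigma_def by (rule sets_measure_of) auto

lemma space_gen_sigma: "space (gen_sigma M N X I) = space M"
  by (simp add: gen_sigma_def space_measure_of_conv)

lemma gen_sigma_mono:
  assumes "I \<subseteq> J" shows "sets (gen_sigma M N X I) \<subseteq> sets (gen_sigma M N X J)"
  unfolding gen_sigma_sets using assms by (intro sigma_sets_mono') auto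

lemma measurable_gen_sigma:
  assumes "i \<in> I" "X i \<in> M \<rightarrow>\<^sub>M N" shows "X i \<in> gen_sigma M N X I \<rightarrow>\<^sub>M N"
proof (rule measurableI)
  fix \<omega> assume "\<omega> \<in> space (gen_sigma M N X I)"
  then show "X i \<omega> \<in> space N" using assms by (simp add: space_gen_sigma measurable_space)
next
  fix A assume "A \<in> sets N"
  then show "X i -` A \<inter> space (gen_sigma M N X I) \<in> sets (gen_sigma M N X I)"
    unfolding gen_sigma_sets space_gen_sigma using assms(1) by (intro sigma_sets.Basic) auto
qed

lemma gen_sigma_empty: "sets (gen_sigma M N X {}) = {{}, space M}"
  unfolding gen_sigma_sets by (simp add: sigma_sets_empty_eq)

lemma indep_set_trivial:
  assumes "sets F \<subseteq> events"
  shows "indep_set {{}, space M} (sets F)" "indep_set (sets F) {{}, space M}"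
  using assms unfolding indep_sets2_eq
  by (auto simp: prob_space Int_absorb1 Int_absorb2 dest!: subsetD[OF assms] sets.sets_into_space)

lemma indep_gen_sigma:
  assumes ind: "indep_vars (\<lambda>_. N) X I" and AB: "A \<subseteq> I" "B \<subseteq> I" "A \<inter> B = {}"
  shows "indep_set (sets (gen_sigma M N X A)) (sets (gen_sigma M N X B))"
proof -
  let ?E = "\<lambda>i. {X i -` A \<inter> space M | A. A \<in> sets N}"
  have "indep_sets ?E I" using ind by (simp add: indep_vars_def2)
  then have "indep_sets ?E (\<Union>j\<in>UNIV. case_bool A B j)"
    by (rule indep_sets_mono_index[rotated]) (use AB in \<open>auto split: bool.splits\<close>)
  then have "indep_sets (\<lambda>j. sigma_sets (space M) (\<Union>i\<in>case_bool A B j. ?E i)) UNIV"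
  proof (rule indep_sets_collect_sigma)
    show "Int_stable (?E i)" for i
      by (auto simp: Int_stable_def) (metis (no_types, opaque_lifting) sets.Int vimage_Int Int_assoc Int_left_commute Int_absorb)
    show "disjoint_family_on (case_bool A B) UNIV"
      using AB(3) by (auto simp: disjoint_family_on_def split: bool.splits)
  qed
  then show ?thesis unfolding indep_set_def gen_sigma_sets
    by (rule indep_sets_mono_sets) (auto split: bool.split)
qed

text \<open>Intersections of an event of A with an event of B form a generator stable under
  intersection. On it the probability splits into four factors, first by independence of A and B and
  then inside each of them. It is used with A generated by the Gaussian vectors and B by the
  matrices.\<close>

lemma indep_set_join:
  assumes W: "indep_set (sets A) (sets B)" and SA: "subalgebra M A" and SB: "subalgebra M B"
    and A1: "subalgebra A A1" and A2: "subalgebra A A2" and B1: "subalgebra B B1" and B2: "subalgebra B B2"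
    and iA: "indep_set (sets A1) (sets A2)" and iB: "indep_set (sets B1) (sets B2)"
  shows "indep_set (sigma_sets (space M) (sets A1 \<union> sets B1)) (sigma_sets (space M) (sets A2 \<union> sets B2))"
proof -
  define E where "E S T = {a \<inter> b |a b. a \<in> sets S \<and> b \<in> sets T}" for S T :: "'a measure"
  have IE: "Int_stable (E S T)" for S T
    unfolding Int_stable_def E_def
  proof safe
    fix a b a' b' assume h: "a \<in> sets S" "b \<in> sets T" "a' \<in> sets S" "b' \<in> sets T"
    show "\<exists>a'' b''. (a \<inter> b) \<inter> (a' \<inter> b') = a'' \<inter> b'' \<and> a'' \<in> sets S \<and> b'' \<in> sets T"
      by (rule exI[of _ "a \<inter> a'"], rule exI[of _ "b \<inter> b'"]) (use h in auto)
  qed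
  have PW: "prob (a \<inter> b) = prob a * prob b" if "a \<in> sets A" "b \<in> sets B" for a b
    using indep_setD[OF W that] .
  have sp: "space A1 = space M" "space A2 = space M" "space B1 = space M" "space B2 = space M"
    using SA SB A1 A2 B1 B2 by (auto simp: subalgebra_def)
  have ev: "E A1 B1 \<subseteq> events" "E A2 B2 \<subseteq> events"
  proof -
    have "sets A1 \<subseteq> events" "sets A2 \<subseteq> events" "sets B1 \<subseteq> events" "sets B2 \<subseteq> events"
      using SA SB A1 A2 B1 B2 by (auto simp: subalgebra_def)
    then show "E A1 B1 \<subseteq> events" "E A2 B2 \<subseteq> events" unfolding E_def by blast+
  qed
  have "indep_set (E A1 B1) (E A2 B2)"
    unfolding indep_sets2_eq
  proof (intro conjI ballI ev)
    fix u v assume "u \<in> E A1 B1" "v \<in> E A2 B2"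
    then obtain a1 b1 a2 b2 where h: "a1 \<in> sets A1" "b1 \<in> sets B1" "a2 \<in> sets A2" "b2 \<in> sets B2" "u = a1 \<inter> b1" "v = a2 \<inter> b2"
      by (auto simp: E_def)
    have h': "a1 \<in> sets A" "a2 \<in> sets A" "b1 \<in> sets B" "b2 \<in> sets B" using h A1 A2 B1 B2 by (auto simp: subalgebra_def)
    have "u \<inter> v = (a1 \<inter> a2) \<inter> (b1 \<inter> b2)" using h by auto
    then have "prob (u \<inter> v) = prob (a1 \<inter> a2) * prob (b1 \<inter> b2)" using PW[of "a1 \<inter> a2" "b1 \<inter> b2"] h' by auto
    also have "\<dots> = (prob a1 * prob a2) * (prob b1 * prob b2)"
      using indep_setD[OF iA] indep_setD[OF iB] h by auto
    finally show "prob (u \<inter> v) = prob u * prob v" using PW h h' by (simp add: mult_ac)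
  qed
  then have "indep_set (sigma_sets (space M) (E A1 B1)) (sigma_sets (space M) (E A2 B2))"
    by (rule indep_set_sigma_sets[OF _ IE IE])
  moreover have "sigma_sets (space M) (sets S \<union> sets T) \<subseteq> sigma_sets (space M) (E S T)"
    if "space S = space M" "space T = space M" for S T
  proof (rule sigma_sets_mono, safe)
    fix a assume "a \<in> sets S"
    then have "a = a \<inter> space M" using sets.sets_into_space[of a S] that by auto
    then have "a \<in> E S T" unfolding E_def using \<open>a \<in> sets S\<close> that sets.top[of T] by auto
    then show "a \<in> sigma_sets (space M) (E S T)" by (rule sigma_sets.Basic)
  next
    fix a assume "a \<in> sets T"
    then have "a = space M \<inter> a" using sets.sets_into_space[of a T] that by auto
    then have "a \<in> E S T" unfolding E_def using \<open>a \<in> sets T\<close> that sets.top[of S] by auto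
    then show "a \<in> sigma_sets (space M) (E S T)" by (rule sigma_sets.Basic)
  qed
  ultimately show ?thesis unfolding indep_sets2_eq using sp by (meson subsetD subset_trans)
qed

text \<open>With \<open>max m 1\<close> in place of \<open>m\<close> the case \<open>m = 0\<close>, in which \<open>m_dependent\<close> makes all
  members of the sequence almost surely constant, needs no separate treatment.\<close>

lemma m_dependent_indep:
  assumes dep: "m_dependent M m p n y S" and kl: "k + max m 1 \<le> l"
    and y: "\<And>j. j \<in> {1..n} \<Longrightarrow> y j \<in> M \<rightarrow>\<^sub>M borel_vec p" and S: "\<And>j. j \<in> {1..n} \<Longrightarrow> S j \<in> M \<rightarrow>\<^sub>M borel_mat p"
  shows "indep_set (sets (pair_sigma M p y S ({1..k} \<inter> {1..n}))) (sets (pair_sigma M p y S ({l..n} \<inter> {1..n})))"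
proof -
  have m: "(\<lambda>\<omega>. (y j \<omega>, S j \<omega>)) \<in> M \<rightarrow>\<^sub>M borel_vec p \<Otimes>\<^sub>M borel_mat p" if "j \<in> {1..n}" for j
    using y[OF that] S[OF that] by (rule measurable_Pair)
  have sub: "sets (pair_sigma M p y S I) \<subseteq> events" if "I \<subseteq> {1..n}" for I
  proof -
    have "subalgebra M (gen_sigma M (borel_vec p \<Otimes>\<^sub>M borel_mat p) (\<lambda>j \<omega>. (y j \<omega>, S j \<omega>)) I)"
      by (rule subalgebra_gen_sigma) (use m that in auto)
    then show ?thesis by (simp add: pair_sigma_def subalgebra_def)
  qed
  \<comment> \<open>The condition in \<open>m_dependent\<close> speaks only about 1 <= k and k + m
    <= n. Beyond these limits one of the two sigma-algebras is generated by an empty family and is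
    trivial.\<close>
  consider "k = 0" | "l > n" | "1 \<le> k" "k + m \<le> n" "l \<le> n" using kl by linarith
  then show ?thesis
  proof cases
    case 1
    then show ?thesis using indep_set_trivial(1)[OF sub[of "{l..n} \<inter> {1..n}"]] by (simp add: pair_sigma_def gen_sigma_empty)
  next
    case 2
    then show ?thesis using indep_set_trivial(2)[OF sub[of "{1..k} \<inter> {1..n}"]] by (simp add: pair_sigma_def gen_sigma_empty)
  next
    case 3
    then have "indep_set (sets (pair_sigma M p y S {1..k})) (sets (pair_sigma M p y S {k+m..n}))"
      using dep by (auto simp: m_dependent_def)
    moreover have "sets (pair_sigma M p y S ({1..k} \<inter> {1..n})) \<subseteq> sets (pair_sigma M p y S {1..k})"
      "sets (pair_sigma M p y S ({l..n} \<inter> {1..n})) \<subseteq> sets (pair_sigma M p y S {k+m..n})"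
      unfolding pair_sigma_def using kl by (auto intro!: gen_sigma_mono)
    ultimately show ?thesis unfolding indep_sets2_eq by (meson subsetD subset_trans)
  qed
qed

end

section \<open>From log-determinants to Stieltjes transforms\<close>

lemma poly_pderiv_prod_linear:
  fixes z :: complex
  assumes "z \<notin> set as"
  shows "poly (pderiv (\<Prod>a\<leftarrow>as. [:- a, 1:])) z = poly (\<Prod>a\<leftarrow>as. [:- a, 1:]) z * (\<Sum>a\<leftarrow>as. 1 / (z - a))"
  using assms
proof (induction as)
  case (Cons a as)
  then have "z - a \<noteq> 0" "z \<notin> set as" by auto
  define Q where "Q = (\<Prod>a\<leftarrow>as. [:- a, 1:])"
  have "pderiv ([:- a, 1:] * Q) = [:- a, 1:] * pderiv Q + Q"
    by (subst pderiv_mult) (simp add: pderiv_pCons)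
  then have "poly (pderiv ([:- a, 1:] * Q)) z = (z - a) * poly (pderiv Q) z + poly Q z"
    by (simp only: poly_mult poly_add) simp
  also have "poly (pderiv Q) z = poly Q z * (\<Sum>a\<leftarrow>as. 1 / (z - a))" using Cons.IH \<open>z \<notin> set as\<close> by (simp add: Q_def)
  also have "(z - a) * (poly Q z * (\<Sum>a\<leftarrow>as. 1 / (z - a))) + poly Q z = ((z - a) * poly Q z) * (\<Sum>a\<leftarrow>a # as. 1 / (z - a))"
    using \<open>z - a \<noteq> 0\<close> by (simp add: distrib_left)
  also have "(z - a) * poly Q z = poly ([:- a, 1:] * Q) z" by (simp only: poly_mult) simp
  finally show ?case by (simp only: list.map prod_list.Cons Q_def)
qed simp

lemma poly_prod_linear: "poly (\<Prod>a\<leftarrow>as. [:- a, 1:]) z = (\<Prod>a\<leftarrow>as. z - (a::complex))"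
  by (induction as) (auto simp: algebra_simps)

lemma poly_char_poly:
  assumes "A \<in> carrier_mat p p"
  shows "poly (char_poly A) z = Determinant.det (z \<cdot>\<^sub>m 1\<^sub>m p - (A :: complex mat))"
proof -
  have "- char_matrix A z = z \<cdot>\<^sub>m 1\<^sub>m p - A"
    using assms by (intro eq_matI) (auto simp: char_matrix_def)
  then show ?thesis using char_poly_matrix[OF assms] by simp
qed

text \<open>The trace of the adjugate of z I - A is the sum of its principal minors, that is, the
  derivative of the characteristic polynomial at z. Hence the trace of the inverse is a logarithmic
  derivative and can be read off from the roots without diagonalising A.\<close>

lemma trace_inverse_eigenvalues:
  fixes A :: "complex mat"
  assumes A: "A \<in> carrier_mat p p" and cp: "char_poly A = (\<Prod>a\<leftarrow>as. [:- a, 1:])" and z: "z \<notin> set as"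
  shows "mat_trace (the (mat_inverse (A - z \<cdot>\<^sub>m 1\<^sub>m p))) = (\<Sum>a\<leftarrow>as. 1 / (a - z))"
proof -
  define B where "B = z \<cdot>\<^sub>m 1\<^sub>m p - A"
  have Bc: "B \<in> carrier_mat p p" using A by (simp add: B_def minus_carrier_mat)
  have AB: "A - z \<cdot>\<^sub>m 1\<^sub>m p = - B" using A by (intro eq_matI) (auto simp: B_def)
  have mBc: "- B \<in> carrier_mat p p" using Bc by simp
  have pz: "poly (char_poly A) z \<noteq> 0"
    using z by (auto simp: cp poly_prod_linear prod_list_zero_iff)
  have dB: "Determinant.det B \<noteq> 0" using pz poly_char_poly[OF A] by (simp add: B_def)
  then have dmB: "Determinant.det (- B) \<noteq> 0"
    using det_0_negate[OF Bc] by simp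
  obtain C where C: "mat_inverse (- B) = Some C"
    using mat_inverse(1)[OF mBc, of "()"] det_non_zero_imp_unit[OF mBc dmB, of "()"] by (cases "mat_inverse (- B)") auto
  note C' = mat_inverse(2)[OF mBc C]
  define D where "D = adj_mat B"
  have D: "D \<in> carrier_mat p p" "D * B = Determinant.det B \<cdot>\<^sub>m 1\<^sub>m p" using adj_mat[OF Bc] by (auto simp: D_def)
  have "D = D * (- B * C)" using C' D by simp
  also have "\<dots> = D * - B * C" using D mBc C' by (intro assoc_mult_mat[symmetric, of _ p p _ p _ p]) auto
  also have "D * - B = - (Determinant.det B \<cdot>\<^sub>m 1\<^sub>m p)" using D Bc by simp
  also have "- (Determinant.det B \<cdot>\<^sub>m 1\<^sub>m p) * C = - (Determinant.det B \<cdot>\<^sub>m C)"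
  proof -
    have "- (Determinant.det B \<cdot>\<^sub>m 1\<^sub>m p) * C = - (Determinant.det B \<cdot>\<^sub>m 1\<^sub>m p * C)" using C' by auto
    also have "Determinant.det B \<cdot>\<^sub>m 1\<^sub>m p * C = Determinant.det B \<cdot>\<^sub>m C"
      using C' left_mult_one_mat[of C p p] by (simp add: mult_smult_assoc_mat[of _ p p _ p])
    finally show ?thesis .
  qed
  finally have DC: "D = - (Determinant.det B \<cdot>\<^sub>m C)" .
  have "(\<Sum>i<p. D $$ (i, i)) = - Determinant.det B * mat_trace C"
    unfolding DC using C' by (auto simp: mat_trace_def sum_distrib_left sum_negf)
  moreover have "(\<Sum>i<p. D $$ (i, i)) = poly (pderiv (char_poly A)) z"
  proof -
    have "D $$ (i, i) = poly (char_poly (mat_delete A i i)) z" if i: "i < p" for i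
    proof -
      have m: "mat_delete A i i \<in> carrier_mat (p - 1) (p - 1)" using A mat_delete_carrier by blast
      have "mat_delete B i i = z \<cdot>\<^sub>m 1\<^sub>m (p - 1) - mat_delete A i i"
        using A i by (intro eq_matI) (auto simp: B_def mat_delete_def)
      then show ?thesis unfolding poly_char_poly[OF m] D_def adj_mat_def using i Bc
        by (simp add: cofactor_def)
    qed
    then show ?thesis unfolding pderiv_char_poly[OF A] by (simp add: poly_sum)
  qed
  ultimately have "- Determinant.det B * mat_trace C = Determinant.det B * (\<Sum>a\<leftarrow>as. 1 / (z - a))"
    using poly_pderiv_prod_linear[OF z] poly_char_poly[OF A, of z] by (simp add: cp B_def)
  then have "mat_trace C = - (\<Sum>a\<leftarrow>as. 1 / (z - a))" using dB
    by (metis minus_mult_left minus_mult_right mult_left_cancel minus_minus)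
  also have "\<dots> = (\<Sum>a\<leftarrow>as. 1 / (a - z))"
    by (induction as) (auto simp: minus_divide_right)
  finally show ?thesis unfolding AB C by simp
qed

text \<open>Rayleigh quotient: pairing A v with the conjugate of v gives a |v|^2 on one side and the
  average of the |x_j . v|^2 on the other. Complex eigenvectors have to be considered because at
  this point the eigenvalue is not known to be real.\<close>

lemma real_gram_eigenvalue:
  assumes xc: "\<And>j. j \<in> I \<Longrightarrow> x j \<in> carrier_vec p" and fin: "finite I"
    and ev: "eigenvalue (map_mat complex_of_real (reg_gram p n I x 0)) a"
  shows "a \<in> complex_of_real ` {0..}"
proof -
  let ?A = "map_mat complex_of_real (reg_gram p n I x 0)"
  have A: "?A \<in> carrier_mat p p" by simp
  obtain v where v: "v \<in> carrier_vec p" "v \<noteq> 0\<^sub>v p" "?A *\<^sub>v v = a \<cdot>\<^sub>v v"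
    using ev unfolding eigenvalue_def eigenvector_def by (auto simp: reg_gram_def)
  define N where "N = (\<Sum>i<p. (cmod (v $ i))\<^sup>2)"
  define Q where "Q = (\<Sum>j\<in>I. (cmod (\<Sum>b<p. complex_of_real (x j $ b) * v $ b))\<^sup>2) / real n"
  have "(\<Sum>i<p. cnj (v $ i) * (?A *\<^sub>v v) $ i) = a * complex_of_real N"
    unfolding v(3) using v(1) by (simp add: N_def sum_distrib_left complex_norm_square mult_ac del: of_real_power)
  moreover have "(\<Sum>i<p. cnj (v $ i) * (?A *\<^sub>v v) $ i) = complex_of_real Q"
  proof -
    have "(\<Sum>i<p. cnj (v $ i) * (?A *\<^sub>v v) $ i)
      = (\<Sum>i<p. cnj (v $ i) * (\<Sum>b<p. complex_of_real ((\<Sum>j\<in>I. x j $ i * x j $ b) / real n) * v $ b))"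
      by (intro sum.cong refl) (use v(1) in \<open>simp add: scalar_prod_def lessThan_atLeast0 reg_gram_def\<close>)
    also have "\<dots> = (\<Sum>i<p. \<Sum>b<p. \<Sum>j\<in>I. cnj (complex_of_real (x j $ i) * v $ i) * (complex_of_real (x j $ b) * v $ b)) / of_nat n"
      by (simp add: sum_distrib_left sum_distrib_right sum_divide_distrib mult_ac)
    also have "(\<Sum>i<p. \<Sum>b<p. \<Sum>j\<in>I. cnj (complex_of_real (x j $ i) * v $ i) * (complex_of_real (x j $ b) * v $ b))
      = (\<Sum>j\<in>I. \<Sum>i<p. \<Sum>b<p. cnj (complex_of_real (x j $ i) * v $ i) * (complex_of_real (x j $ b) * v $ b))"
      by (subst sum.swap[of _ I], subst sum.swap[of _ I], rule refl)
    also have "\<dots> = (\<Sum>j\<in>I. cnj (\<Sum>b<p. complex_of_real (x j $ b) * v $ b) * (\<Sum>b<p. complex_of_real (x j $ b) * v $ b))"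
      by (simp add: sum_product cnj_sum)
    also have "\<dots> = complex_of_real (\<Sum>j\<in>I. (cmod (\<Sum>b<p. complex_of_real (x j $ b) * v $ b))\<^sup>2)"
      by (simp only: of_real_sum complex_norm_square mult.commute)
    finally show ?thesis by (simp add: Q_def)
  qed
  ultimately have aN: "a * complex_of_real N = complex_of_real Q" by simp
  have "N > 0"
  proof -
    obtain i where "i < p" "v $ i \<noteq> 0" using v by (metis eq_vecI carrier_vecD index_zero_vec(1) index_zero_vec(2))
    then show ?thesis unfolding N_def by (intro sum_pos2[of _ i]) auto
  qed
  then have "a = complex_of_real (Q / N)" using aN by (simp add: field_simps)
  moreover have "Q / N \<ge> 0" using \<open>N > 0\<close> by (auto simp: Q_def intro!: divide_nonneg_nonneg sum_nonneg)
  ultimately show ?thesis by (auto simp only: atLeast_iff intro: image_eqI)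
qed

lemma data_mat_gram:
  assumes xc: "\<And>j. j \<in> {1..n} \<Longrightarrow> x j \<in> carrier_vec p"
  shows "(1 / real n) \<cdot>\<^sub>m (data_mat p n x * transpose_mat (data_mat p n x)) = reg_gram p n {1..n} x 0"
proof (rule eq_matI)
  fix a b assume "a < dim_row (reg_gram p n {1..n} x 0)" "b < dim_col (reg_gram p n {1..n} x 0)"
  then have ab: "a < p" "b < p" by (auto simp: reg_gram_def)
  have e: "data_mat p n x $$ (c, i) = x (Suc i) $ c" if "c < p" "i < n" for c i
    using that by (simp add: data_mat_def mat_of_cols_index del: upt_Suc)
  have d: "data_mat p n x \<in> carrier_mat p n" by (simp add: data_mat_def mat_of_cols_def del: upt_Suc)
  have "(data_mat p n x * transpose_mat (data_mat p n x)) $$ (a, b) = (\<Sum>i<n. x (Suc i) $ a * x (Suc i) $ b)"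
    using d ab by (simp add: scalar_prod_def lessThan_atLeast0 e)
  also have "\<dots> = (\<Sum>j\<in>{1..n}. x j $ a * x j $ b)"
    by (rule sum.reindex_bij_witness[of _ "\<lambda>j. j - 1" Suc]) auto
  finally show "((1 / real n) \<cdot>\<^sub>m (data_mat p n x * transpose_mat (data_mat p n x))) $$ (a, b) = reg_gram p n {1..n} x 0 $$ (a, b)"
    using ab d by (simp add: reg_gram_def del: index_mult_mat(1))
qed (auto simp: reg_gram_def data_mat_def mat_of_cols_def)

text \<open>One list of eigenvalues represents both the log-determinants and the resolvent trace.
  These two formulas are all that the limit argument uses; matrices no longer occur in it.\<close>

lemma gram_spectrum:
  assumes xc: "\<And>j. j \<in> {1..n} \<Longrightarrow> x j \<in> carrier_vec p"
  obtains es :: "real list" where "length es = p" "\<And>e. e \<in> set es \<Longrightarrow> 0 \<le> e"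
    "\<And>\<nu>. \<nu> > 0 \<Longrightarrow> ln (Determinant.det (reg_gram p n {1..n} x \<nu>)) = (\<Sum>e\<leftarrow>es. ln (e + \<nu>))"
    "\<And>z. z \<notin> complex_of_real ` {0..} \<Longrightarrow> resolvent_trace p n x z = (\<Sum>e\<leftarrow>es. 1 / (complex_of_real e - z)) / of_nat p"
proof -
  let ?G = "reg_gram p n {1..n} x"
  let ?A = "map_mat complex_of_real (?G 0)"
  have A: "?A \<in> carrier_mat p p" by simp
  obtain as where as: "char_poly ?A = (\<Prod>a\<leftarrow>as. [:- a, 1:])" "length as = p" using char_poly_factorized[OF A] by blast
  have pos: "a \<in> complex_of_real ` {0..}" if "a \<in> set as" for a
  proof -
    have "poly (char_poly ?A) a = 0" unfolding as(1) poly_prod_linear using that by (auto simp: prod_list_zero_iff)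
    then have "eigenvalue ?A a" using eigenvalue_root_char_poly[OF A] by simp
    then show ?thesis using real_gram_eigenvalue[of "{1..n}" x p n a] xc by auto
  qed
  define es where "es = map Re as"
  have as_es: "as = map complex_of_real es"
    using pos by (auto simp: es_def intro!: nth_equalityI) (metis (no_types, lifting) Re_complex_of_real image_iff nth_mem)
  have nn: "0 \<le> e" if "e \<in> set es" for e using that by (auto simp: es_def dest!: pos)
  have l: "length es = p" using as by (simp add: es_def)
  have "ln (Determinant.det (?G \<nu>)) = (\<Sum>e\<leftarrow>es. ln (e + \<nu>))" if nu: "\<nu> > 0" for \<nu>
  proof -
    have "complex_of_real (Determinant.det (?G \<nu>)) = Determinant.det (map_mat complex_of_real (?G \<nu>))"
      by (simp add: of_real_hom.hom_det)
    also have "map_mat complex_of_real (?G \<nu>) = (-1) \<cdot>\<^sub>m ((- complex_of_real \<nu>) \<cdot>\<^sub>m 1\<^sub>m p - ?A)"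
      by (intro eq_matI) (auto simp: reg_gram_def)
    also have "Determinant.det \<dots> = (-1) ^ p * poly (char_poly ?A) (- complex_of_real \<nu>)"
      unfolding poly_char_poly[OF A] by (simp add: det_smult) (simp add: reg_gram_def)
    also have "\<dots> = (-1) ^ p * (\<Prod>e\<leftarrow>es. - complex_of_real (e + \<nu>))"
      proof -
      have "poly (char_poly ?A) (- complex_of_real \<nu>) = (\<Prod>a\<leftarrow>as. - complex_of_real \<nu> - a)"
        unfolding as(1) poly_prod_linear ..
      also have "\<dots> = (\<Prod>e\<leftarrow>es. - complex_of_real (e + \<nu>))"
        unfolding as_es map_map comp_def by (intro arg_cong[of _ _ prod_list] map_cong refl) simp
      finally show ?thesis by (simp only:)
    qed
    also have "\<dots> = complex_of_real (\<Prod>e\<leftarrow>es. e + \<nu>)"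
      unfolding l[symmetric]
    proof (induction es)
      case (Cons e es)
      then show ?case by (simp add: Cons.IH[symmetric] algebra_simps)
    qed simp
    finally have "Determinant.det (?G \<nu>) = (\<Prod>e\<leftarrow>es. e + \<nu>)" by (simp only: of_real_eq_iff)
    moreover have "ln (\<Prod>e\<leftarrow>es. e + \<nu>) = (\<Sum>e\<leftarrow>es. ln (e + \<nu>)) \<and> (\<Prod>e\<leftarrow>es. e + \<nu>) > 0"
      using nn by (induction es) (auto simp: ln_mult_pos nu add_nonneg_pos)
    ultimately show ?thesis by simp
  qed
  moreover have "resolvent_trace p n x z = (\<Sum>e\<leftarrow>es. 1 / (complex_of_real e - z)) / of_nat p" if z: "z \<notin> complex_of_real ` {0..}" for z
  proof -
    have "z \<notin> set as" using pos z by blast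
    then have "mat_trace (the (mat_inverse (?A - z \<cdot>\<^sub>m 1\<^sub>m p))) = (\<Sum>a\<leftarrow>as. 1 / (a - z))"
      by (rule trace_inverse_eigenvalues[OF A as(1)])
    also have "\<dots> = (\<Sum>e\<leftarrow>es. 1 / (complex_of_real e - z))" unfolding as_es map_map comp_def ..
    finally have tr: "mat_trace (the (mat_inverse (?A - z \<cdot>\<^sub>m 1\<^sub>m p))) = (\<Sum>e\<leftarrow>es. 1 / (complex_of_real e - z))" .
    have "(1 / real n) \<cdot>\<^sub>m (data_mat p n x * transpose_mat (data_mat p n x)) = ?G 0"
      by (rule data_mat_gram) (rule xc)
    then show ?thesis unfolding resolvent_trace_def Let_def by (simp only: tr)
  qed
  ultimately show ?thesis using that[OF l nn] by blast
qed

text \<open>From x - x^2 <= ln (1 + x) <= x with x = h / (e + q). The error is uniform in the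
  eigenvalue \<open>e\<close>, so differences of log-determinants with a small step approximate the
  Stieltjes transform at -q uniformly over all spectra.\<close>

lemma ln_difference_quotient:
  assumes "e \<ge> 0" "q > 0" "h > (0::real)"
  shows "\<bar>1 / (e + q) - (ln (e + q + h) - ln (e + q)) / h\<bar> \<le> h / q\<^sup>2"
proof -
  define s where "s = e + q"
  have s: "s \<ge> q" "s > 0" using assms by (auto simp: s_def)
  have "ln (s + h) - ln s = ln ((s + h) / s)" using s assms by (simp add: ln_divide_pos)
  then have r: "ln (s + h) - ln s = ln (1 + h / s)" using s by (simp add: add_divide_distrib)
  have up: "ln (1 + h / s) \<le> h / s" using s assms by (intro ln_add_one_self_le_self) auto
  have lo: "h / s - (h / s)\<^sup>2 \<le> ln (1 + h / s)"
  proof (cases "h / s \<le> 1")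
    case True then show ?thesis using s assms by (intro ln_one_plus_pos_lower_bound) auto
  next
    case False
    then have "h / s * 1 \<le> h / s * (h / s)" by (intro mult_left_mono) auto
    moreover have "0 \<le> ln (1 + h / s)" using s assms by simp
    ultimately show ?thesis by (simp add: power2_eq_square)
  qed
  have "\<bar>1 / s - ln (1 + h / s) / h\<bar> = \<bar>(h / s - ln (1 + h / s)) / h\<bar>" using assms s by (simp add: diff_divide_distrib)
  also have "\<dots> = (h / s - ln (1 + h / s)) / h" using up assms by simp
  also have "\<dots> \<le> (h / s)\<^sup>2 / h" using lo assms by (intro divide_right_mono) auto
  also have "\<dots> = h / s\<^sup>2" using assms by (simp add: power2_eq_square)
  also have "\<dots> \<le> h / q\<^sup>2" using s assms by (intro divide_left_mono power_mono mult_pos_pos zero_less_power) auto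
  finally show ?thesis unfolding s_def[symmetric] r .
qed

lemma sum_list_bound:
  fixes f :: "real \<Rightarrow> 'b::real_normed_vector"
  assumes "\<And>e. e \<in> set es \<Longrightarrow> norm (f e) \<le> C"
  shows "norm (\<Sum>e\<leftarrow>es. f e) \<le> real (length es) * C"
  using assms
proof (induction es)
  case (Cons e es)
  have "norm (f e + (\<Sum>e\<leftarrow>es. f e)) \<le> C + real (length es) * C"
    using Cons by (intro norm_triangle_mono) auto
  then show ?case by (simp add: algebra_simps)
qed simp

text \<open>The functions \<open>F n\<close> are holomorphic off the half line [0, \<infinity>) and
  at distance d from it bounded by 2 / d, independently of \<open>n\<close>. If convergence failed
  at z, a subsequence staying away from 0 there would have a further subsequence with a holomorphic
  limit; this limit vanishes at the points -q k, which accumulate inside the domain, and hence at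
  z.\<close>

lemma stieltjes_convergence:
  fixes p :: "nat \<Rightarrow> nat" and as bs :: "nat \<Rightarrow> real list"
  assumes len: "\<And>n. n \<ge> 1 \<Longrightarrow> length (as n) = p n \<and> length (bs n) = p n"
    and nn: "\<And>n e. n \<ge> 1 \<Longrightarrow> e \<in> set (as n) \<union> set (bs n) \<Longrightarrow> 0 \<le> e" and p: "\<And>n. n \<ge> 1 \<Longrightarrow> p n \<ge> 1"
    and conv: "\<And>k l. (\<lambda>n. ((\<Sum>e\<leftarrow>as n. ln (e + (1 + 1 / real (Suc k)) + 1 / real (Suc l)) - ln (e + (1 + 1 / real (Suc k))))
        - (\<Sum>e\<leftarrow>bs n. ln (e + (1 + 1 / real (Suc k)) + 1 / real (Suc l)) - ln (e + (1 + 1 / real (Suc k))))) / real (p n)) \<longlonglongrightarrow> 0"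
    and z: "z \<notin> complex_of_real ` {0..}"
  shows "(\<lambda>n. (\<Sum>e\<leftarrow>as n. 1 / (complex_of_real e - z)) / of_nat (p n) - (\<Sum>e\<leftarrow>bs n. 1 / (complex_of_real e - z)) / of_nat (p n)) \<longlonglongrightarrow> 0"
proof -
  define T where "T = complex_of_real ` {0..}"
  \<comment> \<open>The shift to \<open>Suc n\<close> removes the index 0, to which the hypotheses
    do not apply.\<close>
  define F where "F n w = (\<Sum>e\<leftarrow>as (Suc n). 1 / (complex_of_real e - w)) / of_nat (p (Suc n)) - (\<Sum>e\<leftarrow>bs (Suc n). 1 / (complex_of_real e - w)) / of_nat (p (Suc n))" for n w
  have "T = \<real>\<^sub>\<ge>\<^sub>0" by (auto simp: T_def nonneg_Reals_def)
  then have T: "closed T" by simp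
  have opS: "open (- T)" using T by (simp add: open_Compl)
  have conS: "connected (- T)" unfolding T_def by (intro starlike_imp_connected starlike_slotted_complex_plane_right)
  have hol1: "(\<lambda>w. \<Sum>e\<leftarrow>es. 1 / (complex_of_real e - w)) holomorphic_on (- T)" if "\<And>e. e \<in> set es \<Longrightarrow> 0 \<le> e" for es
    using that
  proof (induction es)
    case (Cons e es)
    have "complex_of_real e - w \<noteq> 0" if "w \<in> - T" for w using that Cons.prems[of e] by (auto simp: T_def)
    then show ?case using Cons by (auto intro!: holomorphic_intros)
  qed auto
  have holF: "F n holomorphic_on (- T)" for n
    unfolding F_def using nn[of "Suc n"] p[of "Suc n"] by (intro holomorphic_intros hol1) auto
  have bF: "norm (F n w) \<le> 2 / d" if d: "d > 0" "\<And>y. y \<in> T \<Longrightarrow> d \<le> dist w y" for n w d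
  proof -
    have b: "norm ((\<Sum>e\<leftarrow>es. 1 / (complex_of_real e - w)) / of_nat (p (Suc n))) \<le> 1 / d"
      if es: "length es = p (Suc n)" "\<And>e. e \<in> set es \<Longrightarrow> 0 \<le> e" for es
    proof -
      have "norm (\<Sum>e\<leftarrow>es. 1 / (complex_of_real e - w)) \<le> real (length es) * (1 / d)"
      proof (rule sum_list_bound)
        fix e assume "e \<in> set es"
        then have "d \<le> norm (complex_of_real e - w)"
          using d(2)[of "complex_of_real e"] es(2) by (auto simp: T_def dist_norm norm_minus_commute)
        then show "norm (1 / (complex_of_real e - w)) \<le> 1 / d" using \<open>d > 0\<close> by (simp add: norm_divide divide_left_mono mult_pos_pos frac_le)
      qed
      then show ?thesis using p[of "Suc n"] es(1) by (simp add: norm_divide field_simps)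
    qed
    have "norm (F n w) \<le> 1 / d + 1 / d"
      unfolding F_def using len[of "Suc n"] nn[of "Suc n"] by (intro order_trans[OF norm_triangle_ineq4] add_mono b) auto
    then show ?thesis by simp
  qed
  \<comment> \<open>The points -q k tend to -1 without reaching it. The limit -1 lies in the slit
    plane, as the identity theorem demands.\<close>
  define q where "q k = 1 + 1 / real (Suc k)" for k
  have q1: "q k \<ge> 1" for k by (simp add: q_def)
  have zero: "(\<lambda>n. F n (- complex_of_real (q k))) \<longlonglongrightarrow> 0" for k
  proof -
    define R where "R es = (\<Sum>e\<leftarrow>es. 1 / (e + q k))" for es
    define L where "L l es = (\<Sum>e\<leftarrow>es. ln (e + q k + 1 / real (Suc l)) - ln (e + q k))" for l es
    have RL: "\<bar>R es - real (Suc l) * L l es\<bar> \<le> real (length es) * (1 / real (Suc l))" if "\<And>e. e \<in> set es \<Longrightarrow> 0 \<le> e" for es l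
    proof -
      have "R es - real (Suc l) * L l es = (\<Sum>e\<leftarrow>es. 1 / (e + q k) - (ln (e + q k + 1 / real (Suc l)) - ln (e + q k)) / (1 / real (Suc l)))"
        unfolding R_def L_def by (induction es) (auto simp: algebra_simps)
      moreover have "norm (\<Sum>e\<leftarrow>es. 1 / (e + q k) - (ln (e + q k + 1 / real (Suc l)) - ln (e + q k)) / (1 / real (Suc l))) \<le> real (length es) * (1 / real (Suc l))"
      proof (rule sum_list_bound)
        fix e assume "e \<in> set es"
        have "norm (1 / (e + q k) - (ln (e + q k + 1 / real (Suc l)) - ln (e + q k)) / (1 / real (Suc l))) \<le> (1 / real (Suc l)) / (q k)\<^sup>2"
          using ln_difference_quotient[of e "q k" "1 / real (Suc l)"] that[OF \<open>e \<in> set es\<close>] q1[of k] by simp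
        also have "\<dots> \<le> (1 / real (Suc l)) / 1\<^sup>2" using q1[of k] by (intro divide_left_mono power_mono) auto
        finally show "norm (1 / (e + q k) - (ln (e + q k + 1 / real (Suc l)) - ln (e + q k)) / (1 / real (Suc l))) \<le> 1 / real (Suc l)" by simp
      qed
      ultimately show ?thesis by simp
    qed
    have FR: "F n (- complex_of_real (q k)) = complex_of_real ((R (as (Suc n)) - R (bs (Suc n))) / real (p (Suc n)))" for n
    proof -
      have "(\<Sum>e\<leftarrow>es. 1 / (complex_of_real e - (- complex_of_real (q k)))) = complex_of_real (R es)" for es
        unfolding R_def by (induction es) auto
      then show ?thesis by (simp add: F_def diff_divide_distrib)
    qed
    have "(\<lambda>n. (R (as (Suc n)) - R (bs (Suc n))) / real (p (Suc n))) \<longlonglongrightarrow> 0"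
    proof (rule LIMSEQ_I)
      fix r :: real assume r: "r > 0"
      \<comment> \<open>The step 1 / (l + 1) is fixed first: each of the two difference quotients
        then costs less than r / 4 per eigenvalue. Only afterwards \<open>N\<close> is chosen, so
        that the log-determinants, magnified by l + 1, contribute less than r / 2.\<close>
      obtain l where l: "1 / real (Suc l) < r / 4" using reals_Archimedean[of "r / 4"] r by (auto simp: inverse_eq_divide)
      have c: "(\<lambda>n. (L l (as (Suc n)) - L l (bs (Suc n))) / real (p (Suc n))) \<longlonglongrightarrow> 0"
        using LIMSEQ_Suc[OF conv[of k l]] by (simp add: L_def q_def)
      have "r / (2 * real (Suc l)) > 0" using r by simp
      then obtain N where N: "\<And>n. n \<ge> N \<Longrightarrow> norm ((L l (as (Suc n)) - L l (bs (Suc n))) / real (p (Suc n)) - 0) < r / (2 * real (Suc l))"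
        using LIMSEQ_D[OF c] by blast
      show "\<exists>N. \<forall>n\<ge>N. norm ((R (as (Suc n)) - R (bs (Suc n))) / real (p (Suc n)) - 0) < r"
      proof (intro exI allI impI)
        fix n assume "n \<ge> N"
        define P where "P = real (p (Suc n))"
        have P: "P \<ge> 1" using p[of "Suc n"] by (simp add: P_def)
        define ra rb la lb where "ra = R (as (Suc n))" and "rb = R (bs (Suc n))" and "la = L l (as (Suc n))" and "lb = L l (bs (Suc n))"
        have "\<bar>ra - real (Suc l) * la\<bar> \<le> P * (1 / real (Suc l))" "\<bar>rb - real (Suc l) * lb\<bar> \<le> P * (1 / real (Suc l))"
          using RL[of "as (Suc n)" l] RL[of "bs (Suc n)" l] len[of "Suc n"] nn[of "Suc n"] by (auto simp: P_def ra_def rb_def la_def lb_def)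
        moreover have "P * (1 / real (Suc l)) \<le> P * (r / 4)" using l P by (intro mult_left_mono) auto
        moreover have lalb: "\<bar>la - lb\<bar> < P * (r / (2 * real (Suc l)))"
          using N[OF \<open>n \<ge> N\<close>] P by (simp add: P_def la_def lb_def abs_divide pos_divide_less_eq mult.commute)
        moreover have "\<bar>real (Suc l) * la - real (Suc l) * lb\<bar> < P * (r / 2)"
        proof -
          have "real (Suc l) * \<bar>la - lb\<bar> < real (Suc l) * (P * (r / (2 * real (Suc l))))"
            using lalb by (intro mult_strict_left_mono) auto
          also have "\<dots> = P * (r / 2)" by (simp add: field_simps)
          finally show ?thesis by (simp only: right_diff_distrib[symmetric] abs_mult abs_of_nat)
        qed
        ultimately have "\<bar>ra - rb\<bar> < P * (r / 4) + P * (r / 4) + P * (r / 2)" by linarith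
        then have "\<bar>ra - rb\<bar> < P * r" by (simp add: algebra_simps)
        then show "norm ((R (as (Suc n)) - R (bs (Suc n))) / real (p (Suc n)) - 0) < r"
          using P by (simp add: P_def ra_def rb_def abs_divide pos_divide_less_eq mult.commute)
      qed
    qed
    then have "(\<lambda>n. complex_of_real ((R (as (Suc n)) - R (bs (Suc n))) / real (p (Suc n)))) \<longlonglongrightarrow> complex_of_real 0"
      by (rule tendsto_of_real)
    then show ?thesis unfolding FR by (simp only: of_real_0)
  qed
  have zS: "z \<in> - T" using z by (simp add: T_def)
  have "(\<lambda>n. F n z) \<longlonglongrightarrow> 0"
  proof (rule ccontr)
    assume "\<not> (\<lambda>n. F n z) \<longlonglongrightarrow> 0"
    then obtain r where r: "r > 0" "\<And>N. \<exists>n\<ge>N. norm (F n z) \<ge> r"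
      unfolding LIMSEQ_iff by (auto simp: not_less)
    then have "infinite {n. norm (F n z) \<ge> r}" unfolding infinite_nat_iff_unbounded_le by auto
    then obtain s :: "nat \<Rightarrow> nat" where s: "strict_mono s" "\<And>n. norm (F (s n) z) \<ge> r"
      using infinite_enumerate[of "{n. norm (F n z) \<ge> r}"] by auto
    have bdd: "\<exists>B. \<forall>h \<in> range F. \<forall> w \<in> K. norm (h w) \<le> B" if K: "compact K" "K \<subseteq> - T" for K
    proof -
      obtain d where d: "d > 0" "\<forall>x\<in>K. \<forall>y\<in>T. d \<le> dist x y"
        using separate_compact_closed[OF K(1) T] K(2) by auto
      then show ?thesis using bF[OF d(1)] by blast
    qed
    have hh: "h holomorphic_on (- T)" if "h \<in> range F" for h using that holF by auto
    have rr: "range (\<lambda>n. F (s n)) \<subseteq> range F" by auto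
    obtain g t where g: "g holomorphic_on (- T)" "strict_mono (t :: nat \<Rightarrow> nat)"
      "\<And>x. x \<in> - T \<Longrightarrow> ((\<lambda>n. F (s (t n)) x) \<longlongrightarrow> g x) sequentially"
      using Montel[OF opS hh bdd rr] by metis
    have st: "strict_mono (\<lambda>n. s (t n))" using s(1) g(2) by (simp add: strict_mono_def)
    have qS: "- complex_of_real (q k) \<in> - T" for k
    proof -
      have "Re w \<ge> 0" if "w \<in> T" for w using that by (auto simp: T_def)
      from this[of "- complex_of_real (q k)"] q1[of k] show ?thesis by auto
    qed
    have g0: "g (- complex_of_real (q k)) = 0" for k
      using LIMSEQ_subseq_LIMSEQ[OF zero[of k] st] g(3)[OF qS] LIMSEQ_unique by (fastforce simp: comp_def)
    have "g z = 0"
    proof (rule analytic_continuation[OF g(1) opS conS, of "range (\<lambda>k. - complex_of_real (q k))" "-1"])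
      show "range (\<lambda>k. - complex_of_real (q k)) \<subseteq> - T" using qS by auto
      have "Re w \<ge> 0" if "w \<in> T" for w using that by (auto simp: T_def)
      from this[of "-1"] show "-1 \<in> - T" by auto
      show "-1 islimpt range (\<lambda>k. - complex_of_real (q k))"
        unfolding islimpt_approachable
      proof (intro allI impI)
        fix e :: real assume "e > 0"
        then obtain k where k: "1 / real (Suc k) < e" using reals_Archimedean by (auto simp: inverse_eq_divide)
        have "- complex_of_real (q k) - (- 1) = complex_of_real (- (1 / real (Suc k)))" by (simp add: q_def)
        then have "dist (- complex_of_real (q k)) (-1) = 1 / real (Suc k)" unfolding dist_norm by (simp only: norm_of_real) simp
        moreover from this have "- complex_of_real (q k) \<noteq> -1" by auto
        ultimately show "\<exists>x'\<in>range (\<lambda>k. - complex_of_real (q k)). x' \<noteq> - 1 \<and> dist x' (- 1) < e" using k by auto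
      qed
    qed (use g0 zS in auto)
    moreover have "norm (g z) \<ge> r"
      by (rule Lim_bounded2[OF tendsto_norm[OF g(3)[OF zS]]]) (use s(2) in auto)
    ultimately show False using r(1) by simp
  qed
  then show ?thesis unfolding F_def by (rule LIMSEQ_imp_Suc)
qed

lemma resolvent_trace_convergence:
  fixes x y :: "nat \<Rightarrow> nat \<Rightarrow> real Matrix.vec"
  assumes p: "\<And>n. n \<ge> 1 \<Longrightarrow> p n \<ge> 1"
    and xc: "\<And>n j. n \<ge> 1 \<Longrightarrow> j \<in> {1..n} \<Longrightarrow> x n j \<in> carrier_vec (p n) \<and> y n j \<in> carrier_vec (p n)"
    and conv: "\<And>k l. (\<lambda>n. (logdet_ratio (p n) n (1 + 1 / real (Suc k)) (1 + 1 / real (Suc k) + 1 / real (Suc l)) {1..n} (x n)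
       - logdet_ratio (p n) n (1 + 1 / real (Suc k)) (1 + 1 / real (Suc k) + 1 / real (Suc l)) {1..n} (y n)) / real (p n)) \<longlonglongrightarrow> 0"
    and z: "z \<notin> complex_of_real ` {0..}"
  shows "(\<lambda>n. resolvent_trace (p n) n (x n) z - resolvent_trace (p n) n (y n) z) \<longlonglongrightarrow> 0"
proof -
  have "\<exists>es. n \<ge> 1 \<longrightarrow> length es = p n \<and> (\<forall>e\<in>set es. 0 \<le> e) \<and>
      (\<forall>\<nu>>0. ln (Determinant.det (reg_gram (p n) n {1..n} (u n) \<nu>)) = (\<Sum>e\<leftarrow>es. ln (e + \<nu>))) \<and>
      resolvent_trace (p n) n (u n) z = (\<Sum>e\<leftarrow>es. 1 / (complex_of_real e - z)) / of_nat (p n)"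
    if uc: "\<And>n j. n \<ge> 1 \<Longrightarrow> j \<in> {1..n} \<Longrightarrow> u n j \<in> carrier_vec (p n)" for u n
  proof (cases "n \<ge> 1")
    case True
    obtain es :: "real list" where "length es = p n" "\<And>e. e \<in> set es \<Longrightarrow> 0 \<le> e"
      "\<And>\<nu>. \<nu> > 0 \<Longrightarrow> ln (Determinant.det (reg_gram (p n) n {1..n} (u n) \<nu>)) = (\<Sum>e\<leftarrow>es. ln (e + \<nu>))"
      "\<And>z. z \<notin> complex_of_real ` {0..} \<Longrightarrow> resolvent_trace (p n) n (u n) z = (\<Sum>e\<leftarrow>es. 1 / (complex_of_real e - z)) / of_nat (p n)"
      using gram_spectrum[of n "u n" "p n"] uc[OF True] by blast
    then show ?thesis using z by blast
  qed simp
  note ex = this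
  have "\<forall>n. \<exists>es. n \<ge> 1 \<longrightarrow> length es = p n \<and> (\<forall>e\<in>set es. 0 \<le> e) \<and>
      (\<forall>\<nu>>0. ln (Determinant.det (reg_gram (p n) n {1..n} (x n) \<nu>)) = (\<Sum>e\<leftarrow>es. ln (e + \<nu>))) \<and>
      resolvent_trace (p n) n (x n) z = (\<Sum>e\<leftarrow>es. 1 / (complex_of_real e - z)) / of_nat (p n)"
    by (intro allI ex) (use xc in auto)
  then obtain as where as: "\<And>n. n \<ge> 1 \<Longrightarrow> length (as n) = p n" "\<And>n e. n \<ge> 1 \<Longrightarrow> e \<in> set (as n) \<Longrightarrow> 0 \<le> (e::real)"
      "\<And>n \<nu>. n \<ge> 1 \<Longrightarrow> \<nu> > 0 \<Longrightarrow> ln (Determinant.det (reg_gram (p n) n {1..n} (x n) \<nu>)) = (\<Sum>e\<leftarrow>as n. ln (e + \<nu>))"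
      "\<And>n. n \<ge> 1 \<Longrightarrow> resolvent_trace (p n) n (x n) z = (\<Sum>e\<leftarrow>as n. 1 / (complex_of_real e - z)) / of_nat (p n)"
    by (subst (asm) choice_iff) blast
  have "\<forall>n. \<exists>es. n \<ge> 1 \<longrightarrow> length es = p n \<and> (\<forall>e\<in>set es. 0 \<le> e) \<and>
      (\<forall>\<nu>>0. ln (Determinant.det (reg_gram (p n) n {1..n} (y n) \<nu>)) = (\<Sum>e\<leftarrow>es. ln (e + \<nu>))) \<and>
      resolvent_trace (p n) n (y n) z = (\<Sum>e\<leftarrow>es. 1 / (complex_of_real e - z)) / of_nat (p n)"
    by (intro allI ex) (use xc in auto)
  then obtain bs where bs: "\<And>n. n \<ge> 1 \<Longrightarrow> length (bs n) = p n" "\<And>n e. n \<ge> 1 \<Longrightarrow> e \<in> set (bs n) \<Longrightarrow> 0 \<le> (e::real)"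
      "\<And>n \<nu>. n \<ge> 1 \<Longrightarrow> \<nu> > 0 \<Longrightarrow> ln (Determinant.det (reg_gram (p n) n {1..n} (y n) \<nu>)) = (\<Sum>e\<leftarrow>bs n. ln (e + \<nu>))"
      "\<And>n. n \<ge> 1 \<Longrightarrow> resolvent_trace (p n) n (y n) z = (\<Sum>e\<leftarrow>bs n. 1 / (complex_of_real e - z)) / of_nat (p n)"
    by (subst (asm) choice_iff) blast
  have sd: "(\<Sum>e\<leftarrow>es. f e - g e) = (\<Sum>e\<leftarrow>es. f e) - (\<Sum>e\<leftarrow>es. g e)" for es and f g :: "real \<Rightarrow> real"
    by (induction es) auto
  have "(\<lambda>n. (\<Sum>e\<leftarrow>as n. 1 / (complex_of_real e - z)) / of_nat (p n) - (\<Sum>e\<leftarrow>bs n. 1 / (complex_of_real e - z)) / of_nat (p n)) \<longlonglongrightarrow> 0"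
  proof (rule stieltjes_convergence[OF _ _ p _ z])
    show "(\<lambda>n. ((\<Sum>e\<leftarrow>as n. ln (e + (1 + 1 / real (Suc k)) + 1 / real (Suc l)) - ln (e + (1 + 1 / real (Suc k))))
        - (\<Sum>e\<leftarrow>bs n. ln (e + (1 + 1 / real (Suc k)) + 1 / real (Suc l)) - ln (e + (1 + 1 / real (Suc k))))) / real (p n)) \<longlonglongrightarrow> 0" for k l
    proof (rule Lim_transform_eventually[OF conv[of k l]])
      have q: "1 + 1 / real (Suc k) > 0" "1 + 1 / real (Suc k) + 1 / real (Suc l) > 0" by (simp_all add: add_pos_pos)
      show "\<forall>\<^sub>F n in sequentially. (logdet_ratio (p n) n (1 + 1 / real (Suc k)) (1 + 1 / real (Suc k) + 1 / real (Suc l)) {1..n} (x n)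
       - logdet_ratio (p n) n (1 + 1 / real (Suc k)) (1 + 1 / real (Suc k) + 1 / real (Suc l)) {1..n} (y n)) / real (p n)
       = ((\<Sum>e\<leftarrow>as n. ln (e + (1 + 1 / real (Suc k)) + 1 / real (Suc l)) - ln (e + (1 + 1 / real (Suc k))))
        - (\<Sum>e\<leftarrow>bs n. ln (e + (1 + 1 / real (Suc k)) + 1 / real (Suc l)) - ln (e + (1 + 1 / real (Suc k))))) / real (p n)"
        using eventually_ge_at_top[of 1]
      proof eventually_elim
        case (elim n)
        show ?case unfolding logdet_ratio_def as(3)[OF elim q(1)] as(3)[OF elim q(2)] bs(3)[OF elim q(1)] bs(3)[OF elim q(2)] sd
          by (simp add: add.assoc)
      qed
    qed
  qed (use as bs in auto)
  then show ?thesis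
  proof (rule Lim_transform_eventually)
    show "\<forall>\<^sub>F n in sequentially. (\<Sum>e\<leftarrow>as n. 1 / (complex_of_real e - z)) / of_nat (p n) - (\<Sum>e\<leftarrow>bs n. 1 / (complex_of_real e - z)) / of_nat (p n)
      = resolvent_trace (p n) n (x n) z - resolvent_trace (p n) n (y n) z"
      using eventually_ge_at_top[of 1] by eventually_elim (simp only: as(4) bs(4))
  qed
qed

section \<open>The spectral norm\<close>

lemma quadratic_entries:
  assumes "(B::real mat) \<in> carrier_mat p p" "v \<in> carrier_vec p"
  shows "v \<bullet> (B *\<^sub>v v) = (\<Sum>i<p. \<Sum>j<p. v $ i * v $ j * B $$ (i, j))"
proof -
  have "v \<bullet> (B *\<^sub>v v) = (\<Sum>i<p. v $ i * (\<Sum>j<p. B $$ (i, j) * v $ j))"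
    unfolding sprod_sum[OF assms(2) mult_mat_vec_carrier[OF assms]]
    by (intro sum.cong refl) (use assms in \<open>simp add: scalar_prod_def lessThan_atLeast0\<close>)
  then show ?thesis by (simp add: sum_distrib_left mult_ac)
qed

lemma mult_vec_square_entries:
  assumes "(B::real mat) \<in> carrier_mat p p" "(v::real Matrix.vec) \<in> carrier_vec p"
  shows "(B *\<^sub>v v) \<bullet> (B *\<^sub>v v) = (\<Sum>i<p. (\<Sum>j<p. B $$ (i, j) * v $ j)\<^sup>2)"
  unfolding sprod_sum[OF mult_mat_vec_carrier[OF assms] mult_mat_vec_carrier[OF assms]] power2_eq_square
  by (intro sum.cong refl) (use assms in \<open>simp add: scalar_prod_def lessThan_atLeast0\<close>)

lemma spectral_norm_bdd:
  assumes B: "B \<in> carrier_mat p p"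
  shows "bdd_above ((\<lambda>v. sqrt ((B *\<^sub>v v) \<bullet> (B *\<^sub>v v))) ` {v \<in> carrier_vec (dim_col B). v \<bullet> v = 1})"
proof (rule bdd_aboveI2)
  fix v :: "real Matrix.vec" assume v: "v \<in> {v \<in> carrier_vec (dim_col B). v \<bullet> v = 1}"
  then have vc: "v \<in> carrier_vec p" using B by auto
  have "(\<Sum>j<p. B $$ (i, j) * v $ j)\<^sup>2 \<le> (\<Sum>j<p. (B $$ (i, j))\<^sup>2)" for i
  proof -
    have "(\<Sum>j<p. B $$ (i, j) * v $ j)\<^sup>2 \<le> (\<Sum>j<p. (B $$ (i, j))\<^sup>2) * (\<Sum>j<p. (v $ j)\<^sup>2)" by (rule Cauchy_Schwarz_ineq_sum)
    also have "(\<Sum>j<p. (v $ j)\<^sup>2) = 1" using v vc by (simp add: sprod_sum[of _ p] power2_eq_square)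
    finally show ?thesis by simp
  qed
  then show "sqrt ((B *\<^sub>v v) \<bullet> (B *\<^sub>v v)) \<le> sqrt (\<Sum>i<p. \<Sum>j<p. (B $$ (i, j))\<^sup>2)"
    unfolding mult_vec_square_entries[OF B vc] by (intro real_sqrt_le_mono sum_mono)
qed

text \<open>Positivity of \<open>p\<close> supplies a unit vector; for p = 0 the supremum in the
  definition would run over the empty set.\<close>

lemma spectral_norm_nonneg:
  assumes B: "B \<in> carrier_mat p p" and p: "p \<ge> 1"
  shows "0 \<le> spectral_norm B"
proof -
  have "0 \<le> sqrt ((B *\<^sub>v unit_vec p 0) \<bullet> (B *\<^sub>v unit_vec p 0))" by (simp add: sprod_self_nonneg)
  also have "\<dots> \<le> spectral_norm B" unfolding spectral_norm_def
    by (rule cSUP_upper[OF _ spectral_norm_bdd[OF B]]) (use B p in auto)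
  finally show ?thesis .
qed

lemma spectral_norm_mult_vec:
  assumes B: "B \<in> carrier_mat p p" and v: "v \<in> carrier_vec p"
  shows "(B *\<^sub>v v) \<bullet> (B *\<^sub>v v) \<le> (spectral_norm B)\<^sup>2 * (v \<bullet> v)"
proof (cases "v \<bullet> v = 0")
  case True
  then have "v = 0\<^sub>v p" using sprod_self_eq_0[OF v] by simp
  then have "B *\<^sub>v v = 0\<^sub>v p" using B by (intro eq_vecI) auto
  then show ?thesis using True by simp
next
  case False
  then have pos: "v \<bullet> v > 0" using sprod_self_nonneg[of v] by simp
  define t where "t = 1 / sqrt (v \<bullet> v)"
  have t2: "t * t * (v \<bullet> v) = 1" using pos by (simp add: t_def)
  have Btv: "B *\<^sub>v (t \<cdot>\<^sub>v v) = t \<cdot>\<^sub>v (B *\<^sub>v v)" using B v by (simp add: mult_mat_vec[of _ p p])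
  have "sqrt ((B *\<^sub>v (t \<cdot>\<^sub>v v)) \<bullet> (B *\<^sub>v (t \<cdot>\<^sub>v v))) \<le> spectral_norm B"
    unfolding spectral_norm_def
    by (rule cSUP_upper[OF _ spectral_norm_bdd[OF B]]) (use B v t2 in \<open>simp add: mult.assoc\<close>)
  then have "(sqrt ((B *\<^sub>v (t \<cdot>\<^sub>v v)) \<bullet> (B *\<^sub>v (t \<cdot>\<^sub>v v))))\<^sup>2 \<le> (spectral_norm B)\<^sup>2"
    by (intro power_mono) (auto simp: sprod_self_nonneg)
  then have "(B *\<^sub>v (t \<cdot>\<^sub>v v)) \<bullet> (B *\<^sub>v (t \<cdot>\<^sub>v v)) \<le> (spectral_norm B)\<^sup>2" by (simp add: sprod_self_nonneg)
  then have le: "t * t * ((B *\<^sub>v v) \<bullet> (B *\<^sub>v v)) \<le> (spectral_norm B)\<^sup>2"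
    unfolding Btv using mult_mat_vec_carrier[OF B v] by (simp add: mult.assoc)
  have "(B *\<^sub>v v) \<bullet> (B *\<^sub>v v) = (t * t * ((B *\<^sub>v v) \<bullet> (B *\<^sub>v v))) * (v \<bullet> v)" using t2 by (simp add: mult_ac)
  also have "\<dots> \<le> (spectral_norm B)\<^sup>2 * (v \<bullet> v)" using le pos by (intro mult_right_mono) auto
  finally show ?thesis .
qed

lemma spectral_norm_quadratic:
  assumes B: "B \<in> carrier_mat p p" and v: "v \<in> carrier_vec p" and p: "p \<ge> 1"
  shows "v \<bullet> (B *\<^sub>v v) \<le> spectral_norm B * (v \<bullet> v)"
proof -
  have c: "B *\<^sub>v v \<in> carrier_vec p" by (rule mult_mat_vec_carrier[OF B v])
  have "(v \<bullet> (B *\<^sub>v v))\<^sup>2 \<le> (v \<bullet> v) * ((spectral_norm B)\<^sup>2 * (v \<bullet> v))"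
    using sprod_cauchy_schwarz[OF v c] spectral_norm_mult_vec[OF B v] sprod_self_nonneg[of v]
    by (meson mult_left_mono order_trans)
  also have "\<dots> = (spectral_norm B * (v \<bullet> v))\<^sup>2" by (simp add: power2_eq_square)
  finally show ?thesis
    by (rule power2_le_imp_le) (use spectral_norm_nonneg[OF B p] sprod_self_nonneg[of v] in auto)
qed

lemma spectral_norm_le:
  assumes B: "B \<in> carrier_mat p p" and p: "p \<ge> 1" and c: "c \<ge> 0"
    and le: "\<And>v. v \<in> carrier_vec p \<Longrightarrow> (B *\<^sub>v v) \<bullet> (B *\<^sub>v v) \<le> c\<^sup>2 * (v \<bullet> v)"
  shows "spectral_norm B \<le> c"
  unfolding spectral_norm_def
proof (rule cSUP_least)
  have "(unit_vec p 0 :: real Matrix.vec) \<in> {v \<in> carrier_vec (dim_col B). v \<bullet> v = 1}"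
    using B p scalar_prod_left_unit[of "unit_vec p 0 :: real Matrix.vec" p 0] by simp
  then show "{v :: real Matrix.vec \<in> carrier_vec (dim_col B). v \<bullet> v = 1} \<noteq> {}" by blast
  fix v :: "real Matrix.vec" assume "v \<in> {v \<in> carrier_vec (dim_col B). v \<bullet> v = 1}"
  then have "(B *\<^sub>v v) \<bullet> (B *\<^sub>v v) \<le> c\<^sup>2" using le[of v] B by auto
  then have "sqrt ((B *\<^sub>v v) \<bullet> (B *\<^sub>v v)) \<le> sqrt (c\<^sup>2)" by (rule real_sqrt_le_mono)
  then show "sqrt ((B *\<^sub>v v) \<bullet> (B *\<^sub>v v)) \<le> c" using c by simp
qed

text \<open>Vectors with rational coordinates suffice to test the operator norm.\<close>

lemma measurable_spectral_norm:
  assumes B: "B \<in> M \<rightarrow>\<^sub>M borel_mat p" and p: "p \<ge> 1"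
  shows "(\<lambda>\<omega>. spectral_norm (B \<omega>)) \<in> borel_measurable M"
  unfolding borel_measurable_iff_le
proof
  fix a :: real
  \<comment> \<open>A vector is coded by a common denominator and a list of numerators, which makes
    countability evident. Rounding the coordinates down to multiples of 1 / (k + 1) gives
    approximations inside this set.\<close>
  define Q where "Q = (\<lambda>(k, xs). Matrix.vec p (\<lambda>i. real_of_int (xs ! i) / real k)) ` (UNIV :: (nat \<times> int list) set)"
  have Qc: "countable Q" by (simp add: Q_def)
  have Bc: "B \<omega> \<in> carrier_mat p p" if "\<omega> \<in> space M" for \<omega> using measurable_borel_matD(1)[OF B that] .
  show "{\<omega> \<in> space M. spectral_norm (B \<omega>) \<le> a} \<in> sets M"
  proof (cases "a < 0")
    case True
    then have "{\<omega> \<in> space M. spectral_norm (B \<omega>) \<le> a} = {}"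
      using spectral_norm_nonneg[OF Bc p] by force
    then show ?thesis by (simp only: sets.empty_sets)
  next
    case False
    \<comment> \<open>The homogeneous form of the inequality is used because vectors with rational
      coordinates need not be normalisable within the set.\<close>
    have "(spectral_norm (B \<omega>) \<le> a) = (\<forall>v\<in>Q. (B \<omega> *\<^sub>v v) \<bullet> (B \<omega> *\<^sub>v v) \<le> a\<^sup>2 * (v \<bullet> v))" if \<omega>: "\<omega> \<in> space M" for \<omega>
    proof
      assume le: "spectral_norm (B \<omega>) \<le> a"
      show "\<forall>v\<in>Q. (B \<omega> *\<^sub>v v) \<bullet> (B \<omega> *\<^sub>v v) \<le> a\<^sup>2 * (v \<bullet> v)"
      proof
        fix v assume "v \<in> Q"
        then have v: "v \<in> carrier_vec p" by (auto simp: Q_def)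
        have "(spectral_norm (B \<omega>))\<^sup>2 * (v \<bullet> v) \<le> a\<^sup>2 * (v \<bullet> v)"
          using le spectral_norm_nonneg[OF Bc[OF \<omega>] p] by (intro mult_right_mono power_mono sprod_self_nonneg) auto
        then show "(B \<omega> *\<^sub>v v) \<bullet> (B \<omega> *\<^sub>v v) \<le> a\<^sup>2 * (v \<bullet> v)"
          using spectral_norm_mult_vec[OF Bc[OF \<omega>] v] by linarith
      qed
    next
      assume q: "\<forall>v\<in>Q. (B \<omega> *\<^sub>v v) \<bullet> (B \<omega> *\<^sub>v v) \<le> a\<^sup>2 * (v \<bullet> v)"
      show "spectral_norm (B \<omega>) \<le> a"
      proof (rule spectral_norm_le[OF Bc[OF \<omega>] p])
        fix v :: "real Matrix.vec" assume v: "v \<in> carrier_vec p"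
        define u where "u k = Matrix.vec p (\<lambda>i. real_of_int \<lfloor>real (Suc k) * v $ i\<rfloor> / real (Suc k))" for k
        have uc: "u k \<in> carrier_vec p" for k by (simp add: u_def)
        have uQ: "u k \<in> Q" for k
        proof -
          have "u k = (\<lambda>(k, xs). Matrix.vec p (\<lambda>i. real_of_int (xs ! i) / real k)) (Suc k, map (\<lambda>i. \<lfloor>real (Suc k) * v $ i\<rfloor>) [0..<p])"
            by (intro eq_vecI) (auto simp: u_def simp del: of_nat_Suc)
          then show ?thesis unfolding Q_def by blast
        qed
        have lim: "(\<lambda>k. u k $ i) \<longlonglongrightarrow> v $ i" if "i < p" for i
        proof (rule tendsto_sandwich[of "\<lambda>k. v $ i - 1 / real (Suc k)" _ _ "\<lambda>k. v $ i"])
          have f: "real_of_int \<lfloor>real (Suc k) * v $ i\<rfloor> \<le> real (Suc k) * v $ i"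
              "real (Suc k) * v $ i - 1 \<le> real_of_int \<lfloor>real (Suc k) * v $ i\<rfloor>" for k by linarith+
          show "\<forall>\<^sub>F k in sequentially. v $ i - 1 / real (Suc k) \<le> u k $ i"
          proof (intro always_eventually allI)
            fix k
            have "(real (Suc k) * v $ i - 1) / real (Suc k) \<le> u k $ i"
              using f(2)[of k] that by (simp add: u_def divide_right_mono del: of_nat_Suc)
            then show "v $ i - 1 / real (Suc k) \<le> u k $ i" by (simp add: diff_divide_distrib del: of_nat_Suc)
          qed
          show "\<forall>\<^sub>F k in sequentially. u k $ i \<le> v $ i"
          proof (intro always_eventually allI)
            fix k :: nat
            have "u k $ i \<le> (real (Suc k) * v $ i) / real (Suc k)"
              unfolding u_def index_vec[OF that] by (rule divide_right_mono[OF f(1)]) simp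
            also have "(real (Suc k) * v $ i) / real (Suc k) = v $ i" by (rule nonzero_mult_div_cancel_left) simp
            finally show "u k $ i \<le> v $ i" .
          qed
          show "(\<lambda>k. v $ i - 1 / real (Suc k)) \<longlonglongrightarrow> v $ i"
            using tendsto_diff[OF tendsto_const LIMSEQ_inverse_real_of_nat, of "v $ i"] by (simp add: inverse_eq_divide)
        qed simp
        have "(\<lambda>k. (B \<omega> *\<^sub>v u k) \<bullet> (B \<omega> *\<^sub>v u k)) \<longlonglongrightarrow> (B \<omega> *\<^sub>v v) \<bullet> (B \<omega> *\<^sub>v v)"
          unfolding mult_vec_square_entries[OF Bc[OF \<omega>] uc] mult_vec_square_entries[OF Bc[OF \<omega>] v]
          by (intro tendsto_sum tendsto_power tendsto_mult tendsto_const lim) auto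
        moreover have "(\<lambda>k. a\<^sup>2 * (u k \<bullet> u k)) \<longlonglongrightarrow> a\<^sup>2 * (v \<bullet> v)"
          unfolding sprod_sum[OF uc uc] sprod_sum[OF v v]
          by (intro tendsto_sum tendsto_mult tendsto_const lim) auto
        ultimately show "(B \<omega> *\<^sub>v v) \<bullet> (B \<omega> *\<^sub>v v) \<le> a\<^sup>2 * (v \<bullet> v)"
          by (rule LIMSEQ_le) (use q uQ in auto)
      qed (use False in auto)
    qed
    then have "{\<omega> \<in> space M. spectral_norm (B \<omega>) \<le> a} = {\<omega> \<in> space M. \<forall>v\<in>Q. (B \<omega> *\<^sub>v v) \<bullet> (B \<omega> *\<^sub>v v) \<le> a\<^sup>2 * (v \<bullet> v)}"
      by auto
    also have "\<dots> \<in> sets M"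
    proof -
      have "(\<Union>v\<in>Q. {\<omega> \<in> space M. \<not> (B \<omega> *\<^sub>v v) \<bullet> (B \<omega> *\<^sub>v v) \<le> a\<^sup>2 * (v \<bullet> v)}) \<in> sets M"
      proof (rule sets.countable_UN'[OF Qc], safe)
        fix v assume "v \<in> Q"
        then have v: "(\<lambda>_. v) \<in> M \<rightarrow>\<^sub>M borel_vec p" by (intro measurable_const) (auto simp: Q_def)
        note [measurable] = measurable_sprod[OF measurable_mult_mat_vec[OF B v] measurable_mult_mat_vec[OF B v]]
        show "{\<omega> \<in> space M. \<not> (B \<omega> *\<^sub>v v) \<bullet> (B \<omega> *\<^sub>v v) \<le> a\<^sup>2 * (v \<bullet> v)} \<in> sets M" by measurable
      qed
      moreover have "{\<omega> \<in> space M. \<forall>v\<in>Q. (B \<omega> *\<^sub>v v) \<bullet> (B \<omega> *\<^sub>v v) \<le> a\<^sup>2 * (v \<bullet> v)}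
        = space M - (\<Union>v\<in>Q. {\<omega> \<in> space M. \<not> (B \<omega> *\<^sub>v v) \<bullet> (B \<omega> *\<^sub>v v) \<le> a\<^sup>2 * (v \<bullet> v)})" by auto
      ultimately show ?thesis by simp
    qed
    finally show ?thesis .
  qed
qed

section \<open>Rank-one decompositions and traces\<close>

lemma mat_trace_mult:
  assumes "(A::real mat) \<in> carrier_mat p p" "B \<in> carrier_mat p p"
  shows "mat_trace (A * B) = (\<Sum>i<p. \<Sum>l<p. A $$ (i, l) * B $$ (l, i))"
  using assms by (auto simp: mat_trace_def mat_mult_entry[of _ p] simp del: index_mult_mat(1))

lemma mat_trace_comm:
  assumes "(A::real mat) \<in> carrier_mat p p" "B \<in> carrier_mat p p"
  shows "mat_trace (A * B) = mat_trace (B * A)"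
  unfolding mat_trace_mult[OF assms] mat_trace_mult[OF assms(2,1)]
  by (subst sum.swap) (simp add: mult.commute)

lemma sym_entry: "A \<in> carrier_mat p p \<Longrightarrow> A\<^sup>T = A \<Longrightarrow> i < p \<Longrightarrow> j < p \<Longrightarrow> A $$ (i, j) = A $$ (j, i)"
  by (metis carrier_matD index_transpose_mat(1))

text \<open>The square of the Frobenius norm, which is the form in which it enters the variance of a
  Gaussian quadratic form.\<close>

definition frobenius :: "nat \<Rightarrow> real mat \<Rightarrow> real" where
  "frobenius p A = (\<Sum>i<p. \<Sum>j<p. (A $$ (i, j))\<^sup>2)"

lemma trace_square_symmetric:
  assumes "A \<in> carrier_mat p p" "A\<^sup>T = A"
  shows "mat_trace (A * A) = frobenius p A"
  using assms sym_entry[OF assms]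
  by (auto simp: mat_trace_def frobenius_def mat_mult_entry[of _ p] power2_eq_square simp del: index_mult_mat(1) intro!: sum.cong)

context
  fixes S :: "real mat" and p :: nat
  assumes S: "S \<in> sym_psd_mats p"
begin

lemma psd_sqrt_carrier: "psd_sqrt S \<in> carrier_mat p p" "(psd_sqrt S)\<^sup>T = psd_sqrt S" "psd_sqrt S * psd_sqrt S = S"
  using psd_sqrt[OF S] sym_psd_matsD by blast+

lemma col_psd_sqrt_carrier: "i < p \<Longrightarrow> col (psd_sqrt S) i \<in> carrier_vec p"
  using psd_sqrt_carrier by auto

lemma psd_sqrt_mult_vec_square:
  assumes "t \<in> carrier_vec p"
  shows "(psd_sqrt S *\<^sub>v t) \<bullet> (psd_sqrt S *\<^sub>v t) = t \<bullet> (S *\<^sub>v t)"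
proof -
  note R = psd_sqrt_carrier
  have c: "psd_sqrt S *\<^sub>v t \<in> carrier_vec p" by (rule mult_mat_vec_carrier[OF R(1) assms])
  have "(psd_sqrt S *\<^sub>v t) \<bullet> (psd_sqrt S *\<^sub>v t) = t \<bullet> (psd_sqrt S *\<^sub>v (psd_sqrt S *\<^sub>v t))"
    by (rule sprod_symmetric_mat[OF R(1,2) c assms])
  also have "psd_sqrt S *\<^sub>v (psd_sqrt S *\<^sub>v t) = S *\<^sub>v t"
    using assoc_mult_mat_vec[OF R(1) R(1) assms] R(3) by simp
  finally show ?thesis .
qed

text \<open>As the root is symmetric, the outer products of its columns add up to S. In this way S
  is handled as a sum of rank-one terms, on the same footing as the outer product of a data
  vector.\<close>

lemma sum_col_psd_sqrt_square:
  assumes "t \<in> carrier_vec p"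
  shows "(\<Sum>i<p. (col (psd_sqrt S) i \<bullet> t)\<^sup>2) = t \<bullet> (S *\<^sub>v t)"
proof -
  note R = psd_sqrt_carrier
  have c: "psd_sqrt S *\<^sub>v t \<in> carrier_vec p" by (rule mult_mat_vec_carrier[OF R(1) assms])
  have "col (psd_sqrt S) i \<bullet> t = (psd_sqrt S *\<^sub>v t) $ i" if "i < p" for i
  proof -
    have "col (psd_sqrt S) i = row (psd_sqrt S) i"
      using R that sym_entry[OF R(1,2)] by (intro eq_vecI) auto
    then show ?thesis using R that by simp
  qed
  then have "(\<Sum>i<p. (col (psd_sqrt S) i \<bullet> t)\<^sup>2) = (psd_sqrt S *\<^sub>v t) \<bullet> (psd_sqrt S *\<^sub>v t)"
    unfolding sprod_sum[OF c c] by (intro sum.cong refl) (simp add: power2_eq_square)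
  then show ?thesis using psd_sqrt_mult_vec_square[OF assms] by simp
qed

lemma sandwich_entry:
  assumes A: "A \<in> carrier_mat p p" and ij: "i < p" "j < p"
  shows "(psd_sqrt S * A * psd_sqrt S) $$ (i, j) = col (psd_sqrt S) i \<bullet> (A *\<^sub>v col (psd_sqrt S) j)"
proof -
  note R = psd_sqrt_carrier
  have "(psd_sqrt S * A * psd_sqrt S) $$ (i, j) = unit_vec p i \<bullet> ((psd_sqrt S * A * psd_sqrt S) *\<^sub>v unit_vec p j)"
    using R(1) A ij by (subst mat_entry_sprod[of _ p]) auto
  also have "(psd_sqrt S * A * psd_sqrt S) *\<^sub>v unit_vec p j = psd_sqrt S *\<^sub>v (A *\<^sub>v (psd_sqrt S *\<^sub>v unit_vec p j))"
    using R(1) A by (simp add: assoc_mult_mat_vec[of _ p p _ p])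
  also have "psd_sqrt S *\<^sub>v unit_vec p j = col (psd_sqrt S) j" using R(1) ij by (intro eq_vecI) (auto simp: scalar_prod_right_unit[of _ p])
  also have "unit_vec p i \<bullet> (psd_sqrt S *\<^sub>v (A *\<^sub>v col (psd_sqrt S) j)) = (A *\<^sub>v col (psd_sqrt S) j) \<bullet> (psd_sqrt S *\<^sub>v unit_vec p i)"
    by (rule sprod_symmetric_mat[OF R(1,2)]) (use A R(1) ij in auto)
  also have "psd_sqrt S *\<^sub>v unit_vec p i = col (psd_sqrt S) i" using R(1) ij by (intro eq_vecI) (auto simp: scalar_prod_right_unit[of _ p])
  finally show ?thesis using A R(1) ij comm_scalar_prod[of "A *\<^sub>v col (psd_sqrt S) j" p "col (psd_sqrt S) i"]
    col_psd_sqrt_carrier[of i] col_psd_sqrt_carrier[of j] mult_mat_vec_carrier[OF A, of "col (psd_sqrt S) j"] by simp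
qed

lemma sandwich_carrier: "A \<in> carrier_mat p p \<Longrightarrow> psd_sqrt S * A * psd_sqrt S \<in> carrier_mat p p"
  using psd_sqrt_carrier by simp

lemma trace_sandwich:
  assumes A: "A \<in> carrier_mat p p"
  shows "mat_trace (psd_sqrt S * A * psd_sqrt S) = mat_trace (S * A)"
proof -
  note R = psd_sqrt_carrier
  have "mat_trace ((psd_sqrt S * A) * psd_sqrt S) = mat_trace (psd_sqrt S * (psd_sqrt S * A))"
    by (rule mat_trace_comm[of _ p]) (use R A in auto)
  also have "psd_sqrt S * (psd_sqrt S * A) = S * A"
    using assoc_mult_mat[OF R(1) R(1) A] R(3) by simp
  finally show ?thesis .
qed

lemma trace_mult_psd:
  assumes A: "A \<in> carrier_mat p p"
  shows "mat_trace (S * A) = (\<Sum>i<p. col (psd_sqrt S) i \<bullet> (A *\<^sub>v col (psd_sqrt S) i))"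
proof -
  have "mat_trace (S * A) = mat_trace (psd_sqrt S * A * psd_sqrt S)" by (rule trace_sandwich[OF A, symmetric])
  also have "\<dots> = (\<Sum>i<p. (psd_sqrt S * A * psd_sqrt S) $$ (i, i))"
    unfolding mat_trace_def carrier_matD(1)[OF sandwich_carrier[OF A]] ..
  finally show ?thesis using sandwich_entry[OF A] by simp
qed

lemma trace_psd_cols: "mat_trace S = (\<Sum>i<p. col (psd_sqrt S) i \<bullet> col (psd_sqrt S) i)"
proof -
  have "S * 1\<^sub>m p = S" by (rule right_mult_one_mat) (use sym_psd_matsD(1)[OF S] in simp)
  then show ?thesis using trace_mult_psd[of "1\<^sub>m p"] col_psd_sqrt_carrier by simp
qed

lemma quadratic_sandwich:
  assumes A: "A \<in> carrier_mat p p" and u: "u \<in> carrier_vec p"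
  shows "(psd_sqrt S *\<^sub>v u) \<bullet> (A *\<^sub>v (psd_sqrt S *\<^sub>v u)) = u \<bullet> ((psd_sqrt S * A * psd_sqrt S) *\<^sub>v u)"
proof -
  note R = psd_sqrt_carrier
  have c: "psd_sqrt S *\<^sub>v u \<in> carrier_vec p" "A *\<^sub>v (psd_sqrt S *\<^sub>v u) \<in> carrier_vec p" using R A u by auto
  have "(psd_sqrt S * A * psd_sqrt S) *\<^sub>v u = psd_sqrt S *\<^sub>v (A *\<^sub>v (psd_sqrt S *\<^sub>v u))"
    using R(1) A u by (simp add: assoc_mult_mat_vec[of _ p p _ p])
  then show ?thesis using sprod_symmetric_mat[OF R(1,2) u c(2)] comm_scalar_prod[OF c] by simp
qed

lemma sandwich_symmetric:
  assumes A: "A \<in> carrier_mat p p" "A\<^sup>T = A"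
  shows "(psd_sqrt S * A * psd_sqrt S)\<^sup>T = psd_sqrt S * A * psd_sqrt S"
proof -
  note R = psd_sqrt_carrier
  have "(psd_sqrt S * A * psd_sqrt S)\<^sup>T = (psd_sqrt S)\<^sup>T * (psd_sqrt S * A)\<^sup>T"
    by (rule transpose_mult[of _ p p _ p]) (use R A in auto)
  also have "(psd_sqrt S * A)\<^sup>T = A\<^sup>T * (psd_sqrt S)\<^sup>T" by (rule transpose_mult[OF R(1) A(1)])
  finally show ?thesis using R A by (simp add: assoc_mult_mat[of _ p p _ p _ p])
qed

text \<open>Cyclicity of the trace brings the square roots together, leaving tr (S A S A). The
  inequality a b <= (a^2 + b^2) / 2 bounds this by the squared Frobenius norm of S A, whose rows are
  A applied to the rows of S; the operator bound \<open>c\<close> then leaves the Frobenius norm of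
  S, and tr (S^2) is the quantity in (A4).\<close>

lemma frobenius_sandwich:
  assumes A: "A \<in> carrier_mat p p" "A\<^sup>T = A" and c: "\<And>v. v \<in> carrier_vec p \<Longrightarrow> (A *\<^sub>v v) \<bullet> (A *\<^sub>v v) \<le> c\<^sup>2 * (v \<bullet> v)"
  shows "frobenius p (psd_sqrt S * A * psd_sqrt S) \<le> c\<^sup>2 * mat_trace (S * S)"
proof -
  note R = psd_sqrt_carrier
  note Sc = sym_psd_matsD(1,2)[OF S]
  let ?R = "psd_sqrt S"
  have SA: "S * A \<in> carrier_mat p p" using Sc A by simp
  have "frobenius p (?R * A * ?R) = mat_trace ((?R * A * ?R) * (?R * A * ?R))"
    using trace_square_symmetric[OF sandwich_carrier[OF A(1)] sandwich_symmetric[OF A]] by simp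
  also have "(?R * A * ?R) * (?R * A * ?R) = ?R * (A * S * A * ?R)"
  proof -
    have "(Q * A * Q) * (Q * A * Q) = Q * (A * (Q * Q) * A * Q)" if "Q \<in> carrier_mat p p" for Q
      using that A by (simp add: assoc_mult_mat[of _ p p _ p _ p])
    then show ?thesis using R(1,3) by metis
  qed
  also have "mat_trace \<dots> = mat_trace (A * S * A * ?R * ?R)"
    by (rule mat_trace_comm[of _ p]) (use R A Sc in auto)
  also have "A * S * A * ?R * ?R = A * (S * A * S)"
  proof -
    have "A * S * A * Q * Q = A * (S * A * (Q * Q))" if "Q \<in> carrier_mat p p" for Q
      using that A Sc by (simp add: assoc_mult_mat[of _ p p _ p _ p])
    then show ?thesis using R(1,3) by metis
  qed
  also have "mat_trace \<dots> = mat_trace ((S * A * S) * A)"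
    by (rule mat_trace_comm[of _ p]) (use A Sc in auto)
  also have "(S * A * S) * A = (S * A) * (S * A)" using A Sc by (simp add: assoc_mult_mat[of _ p p _ p _ p])
  also have "mat_trace \<dots> = (\<Sum>i<p. \<Sum>j<p. (S * A) $$ (i, j) * (S * A) $$ (j, i))"
    by (rule mat_trace_mult[OF SA SA])
  also have "\<dots> \<le> (\<Sum>i<p. \<Sum>j<p. (((S * A) $$ (i, j))\<^sup>2 + ((S * A) $$ (j, i))\<^sup>2) / 2)"
  proof (intro sum_mono)
    have "a * b \<le> (a\<^sup>2 + b\<^sup>2) / 2" for a b :: real using sum_squares_bound[of a b] by simp
    then show "(S * A) $$ (i, j) * (S * A) $$ (j, i) \<le> (((S * A) $$ (i, j))\<^sup>2 + ((S * A) $$ (j, i))\<^sup>2) / 2" for i j .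
  qed
  also have "\<dots> = (frobenius p (S * A) + (\<Sum>i<p. \<Sum>j<p. ((S * A) $$ (j, i))\<^sup>2)) / 2"
    by (simp add: frobenius_def sum.distrib sum_divide_distrib add_divide_distrib)
  also have "(\<Sum>i<p. \<Sum>j<p. ((S * A) $$ (j, i))\<^sup>2) = frobenius p (S * A)" unfolding frobenius_def by (rule sum.swap)
  also have "(frobenius p (S * A) + frobenius p (S * A)) / 2 = frobenius p (S * A)" by simp
  also have "\<dots> \<le> (\<Sum>i<p. c\<^sup>2 * (\<Sum>j<p. (S $$ (i, j))\<^sup>2))"
    unfolding frobenius_def
  proof (rule sum_mono)
    fix i assume i: "i \<in> {..<p}"
    have rc: "row S i \<in> carrier_vec p" using Sc i by auto
    have Arc: "A *\<^sub>v row S i \<in> carrier_vec p" by (rule mult_mat_vec_carrier[OF A(1) rc])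
    have "(S * A) $$ (i, j) = (A *\<^sub>v row S i) $ j" if "j < p" for j
    proof -
      have "col A j = row A j" using A that sym_entry[OF A] by (intro eq_vecI) auto
      then show ?thesis using Sc A i that comm_scalar_prod[of "row S i" p "row A j"] rc by auto
    qed
    then have "(\<Sum>j<p. ((S * A) $$ (i, j))\<^sup>2) = (A *\<^sub>v row S i) \<bullet> (A *\<^sub>v row S i)"
      unfolding sprod_sum[OF Arc Arc] by (intro sum.cong refl) (simp add: power2_eq_square)
    also have "\<dots> \<le> c\<^sup>2 * (row S i \<bullet> row S i)" by (rule c[OF rc])
    also have "row S i \<bullet> row S i = (\<Sum>j<p. (S $$ (i, j))\<^sup>2)"
      unfolding sprod_sum[OF rc rc] using Sc i by (intro sum.cong refl) (simp add: power2_eq_square)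
    finally show "(\<Sum>j<p. ((S * A) $$ (i, j))\<^sup>2) \<le> c\<^sup>2 * (\<Sum>j<p. (S $$ (i, j))\<^sup>2)" .
  qed
  also have "\<dots> = c\<^sup>2 * mat_trace (S * S)"
    unfolding trace_square_symmetric[OF Sc] frobenius_def by (simp add: sum_distrib_left)
  finally show ?thesis .
qed

end

lemma outer_self_carrier [simp]: "y \<in> carrier_vec p \<Longrightarrow> outer_self y \<in> carrier_mat p p"
  by (auto simp: outer_self_def)

lemma outer_self_quadratic:
  assumes "y \<in> carrier_vec p" "v \<in> carrier_vec p"
  shows "v \<bullet> (outer_self y *\<^sub>v v) = (y \<bullet> v)\<^sup>2"
proof -
  have "v \<bullet> (outer_self y *\<^sub>v v) = (\<Sum>i<p. \<Sum>j<p. (y $ i * v $ i) * (y $ j * v $ j))"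
    unfolding quadratic_entries[OF outer_self_carrier[OF assms(1)] assms(2)]
    by (intro sum.cong refl) (use assms in \<open>auto simp: outer_self_def\<close>)
  then show ?thesis using assms by (simp add: sprod_sum[of _ p] power2_eq_square sum_product)
qed

lemma outer_self_psd: "y \<in> carrier_vec p \<Longrightarrow> outer_self y \<in> sym_psd_mats p"
  unfolding sym_psd_mats_def by (auto simp: outer_self_quadratic) (auto intro!: eq_matI simp: outer_self_def)

lemma outer_self_trace: "y \<in> carrier_vec p \<Longrightarrow> mat_trace (outer_self y) = y \<bullet> y"
  by (auto simp: mat_trace_def outer_self_def sprod_sum[of _ p])

lemma measurable_outer_self:
  assumes "y \<in> M \<rightarrow>\<^sub>M borel_vec p"
  shows "(\<lambda>\<omega>. outer_self (y \<omega>)) \<in> M \<rightarrow>\<^sub>M borel_mat p"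
proof (rule measurable_borel_matI)
  show "outer_self (y \<omega>) \<in> carrier_mat p p" if "\<omega> \<in> space M" for \<omega> using measurable_borel_vecD(1)[OF assms that] by simp
  fix i j assume ij: "i < p" "j < p"
  have "(\<lambda>\<omega>. y \<omega> $ i * y \<omega> $ j) \<in> borel_measurable M"
    by (intro borel_measurable_times measurable_borel_vecD(2)[OF assms] ij)
  then show "(\<lambda>\<omega>. outer_self (y \<omega>) $$ (i, j)) \<in> borel_measurable M"
    by (rule measurable_cong[THEN iffD1, rotated]) (use carrier_vecD[OF measurable_borel_vecD(1)[OF assms]] ij in \<open>simp add: outer_self_def\<close>)
qed

section \<open>Quadratic forms of Gaussian vectors\<close>

definition gauss_moment :: "nat \<Rightarrow> real" where
  "gauss_moment k = (\<integral>x. std_normal_density x * x ^ k \<partial>lborel)"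

lemma gauss_moment_simps:
  "gauss_moment 0 = 1" "gauss_moment (Suc 0) = 0" "gauss_moment 2 = 1" "gauss_moment 3 = 0" "gauss_moment 4 = 3"
  using integral_std_normal_moment_even[of 0] integral_std_normal_moment_odd[of 0]
    integral_std_normal_moment_even[of 1] integral_std_normal_moment_odd[of 1] integral_std_normal_moment_even[of 2]
  by (simp_all add: gauss_moment_def fact_numeral)

lemma gauss_pair_product:
  fixes i j p :: nat
  assumes "i < p" "j < p"
  shows "(\<Prod>a<p. gauss_moment ((if a = i then 1 else 0) + (if a = j then 1 else 0))) = (if i = j then 1 else 0)"
proof -
  have "(\<Prod>a<p. gauss_moment ((if a = i then 1 else 0) + (if a = j then 1 else 0)))
    = (\<Prod>a\<in>{i, j}. gauss_moment ((if a = i then 1 else 0) + (if a = j then 1 else 0)))"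
    by (rule prod.mono_neutral_right) (use assms in \<open>auto simp: gauss_moment_simps\<close>)
  also have "\<dots> = (if i = j then 1 else 0)"
    by (cases "i = j") (simp_all add: gauss_moment_simps numeral_2_eq_2[symmetric])
  finally show ?thesis .
qed

text \<open>Isserlis' formula for four factors. The exponent at \<open>a\<close> counts how often
  \<open>a\<close> occurs among the four indices; when all four coincide, the fourth moment 3 is the
  number of pairings.\<close>

lemma gauss_quad_product:
  fixes i j k l p :: nat
  assumes "i < p" "j < p" "k < p" "l < p"
  shows "(\<Prod>a<p. gauss_moment ((if a = i then 1 else 0) + (if a = j then 1 else 0) + (if a = k then 1 else 0) + (if a = l then 1 else 0)))
    = (if i = j \<and> k = l then 1 else 0) + (if i = k \<and> j = l then 1 else 0) + (if i = l \<and> j = k then 1 else 0)"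
proof -
  let ?f = "\<lambda>a. gauss_moment ((if a = i then 1 else 0) + (if a = j then 1 else 0) + (if a = k then 1 else 0) + (if a = l then 1 else 0))"
  have "prod ?f {..<p} = prod ?f {i, j, k, l}"
    by (rule prod.mono_neutral_right) (use assms in \<open>auto simp: gauss_moment_simps\<close>)
  also have "\<dots> = (if i = j \<and> k = l then 1 else 0) + (if i = k \<and> j = l then 1 else 0) + (if i = l \<and> j = k then 1 else 0)"
    by (cases "i = j"; cases "i = k"; cases "i = l"; cases "j = k"; cases "j = l"; cases "k = l")
       (simp_all add: gauss_moment_simps numeral_2_eq_2[symmetric] numeral_3_eq_3[symmetric] eval_nat_numeral(3)[of "num.Bit1 num.One", symmetric] insert_commute)
  finally show ?thesis .
qed

context prob_space
begin

lemma gauss_product_moment: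
  assumes w: "std_normal_vec M p w"
  shows "integrable M (\<lambda>\<omega>. \<Prod>a<p. w \<omega> $ a ^ e a)" "expectation (\<lambda>\<omega>. \<Prod>a<p. w \<omega> $ a ^ e a) = (\<Prod>a<p. gauss_moment (e a))"
proof -
  have ind: "indep_vars (\<lambda>_. borel) (\<lambda>i \<omega>. w \<omega> $ i) {..<p}"
    and d: "\<And>i. i < p \<Longrightarrow> distributed M lborel (\<lambda>\<omega>. w \<omega> $ i) (\<lambda>x. ennreal (std_normal_density x))"
    using w by (auto simp: std_normal_vec_def)
  have ind': "indep_vars (\<lambda>_. borel) (\<lambda>i \<omega>. w \<omega> $ i ^ e i) {..<p}"
    using indep_vars_compose2[OF ind, of "\<lambda>i x. x ^ e i" "\<lambda>_. borel"] by simp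
  have int: "integrable M (\<lambda>\<omega>. w \<omega> $ i ^ e i)" if "i \<in> {..<p}" for i
    using distributed_integrable[OF d, of i "\<lambda>x. x ^ e i"] that integrable_std_normal_moment[of "e i"] by simp
  have m: "expectation (\<lambda>\<omega>. w \<omega> $ i ^ e i) = gauss_moment (e i)" if "i \<in> {..<p}" for i
    using distributed_integral[OF d, of i "\<lambda>x. x ^ e i"] that by (simp add: gauss_moment_def)
  show "integrable M (\<lambda>\<omega>. \<Prod>a<p. w \<omega> $ a ^ e a)" by (rule indep_vars_integrable[OF _ ind' int]) simp
  have "expectation (\<lambda>\<omega>. \<Prod>a<p. w \<omega> $ a ^ e a) = (\<Prod>a<p. expectation (\<lambda>\<omega>. w \<omega> $ a ^ e a))"
    by (rule indep_vars_lebesgue_integral[OF _ ind' int]) simp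
  then show "expectation (\<lambda>\<omega>. \<Prod>a<p. w \<omega> $ a ^ e a) = (\<Prod>a<p. gauss_moment (e a))" by (simp add: m)
qed

lemma gauss_pair_moment:
  assumes w: "std_normal_vec M p w" and ij: "i < p" "j < p"
  shows "integrable M (\<lambda>\<omega>. w \<omega> $ i * w \<omega> $ j)" "expectation (\<lambda>\<omega>. w \<omega> $ i * w \<omega> $ j) = (if i = j then 1 else 0)"
proof -
  have "(\<Prod>a<p. v $ a ^ ((if a = i then 1 else 0) + (if a = j then 1 else 0))) = v $ i * v $ j" for v :: "real Matrix.vec"
    using ij by (simp add: power_add prod.distrib if_distrib[of "\<lambda>k. _ ^ k"] cong: if_cong)
  then show "integrable M (\<lambda>\<omega>. w \<omega> $ i * w \<omega> $ j)" "expectation (\<lambda>\<omega>. w \<omega> $ i * w \<omega> $ j) = (if i = j then 1 else 0)"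
    using gauss_product_moment[OF w, of "\<lambda>a. (if a = i then 1 else 0) + (if a = j then 1 else 0)"] gauss_pair_product[OF ij] by simp_all
qed

lemma gauss_quad_moment:
  assumes w: "std_normal_vec M p w" and ij: "i < p" "j < p" "k < p" "l < p"
  shows "integrable M (\<lambda>\<omega>. w \<omega> $ i * w \<omega> $ j * w \<omega> $ k * w \<omega> $ l)"
    "expectation (\<lambda>\<omega>. w \<omega> $ i * w \<omega> $ j * w \<omega> $ k * w \<omega> $ l)
      = (if i = j \<and> k = l then 1 else 0) + (if i = k \<and> j = l then 1 else 0) + (if i = l \<and> j = k then 1 else 0)"
proof -
  let ?e = "\<lambda>a. (if a = i then 1 else 0) + (if a = j then 1 else 0) + (if a = k then 1 else 0) + (if a = l then 1 else (0::nat))"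
  have "(\<Prod>a<p. v $ a ^ ?e a) = v $ i * v $ j * v $ k * v $ l" for v :: "real Matrix.vec"
    using ij by (simp add: power_add prod.distrib if_distrib[of "\<lambda>k. _ ^ k"] cong: if_cong)
  then show "integrable M (\<lambda>\<omega>. w \<omega> $ i * w \<omega> $ j * w \<omega> $ k * w \<omega> $ l)"
    "expectation (\<lambda>\<omega>. w \<omega> $ i * w \<omega> $ j * w \<omega> $ k * w \<omega> $ l)
      = (if i = j \<and> k = l then 1 else 0) + (if i = k \<and> j = l then 1 else 0) + (if i = l \<and> j = k then 1 else 0)"
    using gauss_product_moment[OF w, of ?e] gauss_quad_product[OF ij] by simp_all
qed

lemma integral_double_sum:
  fixes f :: "nat \<Rightarrow> nat \<Rightarrow> 'a \<Rightarrow> real"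
  assumes "\<And>i j. i < p \<Longrightarrow> j < p \<Longrightarrow> integrable M (f i j)"
  shows "expectation (\<lambda>\<omega>. \<Sum>i<p. \<Sum>j<p. f i j \<omega>) = (\<Sum>i<p. \<Sum>j<p. expectation (f i j))"
proof -
  have "expectation (\<lambda>\<omega>. \<Sum>i<p. \<Sum>j<p. f i j \<omega>) = (\<Sum>i<p. expectation (\<lambda>\<omega>. \<Sum>j<p. f i j \<omega>))"
    by (rule Bochner_Integration.integral_sum) (use assms in \<open>auto intro!: Bochner_Integration.integrable_sum\<close>)
  also have "\<dots> = (\<Sum>i<p. \<Sum>j<p. expectation (f i j))"
    by (intro sum.cong refl Bochner_Integration.integral_sum) (use assms in auto)
  finally show ?thesis .
qed

text \<open>Of the three pairings in the fourth moment the first reproduces the square of the mean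
  and cancels in the variance. The other two coincide because A is symmetric and give twice the
  squared Frobenius norm.\<close>

lemma gauss_quadratic_form:
  assumes w: "std_normal_vec M p w" and A: "A \<in> carrier_mat p p" "A\<^sup>T = A"
  shows "A \<in> sym_psd_mats p \<Longrightarrow> (\<integral>\<^sup>+\<omega>. ennreal (w \<omega> \<bullet> (A *\<^sub>v w \<omega>)) \<partial>M) = ennreal (mat_trace A)"
    and "(\<integral>\<^sup>+\<omega>. ennreal ((w \<omega> \<bullet> (A *\<^sub>v w \<omega>) - mat_trace A)\<^sup>2) \<partial>M) = ennreal (2 * frobenius p A)"
proof -
  have wm: "w \<in> M \<rightarrow>\<^sub>M borel_vec p" using w by (simp add: std_normal_vec_def)
  have wc: "w \<omega> \<in> carrier_vec p" if "\<omega> \<in> space M" for \<omega> using measurable_borel_vecD(1)[OF wm that] .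
  define q where "q \<omega> = (\<Sum>i<p. \<Sum>j<p. A $$ (i, j) * (w \<omega> $ i * w \<omega> $ j))" for \<omega>
  have qw: "w \<omega> \<bullet> (A *\<^sub>v w \<omega>) = q \<omega>" if "\<omega> \<in> space M" for \<omega>
    unfolding quadratic_entries[OF A(1) wc[OF that]] q_def by (simp add: mult_ac)
  have tr: "mat_trace A = (\<Sum>i<p. A $$ (i, i))" using A by (auto simp: mat_trace_def)
  have qi: "integrable M q" unfolding q_def
    by (intro Bochner_Integration.integrable_sum integrable_mult_right gauss_pair_moment[OF w]) auto
  have Eq: "expectation q = mat_trace A"
  proof -
    have "expectation q = (\<Sum>i<p. \<Sum>j<p. A $$ (i, j) * expectation (\<lambda>\<omega>. w \<omega> $ i * w \<omega> $ j))"
      unfolding q_def by (subst integral_double_sum) (auto intro!: integrable_mult_right gauss_pair_moment[OF w])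
    also have "\<dots> = (\<Sum>i<p. \<Sum>j<p. A $$ (i, j) * (if i = j then 1 else 0))"
      by (intro sum.cong refl) (simp add: gauss_pair_moment[OF w])
    also have "\<dots> = mat_trace A" by (simp add: tr if_distrib[of "\<lambda>x. _ * x"] cong: if_cong)
    finally show ?thesis .
  qed
  have q2: "(q \<omega>)\<^sup>2 = (\<Sum>i<p. \<Sum>j<p. \<Sum>k<p. \<Sum>l<p. (A $$ (i, j) * A $$ (k, l)) * (w \<omega> $ i * w \<omega> $ j * w \<omega> $ k * w \<omega> $ l))" for \<omega>
    unfolding q_def power2_eq_square sum_product sum_distrib_left sum_distrib_right
    by (intro sum.cong refl) (simp add: mult_ac)
  have q2i: "integrable M (\<lambda>\<omega>. (q \<omega>)\<^sup>2)" unfolding q2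
    by (intro Bochner_Integration.integrable_sum integrable_mult_right gauss_quad_moment[OF w]) auto
  have Eq2: "expectation (\<lambda>\<omega>. (q \<omega>)\<^sup>2) = (mat_trace A)\<^sup>2 + 2 * frobenius p A"
  proof -
    let ?d = "\<lambda>i j. if i = j then 1 else (0::real)"
    have "expectation (\<lambda>\<omega>. (q \<omega>)\<^sup>2) = (\<Sum>i<p. \<Sum>j<p. \<Sum>k<p. \<Sum>l<p. (A $$ (i, j) * A $$ (k, l)) * expectation (\<lambda>\<omega>. w \<omega> $ i * w \<omega> $ j * w \<omega> $ k * w \<omega> $ l))"
    proof -
      have i: "integrable M (\<lambda>\<omega>. (A $$ (i, j) * A $$ (k, l)) * (w \<omega> $ i * w \<omega> $ j * w \<omega> $ k * w \<omega> $ l))"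
        if "i < p" "j < p" "k < p" "l < p" for i j k l
        by (intro integrable_mult_right gauss_quad_moment[OF w that])
      have "expectation (\<lambda>\<omega>. (q \<omega>)\<^sup>2) = (\<Sum>i<p. \<Sum>j<p. expectation (\<lambda>\<omega>. \<Sum>k<p. \<Sum>l<p. (A $$ (i, j) * A $$ (k, l)) * (w \<omega> $ i * w \<omega> $ j * w \<omega> $ k * w \<omega> $ l)))"
        unfolding q2 by (rule integral_double_sum) (auto intro!: Bochner_Integration.integrable_sum i)
      also have "\<dots> = (\<Sum>i<p. \<Sum>j<p. \<Sum>k<p. \<Sum>l<p. expectation (\<lambda>\<omega>. (A $$ (i, j) * A $$ (k, l)) * (w \<omega> $ i * w \<omega> $ j * w \<omega> $ k * w \<omega> $ l)))"
        by (intro sum.cong refl integral_double_sum i) auto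
      finally show ?thesis by simp
    qed
    also have "\<dots> = (\<Sum>i<p. \<Sum>j<p. \<Sum>k<p. \<Sum>l<p. (A $$ (i, j) * ?d i j) * (A $$ (k, l) * ?d k l) + A $$ (i, j) * (?d i k * (A $$ (k, l) * ?d j l)) + A $$ (i, j) * (?d j k * (A $$ (k, l) * ?d i l)))"
    proof (intro sum.cong refl)
      fix i j k l assume "i \<in> {..<p}" "j \<in> {..<p}" "k \<in> {..<p}" "l \<in> {..<p}"
      then have ij: "i < p" "j < p" "k < p" "l < p" by auto
      have c: "(if P \<and> Q then 1 else (0::real)) = (if P then 1 else 0) * (if Q then 1 else 0)" for P Q by simp
      have "(a * b) * (d1 * d2 + d3 * d4 + d5 * d6) = (a * d1) * (b * d2) + a * (d3 * (b * d4)) + a * (d6 * (b * d5))"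
        for a b d1 d2 d3 d4 d5 d6 :: real by (simp add: algebra_simps)
      then show "(A $$ (i, j) * A $$ (k, l)) * expectation (\<lambda>\<omega>. w \<omega> $ i * w \<omega> $ j * w \<omega> $ k * w \<omega> $ l)
        = (A $$ (i, j) * ?d i j) * (A $$ (k, l) * ?d k l) + A $$ (i, j) * (?d i k * (A $$ (k, l) * ?d j l)) + A $$ (i, j) * (?d j k * (A $$ (k, l) * ?d i l))"
        unfolding gauss_quad_moment(2)[OF w ij] c by (simp only:)
    qed
    also have "\<dots> = (\<Sum>i<p. \<Sum>j<p. A $$ (i, j) * ?d i j) * (\<Sum>k<p. \<Sum>l<p. A $$ (k, l) * ?d k l)
       + (\<Sum>i<p. \<Sum>j<p. A $$ (i, j) * A $$ (i, j)) + (\<Sum>i<p. \<Sum>j<p. A $$ (i, j) * A $$ (j, i))"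
    proof -
      have "(\<Sum>i<p. \<Sum>j<p. \<Sum>k<p. \<Sum>l<p. (A $$ (i, j) * ?d i j) * (A $$ (k, l) * ?d k l))
        = (\<Sum>i<p. \<Sum>j<p. A $$ (i, j) * ?d i j) * (\<Sum>k<p. \<Sum>l<p. A $$ (k, l) * ?d k l)"
        by (simp only: sum_distrib_left[symmetric] sum_distrib_right[symmetric])
      moreover have "(\<Sum>k<p. \<Sum>l<p. A $$ (i, j) * (?d i k * (A $$ (k, l) * ?d j l))) = A $$ (i, j) * A $$ (i, j)" if "i < p" "j < p" for i j
      proof -
        have "(\<Sum>l<p. A $$ (i, j) * (?d i k * (A $$ (k, l) * ?d j l))) = (if i = k then A $$ (i, j) * A $$ (k, j) else 0)" for k
        proof -
          have "(\<Sum>l<p. A $$ (i, j) * (?d i k * (A $$ (k, l) * ?d j l))) = (\<Sum>l<p. if j = l then A $$ (i, j) * (?d i k * A $$ (k, l)) else 0)"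
            by (intro sum.cong refl) simp
          then show ?thesis using that by simp
        qed
        then show ?thesis using that by simp
      qed
      moreover have "(\<Sum>k<p. \<Sum>l<p. A $$ (i, j) * (?d j k * (A $$ (k, l) * ?d i l))) = A $$ (i, j) * A $$ (j, i)" if "i < p" "j < p" for i j
      proof -
        have "(\<Sum>l<p. A $$ (i, j) * (?d j k * (A $$ (k, l) * ?d i l))) = (if j = k then A $$ (i, j) * A $$ (k, i) else 0)" for k
        proof -
          have "(\<Sum>l<p. A $$ (i, j) * (?d j k * (A $$ (k, l) * ?d i l))) = (\<Sum>l<p. if i = l then A $$ (i, j) * (?d j k * A $$ (k, l)) else 0)"
            by (intro sum.cong refl) simp
          then show ?thesis using that by simp
        qed
        then show ?thesis using that by simp
      qed
      ultimately show ?thesis by (simp add: sum.distrib)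
    qed
    also have "(\<Sum>i<p. \<Sum>j<p. A $$ (i, j) * ?d i j) = mat_trace A" by (simp add: tr if_distrib[of "\<lambda>x. _ * x"] cong: if_cong)
    also have "(\<Sum>i<p. \<Sum>j<p. A $$ (i, j) * A $$ (i, j)) = frobenius p A" by (simp add: frobenius_def power2_eq_square)
    also have "(\<Sum>i<p. \<Sum>j<p. A $$ (i, j) * A $$ (j, i)) = frobenius p A"
      unfolding frobenius_def power2_eq_square using sym_entry[OF A] by (intro sum.cong refl) auto
    finally show ?thesis by (simp add: power2_eq_square)
  qed
  show "(\<integral>\<^sup>+\<omega>. ennreal (w \<omega> \<bullet> (A *\<^sub>v w \<omega>)) \<partial>M) = ennreal (mat_trace A)" if psd: "A \<in> sym_psd_mats p"
  proof -
    have "(\<integral>\<^sup>+\<omega>. ennreal (w \<omega> \<bullet> (A *\<^sub>v w \<omega>)) \<partial>M) = (\<integral>\<^sup>+\<omega>. ennreal (q \<omega>) \<partial>M)"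
      by (intro nn_integral_cong) (simp add: qw)
    also have "\<dots> = ennreal (expectation q)"
      by (rule nn_integral_eq_integral[OF qi]) (use sym_psd_matsD(3)[OF psd wc] qw in \<open>auto intro!: AE_I2\<close>)
    finally show ?thesis by (simp add: Eq)
  qed
  have "(\<integral>\<^sup>+\<omega>. ennreal ((w \<omega> \<bullet> (A *\<^sub>v w \<omega>) - mat_trace A)\<^sup>2) \<partial>M) = (\<integral>\<^sup>+\<omega>. ennreal ((q \<omega> - mat_trace A)\<^sup>2) \<partial>M)"
    by (intro nn_integral_cong) (simp add: qw)
  also have "\<dots> = ennreal (expectation (\<lambda>\<omega>. (q \<omega> - mat_trace A)\<^sup>2))"
  proof (rule nn_integral_eq_integral)
    show "integrable M (\<lambda>\<omega>. (q \<omega> - mat_trace A)\<^sup>2)" using qi q2i by (simp add: power2_diff)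
  qed simp
  also have "expectation (\<lambda>\<omega>. (q \<omega> - mat_trace A)\<^sup>2) = 2 * frobenius p A"
    using qi q2i by (simp add: power2_diff Eq Eq2 prob_space) (simp add: power2_eq_square)
  finally show "(\<integral>\<^sup>+\<omega>. ennreal ((w \<omega> \<bullet> (A *\<^sub>v w \<omega>) - mat_trace A)\<^sup>2) \<partial>M) = ennreal (2 * frobenius p A)" .
qed

section \<open>Quadratic forms and conditional expectations\<close>

text \<open>\<open>v\<close> may be unbounded, so pulling its coordinates out of the conditional
  expectation is justified first on the event v . v <= N, where all coefficients are bounded by N.
  Monotone convergence removes the restriction; the bound on the right does not depend on N.\<close>

lemma cond_quadratic:
  assumes F: "subalgebra M F" and v: "v \<in> F \<rightarrow>\<^sub>M borel_vec p" and X: "X \<in> M \<rightarrow>\<^sub>M borel_mat p"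
    and psd: "\<And>\<omega>. \<omega> \<in> space M \<Longrightarrow> X \<omega> \<in> sym_psd_mats p" and int: "integrable_mat M p X" and p: "p \<ge> 1"
  shows "(\<integral>\<^sup>+\<omega>. ennreal (v \<omega> \<bullet> (X \<omega> *\<^sub>v v \<omega>)) \<partial>M)
    \<le> (\<integral>\<^sup>+\<omega>. ennreal (spectral_norm (cond_exp_mat M F p X \<omega>) * (v \<omega> \<bullet> v \<omega>)) \<partial>M)"
proof -
  interpret S: finite_measure_subalgebra M F by unfold_locales (rule F)
  have vM: "v \<in> M \<rightarrow>\<^sub>M borel_vec p" by (rule measurable_compose[OF measurable_ident_subalgebra[OF F] v])
  have vc: "v \<omega> \<in> carrier_vec p" if "\<omega> \<in> space M" for \<omega> using measurable_borel_vecD(1)[OF vM that] .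
  have Xc: "X \<omega> \<in> carrier_mat p p" if "\<omega> \<in> space M" for \<omega> using measurable_borel_matD(1)[OF X that] .
  define E where "E = cond_exp_mat M F p X"
  have Ec: "E \<omega> \<in> carrier_mat p p" for \<omega> by (simp add: E_def cond_exp_mat_def)
  define g where "g \<omega> = v \<omega> \<bullet> (X \<omega> *\<^sub>v v \<omega>)" for \<omega>
  have gm: "g \<in> borel_measurable M" unfolding g_def by (intro measurable_sprod[OF vM] measurable_mult_mat_vec[OF X] vM)
  have g0: "0 \<le> g \<omega>" if "\<omega> \<in> space M" for \<omega> unfolding g_def using sym_psd_matsD(3)[OF psd vc] that by blast
  let ?R = "\<integral>\<^sup>+\<omega>. ennreal (spectral_norm (E \<omega>) * (v \<omega> \<bullet> v \<omega>)) \<partial>M"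
  have trunc: "(\<integral>\<^sup>+\<omega>. ennreal (if v \<omega> \<bullet> v \<omega> \<le> real N then g \<omega> else 0) \<partial>M) \<le> ?R" for N :: nat
  proof -
    define c where "c i j \<omega> = (if v \<omega> \<bullet> v \<omega> \<le> real N then v \<omega> $ i * v \<omega> $ j else 0)" for i j \<omega>
    have vv: "(\<lambda>\<omega>. v \<omega> \<bullet> v \<omega>) \<in> borel_measurable F" by (rule measurable_sprod[OF v v])
    have cF: "c i j \<in> borel_measurable F" if "i < p" "j < p" for i j
      unfolding c_def using vv measurable_borel_vecD(2)[OF v that(1)] measurable_borel_vecD(2)[OF v that(2)] by measurable
    have cb: "\<bar>c i j \<omega>\<bar> \<le> real N" if "i < p" "j < p" "\<omega> \<in> space M" for i j \<omega>
    proof -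
      have le: "(v \<omega> $ i)\<^sup>2 \<le> v \<omega> \<bullet> v \<omega>" if "i < p" for i
        unfolding sprod_sum[OF vc[OF \<open>\<omega> \<in> space M\<close>] vc[OF \<open>\<omega> \<in> space M\<close>]] power2_eq_square
        using that by (intro member_le_sum) auto
      have "\<bar>v \<omega> $ i * v \<omega> $ j\<bar> \<le> ((v \<omega> $ i)\<^sup>2 + (v \<omega> $ j)\<^sup>2) / 2"
        using sum_squares_bound[of "\<bar>v \<omega> $ i\<bar>" "\<bar>v \<omega> $ j\<bar>"] by (simp add: abs_mult)
      also have "\<dots> \<le> v \<omega> \<bullet> v \<omega>" using le[OF that(1)] le[OF that(2)] by simp
      finally show ?thesis by (auto simp: c_def)
    qed
    have Xi: "integrable M (\<lambda>\<omega>. X \<omega> $$ (i, j))" if "i < p" "j < p" for i j using int that by (simp add: integrable_mat_def)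
    have cXi: "integrable M (\<lambda>\<omega>. c i j \<omega> * X \<omega> $$ (i, j))" if ij: "i < p" "j < p" for i j
    proof (rule Bochner_Integration.integrable_bound[of _ "\<lambda>\<omega>. real N * X \<omega> $$ (i, j)"])
      show "integrable M (\<lambda>\<omega>. real N * X \<omega> $$ (i, j))" using Xi[OF ij] by simp
      show "(\<lambda>\<omega>. c i j \<omega> * X \<omega> $$ (i, j)) \<in> borel_measurable M"
        using cF[OF ij] measurable_from_subalg[OF F] Xi[OF ij] by (intro borel_measurable_times) auto
      show "AE \<omega> in M. norm (c i j \<omega> * X \<omega> $$ (i, j)) \<le> norm (real N * X \<omega> $$ (i, j))"
        using cb[OF ij] by (intro AE_I2) (simp add: abs_mult mult_right_mono)
    qed
    note ce = S.real_cond_exp_intg[OF cXi cF borel_measurable_integrable[OF Xi]]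
    have Xe: "(if v \<omega> \<bullet> v \<omega> \<le> real N then g \<omega> else 0) = (\<Sum>i<p. \<Sum>j<p. c i j \<omega> * X \<omega> $$ (i, j))" if "\<omega> \<in> space M" for \<omega>
      using quadratic_entries[OF Xc[OF that] vc[OF that]] by (auto simp: g_def c_def)
    have Ee: "(if v \<omega> \<bullet> v \<omega> \<le> real N then v \<omega> \<bullet> (E \<omega> *\<^sub>v v \<omega>) else 0) = (\<Sum>i<p. \<Sum>j<p. c i j \<omega> * real_cond_exp M F (\<lambda>\<omega>. X \<omega> $$ (i, j)) \<omega>)" if "\<omega> \<in> space M" for \<omega>
      using quadratic_entries[OF Ec vc[OF that]] by (auto simp: c_def E_def cond_exp_mat_def)
    have i1: "integrable M (\<lambda>\<omega>. \<Sum>i<p. \<Sum>j<p. c i j \<omega> * X \<omega> $$ (i, j))"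
      by (intro Bochner_Integration.integrable_sum cXi) auto
    have i2: "integrable M (\<lambda>\<omega>. \<Sum>i<p. \<Sum>j<p. c i j \<omega> * real_cond_exp M F (\<lambda>\<omega>. X \<omega> $$ (i, j)) \<omega>)"
      by (intro Bochner_Integration.integrable_sum ce(1)) auto
    have "(\<integral>\<^sup>+\<omega>. ennreal (if v \<omega> \<bullet> v \<omega> \<le> real N then g \<omega> else 0) \<partial>M) = (\<integral>\<^sup>+\<omega>. ennreal (\<Sum>i<p. \<Sum>j<p. c i j \<omega> * X \<omega> $$ (i, j)) \<partial>M)"
      by (intro nn_integral_cong) (simp only: Xe)
    also have "\<dots> = ennreal (\<integral>\<omega>. (\<Sum>i<p. \<Sum>j<p. c i j \<omega> * X \<omega> $$ (i, j)) \<partial>M)"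
    proof (rule nn_integral_eq_integral[OF i1], rule AE_I2)
      fix \<omega> assume "\<omega> \<in> space M"
      then show "0 \<le> (\<Sum>i<p. \<Sum>j<p. c i j \<omega> * X \<omega> $$ (i, j))" using Xe[of \<omega>] g0[of \<omega>] by (simp split: if_splits)
    qed
    also have "(\<integral>\<omega>. (\<Sum>i<p. \<Sum>j<p. c i j \<omega> * X \<omega> $$ (i, j)) \<partial>M) = (\<integral>\<omega>. (\<Sum>i<p. \<Sum>j<p. c i j \<omega> * real_cond_exp M F (\<lambda>\<omega>. X \<omega> $$ (i, j)) \<omega>) \<partial>M)"
    proof -
      have "(\<integral>\<omega>. (\<Sum>i<p. \<Sum>j<p. c i j \<omega> * X \<omega> $$ (i, j)) \<partial>M) = (\<Sum>i<p. \<Sum>j<p. (\<integral>\<omega>. c i j \<omega> * X \<omega> $$ (i, j) \<partial>M))"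
        by (rule integral_double_sum) (rule cXi)
      also have "\<dots> = (\<Sum>i<p. \<Sum>j<p. (\<integral>\<omega>. c i j \<omega> * real_cond_exp M F (\<lambda>\<omega>. X \<omega> $$ (i, j)) \<omega> \<partial>M))"
        by (intro sum.cong refl ce(2)[symmetric]) auto
      also have "\<dots> = (\<integral>\<omega>. (\<Sum>i<p. \<Sum>j<p. c i j \<omega> * real_cond_exp M F (\<lambda>\<omega>. X \<omega> $$ (i, j)) \<omega>) \<partial>M)"
        by (rule integral_double_sum[symmetric]) (rule ce(1))
      finally show ?thesis .
    qed
    \<comment> \<open>The conditional expectation is taken entry by entry, so its quadratic form is
      not known to be nonnegative at every point. Passing to the positive part avoids the question,
      since the final bound is nonnegative anyway.\<close>
    also have "ennreal \<dots> \<le> ennreal (\<integral>\<omega>. max 0 (\<Sum>i<p. \<Sum>j<p. c i j \<omega> * real_cond_exp M F (\<lambda>\<omega>. X \<omega> $$ (i, j)) \<omega>) \<partial>M)"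
      by (intro ennreal_leI integral_mono i2 integrable_max) auto
    also have "\<dots> = (\<integral>\<^sup>+\<omega>. ennreal (max 0 (\<Sum>i<p. \<Sum>j<p. c i j \<omega> * real_cond_exp M F (\<lambda>\<omega>. X \<omega> $$ (i, j)) \<omega>)) \<partial>M)"
      by (rule nn_integral_eq_integral[symmetric]) (use i2 in auto)
    also have "\<dots> \<le> ?R"
    proof (rule nn_integral_mono, rule ennreal_leI)
      fix \<omega> assume \<omega>: "\<omega> \<in> space M"
      have "0 \<le> spectral_norm (E \<omega>) * (v \<omega> \<bullet> v \<omega>)"
        using spectral_norm_nonneg[OF Ec p] sprod_self_nonneg by simp
      moreover have "(\<Sum>i<p. \<Sum>j<p. c i j \<omega> * real_cond_exp M F (\<lambda>\<omega>. X \<omega> $$ (i, j)) \<omega>) \<le> spectral_norm (E \<omega>) * (v \<omega> \<bullet> v \<omega>)"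
        using spectral_norm_quadratic[OF Ec vc[OF \<omega>] p, of \<omega>] calculation unfolding Ee[OF \<omega>, symmetric] by auto
      ultimately show "max 0 (\<Sum>i<p. \<Sum>j<p. c i j \<omega> * real_cond_exp M F (\<lambda>\<omega>. X \<omega> $$ (i, j)) \<omega>) \<le> spectral_norm (E \<omega>) * (v \<omega> \<bullet> v \<omega>)" by simp
    qed
    finally show ?thesis .
  qed
  have "(\<integral>\<^sup>+\<omega>. ennreal (g \<omega>) \<partial>M) = (\<integral>\<^sup>+\<omega>. (SUP N. ennreal (if v \<omega> \<bullet> v \<omega> \<le> real N then g \<omega> else 0)) \<partial>M)"
  proof (rule nn_integral_cong)
    fix \<omega> assume \<omega>: "\<omega> \<in> space M"
    obtain N where N: "v \<omega> \<bullet> v \<omega> \<le> real N" using real_arch_simple by blast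
    show "ennreal (g \<omega>) = (SUP N. ennreal (if v \<omega> \<bullet> v \<omega> \<le> real N then g \<omega> else 0))"
    proof (rule antisym)
      show "ennreal (g \<omega>) \<le> (SUP N. ennreal (if v \<omega> \<bullet> v \<omega> \<le> real N then g \<omega> else 0))"
        by (rule SUP_upper2[of N]) (use N in auto)
      show "(SUP N. ennreal (if v \<omega> \<bullet> v \<omega> \<le> real N then g \<omega> else 0)) \<le> ennreal (g \<omega>)"
        by (rule SUP_least) auto
    qed
  qed
  also have "\<dots> = (SUP N. \<integral>\<^sup>+\<omega>. ennreal (if v \<omega> \<bullet> v \<omega> \<le> real N then g \<omega> else 0) \<partial>M)"
  proof (rule nn_integral_monotone_convergence_SUP_AE)
    have vvM: "(\<lambda>\<omega>. v \<omega> \<bullet> v \<omega>) \<in> borel_measurable M" by (rule measurable_sprod[OF vM vM])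
    show "(\<lambda>\<omega>. ennreal (if v \<omega> \<bullet> v \<omega> \<le> real N then g \<omega> else 0)) \<in> borel_measurable M" for N
      using vvM gm by measurable
    show "AE \<omega> in M. ennreal (if v \<omega> \<bullet> v \<omega> \<le> real N then g \<omega> else 0) \<le> ennreal (if v \<omega> \<bullet> v \<omega> \<le> real (Suc N) then g \<omega> else 0)" for N
      using g0 by (intro AE_I2) (auto simp: ennreal_leI)
  qed
  also have "\<dots> \<le> ?R" by (intro SUP_least trunc)
  finally show ?thesis by (simp add: g_def E_def)
qed

end

section \<open>The Lindeberg replacement\<close>

lemma ln_lipschitz:
  assumes "0 \<le> s" "0 \<le> (t::real)"
  shows "\<bar>ln (1 + s) - ln (1 + t)\<bar> \<le> \<bar>s - t\<bar>"
proof -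
  have "ln (1 + s) - ln (1 + t) \<le> s - t" if "0 \<le> t" "t \<le> s" for s t :: real
  proof -
    have "ln (1 + s) - ln (1 + t) = ln ((1 + s) / (1 + t))" using that by (simp add: ln_divide_pos)
    also have "\<dots> \<le> (1 + s) / (1 + t) - 1" using that by (intro ln_le_minus_one) (simp add: divide_pos_pos)
    also have "\<dots> = (s - t) / (1 + t)" using that by (simp add: field_simps)
    also have "\<dots> \<le> s - t" using that divide_left_mono[of 1 "1 + t" "s - t"] by simp
    finally show ?thesis .
  qed
  from this[of s t] this[of t s] this assms show ?thesis
    by (cases "s \<le> t") (auto simp: abs_if)
qed

text \<open>With A the resolvent of all other columns and \<open>At\<close> that of the far ones,
  the form of z is led to the form of y along z . A z, tr (S A), tr (S At), y . At y, y . A y. The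
  second and the fourth passage are removals of the columns in J. The data deviation is measured
  with \<open>At\<close>, which will be independent of the pair (y, S); the Gaussian column needs no
  removal and keeps A.\<close>

lemma lindeberg_step:
  fixes h :: "nat \<Rightarrow> real Matrix.vec"
  assumes IJ: "finite I" "J \<subseteq> I" "\<And>j. j \<in> I \<Longrightarrow> h j \<in> carrier_vec p"
    and y: "y \<in> carrier_vec p" and z: "z \<in> carrier_vec p" and S: "S \<in> sym_psd_mats p"
    and ab: "0 < \<alpha>" "\<alpha> < \<beta>" and n: "n \<ge> 1"
  defines "s \<equiv> \<lambda>\<nu> x. (x \<bullet> (resolv p n I h \<nu> *\<^sub>v x)) / real n" and "At \<equiv> \<lambda>\<nu>. resolv p n (I - J) h \<nu>"
    and "K \<equiv> ln (\<beta> / \<alpha>)"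
  shows "\<bar>(ln (1 + s \<alpha> z) - ln (1 + s \<beta> z)) - (ln (1 + s \<alpha> y) - ln (1 + s \<beta> y))\<bar>
    \<le> (\<Sum>\<nu>\<in>{\<alpha>, \<beta>}. (\<Sum>j\<in>J. (h j \<bullet> (At \<nu> *\<^sub>v y))\<^sup>2 + (\<Sum>i<p. (h j \<bullet> (At \<nu> *\<^sub>v col (psd_sqrt S) i))\<^sup>2)) / (real n)\<^sup>2
       + min K (\<bar>y \<bullet> (At \<nu> *\<^sub>v y) - mat_trace (S * At \<nu>)\<bar> / real n)
       + min K (\<bar>z \<bullet> (resolv p n I h \<nu> *\<^sub>v z) - mat_trace (S * resolv p n I h \<nu>)\<bar> / real n))" (is "?L \<le> ?R")
proof -
  have nu: "0 < \<nu>" if "\<nu> \<in> {\<alpha>, \<beta>}" for \<nu> using that ab by auto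
  have hJ: "\<And>j. j \<in> (I - J) \<union> J \<Longrightarrow> h j \<in> carrier_vec p" using IJ by auto
  have fin: "finite (I - J)" "finite J" "(I - J) \<inter> J = {}" using IJ finite_subset by auto
  have un: "(I - J) \<union> J = I" using IJ by auto
  have s0: "0 \<le> s \<nu> x" if "\<nu> \<in> {\<alpha>, \<beta>}" "x \<in> carrier_vec p" for \<nu> x
    unfolding s_def using resolv_quadratic(1)[of I h p \<nu> x n] IJ nu that by auto
  have K0: "0 \<le> K" using ab by (simp add: K_def)
  have b: "0 \<le> ln (1 + s \<alpha> x) - ln (1 + s \<beta> x)" "ln (1 + s \<alpha> x) - ln (1 + s \<beta> x) \<le> K" if "x \<in> carrier_vec p" for x
    unfolding s_def K_def using ln_ratio_bounds[of I h p \<alpha> \<beta> x n] IJ ab that by auto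
  have LK: "?L \<le> K" using b[OF y] b[OF z] by linarith
  define e where "e \<nu> = (\<Sum>j\<in>J. (h j \<bullet> (At \<nu> *\<^sub>v y))\<^sup>2 + (\<Sum>i<p. (h j \<bullet> (At \<nu> *\<^sub>v col (psd_sqrt S) i))\<^sup>2)) / (real n)\<^sup>2" for \<nu>
  define b1 where "b1 \<nu> = \<bar>y \<bullet> (At \<nu> *\<^sub>v y) - mat_trace (S * At \<nu>)\<bar> / real n" for \<nu>
  define d1 where "d1 \<nu> = \<bar>z \<bullet> (resolv p n I h \<nu> *\<^sub>v z) - mat_trace (S * resolv p n I h \<nu>)\<bar> / real n" for \<nu>
  have main: "\<bar>s \<nu> z - s \<nu> y\<bar> \<le> e \<nu> + b1 \<nu> + d1 \<nu>" if \<nu>: "\<nu> \<in> {\<alpha>, \<beta>}" for \<nu>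
  proof -
    have n0: "real n > 0" using n by simp
    let ?A = "resolv p n I h \<nu>"
    have Ac: "?A \<in> carrier_mat p p" using resolv_carrier[of I h p \<nu> n] IJ nu[OF \<nu>] by auto
    have Atc: "At \<nu> \<in> carrier_mat p p" unfolding At_def using resolv_carrier[of "I - J" h p \<nu> n] IJ nu[OF \<nu>] by auto
    have rem: "g \<bullet> (?A *\<^sub>v g) \<le> g \<bullet> (At \<nu> *\<^sub>v g)"
      "g \<bullet> (At \<nu> *\<^sub>v g) - g \<bullet> (?A *\<^sub>v g) \<le> (\<Sum>j\<in>J. (h j \<bullet> (At \<nu> *\<^sub>v g))\<^sup>2) / real n" if "g \<in> carrier_vec p" for g
      using resolv_removal[of "I - J" J h p \<nu> g n] hJ fin nu[OF \<nu>] that unfolding un At_def by auto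
    note r = col_psd_sqrt_carrier[OF S]
    define E1 where "E1 = (\<Sum>j\<in>J. (h j \<bullet> (At \<nu> *\<^sub>v y))\<^sup>2)"
    define E2 where "E2 = (\<Sum>i<p. \<Sum>j\<in>J. (h j \<bullet> (At \<nu> *\<^sub>v col (psd_sqrt S) i))\<^sup>2)"
    have eE: "e \<nu> = (E1 + E2) / (real n)\<^sup>2"
      unfolding e_def E1_def E2_def by (subst sum.swap) (simp add: sum.distrib)
    define ty tS tSA where "ty = y \<bullet> (At \<nu> *\<^sub>v y)" and "tS = mat_trace (S * At \<nu>)" and "tSA = mat_trace (S * ?A)"
    have 1: "y \<bullet> (?A *\<^sub>v y) \<le> ty" "ty - y \<bullet> (?A *\<^sub>v y) \<le> E1 / real n"
      unfolding ty_def E1_def using rem[OF y] by auto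
    have 2: "tSA \<le> tS" "tS - tSA \<le> E2 / real n"
    proof -
      show "tSA \<le> tS" unfolding tSA_def tS_def trace_mult_psd[OF S Ac] trace_mult_psd[OF S Atc]
        by (intro sum_mono rem(1) r) auto
      have "tS - tSA = (\<Sum>i<p. col (psd_sqrt S) i \<bullet> (At \<nu> *\<^sub>v col (psd_sqrt S) i) - col (psd_sqrt S) i \<bullet> (?A *\<^sub>v col (psd_sqrt S) i))"
        unfolding tSA_def tS_def trace_mult_psd[OF S Ac] trace_mult_psd[OF S Atc] by (simp add: sum_subtractf)
      also have "\<dots> \<le> (\<Sum>i<p. (\<Sum>j\<in>J. (h j \<bullet> (At \<nu> *\<^sub>v col (psd_sqrt S) i))\<^sup>2) / real n)"
        by (intro sum_mono rem(2) r) auto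
      finally show "tS - tSA \<le> E2 / real n" by (simp add: E2_def sum_divide_distrib)
    qed
    have "\<bar>z \<bullet> (?A *\<^sub>v z) - y \<bullet> (?A *\<^sub>v y)\<bar> \<le> \<bar>z \<bullet> (?A *\<^sub>v z) - tSA\<bar> + (tS - tSA) + \<bar>ty - tS\<bar> + (ty - y \<bullet> (?A *\<^sub>v y))"
      using 1(1) 2(1) by linarith
    also have "\<dots> \<le> \<bar>z \<bullet> (?A *\<^sub>v z) - tSA\<bar> + E2 / real n + \<bar>ty - tS\<bar> + E1 / real n" using 1(2) 2(2) by linarith
    finally have *: "\<bar>z \<bullet> (?A *\<^sub>v z) - y \<bullet> (?A *\<^sub>v y)\<bar> \<le> \<bar>z \<bullet> (?A *\<^sub>v z) - tSA\<bar> + E2 / real n + \<bar>ty - tS\<bar> + E1 / real n" .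
    have "\<bar>s \<nu> z - s \<nu> y\<bar> = \<bar>z \<bullet> (?A *\<^sub>v z) - y \<bullet> (?A *\<^sub>v y)\<bar> / real n"
      unfolding s_def using n0 by (simp add: diff_divide_distrib[symmetric])
    also have "\<dots> \<le> (\<bar>z \<bullet> (?A *\<^sub>v z) - tSA\<bar> + E2 / real n + \<bar>ty - tS\<bar> + E1 / real n) / real n"
      using * by (rule divide_right_mono) simp
    also have "\<dots> = e \<nu> + b1 \<nu> + d1 \<nu>"
      unfolding eE b1_def d1_def ty_def[symmetric] tS_def[symmetric] tSA_def[symmetric]
      by (simp add: add_divide_distrib power2_eq_square)
    finally show ?thesis .
  qed
  have e0: "0 \<le> e \<nu>" for \<nu> unfolding e_def by (intro divide_nonneg_nonneg sum_nonneg add_nonneg_nonneg) auto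
  have bd0: "0 \<le> b1 \<nu>" "0 \<le> d1 \<nu>" for \<nu> by (auto simp: b1_def d1_def)
  have "?L \<le> \<bar>ln (1 + s \<alpha> z) - ln (1 + s \<alpha> y)\<bar> + \<bar>ln (1 + s \<beta> z) - ln (1 + s \<beta> y)\<bar>" by linarith
  also have "\<dots> \<le> \<bar>s \<alpha> z - s \<alpha> y\<bar> + \<bar>s \<beta> z - s \<beta> y\<bar>"
    using s0 y z by (intro add_mono ln_lipschitz) auto
  also have "\<dots> \<le> (e \<alpha> + b1 \<alpha> + d1 \<alpha>) + (e \<beta> + b1 \<beta> + d1 \<beta>)" by (intro add_mono main) auto
  finally have "?L \<le> (e \<alpha> + b1 \<alpha> + d1 \<alpha>) + (e \<beta> + b1 \<beta> + d1 \<beta>)" .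
  \<comment> \<open>The left-hand side is at most \<open>K\<close> in any case. If one of the
    deviations exceeds \<open>K\<close>, its truncated value alone is already a bound; otherwise
    truncation changes nothing.\<close>
  then have "?L \<le> (e \<alpha> + min K (b1 \<alpha>) + min K (d1 \<alpha>)) + (e \<beta> + min K (b1 \<beta>) + min K (d1 \<beta>))"
    using LK K0 e0[of \<alpha>] e0[of \<beta>] bd0[of \<alpha>] bd0[of \<beta>] by (auto simp: min_def)
  also have "\<dots> = ?R" unfolding e_def b1_def d1_def using ab by simp
  finally show ?thesis .
qed

text \<open>The hybrid \<open>h k\<close> has the columns before k replaced and those from k on
  unchanged, so the difference telescopes between \<open>h 1\<close>, the data, and
  \<open>h (Suc n)\<close>, the Gaussian model. Consecutive hybrids agree off k and share the
  resolvent of the other columns. The argument is deterministic; independence enters only when the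
  right-hand side is integrated.\<close>

lemma lindeberg_pointwise:
  fixes y z :: "nat \<Rightarrow> real Matrix.vec" and S :: "nat \<Rightarrow> real mat" and J :: "nat \<Rightarrow> nat set"
  assumes y: "\<And>j. j \<in> {1..n} \<Longrightarrow> y j \<in> carrier_vec p" and z: "\<And>j. j \<in> {1..n} \<Longrightarrow> z j \<in> carrier_vec p"
    and S: "\<And>j. j \<in> {1..n} \<Longrightarrow> S j \<in> sym_psd_mats p" and J: "\<And>k. J k \<subseteq> {1..n} - {k}"
    and ab: "0 < \<alpha>" "\<alpha> < \<beta>" and n: "n \<ge> 1"
  defines "h \<equiv> \<lambda>k j. if j < k then z j else y j" and "K \<equiv> ln (\<beta> / \<alpha>)"
  defines "At \<equiv> \<lambda>k \<nu>. resolv p n ({1..n} - {k} - J k) (h k) \<nu>" and "A \<equiv> \<lambda>k \<nu>. resolv p n ({1..n} - {k}) (h k) \<nu>"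
  shows "\<bar>logdet_ratio p n \<alpha> \<beta> {1..n} y - logdet_ratio p n \<alpha> \<beta> {1..n} z\<bar>
    \<le> (\<Sum>k=1..n. \<Sum>\<nu>\<in>{\<alpha>, \<beta>}.
        (\<Sum>j\<in>J k. (h k j \<bullet> (At k \<nu> *\<^sub>v y k))\<^sup>2 + (\<Sum>i<p. (h k j \<bullet> (At k \<nu> *\<^sub>v col (psd_sqrt (S k)) i))\<^sup>2)) / (real n)\<^sup>2
       + min K (\<bar>y k \<bullet> (At k \<nu> *\<^sub>v y k) - mat_trace (S k * At k \<nu>)\<bar> / real n)
       + min K (\<bar>z k \<bullet> (A k \<nu> *\<^sub>v z k) - mat_trace (S k * A k \<nu>)\<bar> / real n))"
proof -
  let ?P = "logdet_ratio p n \<alpha> \<beta>"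
  have h: "h k j \<in> carrier_vec p" if "j \<in> {1..n}" for k j using y[OF that] z[OF that] by (simp add: h_def)
  define s where "s k \<nu> x = (x \<bullet> (resolv p n ({1..n} - {k}) (h k) \<nu> *\<^sub>v x)) / real n" for k \<nu> x
  have step: "?P {1..n} (h k) - ?P {1..n} (h (Suc k))
     = (ln (1 + s k \<alpha> (z k)) - ln (1 + s k \<beta> (z k))) - (ln (1 + s k \<alpha> (y k)) - ln (1 + s k \<beta> (y k)))" if k: "k \<in> {1..n}" for k
  proof -
    have e: "{1..n} = insert k ({1..n} - {k})" using k by auto
    have g: "?P {1..n} x = ?P ({1..n} - {k}) x
       - (ln (1 + (x k \<bullet> (resolv p n ({1..n} - {k}) x \<alpha> *\<^sub>v x k)) / real n) - ln (1 + (x k \<bullet> (resolv p n ({1..n} - {k}) x \<beta> *\<^sub>v x k)) / real n))"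
      if x: "\<And>j. j \<in> {1..n} \<Longrightarrow> x j \<in> carrier_vec p" for x
      by (subst (1) e, rule logdet_ratio_insert) (use x k ab in auto)
    have c: "h (Suc k) j = h k j" if "j \<in> {1..n} - {k}" for j using that by (auto simp: h_def)
    have P: "?P ({1..n} - {k}) (h (Suc k)) = ?P ({1..n} - {k}) (h k)" by (rule logdet_ratio_cong) (rule c)
    have R: "resolv p n ({1..n} - {k}) (h (Suc k)) \<nu> = resolv p n ({1..n} - {k}) (h k) \<nu>" for \<nu> by (rule resolv_cong) (rule c)
    have hk: "h (Suc k) k = z k" "h k k = y k" by (auto simp: h_def)
    have g1: "?P {1..n} (h k) = ?P ({1..n} - {k}) (h k)
       - (ln (1 + (h k k \<bullet> (resolv p n ({1..n} - {k}) (h k) \<alpha> *\<^sub>v h k k)) / real n) - ln (1 + (h k k \<bullet> (resolv p n ({1..n} - {k}) (h k) \<beta> *\<^sub>v h k k)) / real n))"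
      by (rule g) (rule h)
    have g2: "?P {1..n} (h (Suc k)) = ?P ({1..n} - {k}) (h (Suc k))
       - (ln (1 + (h (Suc k) k \<bullet> (resolv p n ({1..n} - {k}) (h (Suc k)) \<alpha> *\<^sub>v h (Suc k) k)) / real n)
        - ln (1 + (h (Suc k) k \<bullet> (resolv p n ({1..n} - {k}) (h (Suc k)) \<beta> *\<^sub>v h (Suc k) k)) / real n))"
      by (rule g) (rule h)
    show ?thesis unfolding g1 g2 P R hk s_def by simp
  qed
  have "?P {1..n} y - ?P {1..n} z = ?P {1..n} (h 1) - ?P {1..n} (h (Suc n))"
  proof -
    have "?P {1..n} (h 1) = ?P {1..n} y" "?P {1..n} (h (Suc n)) = ?P {1..n} z"
      by (auto intro!: logdet_ratio_cong simp: h_def)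
    then show ?thesis by simp
  qed
  also have "\<dots> = (\<Sum>k=1..n. ?P {1..n} (h k) - ?P {1..n} (h (Suc k)))"
  proof -
    have "f 1 - f (Suc N) = (\<Sum>k=1..N. f k - f (Suc k))" for f :: "nat \<Rightarrow> real" and N by (induction N) auto
    from this[of "\<lambda>k. ?P {1..n} (h k)" n] show ?thesis .
  qed
  finally have "\<bar>?P {1..n} y - ?P {1..n} z\<bar> \<le> (\<Sum>k=1..n. \<bar>?P {1..n} (h k) - ?P {1..n} (h (Suc k))\<bar>)"
    using sum_abs by simp
  also have "\<dots> \<le> (\<Sum>k=1..n. \<Sum>\<nu>\<in>{\<alpha>, \<beta>}.
        (\<Sum>j\<in>J k. (h k j \<bullet> (At k \<nu> *\<^sub>v y k))\<^sup>2 + (\<Sum>i<p. (h k j \<bullet> (At k \<nu> *\<^sub>v col (psd_sqrt (S k)) i))\<^sup>2)) / (real n)\<^sup>2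
       + min K (\<bar>y k \<bullet> (At k \<nu> *\<^sub>v y k) - mat_trace (S k * At k \<nu>)\<bar> / real n)
       + min K (\<bar>z k \<bullet> (A k \<nu> *\<^sub>v z k) - mat_trace (S k * A k \<nu>)\<bar> / real n))"
  proof (rule sum_mono)
    fix k assume k: "k \<in> {1..n}"
    show "\<bar>?P {1..n} (h k) - ?P {1..n} (h (Suc k))\<bar> \<le> (\<Sum>\<nu>\<in>{\<alpha>, \<beta>}.
        (\<Sum>j\<in>J k. (h k j \<bullet> (At k \<nu> *\<^sub>v y k))\<^sup>2 + (\<Sum>i<p. (h k j \<bullet> (At k \<nu> *\<^sub>v col (psd_sqrt (S k)) i))\<^sup>2)) / (real n)\<^sup>2
       + min K (\<bar>y k \<bullet> (At k \<nu> *\<^sub>v y k) - mat_trace (S k * At k \<nu>)\<bar> / real n)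
       + min K (\<bar>z k \<bullet> (A k \<nu> *\<^sub>v z k) - mat_trace (S k * A k \<nu>)\<bar> / real n))"
      unfolding step[OF k] s_def At_def A_def K_def
      by (rule lindeberg_step) (use J[of k] h y[OF k] z[OF k] S[OF k] ab n in auto)
  qed
  finally show ?thesis .
qed

lemma resolv_psd_norm:
  assumes "\<And>j. j \<in> I \<Longrightarrow> x j \<in> carrier_vec p" "\<nu> > 0" "p \<ge> 1"
  shows "resolv p n I x \<nu> \<in> sym_psd_mats p" "spectral_norm (resolv p n I x \<nu>) \<le> 1 / \<nu>"
proof -
  have c: "resolv p n I x \<nu> \<in> carrier_mat p p" by (rule resolv_carrier) (use assms in auto)
  moreover have "(resolv p n I x \<nu>)\<^sup>T = resolv p n I x \<nu>" by (rule resolv_symmetric) (use assms in auto)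
  moreover have "0 \<le> v \<bullet> (resolv p n I x \<nu> *\<^sub>v v)" if "v \<in> carrier_vec p" for v
    by (rule resolv_quadratic(1)) (use assms that in auto)
  ultimately show "resolv p n I x \<nu> \<in> sym_psd_mats p" unfolding sym_psd_mats_def by blast
  show "spectral_norm (resolv p n I x \<nu>) \<le> 1 / \<nu>"
  proof (rule spectral_norm_le[OF c assms(3)])
    fix v :: "real Matrix.vec" assume "v \<in> carrier_vec p"
    then have "(resolv p n I x \<nu> *\<^sub>v v) \<bullet> (resolv p n I x \<nu> *\<^sub>v v) \<le> (v \<bullet> v) / \<nu>\<^sup>2"
      by (intro resolv_quadratic(2)) (use assms in auto)
    then show "(resolv p n I x \<nu> *\<^sub>v v) \<bullet> (resolv p n I x \<nu> *\<^sub>v v) \<le> (1 / \<nu>)\<^sup>2 * (v \<bullet> v)" by (simp add: power_divide)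
  qed (use assms in auto)
qed

section \<open>Decoupling m-dependent columns\<close>

locale m_dependent_columns = prob_space M for M :: "'a measure" +
  fixes m p n :: nat and y :: "nat \<Rightarrow> 'a \<Rightarrow> real Matrix.vec" and S :: "nat \<Rightarrow> 'a \<Rightarrow> real mat"
  assumes p1: "p \<ge> 1" and n1: "n \<ge> 1"
    and y_rv: "\<And>k. k \<in> {1..n} \<Longrightarrow> y k \<in> M \<rightarrow>\<^sub>M borel_vec p"
    and S_rv: "\<And>k. k \<in> {1..n} \<Longrightarrow> S k \<in> M \<rightarrow>\<^sub>M borel_mat p"
    and S_psd: "\<And>k \<omega>. k \<in> {1..n} \<Longrightarrow> \<omega> \<in> space M \<Longrightarrow> S k \<omega> \<in> sym_psd_mats p"
    and y_int: "\<And>k. k \<in> {1..n} \<Longrightarrow> integrable_mat M p (\<lambda>\<omega>. outer_self (y k \<omega>))"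
    and S_int: "\<And>k. k \<in> {1..n} \<Longrightarrow> integrable_mat M p (S k)"
    and dep: "m_dependent M m p n y S"
begin

text \<open>Cutting the index set down to {1..n} allows intervals whose ends leave the range, such
  as {1..k} with large k or {k + 2 m..n}, without separate boundary cases.\<close>

definition sig :: "nat set \<Rightarrow> 'a measure" where
  "sig I = pair_sigma M p y S (I \<inter> {1..n})"

lemma sig_pair_rv: "k \<in> {1..n} \<Longrightarrow> (\<lambda>\<omega>. (y k \<omega>, S k \<omega>)) \<in> M \<rightarrow>\<^sub>M borel_vec p \<Otimes>\<^sub>M borel_mat p"
  by (intro measurable_Pair y_rv S_rv)

lemma sig_subalgebra: "subalgebra M (sig I)"
  unfolding sig_def pair_sigma_def by (rule subalgebra_gen_sigma) (rule sig_pair_rv, auto)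

lemma space_sig [simp]: "space (sig I) = space M"
  using sig_subalgebra by (simp add: subalgebra_def)

lemma sig_mono: "I \<subseteq> I' \<Longrightarrow> subalgebra (sig I') (sig I)"
  unfolding subalgebra_def using gen_sigma_mono[of "I \<inter> {1..n}" "I' \<inter> {1..n}"]
  by (auto simp: sig_def pair_sigma_def space_gen_sigma)

lemma sig_measurable_M: "f \<in> sig I \<rightarrow>\<^sub>M N \<Longrightarrow> f \<in> M \<rightarrow>\<^sub>M N"
  by (rule measurable_compose[OF measurable_ident_subalgebra[OF sig_subalgebra]])

lemma sig_rv:
  assumes "j \<in> I" "j \<in> {1..n}"
  shows "y j \<in> sig I \<rightarrow>\<^sub>M borel_vec p" "S j \<in> sig I \<rightarrow>\<^sub>M borel_mat p"
    "(\<lambda>\<omega>. psd_sqrt (S j \<omega>)) \<in> sig I \<rightarrow>\<^sub>M borel_mat p"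
proof -
  have *: "(\<lambda>\<omega>. (y j \<omega>, S j \<omega>)) \<in> sig I \<rightarrow>\<^sub>M borel_vec p \<Otimes>\<^sub>M borel_mat p"
    unfolding sig_def pair_sigma_def by (rule measurable_gen_sigma[of j _ "\<lambda>j \<omega>. (y j \<omega>, S j \<omega>)", OF _ sig_pair_rv]) (use assms in auto)
  show "y j \<in> sig I \<rightarrow>\<^sub>M borel_vec p" using measurable_compose[OF * measurable_fst] by simp
  show Sj: "S j \<in> sig I \<rightarrow>\<^sub>M borel_mat p" using measurable_compose[OF * measurable_snd] by simp
  show "(\<lambda>\<omega>. psd_sqrt (S j \<omega>)) \<in> sig I \<rightarrow>\<^sub>M borel_mat p"
    by (rule measurable_psd_sqrt[OF Sj]) (use S_psd assms in auto)
qed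

text \<open>The alternative a = 0 covers truncated subtraction: for k < m the past {1..k - m} is
  empty and its sigma-algebra trivial, although k - m + m <= k fails in the natural numbers.\<close>

lemma sig_indep:
  assumes "a = 0 \<or> a + max m 1 \<le> b"
  shows "indep_set (sets (sig {1..a})) (sets (sig {b..n}))"
proof (cases "a = 0")
  case True
  have "sets (sig {b..n}) \<subseteq> events" using sig_subalgebra by (simp add: subalgebra_def)
  then show ?thesis using True indep_set_trivial(1) by (simp add: sig_def pair_sigma_def gen_sigma_empty)
next
  case False
  then show ?thesis unfolding sig_def using assms by (intro m_dependent_indep[OF dep] y_rv S_rv) auto
qed

lemma y_carrier: "k \<in> {1..n} \<Longrightarrow> \<omega> \<in> space M \<Longrightarrow> y k \<omega> \<in> carrier_vec p"
  using measurable_borel_vecD(1)[OF y_rv] .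

text \<open>m-dependence separates only a past from a future, whereas k lies between the two ranges.
  Therefore {1..k}, which contains both the early range and k, is first separated from {b..n}; then,
  with the late point frozen, {1..a} is separated from {k..n}.\<close>

lemma triple_decoupling:
  assumes ak: "a = 0 \<or> a + max m 1 \<le> k" and kb: "k + max m 1 \<le> b" and ab: "a \<le> k" and k: "k \<in> {1..n}"
    and h: "h \<in> borel_measurable ((sig {1..a} \<Otimes>\<^sub>M sig {b..n}) \<Otimes>\<^sub>M sig {k})"
  shows "(\<integral>\<^sup>+\<omega>. h ((\<omega>, \<omega>), \<omega>) \<partial>M) = (\<integral>\<^sup>+\<omega>3. (\<integral>\<^sup>+\<omega>1. (\<integral>\<^sup>+\<omega>2. h ((\<omega>1, \<omega>3), \<omega>2) \<partial>M) \<partial>M) \<partial>M)"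
proof -
  interpret PP: pair_sigma_finite M M ..
  have id1: "(\<lambda>\<omega>. \<omega>) \<in> sig {1..k} \<rightarrow>\<^sub>M sig {1..a}" "(\<lambda>\<omega>. \<omega>) \<in> sig {1..k} \<rightarrow>\<^sub>M sig {k}"
    using ab k by (auto intro!: measurable_ident_subalgebra sig_mono)
  have g: "(\<lambda>q. h ((fst q, snd q), fst q)) \<in> borel_measurable (sig {1..k} \<Otimes>\<^sub>M sig {b..n})"
    by (intro measurable_compose[OF _ h] measurable_Pair measurable_compose[OF measurable_fst id1(1)]
        measurable_compose[OF measurable_fst id1(2)] measurable_snd)
  have idM: "(\<lambda>\<omega>. \<omega>) \<in> M \<rightarrow>\<^sub>M sig I" for I by (rule measurable_ident_subalgebra[OF sig_subalgebra])
  have gM: "(\<lambda>(\<omega>1, \<omega>3). h ((\<omega>1, \<omega>3), \<omega>1)) \<in> borel_measurable (M \<Otimes>\<^sub>M M)"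
    unfolding case_prod_beta
    by (intro measurable_compose[OF _ h] measurable_Pair measurable_compose[OF measurable_fst idM] measurable_compose[OF measurable_snd idM])
  have "(\<integral>\<^sup>+\<omega>. h ((\<omega>, \<omega>), \<omega>) \<partial>M) = (\<integral>\<^sup>+\<omega>1. (\<integral>\<^sup>+\<omega>3. h ((\<omega>1, \<omega>3), \<omega>1) \<partial>M) \<partial>M)"
    using decouple_nn[OF sig_subalgebra sig_subalgebra sig_indep g] kb by simp
  also have "\<dots> = (\<integral>\<^sup>+\<omega>3. (\<integral>\<^sup>+\<omega>1. h ((\<omega>1, \<omega>3), \<omega>1) \<partial>M) \<partial>M)"
    by (rule PP.Fubini'[OF gM, symmetric])
  also have "\<dots> = (\<integral>\<^sup>+\<omega>3. (\<integral>\<^sup>+\<omega>1. (\<integral>\<^sup>+\<omega>2. h ((\<omega>1, \<omega>3), \<omega>2) \<partial>M) \<partial>M) \<partial>M)"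
  proof (rule nn_integral_cong)
    fix \<omega>3 assume w3: "\<omega>3 \<in> space M"
    have id2: "(\<lambda>\<omega>. \<omega>) \<in> sig {k..n} \<rightarrow>\<^sub>M sig {k}" using k by (auto intro!: measurable_ident_subalgebra sig_mono)
    have g3: "(\<lambda>q. h ((fst q, \<omega>3), snd q)) \<in> borel_measurable (sig {1..a} \<Otimes>\<^sub>M sig {k..n})"
      using w3 by (intro measurable_compose[OF _ h] measurable_Pair measurable_fst measurable_const measurable_compose[OF measurable_snd id2]) auto
    show "(\<integral>\<^sup>+\<omega>1. h ((\<omega>1, \<omega>3), \<omega>1) \<partial>M) = (\<integral>\<^sup>+\<omega>1. (\<integral>\<^sup>+\<omega>2. h ((\<omega>1, \<omega>3), \<omega>2) \<partial>M) \<partial>M)"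
      using decouple_nn[OF sig_subalgebra sig_subalgebra sig_indep[OF ak] g3] by simp
  qed
  finally show ?thesis .
qed

text \<open>Once the late point is frozen, which is possible because it is independent of {1..e},
  the vector \<open>t\<close> is measurable for {1..a} and \<open>cond_quadratic\<close> applies.
  The majorant \<open>T\<close> depends on the early point only, so that the integration over the
  late point has no further effect.\<close>

lemma cond_pair_bound:
  assumes ae: "a \<le> e" and eb: "e + max m 1 \<le> b"
    and t: "t \<in> sig {1..a} \<Otimes>\<^sub>M sig {b..n} \<rightarrow>\<^sub>M borel_vec p" and X: "X \<in> sig {1..e} \<rightarrow>\<^sub>M borel_mat p"
    and psd: "\<And>\<omega>. \<omega> \<in> space M \<Longrightarrow> X \<omega> \<in> sym_psd_mats p" and int: "integrable_mat M p X"
    and T: "\<And>\<omega>1 \<omega>3. \<omega>1 \<in> space M \<Longrightarrow> \<omega>3 \<in> space M \<Longrightarrow> t (\<omega>1, \<omega>3) \<bullet> t (\<omega>1, \<omega>3) \<le> T \<omega>1"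
  shows "(\<integral>\<^sup>+\<omega>. ennreal (t (\<omega>, \<omega>) \<bullet> (X \<omega> *\<^sub>v t (\<omega>, \<omega>))) \<partial>M)
    \<le> (\<integral>\<^sup>+\<omega>. ennreal (spectral_norm (cond_exp_mat M (sig {1..a}) p X \<omega>) * T \<omega>) \<partial>M)"
proof -
  interpret PP: pair_sigma_finite M M ..
  have idM: "(\<lambda>\<omega>. \<omega>) \<in> M \<rightarrow>\<^sub>M sig I" for I by (rule measurable_ident_subalgebra[OF sig_subalgebra])
  have id1: "(\<lambda>\<omega>. \<omega>) \<in> sig {1..e} \<rightarrow>\<^sub>M sig {1..a}" using ae by (auto intro!: measurable_ident_subalgebra sig_mono)
  have XM: "X \<in> M \<rightarrow>\<^sub>M borel_mat p" by (rule sig_measurable_M[OF X])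
  have t': "(\<lambda>q. t (fst q, snd q)) \<in> sig {1..e} \<Otimes>\<^sub>M sig {b..n} \<rightarrow>\<^sub>M borel_vec p"
    by (intro measurable_compose[OF _ t] measurable_Pair measurable_compose[OF measurable_fst id1] measurable_snd)
  have tM: "(\<lambda>q. t (fst q, snd q)) \<in> M \<Otimes>\<^sub>M M \<rightarrow>\<^sub>M borel_vec p"
    by (intro measurable_compose[OF _ t] measurable_Pair measurable_compose[OF measurable_fst idM] measurable_compose[OF measurable_snd idM])
  have g: "(\<lambda>q. ennreal (t (fst q, snd q) \<bullet> (X (fst q) *\<^sub>v t (fst q, snd q)))) \<in> borel_measurable (sig {1..e} \<Otimes>\<^sub>M sig {b..n})"
    by (intro measurable_compose[OF _ measurable_ennreal] measurable_sprod[OF t'] measurable_mult_mat_vec[OF _ t'] measurable_compose[OF measurable_fst X])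
  have gM: "(\<lambda>(\<omega>1, \<omega>3). ennreal (t (\<omega>1, \<omega>3) \<bullet> (X \<omega>1 *\<^sub>v t (\<omega>1, \<omega>3)))) \<in> borel_measurable (M \<Otimes>\<^sub>M M)"
    unfolding case_prod_beta
    by (intro measurable_compose[OF _ measurable_ennreal] measurable_sprod[OF tM] measurable_mult_mat_vec[OF _ tM] measurable_compose[OF measurable_fst XM])
  let ?R = "\<integral>\<^sup>+\<omega>. ennreal (spectral_norm (cond_exp_mat M (sig {1..a}) p X \<omega>) * T \<omega>) \<partial>M"
  have "(\<integral>\<^sup>+\<omega>. ennreal (t (\<omega>, \<omega>) \<bullet> (X \<omega> *\<^sub>v t (\<omega>, \<omega>))) \<partial>M) = (\<integral>\<^sup>+\<omega>1. (\<integral>\<^sup>+\<omega>3. ennreal (t (\<omega>1, \<omega>3) \<bullet> (X \<omega>1 *\<^sub>v t (\<omega>1, \<omega>3))) \<partial>M) \<partial>M)"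
    using decouple_nn[OF sig_subalgebra sig_subalgebra sig_indep g] eb by simp
  also have "\<dots> = (\<integral>\<^sup>+\<omega>3. (\<integral>\<^sup>+\<omega>1. ennreal (t (\<omega>1, \<omega>3) \<bullet> (X \<omega>1 *\<^sub>v t (\<omega>1, \<omega>3))) \<partial>M) \<partial>M)"
    by (rule PP.Fubini'[OF gM, symmetric])
  also have "\<dots> \<le> (\<integral>\<^sup>+\<omega>3. ?R \<partial>M)"
  proof (rule nn_integral_mono)
    fix \<omega>3 assume w3: "\<omega>3 \<in> space M"
    have v: "(\<lambda>\<omega>1. t (\<omega>1, \<omega>3)) \<in> sig {1..a} \<rightarrow>\<^sub>M borel_vec p"
      using w3 by (intro measurable_compose[OF _ t] measurable_Pair measurable_ident measurable_const) auto
    have "(\<integral>\<^sup>+\<omega>1. ennreal (t (\<omega>1, \<omega>3) \<bullet> (X \<omega>1 *\<^sub>v t (\<omega>1, \<omega>3))) \<partial>M)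
      \<le> (\<integral>\<^sup>+\<omega>. ennreal (spectral_norm (cond_exp_mat M (sig {1..a}) p X \<omega>) * (t (\<omega>, \<omega>3) \<bullet> t (\<omega>, \<omega>3))) \<partial>M)"
      by (rule cond_quadratic[OF sig_subalgebra v XM psd int p1])
    also have "\<dots> \<le> ?R"
      using T w3 spectral_norm_nonneg[OF _ p1]
      by (intro nn_integral_mono ennreal_leI mult_left_mono) (auto simp: cond_exp_mat_def)
    finally show "(\<integral>\<^sup>+\<omega>1. ennreal (t (\<omega>1, \<omega>3) \<bullet> (X \<omega>1 *\<^sub>v t (\<omega>1, \<omega>3))) \<partial>M) \<le> ?R" .
  qed
  also have "\<dots> = ?R" by (simp add: emeasure_space_1)
  finally show ?thesis .
qed

text \<open>Here X is separated from both arguments of \<open>t\<close>, so integrating it out alone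
  puts the mean matrix in place of a conditional expectation. Afterwards the decoupling is undone,
  which returns the second moment of \<open>t\<close> on the original space.\<close>

lemma uncond_pair_bound:
  assumes ak: "a = 0 \<or> a + max m 1 \<le> k" and kb: "k + max m 1 \<le> b" and aklt: "a \<le> k" and k: "k \<in> {1..n}"
    and t: "t \<in> sig {1..a} \<Otimes>\<^sub>M sig {b..n} \<rightarrow>\<^sub>M borel_vec p" and X: "X \<in> sig {k} \<rightarrow>\<^sub>M borel_mat p"
    and psd: "\<And>\<omega>. \<omega> \<in> space M \<Longrightarrow> X \<omega> \<in> sym_psd_mats p" and int: "integrable_mat M p X"
  shows "(\<integral>\<^sup>+\<omega>. ennreal (t (\<omega>, \<omega>) \<bullet> (X \<omega> *\<^sub>v t (\<omega>, \<omega>))) \<partial>M)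
    \<le> ennreal (spectral_norm (expectation_mat M p X)) * (\<integral>\<^sup>+\<omega>. ennreal (t (\<omega>, \<omega>) \<bullet> t (\<omega>, \<omega>)) \<partial>M)"
proof -
  let ?N = "spectral_norm (expectation_mat M p X)"
  have Ec: "expectation_mat M p X \<in> carrier_mat p p" by (simp add: expectation_mat_def)
  have N0: "0 \<le> ?N" by (rule spectral_norm_nonneg[OF Ec p1])
  have XM: "X \<in> M \<rightarrow>\<^sub>M borel_mat p" by (rule sig_measurable_M[OF X])
  have tf: "(\<lambda>q. t (fst q)) \<in> (sig {1..a} \<Otimes>\<^sub>M sig {b..n}) \<Otimes>\<^sub>M sig {k} \<rightarrow>\<^sub>M borel_vec p"
    by (rule measurable_compose[OF measurable_fst t])
  have h: "(\<lambda>q. ennreal (t (fst q) \<bullet> (X (snd q) *\<^sub>v t (fst q)))) \<in> borel_measurable ((sig {1..a} \<Otimes>\<^sub>M sig {b..n}) \<Otimes>\<^sub>M sig {k})"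
    by (intro measurable_compose[OF _ measurable_ennreal] measurable_sprod[OF tf] measurable_mult_mat_vec[OF _ tf] measurable_compose[OF measurable_snd X])
  have h2: "(\<lambda>q. ennreal (t (fst q) \<bullet> t (fst q))) \<in> borel_measurable ((sig {1..a} \<Otimes>\<^sub>M sig {b..n}) \<Otimes>\<^sub>M sig {k})"
    by (intro measurable_compose[OF _ measurable_ennreal] measurable_sprod[OF tf tf])
  have inner: "(\<integral>\<^sup>+\<omega>2. ennreal (v \<bullet> (X \<omega>2 *\<^sub>v v)) \<partial>M) \<le> ennreal ?N * (\<integral>\<^sup>+\<omega>2. ennreal (v \<bullet> v) \<partial>M)" if v: "v \<in> carrier_vec p" for v
  proof -
    have Xc: "X \<omega> \<in> carrier_mat p p" if "\<omega> \<in> space M" for \<omega> using measurable_borel_matD(1)[OF XM that] .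
    have i: "integrable M (\<lambda>\<omega>. v $ i * v $ j * X \<omega> $$ (i, j))" if "i < p" "j < p" for i j
      using int that by (auto simp: integrable_mat_def)
    have "(\<integral>\<^sup>+\<omega>2. ennreal (v \<bullet> (X \<omega>2 *\<^sub>v v)) \<partial>M) = (\<integral>\<^sup>+\<omega>. ennreal (\<Sum>i<p. \<Sum>j<p. v $ i * v $ j * X \<omega> $$ (i, j)) \<partial>M)"
      by (intro nn_integral_cong) (simp add: quadratic_entries[OF Xc v])
    also have "\<dots> = ennreal (expectation (\<lambda>\<omega>. \<Sum>i<p. \<Sum>j<p. v $ i * v $ j * X \<omega> $$ (i, j)))"
    proof (rule nn_integral_eq_integral)
      show "integrable M (\<lambda>\<omega>. \<Sum>i<p. \<Sum>j<p. v $ i * v $ j * X \<omega> $$ (i, j))"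
        by (intro Bochner_Integration.integrable_sum i) auto
      show "AE \<omega> in M. 0 \<le> (\<Sum>i<p. \<Sum>j<p. v $ i * v $ j * X \<omega> $$ (i, j))"
        using sym_psd_matsD(3)[OF psd v] quadratic_entries[OF Xc v] by (intro AE_I2) simp
    qed
    also have "expectation (\<lambda>\<omega>. \<Sum>i<p. \<Sum>j<p. v $ i * v $ j * X \<omega> $$ (i, j)) = (\<Sum>i<p. \<Sum>j<p. expectation (\<lambda>\<omega>. v $ i * v $ j * X \<omega> $$ (i, j)))"
      by (rule integral_double_sum) (rule i)
    also have "\<dots> = v \<bullet> (expectation_mat M p X *\<^sub>v v)"
      unfolding quadratic_entries[OF Ec v] by (simp add: expectation_mat_def)
    also have "ennreal \<dots> \<le> ennreal (?N * (v \<bullet> v))"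
      by (intro ennreal_leI spectral_norm_quadratic[OF Ec v p1])
    also have "\<dots> = ennreal ?N * (\<integral>\<^sup>+\<omega>2. ennreal (v \<bullet> v) \<partial>M)"
      using N0 by (simp add: ennreal_mult sprod_self_nonneg emeasure_space_1)
    finally show ?thesis .
  qed
  have tc: "t (\<omega>1, \<omega>3) \<in> carrier_vec p" if "\<omega>1 \<in> space M" "\<omega>3 \<in> space M" for \<omega>1 \<omega>3
    using measurable_borel_vecD(1)[OF t] that by (auto simp: space_pair_measure)
  have "(\<integral>\<^sup>+\<omega>. ennreal (t (\<omega>, \<omega>) \<bullet> (X \<omega> *\<^sub>v t (\<omega>, \<omega>))) \<partial>M)
    = (\<integral>\<^sup>+\<omega>3. (\<integral>\<^sup>+\<omega>1. (\<integral>\<^sup>+\<omega>2. ennreal (t (\<omega>1, \<omega>3) \<bullet> (X \<omega>2 *\<^sub>v t (\<omega>1, \<omega>3))) \<partial>M) \<partial>M) \<partial>M)"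
    using triple_decoupling[OF ak kb aklt k h] by simp
  also have "\<dots> \<le> (\<integral>\<^sup>+\<omega>3. (\<integral>\<^sup>+\<omega>1. ennreal ?N * (\<integral>\<^sup>+\<omega>2. ennreal (t (\<omega>1, \<omega>3) \<bullet> t (\<omega>1, \<omega>3)) \<partial>M) \<partial>M) \<partial>M)"
    by (intro nn_integral_mono inner tc)
  also have "\<dots> = (\<integral>\<^sup>+\<omega>3. (\<integral>\<^sup>+\<omega>1. (\<integral>\<^sup>+\<omega>2. ennreal ?N * ennreal (t (\<omega>1, \<omega>3) \<bullet> t (\<omega>1, \<omega>3)) \<partial>M) \<partial>M) \<partial>M)"
    by (simp add: emeasure_space_1)
  also have "\<dots> = (\<integral>\<^sup>+\<omega>. ennreal ?N * ennreal (t (\<omega>, \<omega>) \<bullet> t (\<omega>, \<omega>)) \<partial>M)"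
    using triple_decoupling[OF ak kb aklt k, of "\<lambda>q. ennreal ?N * ennreal (t (fst q) \<bullet> t (fst q))"] h2 by simp
  also have "\<dots> = ennreal ?N * (\<integral>\<^sup>+\<omega>. ennreal (t (\<omega>, \<omega>) \<bullet> t (\<omega>, \<omega>)) \<partial>M)"
  proof (rule nn_integral_cmult)
    have "(\<lambda>\<omega>. t (\<omega>, \<omega>)) \<in> M \<rightarrow>\<^sub>M borel_vec p"
      by (intro measurable_compose[OF _ t] measurable_Pair measurable_ident_subalgebra[OF sig_subalgebra])
    then show "(\<lambda>\<omega>. ennreal (t (\<omega>, \<omega>) \<bullet> t (\<omega>, \<omega>))) \<in> borel_measurable M"
      by (intro measurable_compose[OF _ measurable_ennreal] measurable_sprod)
  qed
  finally show ?thesis .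
qed

end

section \<open>Hybrid columns and the cost of removing neighbours\<close>

locale gaussian_columns = m_dependent_columns +
  fixes w :: "nat \<Rightarrow> 'a \<Rightarrow> real Matrix.vec"
  assumes w_normal: "\<And>k. k \<in> {1..n} \<Longrightarrow> std_normal_vec M p (w k)"
    and w_indep: "indep_vars (\<lambda>_. borel_vec p) w {1..n}"
    and w_S_indep: "indep_set (sets (gen_sigma M (borel_vec p) w {1..n})) (sets (gen_sigma M (borel_mat p) S {1..n}))"
begin

lemma w_rv: "k \<in> {1..n} \<Longrightarrow> w k \<in> M \<rightarrow>\<^sub>M borel_vec p"
  using w_normal by (simp add: std_normal_vec_def)

lemma w_carrier: "k \<in> {1..n} \<Longrightarrow> \<omega> \<in> space M \<Longrightarrow> w k \<omega> \<in> carrier_vec p"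
  using measurable_borel_vecD(1)[OF w_rv] .

text \<open>The radius is twice the dependence range: for k < j < k + m the late columns that are
  kept have index at least k + 2 m, hence are more than m away from j and independent of everything
  up to j. For m = 0 the set is empty.\<close>

definition nbhd :: "nat \<Rightarrow> nat set" where
  "nbhd k = {j \<in> {1..n}. j \<noteq> k \<and> \<bar>int j - int k\<bar> < 2 * int m}"

text \<open>The columns of the \<open>k\<close>-th hybrid, with the early columns, the late columns and the
  Gaussian vectors evaluated at separate points \<open>\<omega>1\<close>, \<open>\<omega>3\<close> and \<open>u\<close>.\<close>

definition hyb :: "nat \<Rightarrow> (nat \<Rightarrow> real Matrix.vec) \<Rightarrow> 'a \<Rightarrow> 'a \<Rightarrow> nat \<Rightarrow> real Matrix.vec" where
  "hyb k u \<omega>1 \<omega>3 j = (if j < k then psd_sqrt (S j \<omega>1) *\<^sub>v u j else y j \<omega>3)"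

definition far_res :: "nat \<Rightarrow> real \<Rightarrow> (nat \<Rightarrow> real Matrix.vec) \<Rightarrow> 'a \<Rightarrow> 'a \<Rightarrow> real mat" where
  "far_res k \<nu> u \<omega>1 \<omega>3 = resolv p n ({1..n} - {k} - nbhd k) (hyb k u \<omega>1 \<omega>3) \<nu>"

definition full_res :: "nat \<Rightarrow> real \<Rightarrow> (nat \<Rightarrow> real Matrix.vec) \<Rightarrow> 'a \<Rightarrow> real mat" where
  "full_res k \<nu> u \<omega> = resolv p n ({1..n} - {k}) (hyb k u \<omega> \<omega>) \<nu>"

text \<open>The quadratic forms of a matrix \<open>A\<close> in \<open>frame k i\<close>, \<open>i < p\<close>, add up to \<open>tr (S k A)\<close>,
  the one in \<open>frame k p\<close> is \<open>y k \<bullet> A y k\<close>.\<close>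

definition frame :: "nat \<Rightarrow> nat \<Rightarrow> 'a \<Rightarrow> real Matrix.vec" where
  "frame k i \<omega> = (if i < p then col (psd_sqrt (S k \<omega>)) i else y k \<omega>)"

text \<open>The trace factor in (A5), since y . y is the trace of the outer product. The next two
  definitions are the norm factors: \<open>cond_norm\<close> for the conditional sum,
  \<open>mean_norm\<close> for the unconditional one.\<close>

definition mass :: "nat \<Rightarrow> 'a \<Rightarrow> real" where
  "mass k \<omega> = y k \<omega> \<bullet> y k \<omega> + mat_trace (S k \<omega>)"

definition cond_norm :: "nat \<Rightarrow> nat \<Rightarrow> 'a \<Rightarrow> real" where
  "cond_norm a b \<omega> = spectral_norm (cond_exp_mat M (sig {1..a}) p (S b) \<omega>)
     + spectral_norm (cond_exp_mat M (sig {1..a}) p (\<lambda>\<omega>. outer_self (y b \<omega>)) \<omega>)"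

definition mean_norm :: "nat \<Rightarrow> real" where
  "mean_norm k = spectral_norm (expectation_mat M p (S k)) + spectral_norm (expectation_mat M p (\<lambda>\<omega>. outer_self (y k \<omega>)))"

context
  fixes u :: "nat \<Rightarrow> real Matrix.vec" and \<nu> :: real
  assumes u: "\<And>j. j \<in> {1..n} \<Longrightarrow> u j \<in> carrier_vec p" and nu: "\<nu> > 0"
begin

lemma hyb_carrier:
  assumes "j \<in> {1..n}" "\<omega>1 \<in> space M" "\<omega>3 \<in> space M"
  shows "hyb k u \<omega>1 \<omega>3 j \<in> carrier_vec p"
  using assms u y_carrier mult_mat_vec_carrier[OF psd_sqrt_carrier(1)[OF S_psd]] by (simp add: hyb_def)

lemma far_res_facts:
  assumes "\<omega>1 \<in> space M" "\<omega>3 \<in> space M"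
  shows "far_res k \<nu> u \<omega>1 \<omega>3 \<in> carrier_mat p p" "(far_res k \<nu> u \<omega>1 \<omega>3)\<^sup>T = far_res k \<nu> u \<omega>1 \<omega>3"
    "g \<in> carrier_vec p \<Longrightarrow> (far_res k \<nu> u \<omega>1 \<omega>3 *\<^sub>v g) \<bullet> (far_res k \<nu> u \<omega>1 \<omega>3 *\<^sub>v g) \<le> (g \<bullet> g) / \<nu>\<^sup>2"
    "far_res k \<nu> u \<omega>1 \<omega>3 \<in> sym_psd_mats p" "spectral_norm (far_res k \<nu> u \<omega>1 \<omega>3) \<le> 1 / \<nu>"
proof -
  have c: "\<And>j. j \<in> {1..n} - {k} - nbhd k \<Longrightarrow> hyb k u \<omega>1 \<omega>3 j \<in> carrier_vec p" using hyb_carrier assms by auto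
  show "far_res k \<nu> u \<omega>1 \<omega>3 \<in> carrier_mat p p" unfolding far_res_def by (rule resolv_carrier[OF c nu])
  show "(far_res k \<nu> u \<omega>1 \<omega>3)\<^sup>T = far_res k \<nu> u \<omega>1 \<omega>3" unfolding far_res_def by (rule resolv_symmetric[OF c nu])
  show "(far_res k \<nu> u \<omega>1 \<omega>3 *\<^sub>v g) \<bullet> (far_res k \<nu> u \<omega>1 \<omega>3 *\<^sub>v g) \<le> (g \<bullet> g) / \<nu>\<^sup>2" if "g \<in> carrier_vec p"
    unfolding far_res_def by (rule resolv_quadratic(2)[OF c nu that])
  show "far_res k \<nu> u \<omega>1 \<omega>3 \<in> sym_psd_mats p" unfolding far_res_def by (rule resolv_psd_norm(1)[OF c nu p1])
  show "spectral_norm (far_res k \<nu> u \<omega>1 \<omega>3) \<le> 1 / \<nu>" unfolding far_res_def by (rule resolv_psd_norm(2)[OF c nu p1])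
qed

lemma hyb_measurable:
  assumes j: "j \<in> {1..n}" and lo: "j < k \<Longrightarrow> j \<le> a" and hi: "\<not> j < k \<Longrightarrow> b \<le> j"
  shows "(\<lambda>q. hyb k u (fst q) (snd q) j) \<in> sig {1..a} \<Otimes>\<^sub>M sig {b..n} \<rightarrow>\<^sub>M borel_vec p"
proof (cases "j < k")
  case True
  have "(\<lambda>\<omega>. psd_sqrt (S j \<omega>) *\<^sub>v u j) \<in> sig {1..a} \<rightarrow>\<^sub>M borel_vec p"
    using j lo[OF True] u[OF j] by (intro measurable_mult_mat_vec sig_rv(3) measurable_const) auto
  from measurable_compose[OF measurable_fst this] show ?thesis using True by (simp add: hyb_def)
next
  case False
  have "y j \<in> sig {b..n} \<rightarrow>\<^sub>M borel_vec p" using j hi[OF False] by (intro sig_rv(1)) auto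
  from measurable_compose[OF measurable_snd this] show ?thesis using False by (simp add: hyb_def)
qed

lemma far_res_measurable:
  assumes "\<And>j. j \<in> {1..n} - {k} - nbhd k \<Longrightarrow> (j < k \<longrightarrow> j \<le> a) \<and> (k < j \<longrightarrow> b \<le> j)"
  shows "(\<lambda>q. far_res k \<nu> u (fst q) (snd q)) \<in> sig {1..a} \<Otimes>\<^sub>M sig {b..n} \<rightarrow>\<^sub>M borel_mat p"
proof -
  have "(\<lambda>q. resolv p n ({1..n} - {k} - nbhd k) (\<lambda>j. hyb k u (fst q) (snd q) j) \<nu>) \<in> sig {1..a} \<Otimes>\<^sub>M sig {b..n} \<rightarrow>\<^sub>M borel_mat p"
  proof (rule measurable_resolv)
    fix j assume j: "j \<in> {1..n} - {k} - nbhd k"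
    then have "j \<noteq> k" by auto
    with assms[OF j] j show "(\<lambda>q. hyb k u (fst q) (snd q) j) \<in> sig {1..a} \<Otimes>\<^sub>M sig {b..n} \<rightarrow>\<^sub>M borel_vec p"
      by (intro hyb_measurable) auto
  qed
  then show ?thesis by (simp add: far_res_def)
qed

lemma frame_measurable: "k \<in> I \<Longrightarrow> k \<in> {1..n} \<Longrightarrow> frame k i \<in> sig I \<rightarrow>\<^sub>M borel_vec p"
  unfolding frame_def[abs_def] by (cases "i < p") (auto intro!: measurable_mat_col sig_rv)

lemma frame_carrier: "k \<in> {1..n} \<Longrightarrow> \<omega> \<in> space M \<Longrightarrow> frame k i \<omega> \<in> carrier_vec p"
  using y_carrier col_psd_sqrt_carrier[OF S_psd] by (simp add: frame_def)

lemma frame_mass: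
  assumes "k \<in> {1..n}" "\<omega> \<in> space M"
  shows "(\<Sum>i\<le>p. frame k i \<omega> \<bullet> frame k i \<omega>) = mass k \<omega>"
  unfolding lessThan_Suc_atMost[symmetric] sum.lessThan_Suc mass_def trace_psd_cols[OF S_psd[OF assms]]
  by (simp add: frame_def)

lemma frame_quadratic:
  assumes "k \<in> {1..n}" "\<omega> \<in> space M" "t \<in> carrier_vec p"
  shows "(\<Sum>i\<le>p. (frame k i \<omega> \<bullet> t)\<^sup>2) = t \<bullet> (outer_self (y k \<omega>) *\<^sub>v t) + t \<bullet> (S k \<omega> *\<^sub>v t)"
  unfolding lessThan_Suc_atMost[symmetric] sum.lessThan_Suc sum_col_psd_sqrt_square[OF S_psd[OF assms(1,2)] assms(3), symmetric]
    outer_self_quadratic[OF y_carrier[OF assms(1,2)] assms(3)]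
  by (simp add: frame_def)

lemma outer_y_facts:
  assumes "k \<in> {1..n}"
  shows "k \<in> I \<Longrightarrow> (\<lambda>\<omega>. outer_self (y k \<omega>)) \<in> sig I \<rightarrow>\<^sub>M borel_mat p"
    "\<omega> \<in> space M \<Longrightarrow> outer_self (y k \<omega>) \<in> sym_psd_mats p"
  using assms by (auto intro!: measurable_outer_self sig_rv outer_self_psd y_carrier)

text \<open>A column after k is still the original \<open>y j\<close>. The frame vectors and the
  early part of the far resolvent are known given {1..k}, and the late part begins at k + 2 m, at
  least m beyond j. So the conditional norm of the outer product at j is multiplied by the second
  moments of the frame, which add up to \<open>mass k\<close>.\<close>

lemma removal_late:
  assumes k: "k \<in> {1..n}" and j: "j \<in> {1..n}" "k < j" "j < k + m"
  shows "(\<integral>\<^sup>+\<omega>. (\<Sum>i\<le>p. ennreal ((hyb k u \<omega> \<omega> j \<bullet> (far_res k \<nu> u \<omega> \<omega> *\<^sub>v frame k i \<omega>))\<^sup>2)) \<partial>M)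
    \<le> ennreal (1 / \<nu>\<^sup>2) * (\<integral>\<^sup>+\<omega>. ennreal (cond_norm k j \<omega> * mass k \<omega>) \<partial>M)"
proof -
  let ?N = "\<lambda>\<omega>. spectral_norm (cond_exp_mat M (sig {1..k}) p (\<lambda>\<omega>. outer_self (y j \<omega>)) \<omega>)"
  have cm: "(\<lambda>\<omega>. cond_exp_mat M (sig {1..k}) p X \<omega>) \<in> M \<rightarrow>\<^sub>M borel_mat p" for X
    by (rule measurable_borel_matI) (auto simp: cond_exp_mat_def)
  have N0: "0 \<le> spectral_norm (cond_exp_mat M (sig {1..k}) p X \<omega>)" for X \<omega>
    by (rule spectral_norm_nonneg[OF _ p1]) (simp add: cond_exp_mat_def)
  have fr: "(\<lambda>q. far_res k \<nu> u (fst q) (snd q)) \<in> sig {1..k} \<Otimes>\<^sub>M sig {k + 2 * m..n} \<rightarrow>\<^sub>M borel_mat p"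
    by (rule far_res_measurable) (auto simp: nbhd_def)
  have t: "(\<lambda>q. far_res k \<nu> u (fst q) (snd q) *\<^sub>v frame k i (fst q)) \<in> sig {1..k} \<Otimes>\<^sub>M sig {k + 2 * m..n} \<rightarrow>\<^sub>M borel_vec p" for i
    using k by (intro measurable_mult_mat_vec[OF fr] measurable_compose[OF measurable_fst frame_measurable]) auto
  have frM: "frame k i \<in> M \<rightarrow>\<^sub>M borel_vec p" for i by (rule sig_measurable_M[OF frame_measurable[of k "{k}"]]) (use k in auto)
  have farM: "(\<lambda>\<omega>. far_res k \<nu> u \<omega> \<omega>) \<in> M \<rightarrow>\<^sub>M borel_mat p"
    using measurable_compose[OF measurable_Pair[OF measurable_ident_subalgebra[OF sig_subalgebra] measurable_ident_subalgebra[OF sig_subalgebra]] fr] by simp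
  have hyb: "hyb k u \<omega> \<omega> j = y j \<omega>" for \<omega> using j by (simp add: hyb_def)
  have tM: "(\<lambda>\<omega>. far_res k \<nu> u \<omega> \<omega> *\<^sub>v frame k i \<omega>) \<in> M \<rightarrow>\<^sub>M borel_vec p" for i by (rule measurable_mult_mat_vec[OF farM frM])
  have termM: "(\<lambda>\<omega>. ennreal ((hyb k u \<omega> \<omega> j \<bullet> (far_res k \<nu> u \<omega> \<omega> *\<^sub>v frame k i \<omega>))\<^sup>2)) \<in> borel_measurable M" for i
    unfolding hyb by (intro measurable_compose[OF _ measurable_ennreal] borel_measurable_power measurable_sprod[OF y_rv[OF j(1)] tM])
  have one: "(\<integral>\<^sup>+\<omega>. ennreal ((hyb k u \<omega> \<omega> j \<bullet> (far_res k \<nu> u \<omega> \<omega> *\<^sub>v frame k i \<omega>))\<^sup>2) \<partial>M)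
      \<le> (\<integral>\<^sup>+\<omega>. ennreal (?N \<omega> * ((frame k i \<omega> \<bullet> frame k i \<omega>) / \<nu>\<^sup>2)) \<partial>M)" for i
  proof -
    have "(\<integral>\<^sup>+\<omega>. ennreal ((hyb k u \<omega> \<omega> j \<bullet> (far_res k \<nu> u \<omega> \<omega> *\<^sub>v frame k i \<omega>))\<^sup>2) \<partial>M)
      = (\<integral>\<^sup>+\<omega>. ennreal ((far_res k \<nu> u \<omega> \<omega> *\<^sub>v frame k i \<omega>) \<bullet> (outer_self (y j \<omega>) *\<^sub>v (far_res k \<nu> u \<omega> \<omega> *\<^sub>v frame k i \<omega>))) \<partial>M)"
      unfolding hyb
      by (intro nn_integral_cong) (simp only: outer_self_quadratic[OF y_carrier[OF j(1)] measurable_borel_vecD(1)[OF tM]])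
    also have "\<dots> \<le> (\<integral>\<^sup>+\<omega>. ennreal (?N \<omega> * ((frame k i \<omega> \<bullet> frame k i \<omega>) / \<nu>\<^sup>2)) \<partial>M)"
      using cond_pair_bound[of k j "k + 2 * m" "\<lambda>q. far_res k \<nu> u (fst q) (snd q) *\<^sub>v frame k i (fst q)" "\<lambda>\<omega>. outer_self (y j \<omega>)"
          "\<lambda>\<omega>. (frame k i \<omega> \<bullet> frame k i \<omega>) / \<nu>\<^sup>2"] j t[of i] outer_y_facts[OF j(1)] y_int[OF j(1)] far_res_facts(3) frame_carrier[OF k]
      by auto
    finally show ?thesis .
  qed
  have fm: "(\<lambda>\<omega>. ennreal (?N \<omega> * ((frame k i \<omega> \<bullet> frame k i \<omega>) / \<nu>\<^sup>2))) \<in> borel_measurable M" for i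
    by (intro measurable_compose[OF _ measurable_ennreal] borel_measurable_times borel_measurable_divide borel_measurable_const
        measurable_spectral_norm[OF cm p1] measurable_sprod[OF frM frM])
  have massM: "mass k \<in> borel_measurable M"
    unfolding mass_def[abs_def] by (intro borel_measurable_add measurable_sprod[OF y_rv[OF k] y_rv[OF k]] measurable_mat_trace[OF S_rv[OF k]])
  have cnM: "cond_norm k j \<in> borel_measurable M"
    unfolding cond_norm_def[abs_def] by (intro borel_measurable_add measurable_spectral_norm[OF cm p1])
  have "(\<integral>\<^sup>+\<omega>. (\<Sum>i\<le>p. ennreal ((hyb k u \<omega> \<omega> j \<bullet> (far_res k \<nu> u \<omega> \<omega> *\<^sub>v frame k i \<omega>))\<^sup>2)) \<partial>M)
    = (\<Sum>i\<le>p. \<integral>\<^sup>+\<omega>. ennreal ((hyb k u \<omega> \<omega> j \<bullet> (far_res k \<nu> u \<omega> \<omega> *\<^sub>v frame k i \<omega>))\<^sup>2) \<partial>M)"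
    by (rule nn_integral_sum) (rule termM)
  also have "\<dots> \<le> (\<Sum>i\<le>p. \<integral>\<^sup>+\<omega>. ennreal (?N \<omega> * ((frame k i \<omega> \<bullet> frame k i \<omega>) / \<nu>\<^sup>2)) \<partial>M)"
    by (intro sum_mono one)
  also have "\<dots> = (\<integral>\<^sup>+\<omega>. (\<Sum>i\<le>p. ennreal (?N \<omega> * ((frame k i \<omega> \<bullet> frame k i \<omega>) / \<nu>\<^sup>2))) \<partial>M)"
    by (rule nn_integral_sum[symmetric]) (rule fm)
  also have "\<dots> \<le> (\<integral>\<^sup>+\<omega>. ennreal (1 / \<nu>\<^sup>2) * ennreal (cond_norm k j \<omega> * mass k \<omega>) \<partial>M)"
  proof (rule nn_integral_mono)
    fix \<omega> assume w: "\<omega> \<in> space M"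
    have "(\<Sum>i\<le>p. ennreal (?N \<omega> * ((frame k i \<omega> \<bullet> frame k i \<omega>) / \<nu>\<^sup>2))) = ennreal (\<Sum>i\<le>p. ?N \<omega> * ((frame k i \<omega> \<bullet> frame k i \<omega>) / \<nu>\<^sup>2))"
      by (rule sum_ennreal) (intro mult_nonneg_nonneg N0 divide_nonneg_nonneg sprod_self_nonneg, simp)
    also have "(\<Sum>i\<le>p. ?N \<omega> * ((frame k i \<omega> \<bullet> frame k i \<omega>) / \<nu>\<^sup>2)) = 1 / \<nu>\<^sup>2 * (?N \<omega> * mass k \<omega>)"
      by (simp add: sum_distrib_left[symmetric] sum_divide_distrib[symmetric] frame_mass[OF k w])
    also have "ennreal \<dots> \<le> ennreal (1 / \<nu>\<^sup>2 * (cond_norm k j \<omega> * mass k \<omega>))"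
    proof (intro ennreal_leI mult_left_mono mult_right_mono)
      show "?N \<omega> \<le> cond_norm k j \<omega>" unfolding cond_norm_def using N0[of "S j" \<omega>] by simp
      show "0 \<le> mass k \<omega>" unfolding frame_mass[OF k w, symmetric] by (intro sum_nonneg sprod_self_nonneg)
    qed simp
    also have "\<dots> = ennreal (1 / \<nu>\<^sup>2) * ennreal (cond_norm k j \<omega> * mass k \<omega>)"
      by (rule ennreal_mult') simp
    finally show "(\<Sum>i\<le>p. ennreal (?N \<omega> * ((frame k i \<omega> \<bullet> frame k i \<omega>) / \<nu>\<^sup>2))) \<le> ennreal (1 / \<nu>\<^sup>2) * ennreal (cond_norm k j \<omega> * mass k \<omega>)" .
  qed
  also have "\<dots> = ennreal (1 / \<nu>\<^sup>2) * (\<integral>\<^sup>+\<omega>. ennreal (cond_norm k j \<omega> * mass k \<omega>) \<partial>M)"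
    by (rule nn_integral_cmult) (use massM cnM in measurable)
  finally show ?thesis .
qed

text \<open>Symmetry of the far resolvent moves it from the frame of k to column j. The sum over the
  frame then becomes the forms of the outer product and of \<open>S k\<close> in one vector
  \<open>t\<close>, so that the norm can be taken at k and the second moment at j.\<close>

lemma frame_sum_flip:
  assumes k: "k \<in> {1..n}" and j: "j \<in> {1..n}" and w: "\<omega> \<in> space M"
  defines "t \<equiv> far_res k \<nu> u \<omega> \<omega> *\<^sub>v hyb k u \<omega> \<omega> j"
  shows "(\<Sum>i\<le>p. ennreal ((hyb k u \<omega> \<omega> j \<bullet> (far_res k \<nu> u \<omega> \<omega> *\<^sub>v frame k i \<omega>))\<^sup>2))
    = ennreal (t \<bullet> (outer_self (y k \<omega>) *\<^sub>v t)) + ennreal (t \<bullet> (S k \<omega> *\<^sub>v t))"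
proof -
  note f = far_res_facts[OF w w, where k = k]
  note h = hyb_carrier[OF j w w, where k = k]
  have tc: "t \<in> carrier_vec p" unfolding t_def by (rule mult_mat_vec_carrier[OF f(1) h])
  have "(\<Sum>i\<le>p. ennreal ((hyb k u \<omega> \<omega> j \<bullet> (far_res k \<nu> u \<omega> \<omega> *\<^sub>v frame k i \<omega>))\<^sup>2)) = (\<Sum>i\<le>p. ennreal ((frame k i \<omega> \<bullet> t)\<^sup>2))"
    unfolding t_def by (intro sum.cong refl) (simp only: sprod_symmetric_mat[OF f(1,2) h frame_carrier[OF k w]])
  also have "\<dots> = ennreal (\<Sum>i\<le>p. (frame k i \<omega> \<bullet> t)\<^sup>2)" by (rule sum_ennreal) simp
  also have "\<dots> = ennreal (t \<bullet> (outer_self (y k \<omega>) *\<^sub>v t)) + ennreal (t \<bullet> (S k \<omega> *\<^sub>v t))"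
    unfolding frame_quadratic[OF k w tc]
    using sym_psd_matsD(3)[OF outer_y_facts(2)[OF k w] tc] sym_psd_matsD(3)[OF S_psd[OF k w] tc] by (rule ennreal_plus)
  finally show ?thesis .
qed

lemma removal_flip_measurable:
  assumes k: "k \<in> {1..n}" and j: "j \<in> {1..n}"
  defines "t \<equiv> \<lambda>\<omega>. far_res k \<nu> u \<omega> \<omega> *\<^sub>v hyb k u \<omega> \<omega> j"
  shows "(\<lambda>\<omega>. ennreal (t \<omega> \<bullet> (outer_self (y k \<omega>) *\<^sub>v t \<omega>))) \<in> borel_measurable M"
    "(\<lambda>\<omega>. ennreal (t \<omega> \<bullet> (S k \<omega> *\<^sub>v t \<omega>))) \<in> borel_measurable M"
proof -
  have id: "(\<lambda>\<omega>. (\<omega>, \<omega>)) \<in> M \<rightarrow>\<^sub>M sig {1..n} \<Otimes>\<^sub>M sig {0..n}"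
    by (intro measurable_Pair measurable_ident_subalgebra[OF sig_subalgebra])
  have f: "(\<lambda>q. far_res k \<nu> u (fst q) (snd q)) \<in> sig {1..n} \<Otimes>\<^sub>M sig {0..n} \<rightarrow>\<^sub>M borel_mat p"
    by (rule far_res_measurable) auto
  have h: "(\<lambda>q. hyb k u (fst q) (snd q) j) \<in> sig {1..n} \<Otimes>\<^sub>M sig {0..n} \<rightarrow>\<^sub>M borel_vec p"
    by (rule hyb_measurable) (use j in auto)
  have tM: "t \<in> M \<rightarrow>\<^sub>M borel_vec p"
    unfolding t_def using measurable_mult_mat_vec[OF measurable_compose[OF id f] measurable_compose[OF id h]] by simp
  show "(\<lambda>\<omega>. ennreal (t \<omega> \<bullet> (outer_self (y k \<omega>) *\<^sub>v t \<omega>))) \<in> borel_measurable M"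
    by (intro measurable_compose[OF _ measurable_ennreal] measurable_sprod[OF tM] measurable_mult_mat_vec[OF _ tM] measurable_outer_self y_rv k)
  show "(\<lambda>\<omega>. ennreal (t \<omega> \<bullet> (S k \<omega> *\<^sub>v t \<omega>))) \<in> borel_measurable M"
    by (intro measurable_compose[OF _ measurable_ennreal] measurable_sprod[OF tM] measurable_mult_mat_vec[OF _ tM] S_rv k)
qed

text \<open>Now j precedes k, so conditioning is on {1..j} and the roles are exchanged by
  \<open>frame_sum_flip\<close>: the norms belong to k, the squared length to column j. As this
  column is already Gaussian, its squared length is the form of \<open>S j\<close> in
  \<open>u j\<close>, which becomes a trace once the Gaussian vector is averaged.\<close>

lemma removal_early:
  assumes k: "k \<in> {1..n}" and j: "j \<in> {1..n}" "j < k" "k < j + m"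
  shows "(\<integral>\<^sup>+\<omega>. (\<Sum>i\<le>p. ennreal ((hyb k u \<omega> \<omega> j \<bullet> (far_res k \<nu> u \<omega> \<omega> *\<^sub>v frame k i \<omega>))\<^sup>2)) \<partial>M)
    \<le> ennreal (1 / \<nu>\<^sup>2) * (\<integral>\<^sup>+\<omega>. ennreal (cond_norm j k \<omega> * (u j \<bullet> (S j \<omega> *\<^sub>v u j))) \<partial>M)"
proof -
  let ?t = "\<lambda>q. far_res k \<nu> u (fst q) (snd q) *\<^sub>v hyb k u (fst q) (snd q) j"
  let ?T = "\<lambda>\<omega>. (u j \<bullet> (S j \<omega> *\<^sub>v u j)) / \<nu>\<^sup>2"
  let ?N = "\<lambda>X \<omega>. spectral_norm (cond_exp_mat M (sig {1..j}) p X \<omega>)"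
  have cm: "(\<lambda>\<omega>. cond_exp_mat M (sig {1..j}) p X \<omega>) \<in> M \<rightarrow>\<^sub>M borel_mat p" for X
    by (rule measurable_borel_matI) (auto simp: cond_exp_mat_def)
  have N0: "0 \<le> ?N X \<omega>" for X \<omega>
    by (rule spectral_norm_nonneg[OF _ p1]) (simp add: cond_exp_mat_def)
  have t: "?t \<in> sig {1..j} \<Otimes>\<^sub>M sig {k + 2 * m..n} \<rightarrow>\<^sub>M borel_vec p"
  proof (rule measurable_mult_mat_vec)
    show "(\<lambda>q. far_res k \<nu> u (fst q) (snd q)) \<in> sig {1..j} \<Otimes>\<^sub>M sig {k + 2 * m..n} \<rightarrow>\<^sub>M borel_mat p"
      by (rule far_res_measurable) (use j in \<open>auto simp: nbhd_def\<close>)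
    show "(\<lambda>q. hyb k u (fst q) (snd q) j) \<in> sig {1..j} \<Otimes>\<^sub>M sig {k + 2 * m..n} \<rightarrow>\<^sub>M borel_vec p"
      by (rule hyb_measurable) (use j in auto)
  qed
  have T: "?t (\<omega>1, \<omega>3) \<bullet> ?t (\<omega>1, \<omega>3) \<le> ?T \<omega>1" if w: "\<omega>1 \<in> space M" "\<omega>3 \<in> space M" for \<omega>1 \<omega>3
  proof -
    have "?t (\<omega>1, \<omega>3) \<bullet> ?t (\<omega>1, \<omega>3) \<le> (hyb k u \<omega>1 \<omega>3 j \<bullet> hyb k u \<omega>1 \<omega>3 j) / \<nu>\<^sup>2"
      using far_res_facts(3)[OF w hyb_carrier[OF j(1) w]] by simp
    also have "hyb k u \<omega>1 \<omega>3 j \<bullet> hyb k u \<omega>1 \<omega>3 j = u j \<bullet> (S j \<omega>1 *\<^sub>v u j)"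
      using j psd_sqrt_mult_vec_square[OF S_psd[OF j(1) w(1)] u[OF j(1)]] by (simp add: hyb_def)
    finally show ?thesis .
  qed
  have bound: "(\<integral>\<^sup>+\<omega>. ennreal (?t (\<omega>, \<omega>) \<bullet> (X \<omega> *\<^sub>v ?t (\<omega>, \<omega>))) \<partial>M) \<le> (\<integral>\<^sup>+\<omega>. ennreal (?N X \<omega> * ?T \<omega>) \<partial>M)"
    if "X \<in> sig {1..k} \<rightarrow>\<^sub>M borel_mat p" "\<And>\<omega>. \<omega> \<in> space M \<Longrightarrow> X \<omega> \<in> sym_psd_mats p" "integrable_mat M p X" for X
    by (rule cond_pair_bound[where e = k and b = "k + 2 * m" and t = ?t, OF _ _ t that]) (use j T in auto)
  have uc: "(\<lambda>_. u j) \<in> M \<rightarrow>\<^sub>M borel_vec p" using u[OF j(1)] by (intro measurable_const) simp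
  have uSm: "(\<lambda>\<omega>. u j \<bullet> (S j \<omega> *\<^sub>v u j)) \<in> borel_measurable M"
    by (rule measurable_sprod[OF uc measurable_mult_mat_vec[OF S_rv[OF j(1)] uc]])
  have Tm: "?T \<in> borel_measurable M"
    by (intro borel_measurable_divide borel_measurable_const uSm)
  have fm: "(\<lambda>\<omega>. ennreal (?N X \<omega> * ?T \<omega>)) \<in> borel_measurable M" for X
    by (intro measurable_compose[OF _ measurable_ennreal] borel_measurable_times measurable_spectral_norm[OF cm p1] Tm)
  have T0: "0 \<le> u j \<bullet> (S j \<omega> *\<^sub>v u j)" if "\<omega> \<in> space M" for \<omega>
    using sym_psd_matsD(3)[OF S_psd[OF j(1) that] u[OF j(1)]] .
  have "(\<integral>\<^sup>+\<omega>. (\<Sum>i\<le>p. ennreal ((hyb k u \<omega> \<omega> j \<bullet> (far_res k \<nu> u \<omega> \<omega> *\<^sub>v frame k i \<omega>))\<^sup>2)) \<partial>M)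
    = (\<integral>\<^sup>+\<omega>. ennreal (?t (\<omega>, \<omega>) \<bullet> (outer_self (y k \<omega>) *\<^sub>v ?t (\<omega>, \<omega>))) + ennreal (?t (\<omega>, \<omega>) \<bullet> (S k \<omega> *\<^sub>v ?t (\<omega>, \<omega>))) \<partial>M)"
    by (rule nn_integral_cong) (unfold fst_conv snd_conv, rule frame_sum_flip[OF k j(1)])
  also have "\<dots> = (\<integral>\<^sup>+\<omega>. ennreal (?t (\<omega>, \<omega>) \<bullet> (outer_self (y k \<omega>) *\<^sub>v ?t (\<omega>, \<omega>))) \<partial>M) + (\<integral>\<^sup>+\<omega>. ennreal (?t (\<omega>, \<omega>) \<bullet> (S k \<omega> *\<^sub>v ?t (\<omega>, \<omega>))) \<partial>M)"
    by (rule nn_integral_add) (use removal_flip_measurable[OF k j(1)] in simp_all)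
  also have "\<dots> \<le> (\<integral>\<^sup>+\<omega>. ennreal (?N (\<lambda>\<omega>. outer_self (y k \<omega>)) \<omega> * ?T \<omega>) \<partial>M) + (\<integral>\<^sup>+\<omega>. ennreal (?N (S k) \<omega> * ?T \<omega>) \<partial>M)"
    using k by (intro add_mono bound outer_y_facts y_int S_int S_psd sig_rv) auto
  also have "\<dots> = (\<integral>\<^sup>+\<omega>. ennreal (?N (\<lambda>\<omega>. outer_self (y k \<omega>)) \<omega> * ?T \<omega>) + ennreal (?N (S k) \<omega> * ?T \<omega>) \<partial>M)"
    by (rule nn_integral_add[symmetric]) (rule fm)+
  also have "\<dots> = (\<integral>\<^sup>+\<omega>. ennreal (1 / \<nu>\<^sup>2) * ennreal (cond_norm j k \<omega> * (u j \<bullet> (S j \<omega> *\<^sub>v u j))) \<partial>M)"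
  proof (rule nn_integral_cong)
    fix \<omega> assume w: "\<omega> \<in> space M"
    define a b c where "a = ?N (\<lambda>\<omega>. outer_self (y k \<omega>)) \<omega>" and "b = ?N (S k) \<omega>" and "c = u j \<bullet> (S j \<omega> *\<^sub>v u j)"
    have nn: "0 \<le> a" "0 \<le> b" "0 \<le> c" using N0 T0[OF w] by (auto simp: a_def b_def c_def)
    have "ennreal (a * (c / \<nu>\<^sup>2)) + ennreal (b * (c / \<nu>\<^sup>2)) = ennreal (a * (c / \<nu>\<^sup>2) + b * (c / \<nu>\<^sup>2))"
      using nn by (intro ennreal_plus[symmetric]) auto
    also have "a * (c / \<nu>\<^sup>2) + b * (c / \<nu>\<^sup>2) = 1 / \<nu>\<^sup>2 * ((b + a) * c)" by (simp add: algebra_simps add_divide_distrib)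
    also have "ennreal \<dots> = ennreal (1 / \<nu>\<^sup>2) * ennreal ((b + a) * c)" by (rule ennreal_mult') simp
    finally show "ennreal (?N (\<lambda>\<omega>. outer_self (y k \<omega>)) \<omega> * ?T \<omega>) + ennreal (?N (S k) \<omega> * ?T \<omega>)
      = ennreal (1 / \<nu>\<^sup>2) * ennreal (cond_norm j k \<omega> * (u j \<bullet> (S j \<omega> *\<^sub>v u j)))"
      by (simp only: a_def b_def c_def cond_norm_def)
  qed
  also have "\<dots> = ennreal (1 / \<nu>\<^sup>2) * (\<integral>\<^sup>+\<omega>. ennreal (cond_norm j k \<omega> * (u j \<bullet> (S j \<omega> *\<^sub>v u j))) \<partial>M)"
  proof (rule nn_integral_cmult)
    show "(\<lambda>\<omega>. ennreal (cond_norm j k \<omega> * (u j \<bullet> (S j \<omega> *\<^sub>v u j)))) \<in> borel_measurable M"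
      unfolding cond_norm_def
      by (intro measurable_compose[OF _ measurable_ennreal] borel_measurable_times borel_measurable_add
          measurable_spectral_norm[OF cm p1] uSm)
  qed
  finally show ?thesis .
qed

text \<open>At distance at least m both column j and the far resolvent are measurable for {1..k - m}
  and {k + m..n}, so the k-th pair is independent of them and its mean may be used. This produces
  the summands of the second part of (A5).\<close>

lemma removal_far:
  assumes k: "k \<in> {1..n}" and j: "j \<in> {1..n}" "int m \<le> \<bar>int j - int k\<bar>" and m: "m \<ge> 1"
  shows "(\<integral>\<^sup>+\<omega>. (\<Sum>i\<le>p. ennreal ((hyb k u \<omega> \<omega> j \<bullet> (far_res k \<nu> u \<omega> \<omega> *\<^sub>v frame k i \<omega>))\<^sup>2)) \<partial>M)
    \<le> ennreal (1 / \<nu>\<^sup>2) * (ennreal (mean_norm k) * (\<integral>\<^sup>+\<omega>. ennreal (hyb k u \<omega> \<omega> j \<bullet> hyb k u \<omega> \<omega> j) \<partial>M))"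
proof -
  let ?t = "\<lambda>q. far_res k \<nu> u (fst q) (snd q) *\<^sub>v hyb k u (fst q) (snd q) j"
  let ?N = "\<lambda>X. spectral_norm (expectation_mat M p X)"
  have N0: "0 \<le> ?N X" for X
    by (rule spectral_norm_nonneg[OF _ p1]) (simp add: expectation_mat_def)
  have t: "?t \<in> sig {1..k - m} \<Otimes>\<^sub>M sig {k + m..n} \<rightarrow>\<^sub>M borel_vec p"
  proof (rule measurable_mult_mat_vec)
    show "(\<lambda>q. far_res k \<nu> u (fst q) (snd q)) \<in> sig {1..k - m} \<Otimes>\<^sub>M sig {k + m..n} \<rightarrow>\<^sub>M borel_mat p"
      by (rule far_res_measurable) (auto simp: nbhd_def)
    show "(\<lambda>q. hyb k u (fst q) (snd q) j) \<in> sig {1..k - m} \<Otimes>\<^sub>M sig {k + m..n} \<rightarrow>\<^sub>M borel_vec p"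
      by (rule hyb_measurable) (use j m in auto)
  qed
  let ?I = "\<integral>\<^sup>+\<omega>. ennreal (hyb k u \<omega> \<omega> j \<bullet> hyb k u \<omega> \<omega> j) \<partial>M"
  have hM: "(\<lambda>\<omega>. hyb k u \<omega> \<omega> j) \<in> M \<rightarrow>\<^sub>M borel_vec p"
  proof -
    have id: "(\<lambda>\<omega>. (\<omega>, \<omega>)) \<in> M \<rightarrow>\<^sub>M sig {1..n} \<Otimes>\<^sub>M sig {0..n}"
      by (intro measurable_Pair measurable_ident_subalgebra[OF sig_subalgebra])
    have "(\<lambda>q. hyb k u (fst q) (snd q) j) \<in> sig {1..n} \<Otimes>\<^sub>M sig {0..n} \<rightarrow>\<^sub>M borel_vec p"
      by (rule hyb_measurable) (use j in auto)
    from measurable_compose[OF id this] show ?thesis by simp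
  qed
  have tt: "(\<integral>\<^sup>+\<omega>. ennreal (?t (\<omega>, \<omega>) \<bullet> ?t (\<omega>, \<omega>)) \<partial>M) \<le> ennreal (1 / \<nu>\<^sup>2) * ?I"
  proof -
    have "(\<integral>\<^sup>+\<omega>. ennreal (?t (\<omega>, \<omega>) \<bullet> ?t (\<omega>, \<omega>)) \<partial>M) \<le> (\<integral>\<^sup>+\<omega>. ennreal (1 / \<nu>\<^sup>2) * ennreal (hyb k u \<omega> \<omega> j \<bullet> hyb k u \<omega> \<omega> j) \<partial>M)"
    proof (rule nn_integral_mono)
      fix \<omega> assume w: "\<omega> \<in> space M"
      have "?t (\<omega>, \<omega>) \<bullet> ?t (\<omega>, \<omega>) \<le> 1 / \<nu>\<^sup>2 * (hyb k u \<omega> \<omega> j \<bullet> hyb k u \<omega> \<omega> j)"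
        using far_res_facts(3)[OF w w hyb_carrier[OF j(1) w w]] by simp
      then have "ennreal (?t (\<omega>, \<omega>) \<bullet> ?t (\<omega>, \<omega>)) \<le> ennreal (1 / \<nu>\<^sup>2 * (hyb k u \<omega> \<omega> j \<bullet> hyb k u \<omega> \<omega> j))" by (rule ennreal_leI)
      then show "ennreal (?t (\<omega>, \<omega>) \<bullet> ?t (\<omega>, \<omega>)) \<le> ennreal (1 / \<nu>\<^sup>2) * ennreal (hyb k u \<omega> \<omega> j \<bullet> hyb k u \<omega> \<omega> j)"
        by (simp add: ennreal_mult sprod_self_nonneg del: times_divide_eq_left)
    qed
    also have "\<dots> = ennreal (1 / \<nu>\<^sup>2) * ?I"
      by (intro nn_integral_cmult measurable_compose[OF _ measurable_ennreal] measurable_sprod[OF hM hM])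
    finally show ?thesis .
  qed
  have bound: "(\<integral>\<^sup>+\<omega>. ennreal (?t (\<omega>, \<omega>) \<bullet> (X \<omega> *\<^sub>v ?t (\<omega>, \<omega>))) \<partial>M) \<le> ennreal (?N X) * (ennreal (1 / \<nu>\<^sup>2) * ?I)"
    if "X \<in> sig {k} \<rightarrow>\<^sub>M borel_mat p" "\<And>\<omega>. \<omega> \<in> space M \<Longrightarrow> X \<omega> \<in> sym_psd_mats p" "integrable_mat M p X" for X
  proof -
    have "(\<integral>\<^sup>+\<omega>. ennreal (?t (\<omega>, \<omega>) \<bullet> (X \<omega> *\<^sub>v ?t (\<omega>, \<omega>))) \<partial>M) \<le> ennreal (?N X) * (\<integral>\<^sup>+\<omega>. ennreal (?t (\<omega>, \<omega>) \<bullet> ?t (\<omega>, \<omega>)) \<partial>M)"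
      by (rule uncond_pair_bound[where t = ?t, OF _ _ _ k t that]) (use m in auto)
    also have "\<dots> \<le> ennreal (?N X) * (ennreal (1 / \<nu>\<^sup>2) * ?I)" by (intro mult_left_mono tt) simp
    finally show ?thesis .
  qed
  have "(\<integral>\<^sup>+\<omega>. (\<Sum>i\<le>p. ennreal ((hyb k u \<omega> \<omega> j \<bullet> (far_res k \<nu> u \<omega> \<omega> *\<^sub>v frame k i \<omega>))\<^sup>2)) \<partial>M)
    = (\<integral>\<^sup>+\<omega>. ennreal (?t (\<omega>, \<omega>) \<bullet> (outer_self (y k \<omega>) *\<^sub>v ?t (\<omega>, \<omega>))) + ennreal (?t (\<omega>, \<omega>) \<bullet> (S k \<omega> *\<^sub>v ?t (\<omega>, \<omega>))) \<partial>M)"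
    by (rule nn_integral_cong) (unfold fst_conv snd_conv, rule frame_sum_flip[OF k j(1)])
  also have "\<dots> = (\<integral>\<^sup>+\<omega>. ennreal (?t (\<omega>, \<omega>) \<bullet> (outer_self (y k \<omega>) *\<^sub>v ?t (\<omega>, \<omega>))) \<partial>M) + (\<integral>\<^sup>+\<omega>. ennreal (?t (\<omega>, \<omega>) \<bullet> (S k \<omega> *\<^sub>v ?t (\<omega>, \<omega>))) \<partial>M)"
    by (rule nn_integral_add) (use removal_flip_measurable[OF k j(1)] in simp_all)
  also have "\<dots> \<le> ennreal (?N (\<lambda>\<omega>. outer_self (y k \<omega>))) * (ennreal (1 / \<nu>\<^sup>2) * ?I) + ennreal (?N (S k)) * (ennreal (1 / \<nu>\<^sup>2) * ?I)"
    using k by (intro add_mono bound outer_y_facts y_int S_int S_psd sig_rv) auto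
  also have "\<dots> = ennreal (1 / \<nu>\<^sup>2) * (ennreal (mean_norm k) * ?I)"
    unfolding mean_norm_def ennreal_plus[OF N0 N0] by (simp only: distrib_left distrib_right mult_ac add_ac)
  finally show ?thesis .
qed

text \<open>The far resolvent is independent of \<open>(y k, S k)\<close>, so a bound that is uniform over
  deterministic matrices applies to it.\<close>

lemma far_form_deviation:
  assumes k: "k \<in> {1..n}" and K: "K \<ge> 0" and th: "\<theta> \<ge> 0"
    and sup: "\<And>A. A \<in> sym_psd_mats p \<Longrightarrow> spectral_norm A \<le> 1 / \<nu> \<Longrightarrow>
      prob {\<omega> \<in> space M. \<bar>y k \<omega> \<bullet> (A *\<^sub>v y k \<omega>) - mat_trace (S k \<omega> * A)\<bar> > \<theta>} \<le> s"
  shows "(\<integral>\<^sup>+\<omega>. ennreal (min K (\<bar>y k \<omega> \<bullet> (far_res k \<nu> u \<omega> \<omega> *\<^sub>v y k \<omega>) - mat_trace (S k \<omega> * far_res k \<nu> u \<omega> \<omega>)\<bar> / real n)) \<partial>M)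
    \<le> ennreal (\<theta> / real n + K * s)"
proof -
  \<comment> \<open>The far resolvent leaves out at least the indices at distance below
    \<open>d\<close>. The value 1 for m = 0 keeps both index ranges away from k itself.\<close>
  define d where "d = max (2 * m) 1"
  define D where "D q = \<bar>y k (snd q) \<bullet> (far_res k \<nu> u (fst (fst q)) (snd (fst q)) *\<^sub>v y k (snd q)) - mat_trace (S k (snd q) * far_res k \<nu> u (fst (fst q)) (snd (fst q)))\<bar>" for q
  have fr: "(\<lambda>q. far_res k \<nu> u (fst q) (snd q)) \<in> sig {1..k - d} \<Otimes>\<^sub>M sig {k + d..n} \<rightarrow>\<^sub>M borel_mat p"
    by (rule far_res_measurable) (auto simp: nbhd_def d_def)
  let ?S3 = "(sig {1..k - d} \<Otimes>\<^sub>M sig {k + d..n}) \<Otimes>\<^sub>M sig {k}"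
  have fr3: "(\<lambda>q. far_res k \<nu> u (fst (fst q)) (snd (fst q))) \<in> ?S3 \<rightarrow>\<^sub>M borel_mat p"
    by (rule measurable_compose[OF measurable_fst fr])
  have y3: "(\<lambda>q. y k (snd q)) \<in> ?S3 \<rightarrow>\<^sub>M borel_vec p" "(\<lambda>q. S k (snd q)) \<in> ?S3 \<rightarrow>\<^sub>M borel_mat p"
    using k by (auto intro!: measurable_compose[OF measurable_snd] sig_rv)
  have Dm: "D \<in> borel_measurable ?S3"
    unfolding D_def[abs_def] by (intro borel_measurable_abs borel_measurable_diff measurable_sprod[OF y3(1) measurable_mult_mat_vec[OF fr3 y3(1)]] measurable_mat_trace_mult[OF y3(2) fr3])
  have hm: "(\<lambda>q. indicator {\<theta><..} (D q)) \<in> borel_measurable ?S3"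
    by (rule measurable_compose[OF Dm]) simp
  have s0: "0 \<le> s"
  proof -
    obtain \<omega> where w: "\<omega> \<in> space M" using not_empty by blast
    show ?thesis by (rule order_trans[OF measure_nonneg sup]) (rule far_res_facts(4,5)[OF w w])+
  qed
  have inner: "(\<integral>\<^sup>+\<omega>2. indicator {\<theta><..} (D ((\<omega>1, \<omega>3), \<omega>2)) \<partial>M) \<le> ennreal s" if w: "\<omega>1 \<in> space M" "\<omega>3 \<in> space M" for \<omega>1 \<omega>3
  proof -
    let ?A = "far_res k \<nu> u \<omega>1 \<omega>3"
    have Ac: "(\<lambda>_. ?A) \<in> M \<rightarrow>\<^sub>M borel_mat p" using far_res_facts(1)[OF w] by (intro measurable_const) simp
    have m: "{\<omega> \<in> space M. \<bar>y k \<omega> \<bullet> (?A *\<^sub>v y k \<omega>) - mat_trace (S k \<omega> * ?A)\<bar> > \<theta>} \<in> events"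
    proof -
      note [measurable] = measurable_sprod[OF y_rv[OF k] measurable_mult_mat_vec[OF Ac y_rv[OF k]]] measurable_mat_trace_mult[OF S_rv[OF k] Ac]
      show ?thesis by measurable
    qed
    have "(\<integral>\<^sup>+\<omega>2. indicator {\<theta><..} (D ((\<omega>1, \<omega>3), \<omega>2)) \<partial>M)
      = (\<integral>\<^sup>+\<omega>2. indicator {\<omega> \<in> space M. \<bar>y k \<omega> \<bullet> (?A *\<^sub>v y k \<omega>) - mat_trace (S k \<omega> * ?A)\<bar> > \<theta>} \<omega>2 \<partial>M)"
      by (intro nn_integral_cong) (auto simp: D_def indicator_def)
    also have "\<dots> = ennreal (prob {\<omega> \<in> space M. \<bar>y k \<omega> \<bullet> (?A *\<^sub>v y k \<omega>) - mat_trace (S k \<omega> * ?A)\<bar> > \<theta>})"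
      using m by (simp add: emeasure_eq_measure)
    also have "\<dots> \<le> ennreal s" by (intro ennreal_leI sup far_res_facts w)
    finally show ?thesis .
  qed
  have DM: "(\<lambda>\<omega>. D ((\<omega>, \<omega>), \<omega>)) \<in> borel_measurable M"
    by (intro measurable_compose[OF _ Dm] measurable_Pair measurable_ident_subalgebra[OF sig_subalgebra])
  have "(\<integral>\<^sup>+\<omega>. ennreal (min K (D ((\<omega>, \<omega>), \<omega>) / real n)) \<partial>M) \<le> (\<integral>\<^sup>+\<omega>. ennreal (\<theta> / real n) + ennreal K * indicator {\<theta><..} (D ((\<omega>, \<omega>), \<omega>)) \<partial>M)"
  proof (rule nn_integral_mono)
    fix \<omega>
    show "ennreal (min K (D ((\<omega>, \<omega>), \<omega>) / real n)) \<le> ennreal (\<theta> / real n) + ennreal K * indicator {\<theta><..} (D ((\<omega>, \<omega>), \<omega>))"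
    proof (cases "D ((\<omega>, \<omega>), \<omega>) > \<theta>")
      case True
      have "ennreal (min K (D ((\<omega>, \<omega>), \<omega>) / real n)) \<le> ennreal K" by (rule ennreal_leI) simp
      also have "\<dots> \<le> ennreal (\<theta> / real n) + ennreal K" by simp
      finally show ?thesis using True by simp
    next
      case False
      then have "ennreal (min K (D ((\<omega>, \<omega>), \<omega>) / real n)) \<le> ennreal (\<theta> / real n)"
        by (intro ennreal_leI) (simp add: min.coboundedI2 divide_right_mono)
      then show ?thesis using False by simp
    qed
  qed
  also have "\<dots> = ennreal (\<theta> / real n) + ennreal K * (\<integral>\<^sup>+\<omega>. indicator {\<theta><..} (D ((\<omega>, \<omega>), \<omega>)) \<partial>M)"
  proof -
    have i: "(\<lambda>\<omega>. indicator {\<theta><..} (D ((\<omega>, \<omega>), \<omega>)) :: ennreal) \<in> borel_measurable M"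
      by (rule measurable_compose[OF DM]) simp
    then have "(\<integral>\<^sup>+\<omega>. ennreal (\<theta> / real n) + ennreal K * indicator {\<theta><..} (D ((\<omega>, \<omega>), \<omega>)) \<partial>M)
      = (\<integral>\<^sup>+\<omega>. ennreal (\<theta> / real n) \<partial>M) + (\<integral>\<^sup>+\<omega>. ennreal K * indicator {\<theta><..} (D ((\<omega>, \<omega>), \<omega>)) \<partial>M)"
      by (intro nn_integral_add) auto
    then show ?thesis using nn_integral_cmult[OF i, of "ennreal K"] by (simp add: emeasure_space_1)
  qed
  also have "(\<integral>\<^sup>+\<omega>. indicator {\<theta><..} (D ((\<omega>, \<omega>), \<omega>)) \<partial>M) = (\<integral>\<^sup>+\<omega>3. (\<integral>\<^sup>+\<omega>1. (\<integral>\<^sup>+\<omega>2. indicator {\<theta><..} (D ((\<omega>1, \<omega>3), \<omega>2)) \<partial>M) \<partial>M) \<partial>M)"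
    by (rule triple_decoupling[OF _ _ _ k hm]) (auto simp: d_def)
  also have "\<dots> \<le> (\<integral>\<^sup>+\<omega>3. (\<integral>\<^sup>+\<omega>1. ennreal s \<partial>M) \<partial>M)" by (intro nn_integral_mono inner)
  also have "\<dots> = ennreal s" by (simp add: emeasure_space_1)
  finally have "(\<integral>\<^sup>+\<omega>. ennreal (min K (D ((\<omega>, \<omega>), \<omega>) / real n)) \<partial>M) \<le> ennreal (\<theta> / real n) + ennreal K * ennreal s"
    by (simp add: mult_left_mono add_left_mono)
  also have "\<dots> = ennreal (\<theta> / real n + K * s)" using K s0 th by (simp add: ennreal_mult ennreal_plus)
  finally show ?thesis by (simp add: D_def)
qed

end

end

text \<open>Chebyshev's inequality in truncated form: the integrand is at most \<theta> / n where
  the deviation X is at most \<theta> in modulus, and at most K <= K X^2 / \<theta>^2 elsewhere. The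
  variance is twice the squared Frobenius norm of the matrix A conjugated by the root of S,
  controlled by \<open>frobenius_sandwich\<close>.\<close>

lemma (in prob_space) gauss_form_deviation:
  assumes w: "std_normal_vec M p w" and S: "S \<in> sym_psd_mats p"
    and A: "A \<in> carrier_mat p p" "A\<^sup>T = A" and c: "\<And>v. v \<in> carrier_vec p \<Longrightarrow> (A *\<^sub>v v) \<bullet> (A *\<^sub>v v) \<le> c\<^sup>2 * (v \<bullet> v)"
    and K: "K \<ge> 0" and th: "\<theta> > 0"
  shows "(\<integral>\<^sup>+\<omega>. ennreal (min K (\<bar>(psd_sqrt S *\<^sub>v w \<omega>) \<bullet> (A *\<^sub>v (psd_sqrt S *\<^sub>v w \<omega>)) - mat_trace (S * A)\<bar> / real n)) \<partial>M)
    \<le> ennreal (\<theta> / real n + K * (2 * (c\<^sup>2 * mat_trace (S * S))) / \<theta>\<^sup>2)"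
proof -
  let ?B = "psd_sqrt S * A * psd_sqrt S"
  have wM: "w \<in> M \<rightarrow>\<^sub>M borel_vec p" using w by (simp add: std_normal_vec_def)
  have Bc: "?B \<in> carrier_mat p p" by (rule sandwich_carrier[OF S A(1)])
  define X where "X \<omega> = w \<omega> \<bullet> (?B *\<^sub>v w \<omega>) - mat_trace ?B" for \<omega>
  have XM: "X \<in> borel_measurable M"
    unfolding X_def[abs_def] using Bc by (intro borel_measurable_diff measurable_sprod[OF wM measurable_mult_mat_vec[OF _ wM]] measurable_const) simp_all
  have SS: "0 \<le> mat_trace (S * S)"
  proof -
    note sS = sym_psd_matsD(1,2)[OF S]
    show ?thesis unfolding trace_square_symmetric[OF sS] frobenius_def by (intro sum_nonneg) simp
  qed
  have "(\<integral>\<^sup>+\<omega>. ennreal (min K (\<bar>(psd_sqrt S *\<^sub>v w \<omega>) \<bullet> (A *\<^sub>v (psd_sqrt S *\<^sub>v w \<omega>)) - mat_trace (S * A)\<bar> / real n)) \<partial>M)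
      = (\<integral>\<^sup>+\<omega>. ennreal (min K (\<bar>X \<omega>\<bar> / real n)) \<partial>M)"
    by (intro nn_integral_cong) (simp only: X_def quadratic_sandwich[OF S A(1) measurable_borel_vecD(1)[OF wM]] trace_sandwich[OF S A(1)])
  also have "\<dots> \<le> (\<integral>\<^sup>+\<omega>. ennreal (\<theta> / real n) + ennreal (K / \<theta>\<^sup>2) * ennreal ((X \<omega>)\<^sup>2) \<partial>M)"
  proof (rule nn_integral_mono)
    fix \<omega>
    have "min K (\<bar>X \<omega>\<bar> / real n) \<le> \<theta> / real n + K / \<theta>\<^sup>2 * (X \<omega>)\<^sup>2"
    proof (cases "\<bar>X \<omega>\<bar> \<le> \<theta>")
      case True
      then have "\<bar>X \<omega>\<bar> / real n \<le> \<theta> / real n" by (rule divide_right_mono) simp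
      then have "min K (\<bar>X \<omega>\<bar> / real n) \<le> \<theta> / real n" by linarith
      also have "\<dots> \<le> \<theta> / real n + K / \<theta>\<^sup>2 * (X \<omega>)\<^sup>2" using K by simp
      finally show ?thesis .
    next
      case False
      then have "\<theta>\<^sup>2 \<le> (X \<omega>)\<^sup>2" using th power_mono[of \<theta> "\<bar>X \<omega>\<bar>" 2] by simp
      then have "K * 1 \<le> K * ((X \<omega>)\<^sup>2 / \<theta>\<^sup>2)" using K th by (intro mult_left_mono) (auto simp: le_divide_eq)
      moreover have "0 \<le> \<theta> / real n" using th by simp
      ultimately show ?thesis by (simp add: min_def)
    qed
    then have "ennreal (min K (\<bar>X \<omega>\<bar> / real n)) \<le> ennreal (\<theta> / real n + K / \<theta>\<^sup>2 * (X \<omega>)\<^sup>2)" by (rule ennreal_leI)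
    also have "\<dots> = ennreal (\<theta> / real n) + ennreal (K / \<theta>\<^sup>2) * ennreal ((X \<omega>)\<^sup>2)"
      using K th by (simp add: ennreal_mult' ennreal_plus del: times_divide_eq_left)
    finally show "ennreal (min K (\<bar>X \<omega>\<bar> / real n)) \<le> ennreal (\<theta> / real n) + ennreal (K / \<theta>\<^sup>2) * ennreal ((X \<omega>)\<^sup>2)" .
  qed
  also have "\<dots> = ennreal (\<theta> / real n) + ennreal (K / \<theta>\<^sup>2) * (\<integral>\<^sup>+\<omega>. ennreal ((X \<omega>)\<^sup>2) \<partial>M)"
  proof -
    have i: "(\<lambda>\<omega>. ennreal ((X \<omega>)\<^sup>2)) \<in> borel_measurable M" using XM by measurable
    have "(\<integral>\<^sup>+\<omega>. ennreal (\<theta> / real n) + ennreal (K / \<theta>\<^sup>2) * ennreal ((X \<omega>)\<^sup>2) \<partial>M)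
      = (\<integral>\<^sup>+\<omega>. ennreal (\<theta> / real n) \<partial>M) + (\<integral>\<^sup>+\<omega>. ennreal (K / \<theta>\<^sup>2) * ennreal ((X \<omega>)\<^sup>2) \<partial>M)"
      by (rule nn_integral_add) (use i in measurable)
    then show ?thesis using nn_integral_cmult[OF i, of "ennreal (K / \<theta>\<^sup>2)"] by (simp add: emeasure_space_1)
  qed
  also have "(\<integral>\<^sup>+\<omega>. ennreal ((X \<omega>)\<^sup>2) \<partial>M) = ennreal (2 * frobenius p ?B)"
    unfolding X_def by (rule gauss_quadratic_form(2)[OF w Bc sandwich_symmetric[OF S A]])
  also have "ennreal (K / \<theta>\<^sup>2) * ennreal (2 * frobenius p ?B) \<le> ennreal (K / \<theta>\<^sup>2) * ennreal (2 * (c\<^sup>2 * mat_trace (S * S)))"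
    using frobenius_sandwich[OF S A, of c] c by (intro mult_left_mono ennreal_leI) auto
  also have "ennreal (\<theta> / real n) + ennreal (K / \<theta>\<^sup>2) * ennreal (2 * (c\<^sup>2 * mat_trace (S * S)))
    = ennreal (\<theta> / real n + K * (2 * (c\<^sup>2 * mat_trace (S * S))) / \<theta>\<^sup>2)"
    using K th SS by (simp add: ennreal_mult[symmetric] ennreal_plus[symmetric] del: ennreal_plus)
  finally show ?thesis by (simp add: add_left_mono)
qed

section \<open>Averaging over the Gaussian vectors on the product space\<close>

context gaussian_columns
begin

lemma S_sqrt_rv: "k \<in> {1..n} \<Longrightarrow> (\<lambda>\<omega>. psd_sqrt (S k \<omega>)) \<in> M \<rightarrow>\<^sub>M borel_mat p"
  by (rule measurable_psd_sqrt[OF S_rv S_psd])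

text \<open>Convention for the product space: the first coordinate drives the Gaussian vectors, the
  second the data and the matrices. The two are thereby independent regardless of their joint law on
  the original space.\<close>

lemma pair_hyb_measurable:
  assumes "j \<in> {1..n}"
  shows "(\<lambda>q. hyb k (\<lambda>j. w j (fst q)) (snd q) (snd q) j) \<in> M \<Otimes>\<^sub>M M \<rightarrow>\<^sub>M borel_vec p"
  unfolding hyb_def using assms
  by (cases "j < k") (auto intro!: measurable_mult_mat_vec measurable_compose[OF measurable_snd] measurable_compose[OF measurable_fst]
      S_sqrt_rv w_rv y_rv)

lemma pair_resolv_measurable:
  assumes "I \<subseteq> {1..n}"
  shows "(\<lambda>q. resolv p n I (hyb k (\<lambda>j. w j (fst q)) (snd q) (snd q)) \<nu>) \<in> M \<Otimes>\<^sub>M M \<rightarrow>\<^sub>M borel_mat p"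
  by (rule measurable_resolv[where x = "\<lambda>j q. hyb k (\<lambda>j. w j (fst q)) (snd q) (snd q) j"], rule pair_hyb_measurable) (use assms in auto)

lemma pair_far_res_measurable: "(\<lambda>q. far_res k \<nu> (\<lambda>j. w j (fst q)) (snd q) (snd q)) \<in> M \<Otimes>\<^sub>M M \<rightarrow>\<^sub>M borel_mat p"
  unfolding far_res_def by (rule pair_resolv_measurable) auto

lemma pair_full_res_measurable: "(\<lambda>q. full_res k \<nu> (\<lambda>j. w j (fst q)) (snd q)) \<in> M \<Otimes>\<^sub>M M \<rightarrow>\<^sub>M borel_mat p"
  unfolding full_res_def by (rule pair_resolv_measurable) auto

text \<open>With the data and matrices fixed at \<omega>, the full resolvent is random only through
  the vectors \<open>w j\<close> with j < k, of which \<open>w k\<close> is independent. This is why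
  no neighbours have to be removed for the Gaussian column.\<close>

lemma full_form_deviation_pointwise:
  assumes k: "k \<in> {1..n}" and nu: "\<nu> > 0" and K: "K \<ge> 0" and th: "\<theta> > 0" and w0: "\<omega> \<in> space M"
  defines "z \<equiv> \<lambda>\<omega>'. psd_sqrt (S k \<omega>) *\<^sub>v w k \<omega>'"
  shows "(\<integral>\<^sup>+\<omega>'. ennreal (min K (\<bar>z \<omega>' \<bullet> (full_res k \<nu> (\<lambda>j. w j \<omega>') \<omega> *\<^sub>v z \<omega>') - mat_trace (S k \<omega> * full_res k \<nu> (\<lambda>j. w j \<omega>') \<omega>)\<bar> / real n)) \<partial>M)
    \<le> ennreal (\<theta> / real n + K * (2 * ((1 / \<nu>)\<^sup>2 * mat_trace (S k \<omega> * S k \<omega>))) / \<theta>\<^sup>2)"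
proof -
  let ?F = "gen_sigma M (borel_vec p) w {1..<k}" and ?G = "gen_sigma M (borel_vec p) w {k}"
  let ?A = "\<lambda>\<omega>1. full_res k \<nu> (\<lambda>j. w j \<omega>1) \<omega>"
  let ?h = "\<lambda>\<omega>1 \<omega>2. ennreal (min K (\<bar>z \<omega>2 \<bullet> (?A \<omega>1 *\<^sub>v z \<omega>2) - mat_trace (S k \<omega> * ?A \<omega>1)\<bar> / real n))"
  have F: "subalgebra M ?F" "subalgebra M ?G" using k by (auto intro!: subalgebra_gen_sigma w_rv)
  have ind: "indep_set (sets ?F) (sets ?G)" using k by (intro indep_gen_sigma[OF w_indep]) auto
  have const: "(\<lambda>_. psd_sqrt (S j \<omega>)) \<in> N \<rightarrow>\<^sub>M borel_mat p" if "j \<in> {1..n}" for j and N :: "'a measure"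
    using psd_sqrt_carrier(1)[OF S_psd[OF that w0]] by (intro measurable_const) simp
  have hyb: "(\<lambda>\<omega>1. hyb k (\<lambda>j. w j \<omega>1) \<omega> \<omega> j) \<in> ?F \<rightarrow>\<^sub>M borel_vec p" if j: "j \<in> {1..n} - {k}" for j
  proof (cases "j < k")
    case True
    have "w j \<in> ?F \<rightarrow>\<^sub>M borel_vec p" using True j by (intro measurable_gen_sigma w_rv) auto
    from measurable_mult_mat_vec[OF const this] show ?thesis using True j by (simp add: hyb_def)
  next
    case False
    have "(\<lambda>_. y j \<omega>) \<in> ?F \<rightarrow>\<^sub>M borel_vec p" using y_carrier[of j \<omega>] j w0 by (intro measurable_const) auto
    then show ?thesis using False by (simp add: hyb_def)
  qed
  have A: "?A \<in> ?F \<rightarrow>\<^sub>M borel_mat p"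
    unfolding full_res_def by (rule measurable_resolv[OF hyb])
  have z: "z \<in> ?G \<rightarrow>\<^sub>M borel_vec p"
    unfolding z_def using k by (intro measurable_mult_mat_vec[OF const] measurable_gen_sigma w_rv) auto
  have Sc: "(\<lambda>_. S k \<omega>) \<in> N \<rightarrow>\<^sub>M borel_mat p" for N :: "('a \<times> 'a) measure"
    using sym_psd_matsD(1)[OF S_psd[OF k w0]] by (intro measurable_const) simp
  note A2 = measurable_compose[OF measurable_fst A] and z2 = measurable_compose[OF measurable_snd z]
  have h: "(\<lambda>q. ?h (fst q) (snd q)) \<in> borel_measurable (?F \<Otimes>\<^sub>M ?G)"
    by (intro measurable_compose[OF _ measurable_ennreal] borel_measurable_min borel_measurable_const borel_measurable_divide
        borel_measurable_abs borel_measurable_diff measurable_sprod[OF z2 measurable_mult_mat_vec[OF A2 z2]] measurable_mat_trace_mult[OF Sc A2])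
  have "(\<integral>\<^sup>+\<omega>'. ?h \<omega>' \<omega>' \<partial>M) = (\<integral>\<^sup>+\<omega>1. (\<integral>\<^sup>+\<omega>2. ?h \<omega>1 \<omega>2 \<partial>M) \<partial>M)"
    using decouple_nn[OF F ind h] by simp
  also have "\<dots> \<le> (\<integral>\<^sup>+\<omega>1. ennreal (\<theta> / real n + K * (2 * ((1 / \<nu>)\<^sup>2 * mat_trace (S k \<omega> * S k \<omega>))) / \<theta>\<^sup>2) \<partial>M)"
  proof (rule nn_integral_mono)
    fix \<omega>1 assume w1: "\<omega>1 \<in> space M"
    have c: "hyb k (\<lambda>j. w j \<omega>1) \<omega> \<omega> j \<in> carrier_vec p" if "j \<in> {1..n} - {k}" for j
      using hyb_carrier[where u = "\<lambda>j. w j \<omega>1" and k = k, OF _ nu] w_carrier w1 w0 that by auto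
    show "(\<integral>\<^sup>+\<omega>2. ?h \<omega>1 \<omega>2 \<partial>M) \<le> ennreal (\<theta> / real n + K * (2 * ((1 / \<nu>)\<^sup>2 * mat_trace (S k \<omega> * S k \<omega>))) / \<theta>\<^sup>2)"
      unfolding z_def
    proof (rule gauss_form_deviation[OF w_normal[OF k] S_psd[OF k w0] _ _ _ K th])
      show "?A \<omega>1 \<in> carrier_mat p p" unfolding full_res_def by (rule resolv_carrier[OF c nu])
      show "(?A \<omega>1)\<^sup>T = ?A \<omega>1" unfolding full_res_def by (rule resolv_symmetric[OF c nu])
      show "(?A \<omega>1 *\<^sub>v v) \<bullet> (?A \<omega>1 *\<^sub>v v) \<le> (1 / \<nu>)\<^sup>2 * (v \<bullet> v)" if "v \<in> carrier_vec p" for v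
        unfolding full_res_def power_divide power_one times_divide_eq_left mult_1
        by (rule resolv_quadratic(2)[where I = "{1..n} - {k}"]) (use c nu that in blast)+
    qed
  qed
  also have "\<dots> = ennreal (\<theta> / real n + K * (2 * ((1 / \<nu>)\<^sup>2 * mat_trace (S k \<omega> * S k \<omega>))) / \<theta>\<^sup>2)"
    by (simp add: emeasure_space_1)
  finally show ?thesis .
qed

text \<open>Where tr (S k^2) stays below \<delta>, the pointwise bound is monotone in it; on the
  exceptional event the truncation at \<open>K\<close> takes over, and (A4) makes that event rare on
  average.\<close>

lemma full_form_deviation:
  assumes k: "k \<in> {1..n}" and nu: "\<nu> > 0" and K: "K \<ge> 0" and th: "\<theta> > 0" and de: "\<delta> \<ge> 0"
  defines "z \<equiv> \<lambda>q. psd_sqrt (S k (snd q)) *\<^sub>v w k (fst q)" and "A \<equiv> \<lambda>q. full_res k \<nu> (\<lambda>j. w j (fst q)) (snd q)"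
  shows "(\<integral>\<^sup>+q. ennreal (min K (\<bar>z q \<bullet> (A q *\<^sub>v z q) - mat_trace (S k (snd q) * A q)\<bar> / real n)) \<partial>(M \<Otimes>\<^sub>M M))
    \<le> ennreal (\<theta> / real n + K * (2 * ((1 / \<nu>)\<^sup>2 * \<delta>)) / \<theta>\<^sup>2 + K * prob {\<omega> \<in> space M. mat_trace (S k \<omega> * S k \<omega>) > \<delta>})"
proof -
  interpret PP: pair_sigma_finite M M ..
  let ?g = "\<lambda>q. ennreal (min K (\<bar>z q \<bullet> (A q *\<^sub>v z q) - mat_trace (S k (snd q) * A q)\<bar> / real n))"
  let ?E = "{\<omega> \<in> space M. mat_trace (S k \<omega> * S k \<omega>) > \<delta>}"
  let ?c = "\<theta> / real n + K * (2 * ((1 / \<nu>)\<^sup>2 * \<delta>)) / \<theta>\<^sup>2"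
  have Am: "A \<in> M \<Otimes>\<^sub>M M \<rightarrow>\<^sub>M borel_mat p" unfolding A_def by (rule pair_full_res_measurable)
  have zm: "z \<in> M \<Otimes>\<^sub>M M \<rightarrow>\<^sub>M borel_vec p"
    unfolding z_def by (intro measurable_mult_mat_vec measurable_compose[OF measurable_snd S_sqrt_rv[OF k]] measurable_compose[OF measurable_fst w_rv[OF k]])
  have gm: "?g \<in> borel_measurable (M \<Otimes>\<^sub>M M)"
    by (intro measurable_compose[OF _ measurable_ennreal] borel_measurable_min borel_measurable_const borel_measurable_divide
        borel_measurable_abs borel_measurable_diff measurable_sprod[OF zm measurable_mult_mat_vec[OF Am zm]]
        measurable_mat_trace_mult[OF measurable_compose[OF measurable_snd S_rv[OF k]] Am])
  have E: "?E \<in> events"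
    using measurable_mat_trace_mult[OF S_rv[OF k] S_rv[OF k]] by measurable
  have "(\<integral>\<^sup>+q. ?g q \<partial>(M \<Otimes>\<^sub>M M)) = (\<integral>\<^sup>+\<omega>. (\<integral>\<^sup>+\<omega>'. ?g (\<omega>', \<omega>) \<partial>M) \<partial>M)"
    by (rule PP.nn_integral_snd[OF gm, symmetric])
  also have "\<dots> \<le> (\<integral>\<^sup>+\<omega>. ennreal ?c + ennreal K * indicator ?E \<omega> \<partial>M)"
  proof (rule nn_integral_mono)
    fix \<omega> assume w: "\<omega> \<in> space M"
    show "(\<integral>\<^sup>+\<omega>'. ?g (\<omega>', \<omega>) \<partial>M) \<le> ennreal ?c + ennreal K * indicator ?E \<omega>"
    proof (cases "\<omega> \<in> ?E")
      case True
      have "(\<integral>\<^sup>+\<omega>'. ?g (\<omega>', \<omega>) \<partial>M) \<le> (\<integral>\<^sup>+\<omega>'. ennreal K \<partial>M)" by (intro nn_integral_mono ennreal_leI) simp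
      also have "\<dots> = ennreal K" by (simp add: emeasure_space_1)
      also have "\<dots> \<le> ennreal ?c + ennreal K" by simp
      finally show ?thesis using True by simp
    next
      case False
      then have "mat_trace (S k \<omega> * S k \<omega>) \<le> \<delta>" using w by auto
      then have "\<theta> / real n + K * (2 * ((1 / \<nu>)\<^sup>2 * mat_trace (S k \<omega> * S k \<omega>))) / \<theta>\<^sup>2 \<le> ?c"
        using K by (intro add_left_mono divide_right_mono mult_left_mono) auto
      then have "(\<integral>\<^sup>+\<omega>'. ?g (\<omega>', \<omega>) \<partial>M) \<le> ennreal ?c"
        using order_trans[OF full_form_deviation_pointwise[OF k nu K th w] ennreal_leI] by (simp add: z_def A_def)
      then show ?thesis using False by simp
    qed
  qed
  also have "\<dots> = ennreal ?c + ennreal K * emeasure M ?E"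
    using E by (subst nn_integral_add) (auto simp: nn_integral_cmult emeasure_space_1)
  also have "\<dots> = ennreal (?c + K * prob ?E)"
    using K th de by (simp add: emeasure_eq_measure ennreal_mult ennreal_plus)
  finally show ?thesis .
qed

definition removal :: "nat \<Rightarrow> real \<Rightarrow> nat \<Rightarrow> 'a \<times> 'a \<Rightarrow> ennreal" where
  "removal k \<nu> j q = (\<Sum>i\<le>p. ennreal ((hyb k (\<lambda>j. w j (fst q)) (snd q) (snd q) j
     \<bullet> (far_res k \<nu> (\<lambda>j. w j (fst q)) (snd q) (snd q) *\<^sub>v frame k i (snd q)))\<^sup>2))"

text \<open>The summand of (A5) that pays for removing column j from the resolvent at k. In the near
  case it is symmetric in k and j: the norm is always taken at the later index, conditionally on the
  past of the earlier one.\<close>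

definition pair_weight :: "nat \<Rightarrow> nat \<Rightarrow> ennreal" where
  "pair_weight k j = (if \<bar>int j - int k\<bar> < int m
     then \<integral>\<^sup>+\<omega>. ennreal (cond_norm (min k j) (max k j) \<omega> * mass (min k j) \<omega>) \<partial>M
     else ennreal (mean_norm k) * (\<integral>\<^sup>+\<omega>. ennreal (mass j \<omega>) \<partial>M))"

lemma frame_rv: "k \<in> {1..n} \<Longrightarrow> frame k i \<in> M \<rightarrow>\<^sub>M borel_vec p"
  by (rule sig_measurable_M[OF frame_measurable[where k = k and I = "{k}" and u = "\<lambda>_. 0\<^sub>v p" and \<nu> = 1]]) auto

lemma removal_measurable:
  assumes "k \<in> {1..n}" "j \<in> {1..n}"
  shows "removal k \<nu> j \<in> borel_measurable (M \<Otimes>\<^sub>M M)"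
  unfolding removal_def[abs_def]
  by (intro borel_measurable_sum measurable_compose[OF _ measurable_ennreal] borel_measurable_power
      measurable_sprod[OF pair_hyb_measurable[OF assms(2)] measurable_mult_mat_vec[OF pair_far_res_measurable
        measurable_compose[OF measurable_snd frame_rv[OF assms(1)]]]])

text \<open>After exchanging the integrations the matrix is fixed while the Gaussian vector is
  averaged, and its mean form is the trace. The factor \<open>g\<close> carries the conditional norm
  along.\<close>

lemma gauss_trace:
  assumes j: "j \<in> {1..n}" and g: "g \<in> borel_measurable M"
  shows "(\<integral>\<^sup>+\<omega>'. (\<integral>\<^sup>+\<omega>. ennreal (g \<omega> * (w j \<omega>' \<bullet> (S j \<omega> *\<^sub>v w j \<omega>'))) \<partial>M) \<partial>M)
    \<le> (\<integral>\<^sup>+\<omega>. ennreal (g \<omega> * mat_trace (S j \<omega>)) \<partial>M)"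
proof -
  interpret PP: pair_sigma_finite M M ..
  have wm: "(\<lambda>q. w j (snd q)) \<in> M \<Otimes>\<^sub>M M \<rightarrow>\<^sub>M borel_vec p" by (rule measurable_compose[OF measurable_snd w_rv[OF j]])
  have m: "(\<lambda>(\<omega>, \<omega>'). ennreal (g \<omega> * (w j \<omega>' \<bullet> (S j \<omega> *\<^sub>v w j \<omega>')))) \<in> borel_measurable (M \<Otimes>\<^sub>M M)"
    unfolding case_prod_beta
    by (intro measurable_compose[OF _ measurable_ennreal] borel_measurable_times measurable_compose[OF measurable_fst g]
        measurable_sprod[OF wm measurable_mult_mat_vec[OF measurable_compose[OF measurable_fst S_rv[OF j]] wm]])
  have "(\<integral>\<^sup>+\<omega>'. (\<integral>\<^sup>+\<omega>. ennreal (g \<omega> * (w j \<omega>' \<bullet> (S j \<omega> *\<^sub>v w j \<omega>'))) \<partial>M) \<partial>M)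
    = (\<integral>\<^sup>+\<omega>. (\<integral>\<^sup>+\<omega>'. ennreal (g \<omega> * (w j \<omega>' \<bullet> (S j \<omega> *\<^sub>v w j \<omega>'))) \<partial>M) \<partial>M)"
    by (rule PP.Fubini'[OF m])
  also have "\<dots> \<le> (\<integral>\<^sup>+\<omega>. ennreal (g \<omega> * mat_trace (S j \<omega>)) \<partial>M)"
  proof (rule nn_integral_mono)
    fix \<omega> assume w: "\<omega> \<in> space M"
    note Sp = S_psd[OF j w]
    have Sc: "(\<lambda>_. S j \<omega>) \<in> M \<rightarrow>\<^sub>M borel_mat p" using sym_psd_matsD(1)[OF Sp] by (intro measurable_const) simp
    have q: "(\<lambda>\<omega>'. ennreal (w j \<omega>' \<bullet> (S j \<omega> *\<^sub>v w j \<omega>'))) \<in> borel_measurable M"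
      by (intro measurable_compose[OF _ measurable_ennreal] measurable_sprod[OF w_rv[OF j] measurable_mult_mat_vec[OF Sc w_rv[OF j]]])
    have S0: "0 \<le> mat_trace (S j \<omega>)" unfolding trace_psd_cols[OF Sp] by (intro sum_nonneg sprod_self_nonneg)
    have "(\<integral>\<^sup>+\<omega>'. ennreal (g \<omega> * (w j \<omega>' \<bullet> (S j \<omega> *\<^sub>v w j \<omega>'))) \<partial>M) = (\<integral>\<^sup>+\<omega>'. ennreal (g \<omega>) * ennreal (w j \<omega>' \<bullet> (S j \<omega> *\<^sub>v w j \<omega>')) \<partial>M)"
      by (intro nn_integral_cong ennreal_mult'' sym_psd_matsD(3)[OF Sp] w_carrier[OF j])
    also have "\<dots> = ennreal (g \<omega>) * ennreal (mat_trace (S j \<omega>))"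
      unfolding nn_integral_cmult[OF q] gauss_quadratic_form(1)[OF w_normal[OF j] sym_psd_matsD(1,2)[OF Sp] Sp] ..
    also have "\<dots> = ennreal (g \<omega> * mat_trace (S j \<omega>))" by (rule ennreal_mult''[OF S0, symmetric])
    finally show "(\<integral>\<^sup>+\<omega>'. ennreal (g \<omega> * (w j \<omega>' \<bullet> (S j \<omega> *\<^sub>v w j \<omega>'))) \<partial>M) \<le> ennreal (g \<omega> * mat_trace (S j \<omega>))" by simp
  qed
  finally show ?thesis .
qed

lemma trace_le_mass:
  assumes "j \<in> {1..n}" "\<omega> \<in> space M"
  shows "0 \<le> mat_trace (S j \<omega>)" "mat_trace (S j \<omega>) \<le> mass j \<omega>" "y j \<omega> \<bullet> y j \<omega> \<le> mass j \<omega>"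
proof -
  show t: "0 \<le> mat_trace (S j \<omega>)" unfolding trace_psd_cols[OF S_psd[OF assms]] by (intro sum_nonneg sprod_self_nonneg)
  show "mat_trace (S j \<omega>) \<le> mass j \<omega>" "y j \<omega> \<bullet> y j \<omega> \<le> mass j \<omega>"
    using t sprod_self_nonneg[of "y j \<omega>"] by (auto simp: mass_def)
qed

lemma cond_norm_facts: "cond_norm a b \<in> borel_measurable M" "0 \<le> cond_norm a b \<omega>"
proof -
  have cm: "(\<lambda>\<omega>. cond_exp_mat M (sig {1..a}) p X \<omega>) \<in> M \<rightarrow>\<^sub>M borel_mat p" for X
    by (rule measurable_borel_matI) (auto simp: cond_exp_mat_def)
  show "cond_norm a b \<in> borel_measurable M"
    unfolding cond_norm_def[abs_def] by (intro borel_measurable_add measurable_spectral_norm[OF cm p1])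
  have "0 \<le> spectral_norm (cond_exp_mat M (sig {1..a}) p X \<omega>)" for X
    by (rule spectral_norm_nonneg[OF _ p1]) (simp add: cond_exp_mat_def)
  then show "0 \<le> cond_norm a b \<omega>" by (simp add: cond_norm_def)
qed

lemma removal_bound:
  assumes k: "k \<in> {1..n}" and j: "j \<in> nbhd k" and nu: "\<nu> > 0"
  shows "(\<integral>\<^sup>+q. removal k \<nu> j q \<partial>(M \<Otimes>\<^sub>M M)) \<le> ennreal (1 / \<nu>\<^sup>2) * pair_weight k j"
proof -
  have jn: "j \<in> {1..n}" "j \<noteq> k" "\<bar>int j - int k\<bar> < 2 * int m" using j by (auto simp: nbhd_def)
  have u: "\<And>i. i \<in> {1..n} \<Longrightarrow> w i \<omega>' \<in> carrier_vec p" if "\<omega>' \<in> space M" for \<omega>' using w_carrier that by blast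
  have eq: "(\<integral>\<^sup>+q. removal k \<nu> j q \<partial>(M \<Otimes>\<^sub>M M)) = (\<integral>\<^sup>+\<omega>'. (\<integral>\<^sup>+\<omega>. removal k \<nu> j (\<omega>', \<omega>) \<partial>M) \<partial>M)"
    by (rule nn_integral_fst[OF removal_measurable[OF k jn(1)], symmetric])
  consider (late) "k < j" "j < k + m" | (early) "j < k" "k < j + m" | (far) "int m \<le> \<bar>int j - int k\<bar>"
    using jn(2) by linarith
  then show ?thesis
  proof cases
    case late
    have "(\<integral>\<^sup>+\<omega>'. (\<integral>\<^sup>+\<omega>. removal k \<nu> j (\<omega>', \<omega>) \<partial>M) \<partial>M) \<le> (\<integral>\<^sup>+\<omega>'. ennreal (1 / \<nu>\<^sup>2) * (\<integral>\<^sup>+\<omega>. ennreal (cond_norm k j \<omega> * mass k \<omega>) \<partial>M) \<partial>M)"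
      unfolding removal_def fst_conv snd_conv by (rule nn_integral_mono) (rule removal_late[OF u nu k jn(1) late])
    also have "\<dots> = ennreal (1 / \<nu>\<^sup>2) * pair_weight k j" using late by (simp add: pair_weight_def emeasure_space_1)
    finally show ?thesis unfolding eq .
  next
    case early
    let ?q = "\<lambda>\<omega>' \<omega>. cond_norm j k \<omega> * (w j \<omega>' \<bullet> (S j \<omega> *\<^sub>v w j \<omega>'))"
    have m: "(\<lambda>\<omega>'. \<integral>\<^sup>+\<omega>. ennreal (?q \<omega>' \<omega>) \<partial>M) \<in> borel_measurable M"
    proof -
      have wm: "(\<lambda>q. w j (fst q)) \<in> M \<Otimes>\<^sub>M M \<rightarrow>\<^sub>M borel_vec p" by (rule measurable_compose[OF measurable_fst w_rv[OF jn(1)]])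
      have "(\<lambda>q. ennreal (?q (fst q) (snd q))) \<in> borel_measurable (M \<Otimes>\<^sub>M M)"
        by (intro measurable_compose[OF _ measurable_ennreal] borel_measurable_times measurable_compose[OF measurable_snd cond_norm_facts(1)]
            measurable_sprod[OF wm measurable_mult_mat_vec[OF measurable_compose[OF measurable_snd S_rv[OF jn(1)]] wm]])
      from borel_measurable_nn_integral_fst[OF this] show ?thesis by simp
    qed
    have "(\<integral>\<^sup>+\<omega>'. (\<integral>\<^sup>+\<omega>. removal k \<nu> j (\<omega>', \<omega>) \<partial>M) \<partial>M) \<le> (\<integral>\<^sup>+\<omega>'. ennreal (1 / \<nu>\<^sup>2) * (\<integral>\<^sup>+\<omega>. ennreal (?q \<omega>' \<omega>) \<partial>M) \<partial>M)"
      unfolding removal_def fst_conv snd_conv by (rule nn_integral_mono) (rule removal_early[OF u nu k jn(1) early])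
    also have "\<dots> = ennreal (1 / \<nu>\<^sup>2) * (\<integral>\<^sup>+\<omega>'. (\<integral>\<^sup>+\<omega>. ennreal (?q \<omega>' \<omega>) \<partial>M) \<partial>M)"
      by (rule nn_integral_cmult[OF m])
    also have "\<dots> \<le> ennreal (1 / \<nu>\<^sup>2) * (\<integral>\<^sup>+\<omega>. ennreal (cond_norm j k \<omega> * mat_trace (S j \<omega>)) \<partial>M)"
      by (intro mult_left_mono gauss_trace[OF jn(1) cond_norm_facts(1)]) simp
    also have "\<dots> \<le> ennreal (1 / \<nu>\<^sup>2) * (\<integral>\<^sup>+\<omega>. ennreal (cond_norm j k \<omega> * mass j \<omega>) \<partial>M)"
      by (intro mult_left_mono nn_integral_mono ennreal_leI trace_le_mass jn(1) cond_norm_facts(2)) simp_all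
    also have "\<dots> = ennreal (1 / \<nu>\<^sup>2) * pair_weight k j" using early by (simp add: pair_weight_def)
    finally show ?thesis unfolding eq .
  next
    case far
    then have m1: "m \<ge> 1" using jn(3) by linarith
    let ?I = "\<lambda>\<omega>'. \<integral>\<^sup>+\<omega>. ennreal (hyb k (\<lambda>j. w j \<omega>') \<omega> \<omega> j \<bullet> hyb k (\<lambda>j. w j \<omega>') \<omega> \<omega> j) \<partial>M"
    have m: "?I \<in> borel_measurable M"
    proof -
      note h = pair_hyb_measurable[OF jn(1), where k = k]
      have "(\<lambda>q. ennreal (hyb k (\<lambda>j. w j (fst q)) (snd q) (snd q) j \<bullet> hyb k (\<lambda>j. w j (fst q)) (snd q) (snd q) j)) \<in> borel_measurable (M \<Otimes>\<^sub>M M)"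
        by (intro measurable_compose[OF _ measurable_ennreal] measurable_sprod[OF h h])
      from borel_measurable_nn_integral_fst[OF this] show ?thesis by simp
    qed
    have I: "(\<integral>\<^sup>+\<omega>'. ?I \<omega>' \<partial>M) \<le> (\<integral>\<^sup>+\<omega>. ennreal (mass j \<omega>) \<partial>M)"
    proof (cases "j < k")
      case True
      have "(\<integral>\<^sup>+\<omega>'. ?I \<omega>' \<partial>M) = (\<integral>\<^sup>+\<omega>'. (\<integral>\<^sup>+\<omega>. ennreal (1 * (w j \<omega>' \<bullet> (S j \<omega> *\<^sub>v w j \<omega>'))) \<partial>M) \<partial>M)"
        using True psd_sqrt_mult_vec_square[OF S_psd[OF jn(1)] w_carrier[OF jn(1)]]
        by (intro nn_integral_cong) (simp add: hyb_def)
      also have "\<dots> \<le> (\<integral>\<^sup>+\<omega>. ennreal (1 * mat_trace (S j \<omega>)) \<partial>M)" by (rule gauss_trace[OF jn(1)]) simp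
      also have "\<dots> \<le> (\<integral>\<^sup>+\<omega>. ennreal (mass j \<omega>) \<partial>M)"
        using trace_le_mass(2)[OF jn(1)] by (intro nn_integral_mono ennreal_leI) simp
      finally show ?thesis .
    next
      case False
      have "(\<integral>\<^sup>+\<omega>'. ?I \<omega>' \<partial>M) = (\<integral>\<^sup>+\<omega>. ennreal (y j \<omega> \<bullet> y j \<omega>) \<partial>M)" using False by (simp add: hyb_def emeasure_space_1)
      also have "\<dots> \<le> (\<integral>\<^sup>+\<omega>. ennreal (mass j \<omega>) \<partial>M)"
        using trace_le_mass(3)[OF jn(1)] by (intro nn_integral_mono ennreal_leI) simp
      finally show ?thesis .
    qed
    have "(\<integral>\<^sup>+\<omega>'. (\<integral>\<^sup>+\<omega>. removal k \<nu> j (\<omega>', \<omega>) \<partial>M) \<partial>M) \<le> (\<integral>\<^sup>+\<omega>'. ennreal (1 / \<nu>\<^sup>2) * ennreal (mean_norm k) * ?I \<omega>' \<partial>M)"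
      unfolding removal_def fst_conv snd_conv mult.assoc by (rule nn_integral_mono) (rule removal_far[OF u nu k jn(1) far m1])
    also have "\<dots> = ennreal (1 / \<nu>\<^sup>2) * ennreal (mean_norm k) * (\<integral>\<^sup>+\<omega>'. ?I \<omega>' \<partial>M)"
      by (rule nn_integral_cmult[OF m])
    also have "\<dots> \<le> ennreal (1 / \<nu>\<^sup>2) * ennreal (mean_norm k) * (\<integral>\<^sup>+\<omega>. ennreal (mass j \<omega>) \<partial>M)"
      by (intro mult_left_mono I) simp
    also have "\<dots> = ennreal (1 / \<nu>\<^sup>2) * pair_weight k j" using far by (simp add: pair_weight_def mult.assoc)
    finally show ?thesis unfolding eq .
  qed
qed

end

section \<open>Comparison of the two means\<close>

context gaussian_columns
begin

lemma mass_expectation: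
  assumes k: "k \<in> {1..n}"
  shows "(\<integral>\<^sup>+\<omega>. ennreal (mass k \<omega>) \<partial>M)
    = ennreal (mat_trace (expectation_mat M p (\<lambda>\<omega>. outer_self (y k \<omega>)) + expectation_mat M p (S k)))"
proof -
  have i: "integrable M (\<lambda>\<omega>. outer_self (y k \<omega>) $$ (i, i))" "integrable M (\<lambda>\<omega>. S k \<omega> $$ (i, i))" if "i < p" for i
    using y_int[OF k] S_int[OF k] that by (auto simp: integrable_mat_def)
  have e: "mass k \<omega> = (\<Sum>i<p. outer_self (y k \<omega>) $$ (i, i) + S k \<omega> $$ (i, i))" if w: "\<omega> \<in> space M" for \<omega>
  proof -
    have d: "dim_row (outer_self (y k \<omega>)) = p" "dim_row (S k \<omega>) = p"
      using outer_self_carrier[OF y_carrier[OF k w]] sym_psd_matsD(1)[OF S_psd[OF k w]] by auto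
    show ?thesis
      unfolding mass_def outer_self_trace[OF y_carrier[OF k w], symmetric] mat_trace_def d sum.distrib ..
  qed
  have "(\<integral>\<^sup>+\<omega>. ennreal (mass k \<omega>) \<partial>M) = (\<integral>\<^sup>+\<omega>. ennreal (\<Sum>i<p. outer_self (y k \<omega>) $$ (i, i) + S k \<omega> $$ (i, i)) \<partial>M)"
    by (intro nn_integral_cong) (simp only: e)
  also have "\<dots> = ennreal (\<integral>\<omega>. (\<Sum>i<p. outer_self (y k \<omega>) $$ (i, i) + S k \<omega> $$ (i, i)) \<partial>M)"
  proof (rule nn_integral_eq_integral)
    show "integrable M (\<lambda>\<omega>. \<Sum>i<p. outer_self (y k \<omega>) $$ (i, i) + S k \<omega> $$ (i, i))"
      by (intro Bochner_Integration.integrable_sum Bochner_Integration.integrable_add i) auto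
    show "AE \<omega> in M. 0 \<le> (\<Sum>i<p. outer_self (y k \<omega>) $$ (i, i) + S k \<omega> $$ (i, i))"
    proof (rule AE_I2)
      fix \<omega> assume w: "\<omega> \<in> space M"
      show "0 \<le> (\<Sum>i<p. outer_self (y k \<omega>) $$ (i, i) + S k \<omega> $$ (i, i))"
        unfolding e[OF w, symmetric] using trace_le_mass(1,2)[OF k w] by linarith
    qed
  qed
  also have "(\<integral>\<omega>. (\<Sum>i<p. outer_self (y k \<omega>) $$ (i, i) + S k \<omega> $$ (i, i)) \<partial>M)
    = (\<Sum>i<p. (\<integral>\<omega>. outer_self (y k \<omega>) $$ (i, i) \<partial>M) + (\<integral>\<omega>. S k \<omega> $$ (i, i) \<partial>M))"
    using i by (subst Bochner_Integration.integral_sum) auto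
  also have "\<dots> = mat_trace (expectation_mat M p (\<lambda>\<omega>. outer_self (y k \<omega>)) + expectation_mat M p (S k))"
    by (simp add: mat_trace_def expectation_mat_def)
  finally show ?thesis .
qed

text \<open>A near pair occurs in both orders with equal weight, hence the factor 2 in front of the
  sum over k < l. The set of far pairs is symmetric, so transposing it puts the norm at l and the
  trace at k, as in (A5).\<close>

lemma sum_pair_weight:
  "(\<Sum>k=1..n. \<Sum>j\<in>nbhd k. pair_weight k j)
    = 2 * (\<Sum>(k, l) \<in> {(k, l). 1 \<le> k \<and> k < l \<and> l \<le> n \<and> l < k + m}. \<integral>\<^sup>+\<omega>. ennreal (cond_norm k l \<omega> * mass k \<omega>) \<partial>M)
    + (\<Sum>(k, l) \<in> {(k, l). 1 \<le> k \<and> k \<le> n \<and> 1 \<le> l \<and> l \<le> n \<and> int m \<le> \<bar>int k - int l\<bar> \<and> \<bar>int k - int l\<bar> < 2 * int m}.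
        ennreal (mean_norm l) * (\<integral>\<^sup>+\<omega>. ennreal (mass k \<omega>) \<partial>M))"
proof -
  define PC where "PC = {(k, l). 1 \<le> k \<and> k < l \<and> l \<le> n \<and> l < k + m}"
  define PU where "PU = {(k, l). 1 \<le> k \<and> k \<le> n \<and> 1 \<le> l \<and> l \<le> n \<and> int m \<le> \<bar>int k - int l\<bar> \<and> \<bar>int k - int l\<bar> < 2 * int m}"
  define PD where "PD = {(k, l). 1 \<le> l \<and> l < k \<and> k \<le> n \<and> k < l + m}"
  have fin: "finite PC" "finite PU" "finite PD"
    by (rule finite_subset[of _ "{1..n} \<times> {1..n}"]; force simp: PC_def PU_def PD_def)+
  have un: "Sigma {1..n} nbhd = PC \<union> PD \<union> PU" and dis: "PC \<inter> PD = {}" "(PC \<union> PD) \<inter> PU = {}"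
    unfolding PC_def PD_def PU_def nbhd_def by (auto simp: abs_if split: if_splits)
  have "(\<Sum>k=1..n. \<Sum>j\<in>nbhd k. pair_weight k j) = (\<Sum>(k, j)\<in>Sigma {1..n} nbhd. pair_weight k j)"
    by (rule sum.Sigma) (auto simp: nbhd_def)
  also have "\<dots> = (\<Sum>(k, j)\<in>PC. pair_weight k j) + (\<Sum>(k, j)\<in>PD. pair_weight k j) + (\<Sum>(k, j)\<in>PU. pair_weight k j)"
    unfolding un using fin dis by (simp add: sum.union_disjoint)
  also have "(\<Sum>(k, j)\<in>PC. pair_weight k j) = (\<Sum>(k, l)\<in>PC. \<integral>\<^sup>+\<omega>. ennreal (cond_norm k l \<omega> * mass k \<omega>) \<partial>M)"
    by (rule sum.cong) (auto simp: PC_def pair_weight_def min_def max_def)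
  also have "(\<Sum>(k, j)\<in>PD. pair_weight k j) = (\<Sum>(k, l)\<in>PC. \<integral>\<^sup>+\<omega>. ennreal (cond_norm k l \<omega> * mass k \<omega>) \<partial>M)"
    by (rule sum.reindex_bij_witness[where i = prod.swap and j = prod.swap]) (auto simp: PC_def PD_def pair_weight_def min_def max_def)
  also have "(\<Sum>(k, j)\<in>PU. pair_weight k j) = (\<Sum>(k, l)\<in>PU. ennreal (mean_norm l) * (\<integral>\<^sup>+\<omega>. ennreal (mass k \<omega>) \<partial>M))"
    by (rule sum.reindex_bij_witness[where i = prod.swap and j = prod.swap]) (auto simp: PU_def pair_weight_def abs_minus_commute)
  finally show ?thesis unfolding PC_def[symmetric] PU_def[symmetric] unfolding mult_2 .
qed

abbreviation gauss_column :: "nat \<Rightarrow> 'a \<Rightarrow> 'a \<Rightarrow> real Matrix.vec" where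
  "gauss_column j \<omega>' \<omega> \<equiv> psd_sqrt (S j \<omega>) *\<^sub>v w j \<omega>'"

lemma gauss_column_carrier:
  assumes "j \<in> {1..n}" "\<omega> \<in> space M" "\<omega>' \<in> space M"
  shows "gauss_column j \<omega>' \<omega> \<in> carrier_vec p"
  using mult_mat_vec_carrier[OF psd_sqrt_carrier(1)[OF S_psd[OF assms(1,2)]] w_carrier[OF assms(1,3)]] .

lemma logdet_ratio_bounded:
  assumes "\<And>j. j \<in> {1..n} \<Longrightarrow> x j \<in> carrier_vec p" "0 < \<alpha>" "\<alpha> < \<beta>"
  shows "\<bar>logdet_ratio p n \<alpha> \<beta> {1..n} x\<bar> \<le> real n * ln (\<beta> / \<alpha>) + \<bar>logdet_ratio p n \<alpha> \<beta> {} (\<lambda>_. 0\<^sub>v p)\<bar>"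
proof -
  have "\<bar>logdet_ratio p n \<alpha> \<beta> ({} \<union> {1..n}) x - logdet_ratio p n \<alpha> \<beta> {} x\<bar> \<le> real (card {1..n}) * ln (\<beta> / \<alpha>)"
    by (rule logdet_ratio_subset) (use assms in auto)
  moreover have "logdet_ratio p n \<alpha> \<beta> {} x = logdet_ratio p n \<alpha> \<beta> {} (\<lambda>_. 0\<^sub>v p)" by (rule logdet_ratio_cong) simp
  ultimately show ?thesis by simp
qed

text \<open>The Gaussian model involves only \<open>w\<close> and \<open>S\<close>, which are
  independent, so its mean can be computed with the two families evaluated at separate points. This
  transfers the comparison of means to the product space.\<close>

lemma gauss_expectation:
  assumes ab: "0 < \<alpha>" "\<alpha> < \<beta>"
  shows "expectation (\<lambda>\<omega>. logdet_ratio p n \<alpha> \<beta> {1..n} (\<lambda>j. gauss_column j \<omega> \<omega>))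
    = (\<integral>\<omega>'. (\<integral>\<omega>. logdet_ratio p n \<alpha> \<beta> {1..n} (\<lambda>j. gauss_column j \<omega>' \<omega>) \<partial>M) \<partial>M)"
proof -
  let ?F = "gen_sigma M (borel_vec p) w {1..n}" and ?G = "gen_sigma M (borel_mat p) S {1..n}"
  have F: "subalgebra M ?F" "subalgebra M ?G" by (auto intro!: subalgebra_gen_sigma w_rv S_rv)
  have wF: "w j \<in> ?F \<rightarrow>\<^sub>M borel_vec p" if "j \<in> {1..n}" for j using that by (intro measurable_gen_sigma w_rv)
  have SG: "(\<lambda>\<omega>. psd_sqrt (S j \<omega>)) \<in> ?G \<rightarrow>\<^sub>M borel_mat p" if "j \<in> {1..n}" for j
    using that S_psd by (intro measurable_psd_sqrt measurable_gen_sigma S_rv) (auto simp: space_gen_sigma)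
  have h: "(\<lambda>q. logdet_ratio p n \<alpha> \<beta> {1..n} (\<lambda>j. gauss_column j (fst q) (snd q))) \<in> borel_measurable (?F \<Otimes>\<^sub>M ?G)"
    by (intro measurable_logdet_ratio[where p = p] measurable_mult_mat_vec measurable_compose[OF measurable_fst wF] measurable_compose[OF measurable_snd SG])
  show ?thesis
    using decouple_lebesgue(1)[OF F w_S_indep h, of "real n * ln (\<beta> / \<alpha>) + \<bar>logdet_ratio p n \<alpha> \<beta> {} (\<lambda>_. 0\<^sub>v p)\<bar>"]
      logdet_ratio_bounded[OF gauss_column_carrier ab] by auto
qed

text \<open>Restricting to \<alpha> >= 1 makes all factors 1 / \<nu>^2 at most 1, and (A3) is needed
  only for matrices of norm at most 1. The outer factor 2 counts the two spectral parameters. The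
  estimate is stated in the extended reals because the expectations in the first part of (A5) are
  not known to be finite for each n.\<close>

lemma lindeberg_expectation:
  assumes ab: "1 \<le> \<alpha>" "\<alpha> < \<beta>" and th: "\<theta> > 0" and de: "\<delta> \<ge> 0"
    and sup: "\<And>k A. k \<in> {1..n} \<Longrightarrow> A \<in> sym_psd_mats p \<Longrightarrow> spectral_norm A \<le> 1 \<Longrightarrow>
      prob {\<omega> \<in> space M. \<bar>y k \<omega> \<bullet> (A *\<^sub>v y k \<omega>) - mat_trace (S k \<omega> * A)\<bar> > \<theta>} \<le> s k"
  defines "K \<equiv> ln (\<beta> / \<alpha>)"
  defines "r \<equiv> \<lambda>k. prob {\<omega> \<in> space M. mat_trace (S k \<omega> * S k \<omega>) > \<delta>}"
  shows "ennreal \<bar>expectation (\<lambda>\<omega>. logdet_ratio p n \<alpha> \<beta> {1..n} (\<lambda>j. y j \<omega>))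
       - expectation (\<lambda>\<omega>. logdet_ratio p n \<alpha> \<beta> {1..n} (\<lambda>j. gauss_column j \<omega> \<omega>))\<bar>
    \<le> 2 * (ennreal (1 / (real n)\<^sup>2) * (\<Sum>k=1..n. \<Sum>j\<in>nbhd k. pair_weight k j)
         + (\<Sum>k=1..n. ennreal (\<theta> / real n + K * s k) + ennreal (\<theta> / real n + K * (2 * \<delta>) / \<theta>\<^sup>2 + K * r k)))"
proof -
  interpret PP: pair_prob_space M M ..
  let ?MM = "M \<Otimes>\<^sub>M M"
  have ab0: "0 < \<alpha>" using ab by simp
  have K0: "0 \<le> K" using ab by (simp add: K_def)
  let ?P = "logdet_ratio p n \<alpha> \<beta> {1..n}"
  define B where "B = real n * K + \<bar>logdet_ratio p n \<alpha> \<beta> {} (\<lambda>_. 0\<^sub>v p)\<bar>"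
  define fY where "fY q = ?P (\<lambda>j. y j (snd q))" for q :: "'a \<times> 'a"
  define fZ where "fZ q = ?P (\<lambda>j. gauss_column j (fst q) (snd q))" for q :: "'a \<times> 'a"
  have sp: "fst q \<in> space M" "snd q \<in> space M" if "q \<in> space ?MM" for q using that by (auto simp: space_pair_measure)
  have colM: "(\<lambda>q. gauss_column j (fst q) (snd q)) \<in> ?MM \<rightarrow>\<^sub>M borel_vec p" if "j \<in> {1..n}" for j
    by (intro measurable_mult_mat_vec measurable_compose[OF measurable_snd S_sqrt_rv[OF that]] measurable_compose[OF measurable_fst w_rv[OF that]])
  have m: "fY \<in> borel_measurable ?MM" "fZ \<in> borel_measurable ?MM"
    unfolding fY_def fZ_def
    by (intro measurable_logdet_ratio[where p = p] measurable_compose[OF measurable_snd y_rv] colM, assumption)+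
  have bnd: "\<bar>?P x\<bar> \<le> B" if "\<And>j. j \<in> {1..n} \<Longrightarrow> x j \<in> carrier_vec p" for x
    unfolding B_def K_def by (rule logdet_ratio_bounded[OF that ab0 ab(2)])
  have b: "\<bar>fY q\<bar> \<le> B \<and> \<bar>fZ q\<bar> \<le> B" if "q \<in> space ?MM" for q
    unfolding fY_def fZ_def by (intro conjI bnd y_carrier gauss_column_carrier sp[OF that])
  have i: "integrable ?MM fY" "integrable ?MM fZ"
    using b m by (auto intro!: PP.P.integrable_const_bound[where B = B] AE_I2)
  have "(\<integral>q. fY q \<partial>?MM) = (\<integral>\<omega>'. (\<integral>\<omega>. fY (\<omega>', \<omega>) \<partial>M) \<partial>M)" "(\<integral>q. fZ q \<partial>?MM) = (\<integral>\<omega>'. (\<integral>\<omega>. fZ (\<omega>', \<omega>) \<partial>M) \<partial>M)"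
    by (rule PP.integral_fst'[symmetric], rule i)+
  then have e: "expectation (\<lambda>\<omega>. ?P (\<lambda>j. y j \<omega>)) - expectation (\<lambda>\<omega>. ?P (\<lambda>j. gauss_column j \<omega> \<omega>)) = (\<integral>q. fY q - fZ q \<partial>?MM)"
    unfolding Bochner_Integration.integral_diff[OF i] gauss_expectation[OF ab0 ab(2)] by (simp add: fY_def[abs_def] fZ_def[abs_def] prob_space)
  define bt where "bt k \<nu> q = min K (\<bar>y k (snd q) \<bullet> (far_res k \<nu> (\<lambda>j. w j (fst q)) (snd q) (snd q) *\<^sub>v y k (snd q))
      - mat_trace (S k (snd q) * far_res k \<nu> (\<lambda>j. w j (fst q)) (snd q) (snd q))\<bar> / real n)" for k \<nu> q
  define dt where "dt k \<nu> q = min K (\<bar>gauss_column k (fst q) (snd q) \<bullet> (full_res k \<nu> (\<lambda>j. w j (fst q)) (snd q) *\<^sub>v gauss_column k (fst q) (snd q))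
      - mat_trace (S k (snd q) * full_res k \<nu> (\<lambda>j. w j (fst q)) (snd q))\<bar> / real n)" for k \<nu> q
  have pos: "0 \<le> bt k \<nu> q" "0 \<le> dt k \<nu> q" for k \<nu> q using K0 by (auto simp: bt_def dt_def)
  let ?T = "\<lambda>k \<nu> q. (\<Sum>j\<in>nbhd k. ennreal (1 / (real n)\<^sup>2) * removal k \<nu> j q) + (ennreal (bt k \<nu> q) + ennreal (dt k \<nu> q))"
  have nb: "nbhd k \<subseteq> {1..n} - {k}" for k by (auto simp: nbhd_def)
  have jn: "j \<in> {1..n}" if "j \<in> nbhd k" for j k using that nb by blast
  have point: "ennreal \<bar>fY q - fZ q\<bar> \<le> (\<Sum>k=1..n. \<Sum>\<nu>\<in>{\<alpha>, \<beta>}. ?T k \<nu> q)" if q: "q \<in> space ?MM" for q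
  proof -
    let ?h = "\<lambda>k. hyb k (\<lambda>j. w j (fst q)) (snd q) (snd q)" and ?A = "\<lambda>k \<nu>. far_res k \<nu> (\<lambda>j. w j (fst q)) (snd q) (snd q)"
    let ?X = "\<lambda>k \<nu>. \<Sum>j\<in>nbhd k. (?h k j \<bullet> (?A k \<nu> *\<^sub>v y k (snd q)))\<^sup>2 + (\<Sum>i<p. (?h k j \<bullet> (?A k \<nu> *\<^sub>v col (psd_sqrt (S k (snd q))) i))\<^sup>2)"
    have "\<bar>fY q - fZ q\<bar> \<le> (\<Sum>k=1..n. \<Sum>\<nu>\<in>{\<alpha>, \<beta>}. ?X k \<nu> / (real n)\<^sup>2 + bt k \<nu> q + dt k \<nu> q)"
      unfolding fY_def fZ_def bt_def dt_def far_res_def full_res_def hyb_def K_def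
      by (rule lindeberg_pointwise[where J = nbhd])
        (use sp[OF q] y_carrier gauss_column_carrier S_psd nb ab0 ab n1 in auto)
    also have "ennreal (\<Sum>k=1..n. \<Sum>\<nu>\<in>{\<alpha>, \<beta>}. ?X k \<nu> / (real n)\<^sup>2 + bt k \<nu> q + dt k \<nu> q) = (\<Sum>k=1..n. \<Sum>\<nu>\<in>{\<alpha>, \<beta>}. ?T k \<nu> q)"
    proof -
      have X0: "0 \<le> ?X k \<nu>" for k \<nu> by (intro sum_nonneg add_nonneg_nonneg) auto
      have dbl: "ennreal (\<Sum>k=1..n. \<Sum>\<nu>\<in>{\<alpha>, \<beta>}. g k \<nu>) = (\<Sum>k=1..n. \<Sum>\<nu>\<in>{\<alpha>, \<beta>}. ennreal (g k \<nu>))"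
        if "\<And>k \<nu>. 0 \<le> g k \<nu>" for g :: "nat \<Rightarrow> real \<Rightarrow> real"
        using that by (simp only: sum_ennreal sum_nonneg)
      have T1: "ennreal (?X k \<nu> / (real n)\<^sup>2 + bt k \<nu> q + dt k \<nu> q) = ?T k \<nu> q" for k \<nu>
      proof -
        have "ennreal (?X k \<nu>) = (\<Sum>j\<in>nbhd k. removal k \<nu> j q)"
        proof -
          have "removal k \<nu> j q = ennreal ((?h k j \<bullet> (?A k \<nu> *\<^sub>v y k (snd q)))\<^sup>2 + (\<Sum>i<p. (?h k j \<bullet> (?A k \<nu> *\<^sub>v col (psd_sqrt (S k (snd q))) i))\<^sup>2))" for j
          proof -
            have "removal k \<nu> j q = ennreal (\<Sum>i\<le>p. (?h k j \<bullet> (?A k \<nu> *\<^sub>v frame k i (snd q)))\<^sup>2)"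
              unfolding removal_def by (rule sum_ennreal) simp
            then show ?thesis
              unfolding lessThan_Suc_atMost[symmetric] sum.lessThan_Suc by (simp add: frame_def add.commute)
          qed
          then show ?thesis by (subst sum_ennreal[symmetric]) (auto intro!: add_nonneg_nonneg sum_nonneg)
        qed
        moreover have "ennreal (?X k \<nu> / (real n)\<^sup>2) = ennreal (1 / (real n)\<^sup>2) * ennreal (?X k \<nu>)"
          using ennreal_mult[of "1 / (real n)\<^sup>2" "?X k \<nu>"] X0 by simp
        ultimately have "ennreal (?X k \<nu> / (real n)\<^sup>2) = (\<Sum>j\<in>nbhd k. ennreal (1 / (real n)\<^sup>2) * removal k \<nu> j q)"
          by (simp only: sum_distrib_left)
        moreover have "ennreal (?X k \<nu> / (real n)\<^sup>2 + bt k \<nu> q + dt k \<nu> q) = ennreal (?X k \<nu> / (real n)\<^sup>2) + (ennreal (bt k \<nu> q) + ennreal (dt k \<nu> q))"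
          using X0 pos by (simp only: add.assoc ennreal_plus divide_nonneg_nonneg add_nonneg_nonneg zero_le_power2)
        ultimately show ?thesis by (simp only:)
      qed
      have T0: "0 \<le> ?X k \<nu> / (real n)\<^sup>2 + bt k \<nu> q + dt k \<nu> q" for k \<nu> using X0 pos by simp
      show ?thesis unfolding dbl[OF T0] T1 ..
    qed
    finally show ?thesis by (simp add: ennreal_leI)
  qed
  have btm: "(\<lambda>q. ennreal (bt k \<nu> q)) \<in> borel_measurable ?MM" "(\<lambda>q. ennreal (dt k \<nu> q)) \<in> borel_measurable ?MM" if k: "k \<in> {1..n}" for k \<nu>
  proof -
    note ym = measurable_compose[OF measurable_snd y_rv[OF k]] and Sm = measurable_compose[OF measurable_snd S_rv[OF k]]
    show "(\<lambda>q. ennreal (bt k \<nu> q)) \<in> borel_measurable ?MM"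
      unfolding bt_def
      by (intro measurable_compose[OF _ measurable_ennreal] borel_measurable_min borel_measurable_const borel_measurable_divide
        borel_measurable_abs borel_measurable_diff measurable_sprod[OF ym measurable_mult_mat_vec[OF pair_far_res_measurable ym]]
        measurable_mat_trace_mult[OF Sm pair_far_res_measurable])
    show "(\<lambda>q. ennreal (dt k \<nu> q)) \<in> borel_measurable ?MM"
      unfolding dt_def
      by (intro measurable_compose[OF _ measurable_ennreal] borel_measurable_min borel_measurable_const borel_measurable_divide
        borel_measurable_abs borel_measurable_diff measurable_sprod[OF colM[OF k] measurable_mult_mat_vec[OF pair_full_res_measurable colM[OF k]]]
        measurable_mat_trace_mult[OF Sm pair_full_res_measurable])
  qed
  have rm: "(\<lambda>q. ennreal (1 / (real n)\<^sup>2) * removal k \<nu> j q) \<in> borel_measurable ?MM" if "k \<in> {1..n}" "j \<in> nbhd k" for k \<nu> j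
    by (intro borel_measurable_times_ennreal removal_measurable borel_measurable_const that(1) jn[OF that(2)])
  have term_le: "(\<integral>\<^sup>+q. ?T k \<nu> q \<partial>?MM) \<le> ennreal (1 / (real n)\<^sup>2) * (\<Sum>j\<in>nbhd k. pair_weight k j)
      + (ennreal (\<theta> / real n + K * s k) + ennreal (\<theta> / real n + K * (2 * \<delta>) / \<theta>\<^sup>2 + K * r k))"
    if k: "k \<in> {1..n}" and nu: "\<nu> \<in> {\<alpha>, \<beta>}" for k \<nu>
  proof -
    have nu1: "1 \<le> \<nu>" using nu ab by auto
    have inv: "1 / \<nu> \<le> 1" "(1 / \<nu>)\<^sup>2 \<le> 1" using nu1 power_mono[of "1 / \<nu>" 1 2] by auto
    have "(\<integral>\<^sup>+q. ?T k \<nu> q \<partial>?MM) = (\<Sum>j\<in>nbhd k. ennreal (1 / (real n)\<^sup>2) * (\<integral>\<^sup>+q. removal k \<nu> j q \<partial>?MM))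
       + ((\<integral>\<^sup>+q. ennreal (bt k \<nu> q) \<partial>?MM) + (\<integral>\<^sup>+q. ennreal (dt k \<nu> q) \<partial>?MM))"
    proof -
      have "(\<integral>\<^sup>+q. ?T k \<nu> q \<partial>?MM) = (\<integral>\<^sup>+q. (\<Sum>j\<in>nbhd k. ennreal (1 / (real n)\<^sup>2) * removal k \<nu> j q) \<partial>?MM)
          + (\<integral>\<^sup>+q. ennreal (bt k \<nu> q) + ennreal (dt k \<nu> q) \<partial>?MM)"
        using btm[OF k] rm[OF k] by (intro nn_integral_add borel_measurable_sum borel_measurable_add) auto
      also have "(\<integral>\<^sup>+q. (\<Sum>j\<in>nbhd k. ennreal (1 / (real n)\<^sup>2) * removal k \<nu> j q) \<partial>?MM)
          = (\<Sum>j\<in>nbhd k. \<integral>\<^sup>+q. ennreal (1 / (real n)\<^sup>2) * removal k \<nu> j q \<partial>?MM)"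
        by (rule nn_integral_sum[OF rm[OF k]])
      also have "\<dots> = (\<Sum>j\<in>nbhd k. ennreal (1 / (real n)\<^sup>2) * (\<integral>\<^sup>+q. removal k \<nu> j q \<partial>?MM))"
        by (intro sum.cong refl nn_integral_cmult removal_measurable k jn)
      also have "(\<integral>\<^sup>+q. ennreal (bt k \<nu> q) + ennreal (dt k \<nu> q) \<partial>?MM) = (\<integral>\<^sup>+q. ennreal (bt k \<nu> q) \<partial>?MM) + (\<integral>\<^sup>+q. ennreal (dt k \<nu> q) \<partial>?MM)"
        by (rule nn_integral_add[OF btm[OF k]])
      finally show ?thesis .
    qed
    also have "\<dots> \<le> ennreal (1 / (real n)\<^sup>2) * (\<Sum>j\<in>nbhd k. pair_weight k j)
      + (ennreal (\<theta> / real n + K * s k) + ennreal (\<theta> / real n + K * (2 * \<delta>) / \<theta>\<^sup>2 + K * r k))"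
    proof (intro add_mono)
      have "(\<integral>\<^sup>+q. removal k \<nu> j q \<partial>?MM) \<le> pair_weight k j" if j: "j \<in> nbhd k" for j
      proof -
        have "(\<integral>\<^sup>+q. removal k \<nu> j q \<partial>?MM) \<le> ennreal (1 / \<nu>\<^sup>2) * pair_weight k j" using nu1 by (intro removal_bound k j) simp
        also have "\<dots> \<le> 1 * pair_weight k j" using inv(2) by (intro mult_right_mono) (auto simp: power_divide)
        finally show ?thesis by simp
      qed
      then show "(\<Sum>j\<in>nbhd k. ennreal (1 / (real n)\<^sup>2) * (\<integral>\<^sup>+q. removal k \<nu> j q \<partial>?MM)) \<le> ennreal (1 / (real n)\<^sup>2) * (\<Sum>j\<in>nbhd k. pair_weight k j)"
        unfolding sum_distrib_left by (intro sum_mono mult_left_mono) auto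
      have "(\<integral>\<^sup>+q. ennreal (bt k \<nu> q) \<partial>?MM) = (\<integral>\<^sup>+\<omega>'. (\<integral>\<^sup>+\<omega>. ennreal (bt k \<nu> (\<omega>', \<omega>)) \<partial>M) \<partial>M)"
        by (rule nn_integral_fst[OF btm(1)[OF k], symmetric])
      also have "\<dots> \<le> (\<integral>\<^sup>+\<omega>'. ennreal (\<theta> / real n + K * s k) \<partial>M)"
      proof (rule nn_integral_mono)
        fix \<omega>' assume w: "\<omega>' \<in> space M"
        show "(\<integral>\<^sup>+\<omega>. ennreal (bt k \<nu> (\<omega>', \<omega>)) \<partial>M) \<le> ennreal (\<theta> / real n + K * s k)"
          unfolding bt_def fst_conv snd_conv
        proof (rule far_form_deviation[OF _ _ k K0])
          show "w j \<omega>' \<in> carrier_vec p" if "j \<in> {1..n}" for j by (rule w_carrier[OF that w])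
          fix A assume "A \<in> sym_psd_mats p" "spectral_norm A \<le> 1 / \<nu>"
          then show "prob {\<omega> \<in> space M. \<theta> < \<bar>y k \<omega> \<bullet> (A *\<^sub>v y k \<omega>) - mat_trace (S k \<omega> * A)\<bar>} \<le> s k"
            using inv(1) by (intro sup k) auto
        qed (use nu1 th in auto)
      qed
      also have "\<dots> = ennreal (\<theta> / real n + K * s k)" by (simp add: emeasure_space_1)
      finally show "(\<integral>\<^sup>+q. ennreal (bt k \<nu> q) \<partial>?MM) \<le> ennreal (\<theta> / real n + K * s k)" .
      have "(\<integral>\<^sup>+q. ennreal (dt k \<nu> q) \<partial>?MM) \<le> ennreal (\<theta> / real n + K * (2 * ((1 / \<nu>)\<^sup>2 * \<delta>)) / \<theta>\<^sup>2 + K * r k)"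
        unfolding dt_def r_def using nu1 by (intro full_form_deviation k K0 th de) simp
      also have "\<dots> \<le> ennreal (\<theta> / real n + K * (2 * \<delta>) / \<theta>\<^sup>2 + K * r k)"
        using K0 de mult_right_mono[OF inv(2) de]
        by (intro ennreal_leI add_mono divide_right_mono mult_left_mono order_refl) auto
      finally show "(\<integral>\<^sup>+q. ennreal (dt k \<nu> q) \<partial>?MM) \<le> ennreal (\<theta> / real n + K * (2 * \<delta>) / \<theta>\<^sup>2 + K * r k)" .
    qed
    finally show ?thesis .
  qed
  have "ennreal \<bar>\<integral>q. fY q - fZ q \<partial>?MM\<bar> \<le> (\<integral>\<^sup>+q. ennreal \<bar>fY q - fZ q\<bar> \<partial>?MM)"
    using integral_norm_bound_ennreal[of ?MM "\<lambda>q. fY q - fZ q"] i by simp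
  also have "\<dots> \<le> (\<integral>\<^sup>+q. (\<Sum>k=1..n. \<Sum>\<nu>\<in>{\<alpha>, \<beta>}. ?T k \<nu> q) \<partial>?MM)" by (rule nn_integral_mono) (rule point)
  also have "\<dots> = (\<Sum>k=1..n. \<Sum>\<nu>\<in>{\<alpha>, \<beta>}. \<integral>\<^sup>+q. ?T k \<nu> q \<partial>?MM)"
  proof -
    have Tm: "?T k \<nu> \<in> borel_measurable ?MM" if k: "k \<in> {1..n}" for k \<nu>
      using btm[OF k] rm[OF k] by (intro borel_measurable_sum borel_measurable_add) auto
    have "(\<integral>\<^sup>+q. (\<Sum>k=1..n. \<Sum>\<nu>\<in>{\<alpha>, \<beta>}. ?T k \<nu> q) \<partial>?MM) = (\<Sum>k=1..n. \<integral>\<^sup>+q. (\<Sum>\<nu>\<in>{\<alpha>, \<beta>}. ?T k \<nu> q) \<partial>?MM)"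
      by (rule nn_integral_sum) (intro borel_measurable_sum Tm)
    also have "\<dots> = (\<Sum>k=1..n. \<Sum>\<nu>\<in>{\<alpha>, \<beta>}. \<integral>\<^sup>+q. ?T k \<nu> q \<partial>?MM)"
      by (intro sum.cong refl nn_integral_sum Tm)
    finally show ?thesis .
  qed
  also have "\<dots> \<le> (\<Sum>k=1..n. \<Sum>\<nu>\<in>{\<alpha>, \<beta>}. ennreal (1 / (real n)\<^sup>2) * (\<Sum>j\<in>nbhd k. pair_weight k j)
      + (ennreal (\<theta> / real n + K * s k) + ennreal (\<theta> / real n + K * (2 * \<delta>) / \<theta>\<^sup>2 + K * r k)))"
    by (intro sum_mono term_le)
  also have "\<dots> = 2 * (ennreal (1 / (real n)\<^sup>2) * (\<Sum>k=1..n. \<Sum>j\<in>nbhd k. pair_weight k j)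
         + (\<Sum>k=1..n. ennreal (\<theta> / real n + K * s k) + ennreal (\<theta> / real n + K * (2 * \<delta>) / \<theta>\<^sup>2 + K * r k)))"
    using ab(2) by (simp only: sum_constant) (simp add: sum_distrib_left sum.distrib distrib_left)
  finally show ?thesis unfolding e .
qed

end

section \<open>The limit\<close>

context gaussian_columns
begin

text \<open>The previous bound divided by n and written in terms of the hypotheses, with thresholds
  \<theta> = \<epsilon> p and \<delta> = \<eta> p^2. The factor n^-2 from the removals becomes the
  n^-3 of (A5). The 4 combines the two spectral parameters with the two orders of a near pair, and
  the Chebyshev term 2 K \<delta> / \<theta>^2 loses its dependence on p.\<close>

lemma expectation_difference_scaled:
  fixes \<epsilon> \<eta> :: real
  assumes ab: "1 \<le> \<alpha>" "\<alpha> < \<beta>" and eps: "\<epsilon> > 0" and eta: "\<eta> \<ge> 0"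
  defines "K \<equiv> ln (\<beta> / \<alpha>)"
  shows "ennreal (\<bar>expectation (\<lambda>\<omega>. logdet_ratio p n \<alpha> \<beta> {1..n} (\<lambda>j. y j \<omega>))
       - expectation (\<lambda>\<omega>. logdet_ratio p n \<alpha> \<beta> {1..n} (\<lambda>j. gauss_column j \<omega> \<omega>))\<bar> / real n)
    \<le> 4 * ((\<Sum>(k, l) \<in> {(k, l). 1 \<le> k \<and> k < l \<and> l \<le> n \<and> l < k + m}.
         \<integral>\<^sup>+\<omega>. ennreal ((spectral_norm (cond_exp_mat M (pair_sigma M p y S {1..k}) p (S l) \<omega>)
             + spectral_norm (cond_exp_mat M (pair_sigma M p y S {1..k}) p (\<lambda>\<omega>'. outer_self (y l \<omega>')) \<omega>))
            * mat_trace (outer_self (y k \<omega>) + S k \<omega>)) \<partial>M) / ennreal (real n ^ 3))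
      + 2 * ennreal ((\<Sum>(k, l) \<in> {(k, l). 1 \<le> k \<and> k \<le> n \<and> 1 \<le> l \<and> l \<le> n \<and> int m \<le> \<bar>int k - int l\<bar> \<and> \<bar>int k - int l\<bar> < 2 * int m}.
         (spectral_norm (expectation_mat M p (S l)) + spectral_norm (expectation_mat M p (\<lambda>\<omega>. outer_self (y l \<omega>))))
         * mat_trace (expectation_mat M p (\<lambda>\<omega>. outer_self (y k \<omega>)) + expectation_mat M p (S k))) / real n ^ 3)
      + 2 * ennreal (2 * \<epsilon> * (real p / real n)
          + K * (1 / real n * (\<Sum>k=1..n. SUP A\<in>{A \<in> sym_psd_mats p. spectral_norm A \<le> 1}.
              prob {\<omega> \<in> space M. \<bar>y k \<omega> \<bullet> (A *\<^sub>v y k \<omega>) - mat_trace (S k \<omega> * A)\<bar> > \<epsilon> * real p}))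
          + 2 * K * \<eta> / \<epsilon>\<^sup>2
          + K * (1 / real n * (\<Sum>k=1..n. prob {\<omega> \<in> space M. mat_trace (S k \<omega> * S k \<omega>) > \<eta> * (real p)\<^sup>2})))"
    (is "ennreal (?D / real n) \<le> 4 * (?AC / _) + 2 * ennreal (?AU / _) + 2 * ennreal (_ + K * (1 / real n * (\<Sum>k=1..n. ?s k)) + _ + K * (1 / real n * (\<Sum>k=1..n. ?r k)))")
proof -
  have n0: "real n > 0" and p0: "real p > 0" using n1 p1 by auto
  have K0: "0 \<le> K" using ab by (simp add: K_def)
  have mean0: "0 \<le> mean_norm k" for k
    unfolding mean_norm_def by (intro add_nonneg_nonneg spectral_norm_nonneg[OF _ p1]) (simp_all add: expectation_mat_def)
  have le_s: "prob {\<omega> \<in> space M. \<bar>y k \<omega> \<bullet> (A *\<^sub>v y k \<omega>) - mat_trace (S k \<omega> * A)\<bar> > \<epsilon> * real p} \<le> ?s k"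
    if "A \<in> sym_psd_mats p" "spectral_norm A \<le> 1" for k A
    using that by (intro cSUP_upper bdd_aboveI2[where M = 1]) auto
  \<comment> \<open>The supremum is only meaningful with an admissible matrix at hand; a far
    resolvent at \<nu> = 1 is semidefinite with norm at most 1.\<close>
  have s0: "0 \<le> ?s k" for k
  proof -
    obtain \<omega> where w: "\<omega> \<in> space M" using not_empty by blast
    have "(\<lambda>_. 0\<^sub>v p) j \<in> carrier_vec p" "(1::real) > 0" for j :: nat by simp_all
    note fr = far_res_facts(4,5)[OF this w w, of k]
    show ?thesis by (rule order_trans[OF measure_nonneg le_s[OF fr(1)]]) (use fr(2) in simp)
  qed
  let ?t = "\<lambda>k. mat_trace (expectation_mat M p (\<lambda>\<omega>. outer_self (y k \<omega>)) + expectation_mat M p (S k))"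
  let ?PU = "{(k, l). 1 \<le> k \<and> k \<le> n \<and> 1 \<le> l \<and> l \<le> n \<and> int m \<le> \<bar>int k - int l\<bar> \<and> \<bar>int k - int l\<bar> < 2 * int m}"
  have AC: "(\<Sum>(k, l) \<in> {(k, l). 1 \<le> k \<and> k < l \<and> l \<le> n \<and> l < k + m}. \<integral>\<^sup>+\<omega>. ennreal (cond_norm k l \<omega> * mass k \<omega>) \<partial>M) = ?AC"
  proof (rule sum.cong[OF refl], clarify)
    fix k l assume kl: "1 \<le> k" "k < l" "l \<le> n"
    then have k: "k \<in> {1..n}" and s: "sig {1..k} = pair_sigma M p y S {1..k}" by (auto simp: sig_def Int_absorb2)
    have mt: "mass k \<omega> = mat_trace (outer_self (y k \<omega>) + S k \<omega>)" if w: "\<omega> \<in> space M" for \<omega>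
      unfolding mass_def outer_self_trace[OF y_carrier[OF k w], symmetric]
      using outer_self_carrier[OF y_carrier[OF k w]] sym_psd_matsD(1)[OF S_psd[OF k w]]
      by (simp add: mat_trace_def sum.distrib)
    show "(\<integral>\<^sup>+\<omega>. ennreal (cond_norm k l \<omega> * mass k \<omega>) \<partial>M)
      = (\<integral>\<^sup>+\<omega>. ennreal ((spectral_norm (cond_exp_mat M (pair_sigma M p y S {1..k}) p (S l) \<omega>)
             + spectral_norm (cond_exp_mat M (pair_sigma M p y S {1..k}) p (\<lambda>\<omega>'. outer_self (y l \<omega>')) \<omega>))
            * mat_trace (outer_self (y k \<omega>) + S k \<omega>)) \<partial>M)"
      by (intro nn_integral_cong) (simp only: cond_norm_def s mt)
  qed
  have AU: "(\<Sum>(k, l) \<in> ?PU. ennreal (mean_norm l) * (\<integral>\<^sup>+\<omega>. ennreal (mass k \<omega>) \<partial>M)) = ennreal ?AU" and AU0: "0 \<le> ?AU"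
  proof -
    have t0: "0 \<le> ?t k" if k: "k \<in> {1..n}" for k
    proof -
      have diag: "0 \<le> X $$ (i, i)" if "X \<in> sym_psd_mats p" "i < p" for X i
        using sym_psd_matsD(3)[OF that(1) unit_vec_carrier, of i] mat_entry_sprod[OF sym_psd_matsD(1)[OF that(1)] that(2,2)] by simp
      have "0 \<le> expectation (\<lambda>\<omega>. outer_self (y k \<omega>) $$ (i, i))" "0 \<le> expectation (\<lambda>\<omega>. S k \<omega> $$ (i, i))" if i: "i < p" for i
        by (intro Bochner_Integration.integral_nonneg diag[OF outer_self_psd[OF y_carrier[OF k]] i] diag[OF S_psd[OF k] i]; assumption)+
      then show ?thesis by (auto simp: mat_trace_def expectation_mat_def intro!: sum_nonneg add_nonneg_nonneg)
    qed
    have "(\<Sum>(k, l) \<in> ?PU. ennreal (mean_norm l) * (\<integral>\<^sup>+\<omega>. ennreal (mass k \<omega>) \<partial>M)) = (\<Sum>(k, l) \<in> ?PU. ennreal (mean_norm l * ?t k))"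
      using mass_expectation mean0 t0 by (intro sum.cong refl) (auto simp: ennreal_mult)
    also have "\<dots> = ennreal (\<Sum>(k, l) \<in> ?PU. mean_norm l * ?t k)"
      unfolding case_prod_beta using mean0 t0 by (intro sum_ennreal mult_nonneg_nonneg) auto
    finally show "(\<Sum>(k, l) \<in> ?PU. ennreal (mean_norm l) * (\<integral>\<^sup>+\<omega>. ennreal (mass k \<omega>) \<partial>M)) = ennreal ?AU" by (simp only: mean_norm_def)
    have "0 \<le> (\<Sum>(k, l) \<in> ?PU. mean_norm l * ?t k)"
      unfolding case_prod_beta using mean0 t0 by (intro sum_nonneg mult_nonneg_nonneg) auto
    then show "0 \<le> ?AU" by (simp only: mean_norm_def)
  qed
  let ?u = "\<epsilon> * real p / real n" and ?v = "K * (2 * (\<eta> * (real p)\<^sup>2)) / (\<epsilon> * real p)\<^sup>2"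
  define G where "G = 2 * \<epsilon> * (real p / real n) + K * (1 / real n * (\<Sum>k=1..n. ?s k)) + 2 * K * \<eta> / \<epsilon>\<^sup>2 + K * (1 / real n * (\<Sum>k=1..n. ?r k))"
  have G: "(\<Sum>k=1..n. ennreal (?u + K * ?s k) + ennreal (?u + ?v + K * ?r k)) = ennreal (real n * G)"
  proof -
    have u0: "0 \<le> ?u" and v0: "0 \<le> ?v" using eps eta K0 by auto
    have "ennreal (?u + K * ?s k) + ennreal (?u + ?v + K * ?r k) = ennreal ((?u + K * ?s k) + (?u + ?v + K * ?r k))" for k
      using u0 v0 K0 s0[of k] by (intro ennreal_plus[symmetric] add_nonneg_nonneg mult_nonneg_nonneg) auto
    then have "(\<Sum>k=1..n. ennreal (?u + K * ?s k) + ennreal (?u + ?v + K * ?r k)) = ennreal (\<Sum>k=1..n. (?u + K * ?s k) + (?u + ?v + K * ?r k))"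
      using u0 v0 K0 s0 by (simp only:) (intro sum_ennreal add_nonneg_nonneg mult_nonneg_nonneg; simp)
    also have "(\<Sum>k=1..n. (?u + K * ?s k) + (?u + ?v + K * ?r k)) = real n * (2 * ?u + ?v) + K * (\<Sum>k=1..n. ?s k) + K * (\<Sum>k=1..n. ?r k)"
      by (simp add: sum.distrib sum_distrib_left algebra_simps)
    also have "\<dots> = real n * G"
      using n0 p0 eps by (simp add: G_def field_simps power2_eq_square)
    finally show ?thesis .
  qed
  have "ennreal ?D \<le> 2 * (ennreal (1 / (real n)\<^sup>2) * (2 * ?AC + ennreal ?AU) + ennreal (real n * G))"
    using lindeberg_expectation[OF ab, of "\<epsilon> * real p" "\<eta> * (real p)\<^sup>2" ?s] eps eta p0 le_s
    unfolding sum_pair_weight AC AU K_def[symmetric] G by auto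
  then have "ennreal (1 / real n) * ennreal ?D \<le> ennreal (1 / real n) * (2 * (ennreal (1 / (real n)\<^sup>2) * (2 * ?AC + ennreal ?AU) + ennreal (real n * G)))"
    by (rule mult_left_mono) simp
  also have "\<dots> = 4 * ((ennreal (1 / real n) * ennreal (1 / (real n)\<^sup>2)) * ?AC) + 2 * ((ennreal (1 / real n) * ennreal (1 / (real n)\<^sup>2)) * ennreal ?AU)
     + 2 * (ennreal (1 / real n) * ennreal (real n * G))"
    by (simp add: distrib_left mult.assoc mult.left_commute)
  also have "ennreal (1 / real n) * ennreal (1 / (real n)\<^sup>2) = ennreal (1 / real n ^ 3)"
    by (simp add: ennreal_mult[symmetric] power2_eq_square power3_eq_cube)
  also have "ennreal (1 / real n ^ 3) * ?AC = ?AC / ennreal (real n ^ 3)"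
    using n0 by (simp add: divide_ennreal_def inverse_ennreal inverse_eq_divide mult.commute)
  also have "ennreal (1 / real n ^ 3) * ennreal ?AU = ennreal (?AU / real n ^ 3)"
    using ennreal_mult[of "1 / real n ^ 3" ?AU] AU0 by simp
  also have "ennreal (1 / real n) * ennreal (real n * G) = ennreal G"
    using n0 ennreal_mult'[of "1 / real n" "real n * G"] by simp
  also have "ennreal (1 / real n) * ennreal ?D = ennreal (?D / real n)"
    using ennreal_mult[of "1 / real n" ?D] by simp
  finally show ?thesis by (simp only: G_def)
qed

lemma concentration_data:
  assumes ab: "0 < \<alpha>" "\<alpha> < \<beta>" and eps: "\<epsilon> > 0"
  defines "f \<equiv> \<lambda>\<omega>. logdet_ratio p n \<alpha> \<beta> {1..n} (\<lambda>j. y j \<omega>)"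
  shows "prob {\<omega> \<in> space M. \<bar>f \<omega> - expectation f\<bar> \<ge> \<epsilon>}
    \<le> 2 * exp (- (\<epsilon>\<^sup>2 / (4 * real (n div max m 1 + 1) * (4 * real (max m 1) * ln (\<beta> / \<alpha>))\<^sup>2)))"
  unfolding f_def
proof (rule logdet_ratio_concentration[where Fs = "\<lambda>k. sig {1..k}" and Gs = "\<lambda>l. sig {l..n}"])
  show "sets (sig {1..0}) = {{}, space M}" by (simp add: sig_def pair_sigma_def gen_sigma_empty)
  show "indep_set (sets (sig {1..k})) (sets (sig {l..n}))" if "k + max m 1 \<le> l" for k l
    using that by (intro sig_indep disjI2)
qed (use ab eps in \<open>auto intro!: sig_subalgebra sig_mono sig_indep sig_rv\<close>)

text \<open>The Gaussian columns inherit m-dependence. \<open>J I\<close> is generated by the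
  vectors \<open>w j\<close> and the matrices \<open>S j\<close> with j in I; separation of past and
  future holds for the \<open>w j\<close> by mutual independence and for the \<open>S j\<close> by
  m-dependence of the pairs, and \<open>indep_set_join\<close> combines the two because the families
  are independent of each other.\<close>

lemma concentration_gauss:
  assumes ab: "0 < \<alpha>" "\<alpha> < \<beta>" and eps: "\<epsilon> > 0"
  defines "f \<equiv> \<lambda>\<omega>. logdet_ratio p n \<alpha> \<beta> {1..n} (\<lambda>j. gauss_column j \<omega> \<omega>)"
  shows "prob {\<omega> \<in> space M. \<bar>f \<omega> - expectation f\<bar> \<ge> \<epsilon>}
    \<le> 2 * exp (- (\<epsilon>\<^sup>2 / (4 * real (n div max m 1 + 1) * (4 * real (max m 1) * ln (\<beta> / \<alpha>))\<^sup>2)))"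
proof -
  define W where "W I = gen_sigma M (borel_vec p) w (I \<inter> {1..n})" for I
  define T where "T I = gen_sigma M (borel_mat p) S (I \<inter> {1..n})" for I
  define J where "J I = sigma (space M) (sets (W I) \<union> sets (T I))" for I
  have WT: "subalgebra M (W I)" "subalgebra M (T I)" for I
    unfolding W_def T_def by (rule subalgebra_gen_sigma, rule w_rv S_rv, simp)+
  have WTm: "subalgebra (W I') (W I)" "subalgebra (T I') (T I)" if "I \<inter> {1..n} \<subseteq> I'" for I I'
    using gen_sigma_mono[of "I \<inter> {1..n}" "I' \<inter> {1..n}"] that by (auto simp: subalgebra_def W_def T_def space_gen_sigma)
  have pow: "sets (W I) \<union> sets (T I) \<subseteq> Pow (space M)" for I
    using WT[of I] sets.space_closed[of M] by (auto simp: subalgebra_def)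
  have setsJ: "sets (J I) = sigma_sets (space M) (sets (W I) \<union> sets (T I))" for I
    unfolding J_def by (rule sets_measure_of[OF pow])
  have spaceJ: "space (J I) = space M" for I
    unfolding J_def by (rule space_measure_of[OF pow])
  have subW: "sets (W I) \<subseteq> events" "sets (T I) \<subseteq> events" for I
    using WT[of I] unfolding subalgebra_def by blast+
  have subJ: "subalgebra M (J I)" for I
    unfolding subalgebra_def setsJ spaceJ using sets.sigma_sets_subset[of "sets (W I) \<union> sets (T I)" M] subW[of I] by blast
  have WTJ: "subalgebra (J I) (W I)" "subalgebra (J I) (T I)" for I
    unfolding subalgebra_def setsJ spaceJ by (auto simp: W_def T_def space_gen_sigma)
  have monoJ: "subalgebra (J I') (J I)" if "I \<inter> {1..n} \<subseteq> I'" for I I'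
  proof -
    have "sets (W I) \<union> sets (T I) \<subseteq> sets (W I') \<union> sets (T I')" using WTm[OF that] unfolding subalgebra_def by blast
    then show ?thesis unfolding subalgebra_def setsJ spaceJ by (intro conjI refl sigma_sets_mono')
  qed
  have col: "(\<lambda>\<omega>. gauss_column j \<omega> \<omega>) \<in> J I \<rightarrow>\<^sub>M borel_vec p" if "j \<in> I" "j \<in> {1..n}" for j I
  proof -
    have j: "j \<in> I \<inter> {1..n}" using that by blast
    have wW: "w j \<in> W I \<rightarrow>\<^sub>M borel_vec p" unfolding W_def by (rule measurable_gen_sigma[where X = w, OF j w_rv[OF that(2)]])
    have ST: "S j \<in> T I \<rightarrow>\<^sub>M borel_mat p" unfolding T_def by (rule measurable_gen_sigma[where X = S, OF j S_rv[OF that(2)]])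
    have RT: "(\<lambda>\<omega>. psd_sqrt (S j \<omega>)) \<in> T I \<rightarrow>\<^sub>M borel_mat p"
      by (rule measurable_psd_sqrt[OF ST]) (simp add: T_def space_gen_sigma S_psd[OF that(2)])
    show ?thesis
      by (rule measurable_mult_mat_vec[OF measurable_compose[OF measurable_ident_subalgebra[OF WTJ(2)] RT]
            measurable_compose[OF measurable_ident_subalgebra[OF WTJ(1)] wW]])
  qed
  have Tsig: "sets (T I) \<subseteq> sets (sig I)" for I
  proof -
    have "S j -` A \<inter> space M \<in> sets (sig I)" if "j \<in> I" "j \<in> {1..n}" "A \<in> sets (borel_mat p)" for j A
      using measurable_sets[OF sig_rv(2)[OF that(1,2)] that(3)] by simp
    then show ?thesis
      unfolding T_def gen_sigma_sets space_sig[of I, symmetric] by (intro sets.sigma_sets_subset) auto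
  qed
  have indJ: "indep_set (sets (J {1..k})) (sets (J {l..n}))" if kl: "k + max m 1 \<le> l" for k l
    unfolding setsJ
  proof (rule indep_set_join[where A = "W {1..n}" and B = "T {1..n}"])
    show "indep_set (sets (W {1..n})) (sets (T {1..n}))" using w_S_indep by (simp add: W_def T_def)
    show "indep_set (sets (W {1..k})) (sets (W {l..n}))"
      unfolding W_def by (rule indep_gen_sigma[OF w_indep]) (use kl in auto)
    have "indep_set (sets (sig {1..k})) (sets (sig {l..n}))" by (rule sig_indep) (use kl in auto)
    then show "indep_set (sets (T {1..k})) (sets (T {l..n}))"
      unfolding indep_set_def by (rule indep_sets_mono_sets) (use Tsig in \<open>auto split: bool.split\<close>)
  qed (auto intro!: WT WTm)
  have "sets (J {1..0}) = {{}, space M}"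
    using sigma_algebra.sigma_sets_eq[OF sigma_algebra_trivial[of "space M"]]
    by (simp add: setsJ W_def T_def gen_sigma_empty)
  then show ?thesis
    unfolding f_def
    by (intro logdet_ratio_concentration[where Fs = "\<lambda>k. J {1..k}" and Gs = "\<lambda>l. J {l..n}"] subJ indJ ab eps monoJ col) auto
qed

end

text \<open>Deviations of size \<epsilon> p, with p of order n, give an exponent of order n / max m
  1, and m = o(n / ln n) lifts it above 2 ln n eventually. The probabilities are then at most 2 /
  n^2 and the Borel-Cantelli lemma applies, first for each \<epsilon> = 1 / (q + 1) so that the
  exceptional sets remain countable in number.\<close>

lemma (in prob_space) concentration_almost_sure:
  fixes f :: "nat \<Rightarrow> 'a \<Rightarrow> real" and m p :: "nat \<Rightarrow> nat"
  assumes m: "(\<lambda>n. real (m n)) \<in> o(\<lambda>n. real n / ln (real n))"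
    and p: "(\<lambda>n. real (p n) / real n) \<longlonglongrightarrow> c" and c: "c > 0" and L: "L > 0"
    and f: "\<And>n. n \<ge> 1 \<Longrightarrow> f n \<in> borel_measurable M"
    and conc: "\<And>n \<epsilon>. n \<ge> 1 \<Longrightarrow> \<epsilon> > 0 \<Longrightarrow> prob {\<omega> \<in> space M. \<bar>f n \<omega> - expectation (f n)\<bar> \<ge> \<epsilon>}
      \<le> 2 * exp (- (\<epsilon>\<^sup>2 / (4 * real (n div max (m n) 1 + 1) * (4 * real (max (m n) 1) * L)\<^sup>2)))"
  shows "AE \<omega> in M. (\<lambda>n. (f n \<omega> - expectation (f n)) / real (p n)) \<longlonglongrightarrow> 0"
proof -
  let ?m = "\<lambda>n. max (m n) 1"
  have mlog: "(\<lambda>n. real (?m n) * ln (real n) / real n) \<longlonglongrightarrow> 0"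
  proof (rule tendsto_sandwich[where f = "\<lambda>_. 0"])
    have a: "(\<lambda>n. real (m n) * ln (real n) / real n) \<longlonglongrightarrow> 0" using smalloD_tendsto[OF m] by simp
    have b: "(\<lambda>n. ln (real n) / real n) \<longlonglongrightarrow> 0" by (rule lim_ln_over_n)
    show "(\<lambda>n. real (m n) * ln (real n) / real n + ln (real n) / real n) \<longlonglongrightarrow> 0" using tendsto_add[OF a b] by simp
    show "\<forall>\<^sub>F n in sequentially. 0 \<le> real (?m n) * ln (real n) / real n"
      using eventually_ge_at_top[of 1] by eventually_elim simp
    show "\<forall>\<^sub>F n in sequentially. real (?m n) * ln (real n) / real n \<le> real (m n) * ln (real n) / real n + ln (real n) / real n"
      using eventually_ge_at_top[of 1]
    proof eventually_elim
      case (elim n)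
      have "real (?m n) * ln (real n) \<le> (real (m n) + 1) * ln (real n)" using elim by (intro mult_right_mono) auto
      then show ?case by (simp add: add_divide_distrib[symmetric] divide_right_mono distrib_right)
    qed
  qed simp
  have main: "AE \<omega> in M. \<forall>\<^sub>F n in sequentially. \<bar>f n \<omega> - expectation (f n)\<bar> < \<epsilon> * real (p n)" if eps: "\<epsilon> > 0" for \<epsilon>
  proof -
    define A where "A n = {\<omega> \<in> space M. n \<ge> 1 \<and> \<bar>f n \<omega> - expectation (f n)\<bar> \<ge> \<epsilon> * real (p n)}" for n
    have Am: "A n \<in> events" for n
    proof (cases "n \<ge> 1")
      case True
      note [measurable] = f[OF True]
      show ?thesis unfolding A_def by measurable
    next
      case False
      then show ?thesis by (simp add: A_def)
    qed
    \<comment> \<open>Adjusted to the two estimates below: the denominator \<open>?d\<close> is at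
      most 128 n max m 1 L^2, and p >= c n / 2. With max m 1 times ln n at most \<kappa> n / 2, the
      product 2 ln n times \<open>?d\<close> is at most 128 \<kappa> n^2 L^2 = \<epsilon>^2 (c n /
      2)^2.\<close>
    define \<kappa> where "\<kappa> = \<epsilon>\<^sup>2 * c\<^sup>2 / (512 * L\<^sup>2)"
    have kap: "\<kappa> > 0" using eps c L by (simp add: \<kappa>_def)
    have pc: "\<forall>\<^sub>F n in sequentially. c / 2 < real (p n) / real n" by (rule order_tendstoD(1)[OF p]) (use c in simp)
    have ml: "\<forall>\<^sub>F n in sequentially. real (?m n) * ln (real n) / real n < min (\<kappa> / 2) 1"
      by (rule order_tendstoD(2)[OF mlog]) (use kap in simp)
    have "\<forall>\<^sub>F n in sequentially. norm (prob (A n)) \<le> 2 * (1 / (real n)\<^sup>2)"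
      using pc ml eventually_ge_at_top[of 3]
    proof eventually_elim
      case (elim n)
      have n0: "real n > 0" and n1: "n \<ge> 1" using elim by auto
      have m1: "real (?m n) \<ge> 1" by simp
      have ln1: "ln (real n) \<ge> 1" using exp_le elim(3) ln_mono[of "exp 1" "real n"] by simp
      have mln: "real (?m n) * ln (real n) \<le> \<kappa> / 2 * real n" "real (?m n) * ln (real n) \<le> real n"
        using elim(2) n0 by (simp_all add: field_simps min_less_iff_conj)
      have mn: "real (?m n) \<le> real n" using mult_left_mono[OF ln1, of "real (?m n)"] mln(2) m1 by linarith
      have p: "real (p n) \<ge> c / 2 * real n" using elim(1) n0 by (simp add: field_simps)
      have p0: "real (p n) > 0" by (rule less_le_trans[OF _ p]) (use c n0 in simp)
      let ?d = "4 * real (n div ?m n + 1) * (4 * real (?m n) * L)\<^sup>2"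
      have d0: "0 < ?d" using L by simp
      have "?d \<le> 128 * real n * real (?m n) * L\<^sup>2"
      proof -
        have "real (n div ?m n) * real (?m n) \<le> real n" by (metis div_times_less_eq_dividend of_nat_le_iff of_nat_mult)
        then have "real (n div ?m n + 1) * real (?m n) \<le> 2 * real n" unfolding of_nat_add of_nat_1 distrib_right mult_1 using mn by linarith
        then have "(real (n div ?m n + 1) * real (?m n)) * (64 * real (?m n) * L\<^sup>2) \<le> (2 * real n) * (64 * real (?m n) * L\<^sup>2)"
          by (rule mult_right_mono) simp
        then show ?thesis by (simp add: power2_eq_square mult_ac)
      qed
      then have "2 * ln (real n) * ?d \<le> 2 * ln (real n) * (128 * real n * real (?m n) * L\<^sup>2)" using ln1 by (intro mult_left_mono) auto
      also have "\<dots> = (real (?m n) * ln (real n)) * (256 * real n * L\<^sup>2)" by (simp add: mult_ac)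
      also have "\<dots> \<le> (\<kappa> / 2 * real n) * (256 * real n * L\<^sup>2)" by (rule mult_right_mono[OF mln(1)]) (use n0 in simp)
      also have "\<dots> = \<epsilon>\<^sup>2 * (c / 2 * real n)\<^sup>2" using L by (simp add: \<kappa>_def field_simps power2_eq_square)
      also have "\<dots> \<le> \<epsilon>\<^sup>2 * (real (p n))\<^sup>2" using p c by (intro mult_left_mono power_mono) auto
      finally have "2 * ln (real n) \<le> (\<epsilon> * real (p n))\<^sup>2 / ?d" using d0 by (simp add: le_divide_eq power_mult_distrib)
      then have "exp (- ((\<epsilon> * real (p n))\<^sup>2 / ?d)) \<le> exp (- (2 * ln (real n)))" by simp
      also have "exp (- (2 * ln (real n))) = 1 / (real n)\<^sup>2"
        using n0 by (simp add: exp_minus exp_double power2_eq_square inverse_eq_divide)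
      finally have "2 * exp (- ((\<epsilon> * real (p n))\<^sup>2 / ?d)) \<le> 2 * (1 / (real n)\<^sup>2)" by simp
      moreover have "prob (A n) \<le> 2 * exp (- ((\<epsilon> * real (p n))\<^sup>2 / ?d))"
        using conc[OF n1, of "\<epsilon> * real (p n)"] eps p0 n1 by (simp add: A_def)
      ultimately show ?case by simp
    qed
    then have "summable (\<lambda>n. prob (A n))"
      by (rule summable_comparison_test_ev) (intro summable_mult inverse_power_summable[where s = 2, unfolded inverse_eq_divide] order_refl)
    then have "AE \<omega> in M. \<forall>\<^sub>F n in sequentially. \<omega> \<in> space M - A n"
      using Am by (intro borel_cantelli_AE1) (auto simp: emeasure_eq_measure)
    then show ?thesis
    proof eventually_elim
      case (elim \<omega>)
      then show ?case using eventually_ge_at_top[of 1] by eventually_elim (auto simp: A_def)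
    qed
  qed
  have "AE \<omega> in M. \<forall>q. \<forall>\<^sub>F n in sequentially. \<bar>f n \<omega> - expectation (f n)\<bar> < 1 / real (Suc q) * real (p n)"
    unfolding AE_all_countable by (intro allI main) simp
  then show ?thesis
  proof eventually_elim
    case (elim \<omega>)
    have pc: "\<forall>\<^sub>F n in sequentially. 0 < real (p n) / real n" by (rule order_tendstoD(1)[OF p c])
    show ?case
      unfolding tendsto_iff dist_real_def
    proof (intro allI impI)
      fix e :: real assume "0 < e"
      then obtain q where q: "1 / real (Suc q) < e" using nat_approx_posE by blast
      show "\<forall>\<^sub>F n in sequentially. \<bar>(f n \<omega> - expectation (f n)) / real (p n) - 0\<bar> < e"
        using elim[THEN spec, of q] pc
      proof eventually_elim
        case (elim n)
        then have p0: "real (p n) > 0" by (simp add: zero_less_divide_iff)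
        have "\<bar>(f n \<omega> - expectation (f n)) / real (p n)\<bar> < 1 / real (Suc q)"
          using elim(1) p0 by (simp add: abs_divide divide_less_eq)
        then show ?case using q by simp
      qed
    qed
  qed
qed

theorem theorem3p1:
  fixes P :: "'a measure"
    and m p :: "nat \<Rightarrow> nat"
    and c :: real
    and y w :: "nat \<Rightarrow> nat \<Rightarrow> 'a \<Rightarrow> real Matrix.vec"
    and S :: "nat \<Rightarrow> nat \<Rightarrow> 'a \<Rightarrow> real mat"
  assumes prob: "prob_space P"
    and p_pos: "\<And>n. n \<ge> 1 \<Longrightarrow> p n \<ge> 1"
    and m_growth: "(\<lambda>n. real (m n)) \<in> o(\<lambda>n. real n / ln (real n))"
    and c_pos: "c > 0"
    and p_growth: "(\<lambda>n. real (p n) / real n) \<longlonglongrightarrow> c"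
    and y_rv: "\<And>n k. n \<ge> 1 \<Longrightarrow> k \<in> {1..n} \<Longrightarrow> y n k \<in> P \<rightarrow>\<^sub>M borel_vec (p n)"
    and S_rv: "\<And>n k. n \<ge> 1 \<Longrightarrow> k \<in> {1..n} \<Longrightarrow> S n k \<in> P \<rightarrow>\<^sub>M borel_mat (p n)"
    and S_psd: "\<And>n k \<omega>. n \<ge> 1 \<Longrightarrow> k \<in> {1..n} \<Longrightarrow> \<omega> \<in> space P \<Longrightarrow> S n k \<omega> \<in> sym_psd_mats (p n)"
    and y_int: "\<And>n k. n \<ge> 1 \<Longrightarrow> k \<in> {1..n} \<Longrightarrow> integrable_mat P (p n) (\<lambda>\<omega>. outer_self (y n k \<omega>))"
    and S_int: "\<And>n k. n \<ge> 1 \<Longrightarrow> k \<in> {1..n} \<Longrightarrow> integrable_mat P (p n) (S n k)"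
    and m_dep: "\<And>n. n \<ge> 1 \<Longrightarrow> m_dependent P (m n) (p n) n (y n) (S n)"
    and w_normal: "\<And>n k. n \<ge> 1 \<Longrightarrow> k \<in> {1..n} \<Longrightarrow> std_normal_vec P (p n) (w n k)"
    and w_indep: "\<And>n. n \<ge> 1 \<Longrightarrow> prob_space.indep_vars P (\<lambda>_. borel_vec (p n)) (w n) {1..n}"
    and w_S_indep: "\<And>n. n \<ge> 1 \<Longrightarrow>
      prob_space.indep_set P (sets (gen_sigma P (borel_vec (p n)) (w n) {1..n}))
                             (sets (gen_sigma P (borel_mat (p n)) (S n) {1..n}))"
    and A3: "\<And>B \<epsilon>. B > 0 \<Longrightarrow> \<epsilon> > 0 \<Longrightarrow>
      (\<lambda>n. 1 / real n * (\<Sum>k=1..n.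
         SUP A\<in>{A \<in> sym_psd_mats (p n). spectral_norm A \<le> B}.
           measure P {\<omega> \<in> space P.
             \<bar>y n k \<omega> \<bullet> (A *\<^sub>v y n k \<omega>) - mat_trace (S n k \<omega> * A)\<bar> > \<epsilon> * real (p n)}))
      \<longlonglongrightarrow> 0"
    and A4: "\<And>\<epsilon>. \<epsilon> > 0 \<Longrightarrow>
      (\<lambda>n. 1 / real n * (\<Sum>k=1..n.
         measure P {\<omega> \<in> space P. mat_trace (S n k \<omega> * S n k \<omega>) > \<epsilon> * (real (p n))\<^sup>2}))
      \<longlonglongrightarrow> 0"
    and A5_cond:
      "(\<lambda>n. (\<Sum>(k, l) \<in> {(k, l). 1 \<le> k \<and> k < l \<and> l \<le> n \<and> l < k + m n}.
         \<integral>\<^sup>+\<omega>. ennreal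
           ((spectral_norm (cond_exp_mat P (pair_sigma P (p n) (y n) (S n) {1..k}) (p n) (S n l) \<omega>)
             + spectral_norm (cond_exp_mat P (pair_sigma P (p n) (y n) (S n) {1..k}) (p n)
                 (\<lambda>\<omega>'. outer_self (y n l \<omega>')) \<omega>))
            * mat_trace (outer_self (y n k \<omega>) + S n k \<omega>)) \<partial>P) / ennreal (real n ^ 3))
      \<longlonglongrightarrow> 0"
    and A5_uncond:
      "(\<lambda>n. \<Sum>(k, l) \<in> {(k, l). 1 \<le> k \<and> k \<le> n \<and> 1 \<le> l \<and> l \<le> n
             \<and> int (m n) \<le> \<bar>int k - int l\<bar> \<and> \<bar>int k - int l\<bar> < 2 * int (m n)}.
         (spectral_norm (expectation_mat P (p n) (S n l))
           + spectral_norm (expectation_mat P (p n) (\<lambda>\<omega>. outer_self (y n l \<omega>))))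
         * mat_trace (expectation_mat P (p n) (\<lambda>\<omega>. outer_self (y n k \<omega>))
             + expectation_mat P (p n) (S n k)))
       \<in> o(\<lambda>n. real n ^ 3)"
  shows "\<forall>z. Im z > 0 \<longrightarrow>
    (AE \<omega> in P. (\<lambda>n.
        resolvent_trace (p n) n (\<lambda>k. y n k \<omega>) z
        - resolvent_trace (p n) n (\<lambda>k. psd_sqrt (S n k \<omega>) *\<^sub>v w n k \<omega>) z)
      \<longlonglongrightarrow> 0)"
proof (intro allI impI)
  fix z :: complex assume z: "Im z > 0"
  interpret prob_space P by (rule prob)
  have columns: "gaussian_columns P (m n) (p n) n (y n) (S n) (w n)" if "n \<ge> 1" for n
    using that by (intro gaussian_columns.intro m_dependent_columns.intro m_dependent_columns_axioms.intro gaussian_columns_axioms.intro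
        prob_space_axioms p_pos y_rv S_rv S_psd y_int S_int m_dep w_normal w_indep w_S_indep)
  define R where "R n j \<omega> = psd_sqrt (S n j \<omega>) *\<^sub>v w n j \<omega>" for n j \<omega>
  have R_rv: "R n j \<in> P \<rightarrow>\<^sub>M borel_vec (p n)" if "n \<ge> 1" "j \<in> {1..n}" for n j
    unfolding R_def[abs_def]
    using measurable_mult_mat_vec[OF gaussian_columns.S_sqrt_rv[OF columns[OF that(1)] that(2)] gaussian_columns.w_rv[OF columns[OF that(1)] that(2)]] .
  define \<alpha> \<beta> where "\<alpha> k = 1 + 1 / real (Suc k)" and "\<beta> k l = 1 + 1 / real (Suc k) + 1 / real (Suc l)" for k l
  have ab: "1 \<le> \<alpha> k" "0 < \<alpha> k" "\<alpha> k < \<beta> k l" for k l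
  proof -
    have "0 < 1 / real (Suc k)" "0 < 1 / real (Suc l)" by simp_all
    then show "1 \<le> \<alpha> k" "0 < \<alpha> k" "\<alpha> k < \<beta> k l" unfolding \<alpha>_def \<beta>_def by linarith+
  qed
  define fY where "fY k l n \<omega> = logdet_ratio (p n) n (\<alpha> k) (\<beta> k l) {1..n} (\<lambda>j. y n j \<omega>)" for k l n \<omega>
  define fZ where "fZ k l n \<omega> = logdet_ratio (p n) n (\<alpha> k) (\<beta> k l) {1..n} (\<lambda>j. R n j \<omega>)" for k l n \<omega>
  have mean: "(\<lambda>n. (expectation (fY k l n) - expectation (fZ k l n)) / real (p n)) \<longlonglongrightarrow> 0" for k l
  proof -
    let ?K = "ln (\<beta> k l / \<alpha> k)"
    let ?D = "\<lambda>n. \<bar>expectation (fY k l n) - expectation (fZ k l n)\<bar>"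
    have K: "0 \<le> ?K" using ab(2)[of k] ab(3)[of k l] by simp
    have "(\<lambda>n. ?D n / real n) \<longlonglongrightarrow> 0"
      unfolding tendsto_iff dist_real_def
    proof (intro allI impI)
      fix e :: real assume e: "0 < e"
      \<comment> \<open>Chosen in this order so that 2 \<epsilon> c = e / 8 and 2 K \<eta> /
        \<epsilon>^2 <= e / 8. With the outer factor 2 the limit of the bound is at most e / 2. The
        denominator K + 1 is positive for every K >= 0.\<close>
      define \<epsilon> \<eta> where "\<epsilon> = e / (16 * c)" and "\<eta> = e * \<epsilon>\<^sup>2 / (16 * (?K + 1))"
      have eps: "\<epsilon> > 0" using e c_pos by (simp add: \<epsilon>_def)
      have eta: "\<eta> > 0" using e eps K by (simp add: \<eta>_def)
      let ?G = "\<lambda>n. 2 * \<epsilon> * (real (p n) / real n)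
          + ?K * (1 / real n * (\<Sum>k=1..n. SUP A\<in>{A \<in> sym_psd_mats (p n). spectral_norm A \<le> 1}.
              prob {\<omega> \<in> space P. \<bar>y n k \<omega> \<bullet> (A *\<^sub>v y n k \<omega>) - mat_trace (S n k \<omega> * A)\<bar> > \<epsilon> * real (p n)}))
          + 2 * ?K * \<eta> / \<epsilon>\<^sup>2
          + ?K * (1 / real n * (\<Sum>k=1..n. prob {\<omega> \<in> space P. mat_trace (S n k \<omega> * S n k \<omega>) > \<eta> * (real (p n))\<^sup>2}))"
      let ?g = "2 * \<epsilon> * c + ?K * 0 + 2 * ?K * \<eta> / \<epsilon>\<^sup>2 + ?K * 0"
      have "0 < (1::real)" by simp
      note A3 = A3[OF this eps]
      have G: "?G \<longlonglongrightarrow> ?g"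
        by (intro tendsto_add tendsto_mult tendsto_const p_growth A3 A4[OF eta])
      \<comment> \<open>The limits are taken in the extended nonnegative reals, where passing a
        constant factor through a limit uses its finiteness.\<close>
      have top: "4 < (top_class.top :: ennreal)" "2 < (top_class.top :: ennreal)" by (metis ennreal_less_top ennreal_numeral)+
      note AC = ennreal_tendsto_cmult[OF top(1) A5_cond]
      note AU = ennreal_tendsto_cmult[OF top(2) tendsto_ennrealI[OF smalloD_tendsto[OF A5_uncond]]]
      note lim = tendsto_add[OF tendsto_add[OF AC AU] ennreal_tendsto_cmult[OF top(2) tendsto_ennrealI[OF G]]]
      have g: "2 * ?g < e"
      proof -
        have *: "2 * (a + q * 0 + b + q * 0) < e" if "a = e / 8" "b \<le> e / 8" for a b q :: real using that e by simp
        have **: "2 * a * (e * b / (16 * q)) / b = (e / 8) * (a / q)" if "b \<noteq> 0" "q \<noteq> 0" for a b q :: real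
          using that by (simp add: field_simps)
        show ?thesis
        proof (rule *)
          show "2 * \<epsilon> * c = e / 8" using c_pos by (simp add: \<epsilon>_def)
          have "2 * ?K * \<eta> / \<epsilon>\<^sup>2 = (e / 8) * (?K / (?K + 1))"
            using **[of "\<epsilon>\<^sup>2" "?K + 1" ?K] eps K unfolding \<eta>_def by simp
          also have "\<dots> \<le> (e / 8) * 1" using e K by (intro mult_left_mono) (auto simp: divide_le_eq)
          finally show "2 * ?K * \<eta> / \<epsilon>\<^sup>2 \<le> e / 8" by simp
        qed
      qed
      have g0: "0 \<le> ?g" using eps eta c_pos K by simp
      have "4 * 0 + 2 * ennreal 0 + 2 * ennreal ?g = ennreal (2 * ?g)" 
        using ennreal_mult[OF zero_le_numeral g0, of "num.Bit0 num.One"] by (simp only: ennreal_numeral mult_zero_right ennreal_0 add_0)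
      also have "\<dots> < ennreal e" using g e by (simp only: ennreal_less_iff[OF mult_nonneg_nonneg[OF zero_le_numeral g0]])
      finally have l: "4 * 0 + 2 * ennreal 0 + 2 * ennreal ?g < ennreal e" .
      show "\<forall>\<^sub>F n in sequentially. \<bar>?D n / real n - 0\<bar> < e"
        using order_tendstoD(2)[OF lim l] eventually_ge_at_top[of 1]
      proof eventually_elim
        case (elim n)
        have "ennreal (?D n / real n) < ennreal e"
          using gaussian_columns.expectation_difference_scaled[OF columns[OF elim(2)] ab(1,3) eps, of \<eta> k l] eta
          by (intro le_less_trans[OF _ elim(1)]) (simp only: fY_def[abs_def] fZ_def[abs_def] R_def less_imp_le)
        then show ?case using ennreal_less_iff[of "?D n / real n" e] by simp
      qed
    qed
    then have "(\<lambda>n. ?D n / real n * (real n / real (p n))) \<longlonglongrightarrow> 0 * inverse c"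
      using tendsto_inverse[OF p_growth] c_pos by (intro tendsto_mult) auto
    moreover have "\<forall>\<^sub>F n in sequentially. ?D n / real n * (real n / real (p n)) = ?D n / real (p n)"
      using eventually_ge_at_top[of 1] by eventually_elim simp
    ultimately have "(\<lambda>n. ?D n / real (p n)) \<longlonglongrightarrow> 0 * inverse c" by (rule Lim_transform_eventually)
    then have "(\<lambda>n. \<bar>(expectation (fY k l n) - expectation (fZ k l n)) / real (p n)\<bar>) \<longlonglongrightarrow> 0" by (simp add: abs_divide)
    then show ?thesis by (rule tendsto_rabs_zero_cancel)
  qed
  have conv: "AE \<omega> in P. (\<lambda>n. (fY k l n \<omega> - fZ k l n \<omega>) / real (p n)) \<longlonglongrightarrow> 0" for k l
  proof -
    have L: "0 < ln (\<beta> k l / \<alpha> k)" using ab(2)[of k] ab(3)[of k l] by simp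
    have "AE \<omega> in P. (\<lambda>n. (fY k l n \<omega> - expectation (fY k l n)) / real (p n)) \<longlonglongrightarrow> 0"
    proof (rule concentration_almost_sure[OF m_growth p_growth c_pos L])
      fix n :: nat assume n: "n \<ge> 1"
      show "fY k l n \<in> borel_measurable P" unfolding fY_def[abs_def] by (rule measurable_logdet_ratio[OF y_rv[OF n]])
      fix \<epsilon> :: real assume "\<epsilon> > 0"
      then show "prob {\<omega> \<in> space P. \<epsilon> \<le> \<bar>fY k l n \<omega> - expectation (fY k l n)\<bar>}
          \<le> 2 * exp (- (\<epsilon>\<^sup>2 / (4 * real (n div max (m n) 1 + 1) * (4 * real (max (m n) 1) * ln (\<beta> k l / \<alpha> k))\<^sup>2)))"
        unfolding fY_def[abs_def] by (rule gaussian_columns.concentration_data[OF columns[OF n] ab(2,3)])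
    qed
    moreover have "AE \<omega> in P. (\<lambda>n. (fZ k l n \<omega> - expectation (fZ k l n)) / real (p n)) \<longlonglongrightarrow> 0"
    proof (rule concentration_almost_sure[OF m_growth p_growth c_pos L])
      fix n :: nat assume n: "n \<ge> 1"
      show "fZ k l n \<in> borel_measurable P" unfolding fZ_def[abs_def] by (rule measurable_logdet_ratio[OF R_rv[OF n]])
      fix \<epsilon> :: real assume "\<epsilon> > 0"
      then show "prob {\<omega> \<in> space P. \<epsilon> \<le> \<bar>fZ k l n \<omega> - expectation (fZ k l n)\<bar>}
          \<le> 2 * exp (- (\<epsilon>\<^sup>2 / (4 * real (n div max (m n) 1 + 1) * (4 * real (max (m n) 1) * ln (\<beta> k l / \<alpha> k))\<^sup>2)))"
        unfolding fZ_def[abs_def] R_def by (rule gaussian_columns.concentration_gauss[OF columns[OF n] ab(2,3)])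
    qed
    ultimately show ?thesis
    proof eventually_elim
      case (elim \<omega>)
      have "(\<lambda>n. (fY k l n \<omega> - expectation (fY k l n)) / real (p n) - (fZ k l n \<omega> - expectation (fZ k l n)) / real (p n)
          + (expectation (fY k l n) - expectation (fZ k l n)) / real (p n)) \<longlonglongrightarrow> 0 - 0 + 0"
        by (intro tendsto_add tendsto_diff elim mean)
      then show ?case by (simp add: add_divide_distrib[symmetric] diff_divide_distrib[symmetric])
    qed
  qed
  have "AE \<omega> in P. \<forall>k l. (\<lambda>n. (fY k l n \<omega> - fZ k l n \<omega>) / real (p n)) \<longlonglongrightarrow> 0"
    unfolding AE_all_countable by (intro allI conv)
  with AE_space have "AE \<omega> in P. (\<lambda>n. resolvent_trace (p n) n (\<lambda>k. y n k \<omega>) z - resolvent_trace (p n) n (\<lambda>k. R n k \<omega>) z) \<longlonglongrightarrow> 0"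
  proof eventually_elim
    case (elim \<omega>)
    show ?case
    proof (rule resolvent_trace_convergence[OF p_pos])
      show "y n j \<omega> \<in> carrier_vec (p n) \<and> R n j \<omega> \<in> carrier_vec (p n)" if "n \<ge> 1" "j \<in> {1..n}" for n j
        using measurable_borel_vecD(1)[OF y_rv[OF that] elim(1)] measurable_borel_vecD(1)[OF R_rv[OF that] elim(1)] by simp
      show "z \<notin> complex_of_real ` {0..}" using z by auto
      show "(\<lambda>n. (logdet_ratio (p n) n (1 + 1 / real (Suc k)) (1 + 1 / real (Suc k) + 1 / real (Suc l)) {1..n} (\<lambda>k. y n k \<omega>)
         - logdet_ratio (p n) n (1 + 1 / real (Suc k)) (1 + 1 / real (Suc k) + 1 / real (Suc l)) {1..n} (\<lambda>k. R n k \<omega>)) / real (p n)) \<longlonglongrightarrow> 0" for k l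
        using elim(2) unfolding fY_def fZ_def \<alpha>_def \<beta>_def by blast
    qed
  qed
  then show "AE \<omega> in P. (\<lambda>n. resolvent_trace (p n) n (\<lambda>k. y n k \<omega>) z
      - resolvent_trace (p n) n (\<lambda>k. psd_sqrt (S n k \<omega>) *\<^sub>v w n k \<omega>) z) \<longlonglongrightarrow> 0"
    by (simp only: R_def)
qed

end
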